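(* Let $\mathcal U$ be a $5$-manifold with a marked contact Engel structure, let $\omega=(\omega^0,\dots,\omega^4)$ be an adapted coframe on $\mathcal U$ satisfying the structure equations (SE) of the context, and let $J,L,M,P,Q,R,S$ be the associated functions. 1. Let $\hat\omega=(\hat\omega^0,\dots,\hat\omega^4)$ be another coframe of the form $\hat\omega=A\cdot\phi^*(\omega)$, where $\phi:\mathcal U\to\mathcal U$ is a diffeomorphism and $A:\mathcal U\to\mathbf S$ is a smooth function with values in the structure group $\mathbf S$ of the context. Suppose that $\hat\omega$ also satisfies (SE), with functions $\hat a,\hat b,\hat c,\hat J,\hat M,\hat P$, and let $\hat L,\hat Q,\hat R,\hat S$ be the corresponding derived functions. Then (vanishing meaning vanishing identically): (a) $J=0$ iff $\hat J=0$; (b) $J=L=0$ iff $\hat J=\hat L=0$; (c) $J=L=M=0$ iff $\hat J=\hat L=\hat M=0$; (d) $J=L=M=P=0$ iff $\hat J=\hat L=\hat M=\hat P=0$; (e) $J=L=M=P=Q=0$ iff $\hat J=\hat L=\hat M=\hat P=\hat Q=0$; (f) $J=L=M=P=Q=R=0$ iff $\hat J=\hat L=\hat M=\hat P=\hat Q=\hat R=0$; (g) $J=L=M=P=Q=R=S=0$ iff $\hat J=\hat L=\hat M=\hat P=\hat Q=\hat R=\hat S=0$. 2. The marked contact Engel structure is flat if and only if $J=L=M=P=Q=R=S=0$. In this case the structure has a $9$-dimensional algebra of infinitesimal symmetries, isomorphic to the parabolic subalgebra $\mathfrak p_1$.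
   Context: All objects are smooth and all considerations are local. A contact twisted cubic structure on a $5$-manifold $\mathcal M$ is a contact distribution $\mathcal C\subset T\mathcal M$ (rank $4$, locally $\mathcal C=\ker\alpha$ with $\alpha\wedge d\alpha\wedge d\alpha\ne0$) together with a subbundle $\gamma\subset\mathbb P(\mathcal C)$ each of whose fibres $\gamma_x$ is a twisted cubic (in a suitable basis of $\mathcal C_x$, $\gamma_x=\{[s^3,s^2t,st^2,t^3]\}$) which is Legendrian: the tangent plane at each nonzero point of the cone $\hat\gamma_x\subset\mathcal C_x$ over $\gamma_x$ is isotropic for $d\alpha|_{\mathcal C_x}$. A marked contact twisted cubic structure is such a structure together with a smooth section $\sigma:\mathcal M\to\gamma$; $\ell^\sigma\subset\mathcal C$ denotes the corresponding line distribution. Equivalences are diffeomorphisms preserving $\mathcal C,\gamma$ and $\sigma$; infinitesimal symmetries are vector fields whose local flows preserve the structure. A coframe $(\omega^0,\dots,\omega^4)$ is adapted to the marked structure if $\mathcal C=\ker\omega^0$, $\hat\gamma$ is the set of vectors in $\mathcal C$ that are simultaneously null for $\omega^1\omega^3-(\omega^2)^2$, $\omega^2\omega^4-(\omega^3)^2$, $\omega^2\omega^3-\omega^1\omega^4$, and $\ell^\sigma=\ker(\omega^0,\omega^1,\omega^2,\omega^3)$. The contact Engel structure is the contact twisted cubic structure given on (open subsets of) $\mathbb R^5$ by the coframe $\alpha^0=dx^0+x^1dx^4-3x^2dx^3$, $\alpha^i=dx^i$ ($i=1,\dots,4$), i.e. $\mathcal C=\ker\alpha^0$ and $\hat\gamma=$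 common null vectors in $\mathcal C$ of $\alpha^1\alpha^3-(\alpha^2)^2$, $\alpha^2\alpha^4-(\alpha^3)^2$, $\alpha^2\alpha^3-\alpha^1\alpha^4$. A marked contact Engel structure is a marked contact twisted cubic structure whose underlying contact twisted cubic structure is locally equivalent to the contact Engel structure. It is called flat if near each point there are coordinates for which $(\alpha^0,\dots,\alpha^4)$ is an adapted coframe of the marked structure (in particular $\ell^\sigma=\ker(\alpha^0,\alpha^1,\alpha^2,\alpha^3)$). Structure equations (SE), which hold for some adapted coframe near any point of any marked contact Engel structure: $$\begin{aligned} d\omega^0&=\omega^1\wedge\omega^4-3\omega^2\wedge\omega^3\\ d\omega^1&=\tfrac34(b^2-4ac+M-P)\,\omega^0\wedge\omega^2+3c\,\omega^1\wedge\omega^2-3a\,\omega^2\wedge\omega^3+3J\,\omega^2\wedge\omega^4\\ d\omega^2&=\tfrac12(b^2-4ac+M-P)\,\omega^0\wedge\omega^3+2c\,\omega^1\wedge\omega^3-2b\,\omega^2\wedge\omega^3+2J\,\omega^3\wedge\omega^4\\ d\omega^3&=\tfrac14(b^2-4ac+M-P)\,\omega^0\wedge\omega^4+c\,\omega^1\wedge\omega^4-b\,\omega^2\wedge\omega^4+a\,\omega^3\wedge\omega^4\\ d\omega^4&=0 . \end{aligned}$$ Write $dF=\sum_iF_{\omega^i}\omega^i$. For a coframe satisfying (SE) the functions $a,b,c,J$ and $M-P$ are determined by (SE), and $M,P,L,Q,R,S$ are then determined by $a_{\omega^2}=\tfrac14(-3b^2+M+3P)$, $L=a_{\omega^3}$,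 $Q=2a_{\omega^1}-3bc-b_{\omega^2}$, $R=c^2-c_{\omega^2}$, $S=c_{\omega^1}$. Structure group: $\mathbf S$ is the group of matrices $$\begin{pmatrix}s_0&0&0&0&0\\ s_1&s_5^3&0&0&0\\ s_2&s_5^2s_7&s_5^2s_8&0&0\\ s_3&s_5s_7^2&2s_5s_7s_8&s_5s_8^2&0\\ s_4&s_7^3&3s_7^2s_8&3s_7s_8^2&s_8^3\end{pmatrix},\qquad s_0s_5s_8\neq0 .$$ $\mathfrak p_1$ is the $9$-dimensional parabolic subalgebra of the split real form $\mathfrak g$ of the exceptional simple Lie algebra of type $G_2$ that stabilizes a null (highest weight) line in the $7$-dimensional irreducible representation $\mathbb R^{3,4}$ of $\mathfrak g$. *)

theory Defs
  imports "HOL-Analysis.Analysis" "HOL-Library.Function_Algebras"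
begin

section \<open>Smooth 5-manifolds\<close>

text \<open>The index type 5 has the elements 0, 1, 2, 3, 4, so the components of a vector in
  \<^typ>\<open>real^5\<close> carry the indices of a coframe \<open>\<omega>\<^sup>0, \<dots>, \<omega>\<^sup>4\<close>.\<close>

primrec Ck_on :: "nat \<Rightarrow> 'a::real_normed_vector set \<Rightarrow> ('a \<Rightarrow> 'b::real_normed_vector) \<Rightarrow> bool" where
  "Ck_on 0 S f \<longleftrightarrow> continuous_on S f"
| "Ck_on (Suc k) S f \<longleftrightarrow>
     (\<forall>x\<in>S. f differentiable (at x)) \<and> (\<forall>v. Ck_on k S (\<lambda>x. frechet_derivative f (at x) v))"

text \<open>Used for open subsets of Euclidean spaces only.\<close>

definition smooth_on :: "'a::real_normed_vector set \<Rightarrow> ('a \<Rightarrow> 'b::real_normed_vector) \<Rightarrow> bool" where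
  "smooth_on S f \<longleftrightarrow> (\<forall>k. Ck_on k S f)"

text \<open>The values of \<open>coord \<kappa>\<close> outside \<open>cdom \<kappa>\<close> are irrelevant.\<close>

datatype 'p chart = Chart (cdom: "'p set") (coord: "'p \<Rightarrow> real^5")

definition icoord :: "'p chart \<Rightarrow> real^5 \<Rightarrow> 'p" where
  "icoord \<kappa> = inv_into (cdom \<kappa>) (coord \<kappa>)"

definition is_chart :: "'p::topological_space chart \<Rightarrow> bool" where
  "is_chart \<kappa> \<longleftrightarrow> open (cdom \<kappa>) \<and> open (coord \<kappa> ` cdom \<kappa>) \<and>
     homeomorphism (cdom \<kappa>) (coord \<kappa> ` cdom \<kappa>) (coord \<kappa>) (icoord \<kappa>)"

definition compatible :: "'p chart \<Rightarrow> 'p chart \<Rightarrow> bool" where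
  "compatible \<kappa> \<mu> \<longleftrightarrow>
     smooth_on (coord \<kappa> ` (cdom \<kappa> \<inter> cdom \<mu>)) (coord \<mu> \<circ> icoord \<kappa>) \<and>
     smooth_on (coord \<mu> ` (cdom \<kappa> \<inter> cdom \<mu>)) (coord \<kappa> \<circ> icoord \<mu>)"

text \<open>\<open>A\<close> is a maximal atlas, so that the members of \<open>A\<close> are exactly the smooth local coordinate
  systems of the 5-manifold \<open>U\<close>; in particular charts may be restricted to open subsets.\<close>

definition manifold5 :: "'p::{t2_space,second_countable_topology} set \<Rightarrow> 'p chart set \<Rightarrow> bool" where
  "manifold5 U A \<longleftrightarrow>
     (\<forall>\<kappa>\<in>A. is_chart \<kappa>) \<and> (\<Union>\<kappa>\<in>A. cdom \<kappa>) = U \<and>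
     (\<forall>\<kappa>\<in>A. \<forall>\<mu>\<in>A. compatible \<kappa> \<mu>) \<and>
     (\<forall>\<kappa>. is_chart \<kappa> \<and> cdom \<kappa> \<subseteq> U \<and> (\<forall>\<mu>\<in>A. compatible \<kappa> \<mu>) \<longrightarrow> \<kappa> \<in> A)"

definition smooth_fun :: "'p chart set \<Rightarrow> ('p \<Rightarrow> 'b::real_normed_vector) \<Rightarrow> bool" where
  "smooth_fun A f \<longleftrightarrow> (\<forall>\<kappa>\<in>A. smooth_on (coord \<kappa> ` cdom \<kappa>) (f \<circ> icoord \<kappa>))"

definition smooth_self_map ::
  "'p::topological_space set \<Rightarrow> 'p chart set \<Rightarrow> ('p \<Rightarrow> 'p) \<Rightarrow> bool" where
  "smooth_self_map U A \<phi> \<longleftrightarrow> \<phi> ` U \<subseteq> U \<and> continuous_on U \<phi> \<and>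
     (\<forall>\<kappa>\<in>A. \<forall>\<mu>\<in>A. smooth_on (coord \<kappa> ` {p \<in> cdom \<kappa>. \<phi> p \<in> cdom \<mu>}) (coord \<mu> \<circ> \<phi> \<circ> icoord \<kappa>))"

definition diffeo :: "'p::topological_space set \<Rightarrow> 'p chart set \<Rightarrow> ('p \<Rightarrow> 'p) \<Rightarrow> bool" where
  "diffeo U A \<phi> \<longleftrightarrow> bij_betw \<phi> U U \<and> smooth_self_map U A \<phi> \<and> smooth_self_map U A (inv_into U \<phi>)"

text \<open>The matrix of the tangent map of \<open>\<phi>\<close> at \<open>p\<close> with respect to the chart \<open>\<kappa>\<close> around \<open>p\<close> and the
  chart \<open>\<mu>\<close> around \<open>\<phi> p\<close>.\<close>

definition tangent_map :: "'p chart \<Rightarrow> 'p chart \<Rightarrow> ('p \<Rightarrow> 'p) \<Rightarrow> 'p \<Rightarrow> real^5^5" where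
  "tangent_map \<kappa> \<mu> \<phi> p = jacobian (coord \<mu> \<circ> \<phi> \<circ> icoord \<kappa>) (at (coord \<kappa> p))"

text \<open>
  Geometric objects are families indexed by the charts, subject to the transformation rule of their
  type. A field of sets of tangent vectors \<open>C\<close> has as \<open>C \<kappa> p\<close> the set of the coordinate vectors, in the
  chart \<open>\<kappa>\<close> around \<open>p\<close>, of its elements at \<open>p\<close>; \<open>X \<kappa> p\<close> is the coordinate vector of \<open>X\<close> at \<open>p\<close>; and row
  \<open>i\<close> of the matrix \<open>W \<kappa> p\<close> consists of the coefficients of \<open>\<omega>\<^sup>i\<close> at \<open>p\<close>.
\<close>

type_synonym 'p tangent_sets = "'p chart \<Rightarrow> 'p \<Rightarrow> (real^5) set"
type_synonym 'p vfield = "'p chart \<Rightarrow> 'p \<Rightarrow> real^5"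
type_synonym 'p coframe = "'p chart \<Rightarrow> 'p \<Rightarrow> real^5^5"

definition tangent_sets :: "'p chart set \<Rightarrow> 'p tangent_sets \<Rightarrow> bool" where
  "tangent_sets A C \<longleftrightarrow> (\<forall>\<kappa>\<in>A. \<forall>\<mu>\<in>A. \<forall>p \<in> cdom \<kappa> \<inter> cdom \<mu>.
     C \<mu> p = (\<lambda>v. tangent_map \<kappa> \<mu> id p *v v) ` C \<kappa> p)"

definition coframe :: "'p chart set \<Rightarrow> 'p coframe \<Rightarrow> bool" where
  "coframe A W \<longleftrightarrow>
     (\<forall>\<kappa>\<in>A. smooth_on (coord \<kappa> ` cdom \<kappa>) (W \<kappa> \<circ> icoord \<kappa>)) \<and>
     (\<forall>\<kappa>\<in>A. \<forall>p \<in> cdom \<kappa>. invertible (W \<kappa> p)) \<and>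
     (\<forall>\<kappa>\<in>A. \<forall>\<mu>\<in>A. \<forall>p \<in> cdom \<kappa> \<inter> cdom \<mu>. W \<kappa> p = W \<mu> p ** tangent_map \<kappa> \<mu> id p)"

text \<open>Smooth vector fields on the open set \<open>V\<close>; the values where \<open>X\<close> has no meaning are normalised to
  0, so that equality of vector fields is equality of functions.\<close>

definition vector_field :: "'p chart set \<Rightarrow> 'p set \<Rightarrow> 'p vfield \<Rightarrow> bool" where
  "vector_field A V X \<longleftrightarrow>
     (\<forall>\<kappa>\<in>A. smooth_on (coord \<kappa> ` (cdom \<kappa> \<inter> V)) (X \<kappa> \<circ> icoord \<kappa>)) \<and>
     (\<forall>\<kappa>\<in>A. \<forall>\<mu>\<in>A. \<forall>p \<in> cdom \<kappa> \<inter> cdom \<mu> \<inter> V. X \<mu> p = tangent_map \<kappa> \<mu> id p *v X \<kappa> p) \<and>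
     (\<forall>\<kappa> p. \<kappa> \<notin> A \<or> p \<notin> cdom \<kappa> \<inter> V \<longrightarrow> X \<kappa> p = 0)"

definition vf_scale :: "real \<Rightarrow> 'p vfield \<Rightarrow> 'p vfield" where
  "vf_scale r X = (\<lambda>\<kappa> p. r *\<^sub>R X \<kappa> p)"

definition vf_bracket :: "'p chart set \<Rightarrow> 'p set \<Rightarrow> 'p vfield \<Rightarrow> 'p vfield \<Rightarrow> 'p vfield" where
  "vf_bracket A V X Y = (\<lambda>\<kappa> p. if \<kappa> \<in> A \<and> p \<in> cdom \<kappa> \<inter> V
     then frechet_derivative (Y \<kappa> \<circ> icoord \<kappa>) (at (coord \<kappa> p)) (X \<kappa> p)
        - frechet_derivative (X \<kappa> \<circ> icoord \<kappa>) (at (coord \<kappa> p)) (Y \<kappa> p)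
     else 0)"

text \<open>\<open>\<Phi> t p\<close>, defined for \<open>\<bar>t\<bar> < \<epsilon>\<close> and \<open>p \<in> D\<close>, is a local flow of the vector field \<open>X\<close> on \<open>V\<close>.\<close>

definition local_flow ::
  "'p::topological_space chart set \<Rightarrow> 'p set \<Rightarrow> 'p vfield \<Rightarrow> real \<Rightarrow> 'p set \<Rightarrow> (real \<Rightarrow> 'p \<Rightarrow> 'p) \<Rightarrow> bool"
  where
  "local_flow A V X \<epsilon> D \<Phi> \<longleftrightarrow>
     0 < \<epsilon> \<and> open D \<and> D \<subseteq> V \<and>
     (\<forall>t. \<forall>p\<in>D. \<bar>t\<bar> < \<epsilon> \<longrightarrow> \<Phi> t p \<in> V) \<and>
     continuous_on {(t, p). \<bar>t\<bar> < \<epsilon> \<and> p \<in> D} (\<lambda>(t, p). \<Phi> t p) \<and>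
     (\<forall>\<kappa>\<in>A. \<forall>\<mu>\<in>A.
        smooth_on {(t, y). \<bar>t\<bar> < \<epsilon> \<and> y \<in> coord \<kappa> ` (cdom \<kappa> \<inter> D) \<and> \<Phi> t (icoord \<kappa> y) \<in> cdom \<mu>}
          (\<lambda>(t, y). coord \<mu> (\<Phi> t (icoord \<kappa> y)))) \<and>
     (\<forall>p\<in>D. \<Phi> 0 p = p) \<and>
     (\<forall>p\<in>D. \<forall>t. \<forall>\<mu>\<in>A. \<bar>t\<bar> < \<epsilon> \<and> \<Phi> t p \<in> cdom \<mu> \<longrightarrow>
        ((\<lambda>s. coord \<mu> (\<Phi> s p)) has_vector_derivative X \<mu> (\<Phi> t p)) (at t))"

section \<open>Differential forms in coordinates\<close>

text \<open>A 1-form on an open subset of \<^typ>\<open>real^5\<close> is given by its coefficient vector. The conventions are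
  \<open>(\<alpha> \<and> \<beta>)(u, v) = \<alpha>(u) \<beta>(v) - \<alpha>(v) \<beta>(u)\<close> and
  \<open>d\<theta>(X, Y) = X(\<theta>(Y)) - Y(\<theta>(X)) - \<theta>([X, Y])\<close>.\<close>

definition wedge :: "real^5 \<Rightarrow> real^5 \<Rightarrow> real^5 \<Rightarrow> real^5 \<Rightarrow> real" where
  "wedge \<alpha> \<beta> u v = (\<alpha> \<bullet> u) * (\<beta> \<bullet> v) - (\<alpha> \<bullet> v) * (\<beta> \<bullet> u)"

definition ext_deriv :: "(real^5 \<Rightarrow> real^5) \<Rightarrow> real^5 \<Rightarrow> real^5 \<Rightarrow> real^5 \<Rightarrow> real" where
  "ext_deriv \<theta> y u v = frechet_derivative \<theta> (at y) u \<bullet> v - frechet_derivative \<theta> (at y) v \<bullet> u"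

text \<open>The value of \<open>\<theta> \<and> \<beta> \<and> \<beta>\<close> on \<open>(v 0, \<dots>, v 4)\<close>, up to the factor \<open>1/4\<close>, for a covector \<open>\<theta>\<close> and an
  alternating bilinear form \<open>\<beta>\<close>.\<close>

definition wedge122 :: "real^5 \<Rightarrow> (real^5 \<Rightarrow> real^5 \<Rightarrow> real) \<Rightarrow> (5 \<Rightarrow> real^5) \<Rightarrow> real" where
  "wedge122 \<theta> \<beta> v = (\<Sum>\<pi> | \<pi> permutes UNIV.
     of_int (sign \<pi>) * (\<theta> \<bullet> v (\<pi> 0)) * \<beta> (v (\<pi> 1)) (v (\<pi> 2)) * \<beta> (v (\<pi> 3)) (v (\<pi> 4)))"

section \<open>Marked contact twisted cubic structures\<close>

text \<open>A subset of a projectivised vector space is represented by its cone, including 0. With respect to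
  the basis \<open>f 0, \<dots>, f 3\<close>, the cone over the twisted cubic consists of the vectors with coordinates
  \<open>(s\<^sup>3, s\<^sup>2 t, s t\<^sup>2, t\<^sup>3)\<close>; scalars need no separate parameter since real cube roots exist.\<close>

definition cubic_cone :: "(nat \<Rightarrow> real^5) \<Rightarrow> (real^5) set" where
  "cubic_cone f = {(\<Sum>k<4. (s ^ (3 - k) * t ^ k) *\<^sub>R f k) | s t. True}"

text \<open>The span of the partial derivatives of the parametrisation: the tangent plane of the cone at the
  point with parameters \<open>(s, t) \<noteq> (0, 0)\<close>.\<close>

definition cubic_cone_tangent :: "(nat \<Rightarrow> real^5) \<Rightarrow> real \<Rightarrow> real \<Rightarrow> (real^5) set" where
  "cubic_cone_tangent f s t = span
     {\<Sum>k<4. (real (3 - k) * s ^ (2 - k) * t ^ k) *\<^sub>R f k,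
      \<Sum>k<4. (real k * s ^ (3 - k) * t ^ (k - 1)) *\<^sub>R f k}"

definition contact_twisted_cubic ::
  "'p set \<Rightarrow> 'p chart set \<Rightarrow> 'p tangent_sets \<Rightarrow> 'p tangent_sets \<Rightarrow> bool" where
  "contact_twisted_cubic U A C G \<longleftrightarrow>
     tangent_sets A C \<and> tangent_sets A G \<and>
     (\<forall>p\<in>U. \<exists>\<kappa>\<in>A. p \<in> cdom \<kappa> \<and>
       (\<exists>(\<alpha> :: real^5 \<Rightarrow> real^5) (f :: nat \<Rightarrow> real^5 \<Rightarrow> real^5).
          smooth_on (coord \<kappa> ` cdom \<kappa>) \<alpha> \<and> (\<forall>k<4. smooth_on (coord \<kappa> ` cdom \<kappa>) (f k)) \<and>
          (\<forall>q \<in> cdom \<kappa>. let y = coord \<kappa> q; e = (\<lambda>k. f k y) in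
             C \<kappa> q = {v. \<alpha> y \<bullet> v = 0} \<and>
             (\<exists>v. wedge122 (\<alpha> y) (ext_deriv \<alpha> y) v \<noteq> 0) \<and>
             inj_on e {..<4} \<and> independent (e ` {..<4}) \<and> span (e ` {..<4}) = C \<kappa> q \<and>
             G \<kappa> q = cubic_cone e \<and>
             (\<forall>s t. (s, t) \<noteq> (0, 0) \<longrightarrow>
                (\<forall>u \<in> cubic_cone_tangent e s t. \<forall>v \<in> cubic_cone_tangent e s t.
                   ext_deriv \<alpha> y u v = 0)))))"

text \<open>The section \<open>\<sigma>\<close> is represented by its line distribution \<open>l\<close>.\<close>

definition marked_contact_twisted_cubic ::
  "'p set \<Rightarrow> 'p chart set \<Rightarrow> 'p tangent_sets \<Rightarrow> 'p tangent_sets \<Rightarrow> 'p tangent_sets \<Rightarrow> bool" where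
  "marked_contact_twisted_cubic U A C G l \<longleftrightarrow>
     contact_twisted_cubic U A C G \<and> tangent_sets A l \<and>
     (\<forall>p\<in>U. \<exists>\<kappa>\<in>A. p \<in> cdom \<kappa> \<and>
       (\<exists>\<sigma> :: real^5 \<Rightarrow> real^5. smooth_on (coord \<kappa> ` cdom \<kappa>) \<sigma> \<and>
          (\<forall>q \<in> cdom \<kappa>. \<sigma> (coord \<kappa> q) \<noteq> 0 \<and> \<sigma> (coord \<kappa> q) \<in> G \<kappa> q \<and>
             l \<kappa> q = span {\<sigma> (coord \<kappa> q)})))"

text \<open>The coframe whose value at a point is \<open>w\<close> is adapted to \<open>C\<close>, \<open>\<gamma>\<close> (to \<open>\<ell>\<^sup>\<sigma>\<close>, respectively) there.\<close>

definition adapted_cubic :: "real^5^5 \<Rightarrow> (real^5) set \<Rightarrow> (real^5) set \<Rightarrow> bool" where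
  "adapted_cubic w C G \<longleftrightarrow>
     C = {v. (w *v v) $ 0 = 0} \<and>
     G = {v. let z = w *v v in z $ 0 = 0 \<and> z $ 1 * z $ 3 - (z $ 2)\<^sup>2 = 0 \<and>
            z $ 2 * z $ 4 - (z $ 3)\<^sup>2 = 0 \<and> z $ 2 * z $ 3 - z $ 1 * z $ 4 = 0}"

definition adapted_mark :: "real^5^5 \<Rightarrow> (real^5) set \<Rightarrow> bool" where
  "adapted_mark w l \<longleftrightarrow>
     l = {v. let z = w *v v in z $ 0 = 0 \<and> z $ 1 = 0 \<and> z $ 2 = 0 \<and> z $ 3 = 0}"

definition adapted_coframe ::
  "'p chart set \<Rightarrow> 'p tangent_sets \<Rightarrow> 'p tangent_sets \<Rightarrow> 'p tangent_sets \<Rightarrow> 'p coframe \<Rightarrow> bool" where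
  "adapted_coframe A C G l W \<longleftrightarrow> coframe A W \<and>
     (\<forall>\<kappa>\<in>A. \<forall>p \<in> cdom \<kappa>. adapted_cubic (W \<kappa> p) (C \<kappa> p) (G \<kappa> p) \<and> adapted_mark (W \<kappa> p) (l \<kappa> p))"

text \<open>\<^const>\<open>vector\<close> starts at index 1 and would put the last entry at index \<open>5 = 0\<close>.\<close>

definition row5 :: "'a \<Rightarrow> 'a \<Rightarrow> 'a \<Rightarrow> 'a \<Rightarrow> 'a \<Rightarrow> 'a^5" where
  "row5 z0 z1 z2 z3 z4 =
     (\<chi> i. if i = 0 then z0 else if i = 1 then z1 else if i = 2 then z2 else if i = 3 then z3 else z4)"

definition engel_coframe :: "real^5 \<Rightarrow> real^5^5" where
  "engel_coframe x = row5
     (row5 1 0 0 (- 3 * x $ 2) (x $ 1))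
     (row5 0 1 0 0 0)
     (row5 0 0 1 0 0)
     (row5 0 0 0 1 0)
     (row5 0 0 0 0 1)"

definition marked_contact_engel ::
  "'p set \<Rightarrow> 'p chart set \<Rightarrow> 'p tangent_sets \<Rightarrow> 'p tangent_sets \<Rightarrow> 'p tangent_sets \<Rightarrow> bool" where
  "marked_contact_engel U A C G l \<longleftrightarrow> marked_contact_twisted_cubic U A C G l \<and>
     (\<forall>p\<in>U. \<exists>\<kappa>\<in>A. p \<in> cdom \<kappa> \<and>
       (\<forall>q \<in> cdom \<kappa>. adapted_cubic (engel_coframe (coord \<kappa> q)) (C \<kappa> q) (G \<kappa> q)))"

definition flat ::
  "'p set \<Rightarrow> 'p chart set \<Rightarrow> 'p tangent_sets \<Rightarrow> 'p tangent_sets \<Rightarrow> 'p tangent_sets \<Rightarrow> bool" where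
  "flat U A C G l \<longleftrightarrow>
     (\<forall>p\<in>U. \<exists>\<kappa>\<in>A. p \<in> cdom \<kappa> \<and>
       (\<forall>q \<in> cdom \<kappa>. adapted_cubic (engel_coframe (coord \<kappa> q)) (C \<kappa> q) (G \<kappa> q) \<and>
          adapted_mark (engel_coframe (coord \<kappa> q)) (l \<kappa> q)))"

definition preserved_at :: "'p chart set \<Rightarrow> ('p \<Rightarrow> 'p) \<Rightarrow> 'p \<Rightarrow> 'p tangent_sets \<Rightarrow> bool" where
  "preserved_at A \<phi> p C \<longleftrightarrow> (\<forall>\<kappa>\<in>A. \<forall>\<mu>\<in>A. p \<in> cdom \<kappa> \<and> \<phi> p \<in> cdom \<mu> \<longrightarrow>
     (\<lambda>v. tangent_map \<kappa> \<mu> \<phi> p *v v) ` C \<kappa> p = C \<mu> (\<phi> p))"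

definition infinitesimal_symmetries ::
  "'p::topological_space chart set \<Rightarrow> 'p tangent_sets \<Rightarrow> 'p tangent_sets \<Rightarrow> 'p tangent_sets \<Rightarrow>
   'p set \<Rightarrow> 'p vfield set" where
  "infinitesimal_symmetries A C G l V = {X. vector_field A V X \<and>
     (\<forall>\<epsilon> D \<Phi>. local_flow A V X \<epsilon> D \<Phi> \<longrightarrow>
        (\<forall>t. \<forall>p\<in>D. \<bar>t\<bar> < \<epsilon> \<longrightarrow>
           preserved_at A (\<Phi> t) p C \<and> preserved_at A (\<Phi> t) p G \<and> preserved_at A (\<Phi> t) p l))}"

section \<open>The structure equations and the structure group\<close>

definition structure_equations ::
  "'p chart set \<Rightarrow> 'p coframe \<Rightarrow> ('p \<Rightarrow> real) \<Rightarrow> ('p \<Rightarrow> real) \<Rightarrow> ('p \<Rightarrow> real) \<Rightarrow> ('p \<Rightarrow> real) \<Rightarrow>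
   ('p \<Rightarrow> real) \<Rightarrow> ('p \<Rightarrow> real) \<Rightarrow> bool" where
  "structure_equations A W a b c J M P \<longleftrightarrow>
     smooth_fun A a \<and> smooth_fun A b \<and> smooth_fun A c \<and> smooth_fun A J \<and>
     smooth_fun A M \<and> smooth_fun A P \<and>
     (\<forall>\<kappa>\<in>A. \<forall>p \<in> cdom \<kappa>. \<forall>u v.
       let K = (b p)\<^sup>2 - 4 * a p * c p + M p - P p;
           \<theta> = (\<lambda>i j. wedge (W \<kappa> p $ i) (W \<kappa> p $ j) u v);
           d = (\<lambda>i. ext_deriv (\<lambda>y. W \<kappa> (icoord \<kappa> y) $ i) (coord \<kappa> p) u v)
       in
         d 0 = \<theta> 1 4 - 3 * \<theta> 2 3 \<and>
         d 1 = 3/4 * K * \<theta> 0 2 + 3 * c p * \<theta> 1 2 - 3 * a p * \<theta> 2 3 + 3 * J p * \<theta> 2 4 \<and>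
         d 2 = 1/2 * K * \<theta> 0 3 + 2 * c p * \<theta> 1 3 - 2 * b p * \<theta> 2 3 + 2 * J p * \<theta> 3 4 \<and>
         d 3 = 1/4 * K * \<theta> 0 4 + c p * \<theta> 1 4 - b p * \<theta> 2 4 + a p * \<theta> 3 4 \<and>
         d 4 = 0)"

text \<open>\<open>F\<^bsub>\<omega>\<^sup>i\<^esub>\<close>, computed in the chart \<open>\<kappa>\<close>: column \<open>i\<close> of the inverse of \<open>W\<close> is the \<open>i\<close>-th vector of the
  frame dual to the coframe.\<close>

definition coframe_deriv :: "'p chart \<Rightarrow> 'p coframe \<Rightarrow> ('p \<Rightarrow> real) \<Rightarrow> 5 \<Rightarrow> 'p \<Rightarrow> real" where
  "coframe_deriv \<kappa> W F i p =
     frechet_derivative (F \<circ> icoord \<kappa>) (at (coord \<kappa> p)) (column i (matrix_inv (W \<kappa> p)))"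

definition derived_functions ::
  "'p chart set \<Rightarrow> 'p coframe \<Rightarrow> ('p \<Rightarrow> real) \<Rightarrow> ('p \<Rightarrow> real) \<Rightarrow> ('p \<Rightarrow> real) \<Rightarrow> ('p \<Rightarrow> real) \<Rightarrow>
   ('p \<Rightarrow> real) \<Rightarrow> ('p \<Rightarrow> real) \<Rightarrow> ('p \<Rightarrow> real) \<Rightarrow> ('p \<Rightarrow> real) \<Rightarrow> ('p \<Rightarrow> real) \<Rightarrow> bool" where
  "derived_functions A W a b c M P L Q R S \<longleftrightarrow>
     (\<forall>\<kappa>\<in>A. \<forall>p \<in> cdom \<kappa>.
        coframe_deriv \<kappa> W a 2 p = 1/4 * (- 3 * (b p)\<^sup>2 + M p + 3 * P p) \<and>
        L p = coframe_deriv \<kappa> W a 3 p \<and>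
        Q p = 2 * coframe_deriv \<kappa> W a 1 p - 3 * b p * c p - coframe_deriv \<kappa> W b 2 p \<and>
        R p = (c p)\<^sup>2 - coframe_deriv \<kappa> W c 2 p \<and>
        S p = coframe_deriv \<kappa> W c 1 p)"

definition structure_group :: "(real^5^5) set" where
  "structure_group = {row5
     (row5 s0 0 0 0 0)
     (row5 s1 (s5^3) 0 0 0)
     (row5 s2 (s5^2 * s7) (s5^2 * s8) 0 0)
     (row5 s3 (s5 * s7^2) (2 * s5 * s7 * s8) (s5 * s8^2) 0)
     (row5 s4 (s7^3) (3 * s7^2 * s8) (3 * s7 * s8^2) (s8^3))
     | s0 s1 s2 s3 s4 s5 s7 s8. s0 * s5 * s8 \<noteq> 0}"

text \<open>\<open>W' = B \<cdot> \<phi>\<^sup>*W\<close>.\<close>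

definition transformed_coframe ::
  "'p chart set \<Rightarrow> ('p \<Rightarrow> real^5^5) \<Rightarrow> ('p \<Rightarrow> 'p) \<Rightarrow> 'p coframe \<Rightarrow> 'p coframe \<Rightarrow> bool" where
  "transformed_coframe A B \<phi> W W' \<longleftrightarrow> (\<forall>\<kappa>\<in>A. \<forall>\<mu>\<in>A. \<forall>p \<in> cdom \<kappa>. \<phi> p \<in> cdom \<mu> \<longrightarrow>
     W' \<kappa> p = B p ** (W \<mu> (\<phi> p) ** tangent_map \<kappa> \<mu> \<phi> p))"

definition vanish_on :: "'p set \<Rightarrow> ('p \<Rightarrow> real) list \<Rightarrow> bool" where
  "vanish_on U fs \<longleftrightarrow> (\<forall>f \<in> set fs. \<forall>p\<in>U. f p = 0)"

section \<open>The parabolic subalgebra\<close>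

text \<open>The split octonions as Zorn's vector matrices \<open>(\<alpha>, u; v, \<beta>)\<close>, with the multiplicative norm
  \<open>\<alpha> \<beta> - u \<bullet> v\<close>. The split real form of type \<open>G\<^sub>2\<close> is their derivation algebra, and
  \<open>\<real>\<^sup>3\<^sup>,\<^sup>4\<close> is the space of imaginary elements, \<open>\<alpha> + \<beta> = 0\<close>.\<close>

type_synonym split_oct = "real \<times> (real^3) \<times> (real^3) \<times> real"

fun oct_mult :: "split_oct \<Rightarrow> split_oct \<Rightarrow> split_oct" where
  "oct_mult (\<alpha>, u, v, \<beta>) (\<alpha>', u', v', \<beta>') =
     (\<alpha> * \<alpha>' + u \<bullet> v',
      \<alpha> *\<^sub>R u' + \<beta>' *\<^sub>R u - cross3 v v',
      \<alpha>' *\<^sub>R v + \<beta> *\<^sub>R v' + cross3 u u',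
      \<beta> * \<beta>' + v \<bullet> u')"

definition split_g2 :: "(split_oct \<Rightarrow> split_oct) set" where
  "split_g2 = {D. linear D \<and> (\<forall>x y. D (oct_mult x y) = oct_mult (D x) y + oct_mult x (D y))}"

text \<open>All null lines in \<open>\<real>\<^sup>3\<^sup>,\<^sup>4\<close> are conjugate; the one chosen is spanned by an extremal weight
  vector.\<close>

definition null_vector :: split_oct where
  "null_vector = (0, axis 1 1, 0, 0)"

definition p1 :: "(split_oct \<Rightarrow> split_oct) set" where
  "p1 = {D \<in> split_g2. \<exists>r. D null_vector = r *\<^sub>R null_vector}"

text \<open>\<open>L\<close> is the image of \<^const>\<open>p1\<close> under an isomorphism of Lie algebras into the vector fields on \<open>V\<close>.\<close>

definition isomorphic_p1 :: "'p chart set \<Rightarrow> 'p set \<Rightarrow> 'p vfield set \<Rightarrow> bool" where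
  "isomorphic_p1 A V L \<longleftrightarrow> (\<exists>F. bij_betw F p1 L \<and>
     (\<forall>D\<in>p1. \<forall>E\<in>p1. F (\<lambda>x. D x + E x) = F D + F E) \<and>
     (\<forall>r. \<forall>D\<in>p1. F (\<lambda>x. r *\<^sub>R D x) = vf_scale r (F D)) \<and>
     (\<forall>D\<in>p1. \<forall>E\<in>p1. F (\<lambda>x. D (E x) - E (D x)) = vf_bracket A V (F D) (F E)))"

text \<open>Symmetry algebras are local: \<open>V\<close> has to be taken small, as globally defined symmetries may fail
  to exist.\<close>

definition symmetries_locally_p1 ::
  "'p::topological_space set \<Rightarrow> 'p chart set \<Rightarrow> 'p tangent_sets \<Rightarrow> 'p tangent_sets \<Rightarrow>
   'p tangent_sets \<Rightarrow> bool" where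
  "symmetries_locally_p1 U A C G l \<longleftrightarrow>
     (\<forall>p\<in>U. \<forall>N. open N \<and> p \<in> N \<longrightarrow> (\<exists>V. open V \<and> connected V \<and> p \<in> V \<and> V \<subseteq> N \<inter> U \<and>
        vector_space.dim vf_scale (infinitesimal_symmetries A C G l V) = 9 \<and>
        isomorphic_p1 A V (infinitesimal_symmetries A C G l V)))"

end

theory Submission
  imports Defs
begin

text \<open>
  The structure equations say that \<open>d\<omega>\<^sup>1 = 3 \<theta> \<and> \<omega>\<^sup>2\<close>, \<open>d\<omega>\<^sup>2 = 2 \<theta> \<and> \<omega>\<^sup>3\<close>, \<open>d\<omega>\<^sup>3 = \<theta> \<and> \<omega>\<^sup>4\<close>
  and \<open>d\<omega>\<^sup>4 = 0\<close> for a closed 1-form \<open>\<theta>\<close>. Under a change of coframe, the equations for the two coframes determine all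
  first derivatives of the group parameters up to the parameters themselves, and each of \<open>J, L, M, P, Q, R, S\<close> is multiplied by
  a nowhere vanishing function, modulo the preceding ones.

  Near a point where all invariants vanish, the flat Engel coframe sheared by a function \<open>u\<close> is adapted; then \<open>\<theta> = - du\<close> and
  the vanishing becomes a closed system of differential equations for \<open>u\<close>. It means that a certain vector of functions with
  values in the 7-dimensional representation of \<open>G\<^sub>2\<close> is constant up to scale and null, so that
  \<open>u\<close> is a quotient of two explicit polynomials. Automorphisms of the Engel structure move this null vector to a fixed one,
  for which the structure is flat.

  The symmetries of the flat model satisfy a linear system of differential equations of finite type with a 9-dimensional space
  of polynomial solutions. It follows by differentiating the invariance under the local flow, and
  conversely the invariance follows from the uniqueness of solutions of linear differential equations.
\<close>

section \<open>Smooth functions\<close>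

text \<open>The lower right block of the structure group is the third symmetric power of a 2x2
  matrix. With the structure equations written through a single closed 1-form \<theta>, a change of
  coframe therefore involves only binomial combinations of two parameters, and the entries of the
  first column merely shift components of \<theta>.

  When all invariants vanish, one first derivative of \<theta> remains free. It is adjoined as a new
  unknown; commutators of the frame determine its derivatives, and the system closes. The null
  condition on the resulting vector is the equation M = P.

  The obstacle lies in the symmetries. An infinitesimal symmetry is defined by a condition on all
  its local flows, which a field without flows would satisfy vacuously. Linear equations for a
  symmetry can be extracted only after every smooth field is known to have a smooth local flow,
  including smooth dependence on the initial point; this is the purpose of the part on differential
  equations.

  Smoothness is expressed by iterated derivatives in fixed directions, so that all orders live in
  one function type; moving directions have to be expanded in a basis.\<close>

abbreviation fder :: "('a::real_normed_vector \<Rightarrow> 'b::real_normed_vector) \<Rightarrow> 'a \<Rightarrow> 'a \<Rightarrow> 'b" where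
  "fder f x \<equiv> frechet_derivative f (at x)"

lemma derivative_cong_open:
  assumes "open S" "x \<in> S" "\<And>y. y \<in> S \<Longrightarrow> f y = g y"
  shows "(f has_derivative f') (at x) \<longleftrightarrow> (g has_derivative f') (at x)"
  using assms by (metis has_derivative_transform_within_open)

lemma frechet_derivative_cong_open:
  assumes "open S" "x \<in> S" "\<And>y. y \<in> S \<Longrightarrow> f y = g y"
  shows "fder f x = fder g x"
  unfolding frechet_derivative_def using derivative_cong_open[OF assms] by simp

text \<open>Openness of \<open>S\<close> makes derivatives at its points depend only on values in
  \<open>S\<close>; the induction passes to the derivatives in each fixed direction.\<close>

lemma Ck_on_cong:
  assumes "open S" "\<And>y. y \<in> S \<Longrightarrow> f y = g y"
  shows "Ck_on k S f \<longleftrightarrow> Ck_on k S g"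
  using assms(2)
proof (induction k arbitrary: f g)
  case 0
  then show ?case by (simp cong: continuous_on_cong)
next
  case (Suc k)
  have "fder f x = fder g x" if "x \<in> S" for x
    using frechet_derivative_cong_open[OF assms(1) that] Suc.prems by blast
  then have "Ck_on k S (\<lambda>x. fder f x v) \<longleftrightarrow>
      Ck_on k S (\<lambda>x. fder g x v)" for v
    by (intro Suc.IH) (auto simp only:)
  moreover have "f differentiable (at x) \<longleftrightarrow> g differentiable (at x)" if "x \<in> S" for x
    unfolding differentiable_def using derivative_cong_open[OF assms(1) that] Suc.prems by blast
  ultimately show ?case by simp
qed

lemma Ck_on_congI:
  "open S \<Longrightarrow> Ck_on k S f \<Longrightarrow> (\<And>y. y \<in> S \<Longrightarrow> g y = f y) \<Longrightarrow> Ck_on k S g"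
  using Ck_on_cong[of S g f] by blast

lemma Ck_on_subset: "Ck_on k S f \<Longrightarrow> T \<subseteq> S \<Longrightarrow> Ck_on k T f"
  by (induction k arbitrary: f) (auto intro: continuous_on_subset)

lemma Ck_on_SucD: "Ck_on (Suc k) S f \<Longrightarrow> Ck_on k S f"
proof (induction k arbitrary: f)
  case 0
  then show ?case
    by (auto intro!: continuous_at_imp_continuous_on differentiable_imp_continuous_within)
next
  case (Suc k)
  from Suc.prems have "\<forall>x\<in>S. f differentiable (at x)"
    "\<And>v. Ck_on (Suc k) S (\<lambda>x. fder f x v)" by simp_all
  with Suc.IH show ?case by simp
qed

lemma Ck_on_le: "Ck_on k S f \<Longrightarrow> j \<le> k \<Longrightarrow> Ck_on j S f"
proof (induction k)
  case (Suc k)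
  then show ?case using Ck_on_SucD[of k S f] by (auto simp del: Ck_on.simps simp: le_Suc_eq)
qed simp

text \<open>Lets an explicit derivative replace \<open>frechet_derivative\<close>, so that each
  closure property becomes an induction on \<open>k\<close> with the usual rule of
  differentiation.\<close>

lemma Ck_on_SucI:
  assumes "open S" "\<And>x. x \<in> S \<Longrightarrow> (f has_derivative f' x) (at x)"
    "\<And>v. Ck_on k S (\<lambda>x. f' x v)"
  shows "Ck_on (Suc k) S f"
proof -
  have "fder f x = f' x" if "x \<in> S" for x
    using assms(2)[OF that] frechet_derivative_at by metis
  then have "Ck_on k S (\<lambda>x. fder f x v)" for v
    using Ck_on_congI[OF assms(1,3)] by simp
  then show ?thesis using assms(2) by (auto simp: differentiable_def)
qed

lemma Ck_on_derivative:
  assumes "Ck_on (Suc k) S f" "x \<in> S"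
  shows "(f has_derivative fder f x) (at x)"
  using assms by (simp add: frechet_derivative_works)

lemma Ck_on_const: "open S \<Longrightarrow> Ck_on k S (\<lambda>x. c)"
proof (induction k arbitrary: c)
  case (Suc k)
  show ?case by (rule Ck_on_SucI[where f' = "\<lambda>x v. 0"]) (use Suc in auto)
qed simp

lemma Ck_on_linear:
  assumes "open S" "bounded_linear L"
  shows "Ck_on k S L"
proof (cases k)
  case 0
  then show ?thesis using assms linear_continuous_on by auto
next
  case (Suc j)
  show ?thesis unfolding Suc
    by (rule Ck_on_SucI[where f' = "\<lambda>x. L"])
      (use assms in \<open>auto intro: Ck_on_const bounded_linear_imp_has_derivative\<close>)
qed

lemma Ck_on_add:
  assumes "open S"
  shows "Ck_on k S f \<Longrightarrow> Ck_on k S g \<Longrightarrow> Ck_on k S (\<lambda>x. f x + g x)"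
proof (induction k arbitrary: f g)
  case 0
  then show ?case by (simp add: continuous_on_add)
next
  case (Suc k)
  show ?case
    by (rule Ck_on_SucI[OF assms has_derivative_add[OF Ck_on_derivative Ck_on_derivative]])
      (use Suc in auto)
qed

lemma Ck_on_bilinear:
  assumes "open S" "bounded_bilinear h"
  shows "Ck_on k S f \<Longrightarrow> Ck_on k S g \<Longrightarrow> Ck_on k S (\<lambda>x. h (f x) (g x))"
proof (induction k arbitrary: f g)
  case 0
  then show ?case using bounded_bilinear.continuous_on[OF assms(2)] by simp
next
  case (Suc k)
  show ?case
    by (rule Ck_on_SucI[OF assms(1)
          bounded_bilinear.FDERIV[OF assms(2) Ck_on_derivative Ck_on_derivative]])
      (use Suc.prems Ck_on_SucD[OF Suc.prems(1)] Ck_on_SucD[OF Suc.prems(2)]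
        in \<open>auto intro!: Ck_on_add[OF assms(1)] Suc.IH\<close>)
qed

lemma Ck_on_linear_comp:
  assumes "open S" "bounded_linear L" "Ck_on k S f"
  shows "Ck_on k S (\<lambda>x. L (f x))"
  using assms(3)
proof (induction k arbitrary: f)
  case 0
  then show ?case using assms(2)
    by (simp add: bounded_linear.continuous_on)
next
  case (Suc k)
  show ?case
    by (rule Ck_on_SucI[OF assms(1) bounded_linear.has_derivative[OF assms(2) Ck_on_derivative]])
      (use Suc in auto)
qed

lemma Ck_on_sum:
  assumes "open S" "\<And>i. i \<in> I \<Longrightarrow> Ck_on k S (f i)"
  shows "Ck_on k S (\<lambda>x. \<Sum>i\<in>I. f i x)"
  using assms(2)
  by (induction I rule: infinite_finite_induct) (auto intro: Ck_on_const Ck_on_add assms(1))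

lemma linear_euclidean_sum:
  fixes L :: "'a::euclidean_space \<Rightarrow> 'b::real_vector"
  assumes "linear L"
  shows "L v = (\<Sum>b\<in>Basis. (v \<bullet> b) *\<^sub>R L b)"
proof -
  have "L v = L (\<Sum>b\<in>Basis. (v \<bullet> b) *\<^sub>R b)" by (simp add: euclidean_representation)
  also have "\<dots> = (\<Sum>b\<in>Basis. (v \<bullet> b) *\<^sub>R L b)"
    using assms by (simp add: linear_sum linear_scale)
  finally show ?thesis .
qed

text \<open>The chain rule differentiates \<open>g\<close> in the moving direction
  \<open>fder f x v\<close>, whereas \<open>Ck_on\<close> knows only fixed directions. Expanding
  that direction in the basis gives a finite sum of products to which the induction hypothesis
  applies; hence the Euclidean intermediate space.\<close>

lemma Ck_on_compose:
  fixes f :: "'a::real_normed_vector \<Rightarrow> 'b::euclidean_space"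
  assumes "open S" "open T" "f ` S \<subseteq> T"
  shows "Ck_on k S f \<Longrightarrow> Ck_on k T g \<Longrightarrow> Ck_on k S (\<lambda>x. g (f x))"
proof (induction k arbitrary: g)
  case 0
  then show ?case using continuous_on_compose2 assms(3) by auto
next
  case (Suc k)
  let ?f = "\<lambda>x. fder f x" and ?g = "\<lambda>x. fder g x"
  have d: "((\<lambda>x. g (f x)) has_derivative (\<lambda>v. ?g (f x) (?f x v))) (at x)" if "x \<in> S" for x
    by (rule has_derivative_compose[OF Ck_on_derivative[OF Suc.prems(1) that]])
      (use Suc.prems(2) assms(3) that in \<open>auto intro!: Ck_on_derivative\<close>)
  have e: "?g (f x) (?f x v) = (\<Sum>b\<in>Basis. (?f x v \<bullet> b) *\<^sub>R ?g (f x) b)" if "x \<in> S" for x v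
  proof (rule linear_euclidean_sum)
    show "linear (?g (f x))"
      using Ck_on_derivative[OF Suc.prems(2)] that assms(3)
      by (meson has_derivative_linear image_subset_iff)
  qed
  have c: "Ck_on k S (\<lambda>x. ?g (f x) (?f x v))" for v
  proof -
    have "Ck_on k S (\<lambda>x. \<Sum>b\<in>Basis. (?f x v \<bullet> b) *\<^sub>R ?g (f x) b)"
    proof (intro Ck_on_sum Ck_on_bilinear[OF assms(1) bounded_bilinear_scaleR] assms(1))
      fix b :: 'b
      show "Ck_on k S (\<lambda>x. ?f x v \<bullet> b)"
        by (rule Ck_on_linear_comp[OF assms(1) bounded_linear_inner_left]) (use Suc.prems in simp)
      show "Ck_on k S (\<lambda>x. ?g (f x) b)"
        by (rule Suc.IH) (use Suc.prems Ck_on_SucD in auto)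
    qed
    then show ?thesis by (rule Ck_on_congI[OF assms(1)]) (rule e)
  qed
  show ?case by (rule Ck_on_SucI[OF assms(1) d c])
qed

section \<open>Closure properties of smooth functions\<close>

named_theorems smooth_intros

lemma smooth_onD: "smooth_on S f \<Longrightarrow> Ck_on k S f" by (simp add: smooth_on_def)

lemma smooth_on_cong:
  "open S \<Longrightarrow> (\<And>y. y \<in> S \<Longrightarrow> f y = g y) \<Longrightarrow> smooth_on S f \<longleftrightarrow> smooth_on S g"
  unfolding smooth_on_def using Ck_on_cong by metis

lemma smooth_on_congI:
  "open S \<Longrightarrow> smooth_on S f \<Longrightarrow> (\<And>y. y \<in> S \<Longrightarrow> g y = f y) \<Longrightarrow> smooth_on S g"
  using smooth_on_cong[of S g f] by blast

lemma smooth_on_subset: "smooth_on S f \<Longrightarrow> T \<subseteq> S \<Longrightarrow> smooth_on T f"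
  unfolding smooth_on_def using Ck_on_subset by blast

lemma smooth_on_derivative:
  "smooth_on S f \<Longrightarrow> x \<in> S \<Longrightarrow> (f has_derivative fder f x) (at x)"
  using smooth_onD Ck_on_derivative by blast

lemma smooth_on_linear_derivative:
  "smooth_on S f \<Longrightarrow> x \<in> S \<Longrightarrow> linear (fder f x)"
  using smooth_on_derivative has_derivative_linear by blast

lemma smooth_on_continuous: "smooth_on S f \<Longrightarrow> continuous_on S f"
  using smooth_onD[of S f 0] by simp

lemma smooth_on_frechet: "smooth_on S f \<Longrightarrow> smooth_on S (\<lambda>x. fder f x v)"
  unfolding smooth_on_def
proof
  fix k assume "\<forall>k. Ck_on k S f"
  then have "Ck_on (Suc k) S f" ..
  then show "Ck_on k S (\<lambda>x. fder f x v)" by simp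
qed

lemma smooth_on_const [smooth_intros]: "open S \<Longrightarrow> smooth_on S (\<lambda>x. c)"
  by (simp add: smooth_on_def Ck_on_const)

lemma smooth_on_linear: "open S \<Longrightarrow> bounded_linear L \<Longrightarrow> smooth_on S L"
  by (simp add: smooth_on_def Ck_on_linear)

lemma smooth_on_id [smooth_intros]: "open S \<Longrightarrow> smooth_on S (\<lambda>x. x)"
  by (rule smooth_on_linear) (auto simp: bounded_linear_ident)

lemma smooth_on_add [smooth_intros]:
  "open S \<Longrightarrow> smooth_on S f \<Longrightarrow> smooth_on S g \<Longrightarrow> smooth_on S (\<lambda>x. f x + g x)"
  by (simp add: smooth_on_def Ck_on_add)

lemma smooth_on_bilinear:
  "open S \<Longrightarrow> bounded_bilinear h \<Longrightarrow> smooth_on S f \<Longrightarrow> smooth_on S g \<Longrightarrow> smooth_on S (\<lambda>x. h (f x) (g x))"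
  by (simp add: smooth_on_def Ck_on_bilinear)

lemma smooth_on_linear_comp:
  "open S \<Longrightarrow> bounded_linear L \<Longrightarrow> smooth_on S f \<Longrightarrow> smooth_on S (\<lambda>x. L (f x))"
  by (simp add: smooth_on_def Ck_on_linear_comp)

lemma smooth_on_sum [smooth_intros]:
  "open S \<Longrightarrow> (\<And>i. i \<in> I \<Longrightarrow> smooth_on S (f i)) \<Longrightarrow> smooth_on S (\<lambda>x. \<Sum>i\<in>I. f i x)"
  by (simp add: smooth_on_def Ck_on_sum)

lemma smooth_on_compose:
  fixes f :: "'a::real_normed_vector \<Rightarrow> 'b::euclidean_space"
  shows "open S \<Longrightarrow> open T \<Longrightarrow> f ` S \<subseteq> T \<Longrightarrow> smooth_on S f \<Longrightarrow> smooth_on T g \<Longrightarrow>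
    smooth_on S (\<lambda>x. g (f x))"
  unfolding smooth_on_def using Ck_on_compose by metis

lemma smooth_on_minus [smooth_intros]: "open S \<Longrightarrow> smooth_on S f \<Longrightarrow> smooth_on S (\<lambda>x. - f x)"
  using smooth_on_linear_comp[OF _ bounded_linear_minus[OF bounded_linear_ident]] by auto

lemma smooth_on_diff [smooth_intros]:
  "open S \<Longrightarrow> smooth_on S f \<Longrightarrow> smooth_on S g \<Longrightarrow> smooth_on S (\<lambda>x. f x - g x)"
  using smooth_on_add[of S f "\<lambda>x. - g x"] smooth_on_minus[of S g] by simp

lemma smooth_on_mult [smooth_intros]:
  fixes f g :: "'a::real_normed_vector \<Rightarrow> 'b::real_normed_algebra"
  shows "open S \<Longrightarrow> smooth_on S f \<Longrightarrow> smooth_on S g \<Longrightarrow> smooth_on S (\<lambda>x. f x * g x)"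
  by (rule smooth_on_bilinear[OF _ bounded_bilinear_mult])

lemma smooth_on_scaleR [smooth_intros]:
  "open S \<Longrightarrow> smooth_on S f \<Longrightarrow> smooth_on S g \<Longrightarrow> smooth_on S (\<lambda>x. f x *\<^sub>R g x)"
  by (rule smooth_on_bilinear[OF _ bounded_bilinear_scaleR])

lemma smooth_on_inner [smooth_intros]:
  "open S \<Longrightarrow> smooth_on S f \<Longrightarrow> smooth_on S g \<Longrightarrow> smooth_on S (\<lambda>x. f x \<bullet> g x)"
  by (rule smooth_on_bilinear[OF _ bounded_bilinear_inner])

lemma smooth_on_power [smooth_intros]:
  fixes f :: "'a::real_normed_vector \<Rightarrow> real"
  shows "open S \<Longrightarrow> smooth_on S f \<Longrightarrow> smooth_on S (\<lambda>x. f x ^ n)"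
  by (induction n) (auto intro: smooth_intros)

lemma smooth_on_prod [smooth_intros]:
  fixes f :: "'i \<Rightarrow> 'a::real_normed_vector \<Rightarrow> real"
  assumes "open S" "\<And>i. i \<in> I \<Longrightarrow> smooth_on S (f i)"
  shows "smooth_on S (\<lambda>x. \<Prod>i\<in>I. f i x)"
  using assms(2)
  by (induction I rule: infinite_finite_induct) (auto intro: smooth_intros assms(1))

text \<open>The derivative -(1/f) f' (1/f) contains 1/f itself, so the claim of order
  \<open>k\<close> supplies the factors needed for order \<open>Suc k\<close>.\<close>

lemma smooth_on_inverse [smooth_intros]:
  fixes f :: "'a::real_normed_vector \<Rightarrow> real"
  assumes "open S" "smooth_on S f" "\<And>x. x \<in> S \<Longrightarrow> f x \<noteq> 0"
  shows "smooth_on S (\<lambda>x. inverse (f x))"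
  unfolding smooth_on_def
proof
  fix k
  show "Ck_on k S (\<lambda>x. inverse (f x))"
  proof (induction k)
    case 0
    show ?case using assms(3) smooth_on_continuous[OF assms(2)]
      by (auto intro: continuous_on_inverse)
  next
    case (Suc k)
    show ?case
    proof (rule Ck_on_SucI[OF assms(1)])
      fix x assume x: "x \<in> S"
      show "((\<lambda>x. inverse (f x)) has_derivative
          (\<lambda>v. - (inverse (f x) * fder f x v * inverse (f x)))) (at x)"
        by (rule Deriv.has_derivative_inverse[OF assms(3)[OF x] smooth_on_derivative[OF assms(2) x]])
    next
      fix v
      show "Ck_on k S (\<lambda>x. - (inverse (f x) * fder f x v * inverse (f x)))"
        by (intro Ck_on_linear_comp[OF assms(1) bounded_linear_minus[OF bounded_linear_ident]]
            Ck_on_bilinear[OF assms(1) bounded_bilinear_mult] Suc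
            smooth_onD[OF smooth_on_frechet[OF assms(2)]])
    qed
  qed
qed

lemma smooth_on_divide [smooth_intros]:
  fixes f g :: "'a::real_normed_vector \<Rightarrow> real"
  shows "open S \<Longrightarrow> smooth_on S f \<Longrightarrow> smooth_on S g \<Longrightarrow> (\<And>x. x \<in> S \<Longrightarrow> g x \<noteq> 0) \<Longrightarrow>
    smooth_on S (\<lambda>x. f x / g x)"
  unfolding divide_inverse by (intro smooth_intros)

lemma smooth_on_vec_nth [smooth_intros]:
  fixes f :: "'a::real_normed_vector \<Rightarrow> 'b::real_normed_vector^'n"
  shows "open S \<Longrightarrow> smooth_on S f \<Longrightarrow> smooth_on S (\<lambda>x. f x $ i)"
  by (rule smooth_on_linear_comp[OF _ bounded_linear_vec_nth])

lemma bounded_linear_axis: "bounded_linear (axis i :: 'a::real_normed_vector \<Rightarrow> 'a^'n)"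
proof (rule bounded_linear_intro[where K = 1])
  fix x :: 'a
  have "(\<Sum>j\<in>UNIV. (norm ((axis i x :: 'a^'n) $ j))\<^sup>2) = (\<Sum>j\<in>UNIV. if j = i then (norm x)\<^sup>2 else 0)"
    by (rule sum.cong) (auto simp: axis_def)
  then show "norm (axis i x :: 'a^'n) \<le> norm x * 1"
    by (simp add: norm_vec_def L2_set_def sum.delta)
qed (auto simp: axis_def vec_eq_iff)

lemma smooth_on_vecI:
  fixes f :: "'a::real_normed_vector \<Rightarrow> 'b::real_normed_vector^'n"
  assumes "open S" "\<And>i. smooth_on S (\<lambda>x. f x $ i)"
  shows "smooth_on S f"
proof -
  have "f = (\<lambda>x. \<Sum>i\<in>UNIV. axis i (f x $ i))"
    by (auto simp: fun_eq_iff vec_eq_iff axis_def sum.delta)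
  moreover have "smooth_on S (\<lambda>x. \<Sum>i\<in>UNIV. axis i (f x $ i))"
    by (intro smooth_on_sum smooth_on_linear_comp[OF _ bounded_linear_axis] assms)
  ultimately show ?thesis by simp
qed

lemma smooth_on_Pair [smooth_intros]:
  assumes "open S" "smooth_on S f" "smooth_on S g"
  shows "smooth_on S (\<lambda>x. (f x, g x))"
proof -
  have "smooth_on S (\<lambda>x. (f x, 0) + (0, g x))"
    by (intro smooth_on_add smooth_on_linear_comp[OF _ bounded_linear_Pair[OF bounded_linear_ident bounded_linear_zero]]
        smooth_on_linear_comp[OF _ bounded_linear_Pair[OF bounded_linear_zero bounded_linear_ident]] assms)
  then show ?thesis by simp
qed

lemma smooth_on_fst [smooth_intros]: "open S \<Longrightarrow> smooth_on S f \<Longrightarrow> smooth_on S (\<lambda>x. fst (f x))"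
  by (rule smooth_on_linear_comp[OF _ bounded_linear_fst])

lemma smooth_on_snd [smooth_intros]: "open S \<Longrightarrow> smooth_on S f \<Longrightarrow> smooth_on S (\<lambda>x. snd (f x))"
  by (rule smooth_on_linear_comp[OF _ bounded_linear_snd])

lemma smooth_on_frechet_along [smooth_intros]:
  fixes f :: "'a::euclidean_space \<Rightarrow> 'b::real_normed_vector"
  assumes "open S" "smooth_on S f" "smooth_on S X"
  shows "smooth_on S (\<lambda>x. fder f x (X x))"
proof -
  have "smooth_on S (\<lambda>x. \<Sum>b\<in>Basis. (X x \<bullet> b) *\<^sub>R fder f x b)"
    by (intro smooth_intros smooth_on_frechet assms)
  then show ?thesis
    by (rule smooth_on_congI[OF assms(1)])
      (rule linear_euclidean_sum[OF smooth_on_linear_derivative[OF assms(2)]])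
qed

text \<open>Both iterated derivatives are limits of the second difference quotient
  \<open>(f (x + h u + h v) - f (x + h u) - f (x + h v) + f x) / h\<^sup>2\<close>.\<close>

lemma second_difference:
  fixes f :: "'a::real_normed_vector \<Rightarrow> real"
  assumes S: "open S" and f: "Ck_on 2 S f"
    and seg: "\<And>s t. 0 \<le> s \<Longrightarrow> s \<le> h \<Longrightarrow> 0 \<le> t \<Longrightarrow> t \<le> h \<Longrightarrow> x + s *\<^sub>R u + t *\<^sub>R v \<in> S"
    and h: "0 < h"
  shows "\<exists>s t. 0 < s \<and> s < h \<and> 0 < t \<and> t < h \<and>
    f (x + h *\<^sub>R u + h *\<^sub>R v) - f (x + h *\<^sub>R u) - f (x + h *\<^sub>R v) + f x =
    h * h * fder (\<lambda>z. fder f z u) (x + s *\<^sub>R u + t *\<^sub>R v) v"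
proof -
  let ?f = "\<lambda>z. fder f z"
  have f1: "(f has_derivative ?f z) (at z)" if "z \<in> S" for z
    using f that Ck_on_derivative by (metis numeral_2_eq_2)
  have "Ck_on (Suc 0) S (\<lambda>z. ?f z u)" using f by (simp add: numeral_2_eq_2)
  then have f2: "((\<lambda>z. ?f z u) has_derivative fder (\<lambda>z. ?f z u) z) (at z)"
    if "z \<in> S" for z
    using that Ck_on_derivative by blast
  \<comment> \<open>The mean value theorem is used twice: for the difference in direction
    \<open>v\<close> as a function of the step along \<open>u\<close>, then for the derivative along
    \<open>u\<close> as a function of the step along \<open>v\<close>.\<close>
  define g where "g s = f (x + s *\<^sub>R u + h *\<^sub>R v) - f (x + s *\<^sub>R u)" for s
  have 1: "(g has_real_derivative ?f (x + s *\<^sub>R u + h *\<^sub>R v) u - ?f (x + s *\<^sub>R u) u) (at s)"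
    if "0 \<le> s" "s \<le> h" for s
  proof -
    have a: "((\<lambda>s. f (x + s *\<^sub>R u + t *\<^sub>R v)) has_derivative
        (\<lambda>r. ?f (x + s *\<^sub>R u + t *\<^sub>R v) (r *\<^sub>R u))) (at s)" if "0 \<le> t" "t \<le> h" for t
      by (rule has_derivative_compose[where g = f, OF _ f1])
        (use seg that \<open>0 \<le> s\<close> \<open>s \<le> h\<close> in \<open>auto intro!: derivative_eq_intros\<close>)
    have b: "((\<lambda>s. f (x + s *\<^sub>R u + t *\<^sub>R v)) has_real_derivative
        ?f (x + s *\<^sub>R u + t *\<^sub>R v) u) (at s)" if "0 \<le> t" "t \<le> h" for t
    proof -
      have "linear (?f (x + s *\<^sub>R u + t *\<^sub>R v))"
        using f1 seg that \<open>0 \<le> s\<close> \<open>s \<le> h\<close> by (meson has_derivative_linear)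
      then have "(\<lambda>r. ?f (x + s *\<^sub>R u + t *\<^sub>R v) (r *\<^sub>R u)) = (*) (?f (x + s *\<^sub>R u + t *\<^sub>R v) u)"
        by (auto simp: fun_eq_iff linear_scale)
      then show ?thesis using a[OF that] unfolding has_field_derivative_def by metis
    qed
    show ?thesis unfolding g_def using b[of h] b[of 0] h
      by (auto intro!: derivative_intros)
  qed
  have "\<exists>s>0. s < h \<and> g h - g 0 = (h - 0) * (?f (x + s *\<^sub>R u + h *\<^sub>R v) u - ?f (x + s *\<^sub>R u) u)"
    by (rule MVT2[OF h]) (use 1 in auto)
  then obtain s where s: "0 < s" "s < h"
    "g h - g 0 = h * (?f (x + s *\<^sub>R u + h *\<^sub>R v) u - ?f (x + s *\<^sub>R u) u)" by auto
  have 2: "((\<lambda>t. ?f (x + s *\<^sub>R u + t *\<^sub>R v) u) has_real_derivative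
      fder (\<lambda>z. ?f z u) (x + s *\<^sub>R u + t *\<^sub>R v) v) (at t)"
    if "0 \<le> t" "t \<le> h" for t
  proof -
    let ?z = "x + s *\<^sub>R u + t *\<^sub>R v"
    have z: "?z \<in> S" using seg s that by auto
    have "((\<lambda>t. ?f (x + s *\<^sub>R u + t *\<^sub>R v) u) has_derivative
        (\<lambda>r. fder (\<lambda>z. ?f z u) ?z (r *\<^sub>R v))) (at t)"
      by (rule has_derivative_compose[where g = "\<lambda>z. ?f z u" and f = "\<lambda>t. x + s *\<^sub>R u + t *\<^sub>R v", OF _ f2[OF z]])
        (auto intro!: derivative_eq_intros)
    moreover have "linear (fder (\<lambda>z. ?f z u) ?z)"
      using f2[OF z] by (rule has_derivative_linear)
    then have "(\<lambda>r. fder (\<lambda>z. ?f z u) ?z (r *\<^sub>R v)) = (*) (fder (\<lambda>z. ?f z u) ?z v)"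
      by (auto simp: fun_eq_iff linear_scale)
    ultimately show ?thesis unfolding has_field_derivative_def by metis
  qed
  have "\<exists>t>0. t < h \<and> ?f (x + s *\<^sub>R u + h *\<^sub>R v) u - ?f (x + s *\<^sub>R u + 0 *\<^sub>R v) u =
      (h - 0) * fder (\<lambda>z. ?f z u) (x + s *\<^sub>R u + t *\<^sub>R v) v"
    by (rule MVT2[OF h]) (use 2 in auto)
  then obtain t where t: "0 < t" "t < h" "?f (x + s *\<^sub>R u + h *\<^sub>R v) u - ?f (x + s *\<^sub>R u) u =
      h * fder (\<lambda>z. ?f z u) (x + s *\<^sub>R u + t *\<^sub>R v) v" by auto
  show ?thesis
    using s t by (intro exI[of _ s] exI[of _ t]) (auto simp: g_def)
qed

lemma symmetric_second_derivative_real: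
  fixes f :: "'a::real_normed_vector \<Rightarrow> real"
  assumes S: "open S" "x \<in> S" and f: "Ck_on 2 S f"
  shows "fder (\<lambda>z. fder f z u) x v =
    fder (\<lambda>z. fder f z v) x u"
proof -
  define D where "D u v z = fder (\<lambda>z. fder f z u) z v" for u v z
  obtain e where e: "e > 0" "ball x e \<subseteq> S" using S open_contains_ball by blast
  define c where "c = norm u + norm v + 1"
  have c: "c > 0" by (simp add: c_def add_nonneg_pos)
  have near: "dist x (x + s *\<^sub>R u + t *\<^sub>R v) < c * h" if "0 \<le> s" "s \<le> h" "0 \<le> t" "t \<le> h" "0 < h" for s t h
  proof -
    have "dist x (x + s *\<^sub>R u + t *\<^sub>R v) = norm (s *\<^sub>R u + t *\<^sub>R v)"
      by (metis add.assoc add_diff_cancel_left' dist_commute dist_norm)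
    also have "\<dots> \<le> s * norm u + t * norm v"
      using norm_triangle_ineq[of "s *\<^sub>R u" "t *\<^sub>R v"] that by simp
    also have "\<dots> \<le> h * norm u + h * norm v"
      using that by (intro add_mono mult_right_mono) auto
    also have "\<dots> < c * h" using that by (simp add: c_def algebra_simps)
    finally show ?thesis .
  qed
  \<comment> \<open>Tends to 0 and is scaled by \<open>c\<close> so that the whole parallelogram
    with sides \<open>h n\<close> stays within \<open>e\<close> of \<open>x\<close>.\<close>
  define h where "h n = e / (c * real (n + 1))" for n
  have h: "0 < h n" "c * h n \<le> e" for n
  proof -
    show "0 < h n" using e c by (auto simp: h_def intro!: divide_pos_pos mult_pos_pos)
    have "c * h n = e / real (n + 1)" using c by (simp add: h_def)
    also have "\<dots> \<le> e / 1" using e by (intro divide_left_mono) auto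
    finally show "c * h n \<le> e" by simp
  qed
  have seg: "x + s *\<^sub>R u + t *\<^sub>R v \<in> S" if "0 \<le> s" "s \<le> h n" "0 \<le> t" "t \<le> h n" for s t n
    using near[OF that h(1)] h(2)[of n] e(2) by auto
  have seg': "x + s *\<^sub>R v + t *\<^sub>R u \<in> S" if "0 \<le> s" "s \<le> h n" "0 \<le> t" "t \<le> h n" for s t n
    using seg[OF that(3,4,1,2)] by (simp add: algebra_simps)
  let ?d = "\<lambda>h. f (x + h *\<^sub>R u + h *\<^sub>R v) - f (x + h *\<^sub>R u) - f (x + h *\<^sub>R v) + f x"
  have "\<exists>z. dist x z < c * h n \<and> ?d (h n) = h n * h n * D u v z" for n
  proof -
    obtain s t where "0 < s" "s < h n" "0 < t" "t < h n"
      "?d (h n) = h n * h n * D u v (x + s *\<^sub>R u + t *\<^sub>R v)"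
      using second_difference[of S f "h n" x u v, OF S(1) f seg[where n = n] h(1)] unfolding D_def by blast
    then show ?thesis
      using near[of s "h n" t] h(1)[of n] by (intro exI[of _ "x + s *\<^sub>R u + t *\<^sub>R v"]) auto
  qed
  then obtain z where z: "\<And>n. dist x (z n) < c * h n" "\<And>n. ?d (h n) = h n * h n * D u v (z n)"
    by metis
  have "\<exists>z. dist x z < c * h n \<and> ?d (h n) = h n * h n * D v u z" for n
  proof -
    obtain s t where st: "0 < s" "s < h n" "0 < t" "t < h n"
      "f (x + h n *\<^sub>R v + h n *\<^sub>R u) - f (x + h n *\<^sub>R v) - f (x + h n *\<^sub>R u) + f x =
        h n * h n * D v u (x + s *\<^sub>R v + t *\<^sub>R u)"
      using second_difference[of S f "h n" x v u, OF S(1) f seg'[where n = n] h(1)] unfolding D_def by blast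
    have e1: "x + h n *\<^sub>R v + h n *\<^sub>R u = x + h n *\<^sub>R u + h n *\<^sub>R v" by (simp add: algebra_simps)
    have e2: "x + s *\<^sub>R v + t *\<^sub>R u = x + t *\<^sub>R u + s *\<^sub>R v" by (simp add: algebra_simps)
    show ?thesis
      using st near[of t "h n" s] h(1)[of n] unfolding e1 e2 by (intro exI[of _ "x + t *\<^sub>R u + s *\<^sub>R v"]) auto
  qed
  then obtain y where y: "\<And>n. dist x (y n) < c * h n" "\<And>n. ?d (h n) = h n * h n * D v u (y n)"
    by metis
  have eq: "D u v (z n) = D v u (y n)" for n
    using z(2)[of n] y(2)[of n] h(1)[of n] by simp
  have h0: "(\<lambda>n. c * h n) \<longlonglongrightarrow> 0"
  proof -
    have "(\<lambda>n. e * inverse (real (Suc n))) \<longlonglongrightarrow> e * 0"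
      by (intro tendsto_mult tendsto_const LIMSEQ_inverse_real_of_nat)
    moreover have "(\<lambda>n. c * h n) = (\<lambda>n. e * inverse (real (Suc n)))"
      using c by (auto simp: h_def divide_inverse)
    ultimately show ?thesis by simp
  qed
  have lim: "w \<longlonglongrightarrow> x" if "\<And>n. dist x (w n) < c * h n" for w
    by (rule tendsto_dist_iff[THEN iffD2], rule tendsto_sandwich[OF _ _ tendsto_const h0])
      (use that in \<open>auto simp: dist_commute intro!: always_eventually less_imp_le\<close>)
  have cont: "isCont (D u v) x" for u v
  proof -
    have "Ck_on 0 S (D u v)" using f by (simp add: numeral_2_eq_2 D_def)
    then show ?thesis using S by (simp add: continuous_on_eq_continuous_at)
  qed
  have "(\<lambda>n. D u v (z n)) \<longlonglongrightarrow> D u v x" "(\<lambda>n. D v u (y n)) \<longlonglongrightarrow> D v u x"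
    using isCont_tendsto_compose[OF cont lim[OF z(1)]] isCont_tendsto_compose[OF cont lim[OF y(1)]] .
  then have "D u v x = D v u x" using eq LIMSEQ_unique by simp
  then show ?thesis by (simp add: D_def)
qed

lemma symmetric_second_derivative:
  fixes f :: "'a::real_normed_vector \<Rightarrow> 'b::euclidean_space"
  assumes S: "open S" "x \<in> S" and f: "Ck_on 2 S f"
  shows "fder (\<lambda>z. fder f z u) x v =
    fder (\<lambda>z. fder f z v) x u"
proof (rule euclidean_eqI)
  fix b :: 'b assume "b \<in> Basis"
  let ?f = "\<lambda>z. f z \<bullet> b"
  have d: "(f has_derivative fder f z) (at z)" if "z \<in> S" for z
    using f that Ck_on_derivative by (metis numeral_2_eq_2)
  have 1: "fder ?f z u = fder f z u \<bullet> b" if "z \<in> S" for z u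
    using frechet_derivative_at[OF has_derivative_inner_left[OF d[OF that], of b]] by metis
  have 2: "fder (\<lambda>z. fder ?f z u) x v =
      fder (\<lambda>z. fder f z u) x v \<bullet> b" for u v
  proof -
    have "Ck_on (Suc 0) S (\<lambda>z. fder f z u)" using f by (simp add: numeral_2_eq_2)
    from frechet_derivative_at[OF has_derivative_inner_left[OF Ck_on_derivative[OF this S(2)], of b]]
    have "fder (\<lambda>z. fder f z u \<bullet> b) x v =
      fder (\<lambda>z. fder f z u) x v \<bullet> b"
      by metis
    moreover have "fder (\<lambda>z. fder ?f z u) x =
        fder (\<lambda>z. fder f z u \<bullet> b) x"
      by (rule frechet_derivative_cong_open[OF S]) (rule 1)
    ultimately show ?thesis by metis
  qed
  have "Ck_on 2 S ?f"
    using f by (rule Ck_on_linear_comp[OF S(1) bounded_linear_inner_left])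
  from symmetric_second_derivative_real[OF S this, of u v]
  show "fder (\<lambda>z. fder f z u) x v \<bullet> b =
    fder (\<lambda>z. fder f z v) x u \<bullet> b"
    by (simp add: 2)
qed

lemma smooth_on_symmetric:
  fixes f :: "'a::real_normed_vector \<Rightarrow> 'b::euclidean_space"
  assumes "open S" "x \<in> S" "smooth_on S f"
  shows "fder (\<lambda>z. fder f z u) x v =
    fder (\<lambda>z. fder f z v) x u"
  using symmetric_second_derivative assms smooth_onD by blast

text \<open>Product rule in the direction argument: one term is a second derivative with the
  direction frozen at \<open>x\<close>, the other differentiates the direction. It separates the
  second derivatives of a transition map in the bracket of two transformed fields.\<close>

lemma frechet_derivative_along:
  fixes f :: "'a::euclidean_space \<Rightarrow> 'b::real_normed_vector"
  assumes S: "open S" "x \<in> S" and f: "smooth_on S f" and X: "smooth_on S X"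
  shows "fder (\<lambda>z. fder f z (X z)) x v =
    fder (\<lambda>z. fder f z (X x)) x v +
    fder f x (fder X x v)"
proof -
  let ?f = "\<lambda>z. fder f z"
  let ?X = "fder X x"
  have X': "(X has_derivative ?X) (at x)" using smooth_on_derivative[OF X S(2)] .
  have fb: "((\<lambda>z. ?f z b) has_derivative fder (\<lambda>z. ?f z b) x) (at x)" for b
    using smooth_on_derivative[OF smooth_on_frechet[OF f] S(2)] .
  have lin: "?f z w = (\<Sum>b\<in>Basis. (w \<bullet> b) *\<^sub>R ?f z b)" if "z \<in> S" for z w
    by (rule linear_euclidean_sum[OF smooth_on_linear_derivative[OF f that]])
  have d1: "((\<lambda>z. \<Sum>b\<in>Basis. (X z \<bullet> b) *\<^sub>R ?f z b) has_derivative
      (\<lambda>v. \<Sum>b\<in>Basis. (X x \<bullet> b) *\<^sub>R fder (\<lambda>z. ?f z b) x v + (?X v \<bullet> b) *\<^sub>R ?f x b)) (at x)"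
    by (intro has_derivative_sum has_derivative_scaleR has_derivative_inner_left X' fb)
  have d2: "((\<lambda>z. \<Sum>b\<in>Basis. (X x \<bullet> b) *\<^sub>R ?f z b) has_derivative
      (\<lambda>v. \<Sum>b\<in>Basis. (X x \<bullet> b) *\<^sub>R fder (\<lambda>z. ?f z b) x v)) (at x)"
    by (intro has_derivative_sum has_derivative_scaleR_right fb)
  have 1: "fder (\<lambda>z. ?f z (X z)) x =
    (\<lambda>v. \<Sum>b\<in>Basis. (X x \<bullet> b) *\<^sub>R fder (\<lambda>z. ?f z b) x v + (?X v \<bullet> b) *\<^sub>R ?f x b)"
    unfolding frechet_derivative_at[OF d1] by (rule frechet_derivative_cong_open[OF S]) (rule lin)
  have 2: "fder (\<lambda>z. ?f z (X x)) x =
    (\<lambda>v. \<Sum>b\<in>Basis. (X x \<bullet> b) *\<^sub>R fder (\<lambda>z. ?f z b) x v)"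
    unfolding frechet_derivative_at[OF d2] by (rule frechet_derivative_cong_open[OF S]) (rule lin)
  show ?thesis unfolding 1 2 using lin[OF S(2), of "?X v"] by (simp add: sum.distrib)
qed

section \<open>Frames and exterior derivatives in coordinates\<close>

lemma exhaust_5:
  fixes x :: 5
  shows "x = 0 \<or> x = 1 \<or> x = 2 \<or> x = 3 \<or> x = 4"
proof (induct x)
  case (of_int z)
  then have "z = 0 \<or> z = 1 \<or> z = 2 \<or> z = 3 \<or> z = 4" by fastforce
  then show ?case by auto
qed

lemma forall_5: "(\<forall>i::5. P i) \<longleftrightarrow> P 0 \<and> P 1 \<and> P 2 \<and> P 3 \<and> P 4"
  by (metis exhaust_5)

lemma UNIV_5: "(UNIV :: 5 set) = {0, 1, 2, 3, 4}"
  using exhaust_5 by auto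

lemma sum_5: "sum f (UNIV :: 5 set) = f 0 + f 1 + f 2 + f 3 + f 4"
  unfolding UNIV_5 by (simp add: ac_simps)

lemma row5_nth [simp]:
  "row5 z0 z1 z2 z3 z4 $ 0 = z0" "row5 z0 z1 z2 z3 z4 $ 1 = z1" "row5 z0 z1 z2 z3 z4 $ 2 = z2"
  "row5 z0 z1 z2 z3 z4 $ 3 = z3" "row5 z0 z1 z2 z3 z4 $ 4 = z4"
  by (simp_all add: row5_def)

lemma vec5_eq_iff:
  "x = y \<longleftrightarrow> x $ 0 = y $ 0 \<and> x $ 1 = y $ 1 \<and> x $ 2 = y $ 2 \<and> x $ 3 = y $ 3 \<and> x $ 4 = y $ 4"
  for x y :: "'a^5"
  unfolding vec_eq_iff forall_5 ..

lemma inner_5: "x \<bullet> y = x $ 0 * y $ 0 + x $ 1 * y $ 1 + x $ 2 * y $ 2 + x $ 3 * y $ 3 + x $ 4 * y $ 4"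
  for x y :: "real^5"
  by (simp add: inner_vec_def sum_5)

lemma matrix_vector_5: "(m *v x) $ i = m $ i $ 0 * x $ 0 + m $ i $ 1 * x $ 1 + m $ i $ 2 * x $ 2 + m $ i $ 3 * x $ 3 + m $ i $ 4 * x $ 4"
  for x :: "real^5"
  by (simp add: matrix_vector_mult_def sum_5)

lemma matrix_matrix_5: "(m ** n) $ i $ j = m $ i $ 0 * n $ 0 $ j + m $ i $ 1 * n $ 1 $ j + m $ i $ 2 * n $ 2 $ j + m $ i $ 3 * n $ 3 $ j + m $ i $ 4 * n $ 4 $ j"
  for m :: "real^5^'n"
  by (simp add: matrix_matrix_mult_def sum_5)

lemma smooth_on_matrixI:
  fixes f :: "'a::real_normed_vector \<Rightarrow> real^'m^'n"
  assumes "open S" "\<And>i j. smooth_on S (\<lambda>x. f x $ i $ j)"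
  shows "smooth_on S f"
  by (intro smooth_on_vecI assms)

lemma smooth_on_row5 [smooth_intros]:
  assumes "open S" "smooth_on S f0" "smooth_on S f1" "smooth_on S f2" "smooth_on S f3" "smooth_on S f4"
  shows "smooth_on S (\<lambda>x. row5 (f0 x) (f1 x) (f2 x) (f3 x) (f4 x))"
proof (rule smooth_on_vecI[OF assms(1)])
  fix i :: 5
  show "smooth_on S (\<lambda>x. row5 (f0 x) (f1 x) (f2 x) (f3 x) (f4 x) $ i)"
    using exhaust_5[of i] assms by auto
qed

lemma smooth_on_matrix_mult [smooth_intros]:
  fixes f :: "'a::real_normed_vector \<Rightarrow> real^'k^'n" and g :: "'a \<Rightarrow> real^'m^'k"
  assumes "open S" "smooth_on S f" "smooth_on S g"
  shows "smooth_on S (\<lambda>x. f x ** g x)"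
  by (rule smooth_on_matrixI) (auto simp: matrix_matrix_mult_def intro!: smooth_intros assms)

lemma smooth_on_matrix_vector_mult [smooth_intros]:
  fixes f :: "'a::real_normed_vector \<Rightarrow> real^'k^'n" and g :: "'a \<Rightarrow> real^'k"
  assumes "open S" "smooth_on S f" "smooth_on S g"
  shows "smooth_on S (\<lambda>x. f x *v g x)"
  by (rule smooth_on_vecI) (auto simp: matrix_vector_mult_def intro!: smooth_intros assms)

definition dual :: "real^5^5 \<Rightarrow> 5 \<Rightarrow> real^5" where
  "dual w i = column i (matrix_inv w)"

lemma matrix_inv_works:
  fixes w :: "real^'n^'n"
  assumes "invertible w"
  shows "w ** matrix_inv w = mat 1" "matrix_inv w ** w = mat 1"
proof -
  have "w ** matrix_inv w = mat 1 \<and> matrix_inv w ** w = mat 1"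
    using assms unfolding invertible_def matrix_inv_def by (rule someI_ex)
  then show "w ** matrix_inv w = mat 1" "matrix_inv w ** w = mat 1" by auto
qed

lemma inner_dual: "invertible w \<Longrightarrow> w $ k \<bullet> dual w i = (if k = i then 1 else 0)"
  using matrix_inv_works(1)[of w]
  by (simp add: dual_def column_def vec_eq_iff matrix_matrix_mult_def inner_vec_def mat_def)

lemma dual_expand:
  assumes "invertible w"
  shows "v = (\<Sum>i\<in>UNIV. (w $ i \<bullet> v) *\<^sub>R dual w i)"
proof -
  have "v = matrix_inv w *v (w *v v)"
    using assms by (simp add: matrix_vector_mul_assoc matrix_inv_works(2))
  also have "\<dots> = (\<Sum>i\<in>UNIV. (w $ i \<bullet> v) *\<^sub>R dual w i)"
    unfolding matrix_mult_sum[of "matrix_inv w"] by (simp add: dual_def scalar_mult_eq_scaleR matrix_vector_mul_component)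
  finally show ?thesis .
qed

lemma dual_unique:
  assumes "invertible w" "\<And>k. w $ k \<bullet> v = (if k = i then 1 else 0)"
  shows "v = dual w i"
  proof -
  have "v = (\<Sum>k\<in>UNIV. if k = i then dual w k else 0)"
    by (rule trans[OF dual_expand[OF assms(1)] sum.cong]) (auto simp: assms(2))
  then show ?thesis by simp
qed

text \<open>Cramer's rule: the inverse becomes a quotient of determinants, from which its smoothness
  is read off.\<close>

lemma matrix_inv_entry:
  fixes w :: "real^'n^'n"
  assumes "invertible w"
  shows "matrix_inv w $ k $ i = det (\<chi> m j. if j = k then (axis i 1 :: real^'n) $ m else w $ m $ j) / det w"
proof -
  have "det w \<noteq> 0" using assms by (simp add: invertible_det_nz)
  moreover have "w *v column i (matrix_inv w) = axis i 1"
    using assms by (metis matrix_inv_works(1) matrix_vector_mul_assoc matrix_vector_mul_lid matrix_vector_mult_basis)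
  ultimately have "column i (matrix_inv w) =
      (\<chi> k. det (\<chi> m j. if j = k then (axis i 1 :: real^'n) $ m else w $ m $ j) / det w)"
    using cramer by blast
  then show ?thesis by (simp add: column_def vec_eq_iff)
qed

lemma smooth_on_det [smooth_intros]:
  fixes f :: "'a::real_normed_vector \<Rightarrow> real^'n^'n"
  assumes "open S" "smooth_on S f"
  shows "smooth_on S (\<lambda>x. det (f x))"
  unfolding det_def by (intro smooth_intros assms)

lemma smooth_on_matrix_inv [smooth_intros]:
  fixes f :: "'a::real_normed_vector \<Rightarrow> real^'n^'n"
  assumes S: "open S" and f: "smooth_on S f" and inv: "\<And>x. x \<in> S \<Longrightarrow> invertible (f x)"
  shows "smooth_on S (\<lambda>x. matrix_inv (f x))"
proof (rule smooth_on_matrixI[OF S])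
  fix k i :: 'n
  have "smooth_on S (\<lambda>x. if j = k then (axis i 1 :: real^'n) $ m else f x $ m $ j)" for m j
    using S f by (cases "j = k") (auto intro!: smooth_intros)
  then have "smooth_on S (\<lambda>x. det (\<chi> m j. if j = k then (axis i 1 :: real^'n) $ m else f x $ m $ j) / det (f x))"
    using inv by (intro smooth_on_divide[OF S smooth_on_det[OF S smooth_on_matrixI[OF S]] smooth_on_det[OF S f]])
      (simp_all add: invertible_det_nz)
  then show "smooth_on S (\<lambda>x. matrix_inv (f x) $ k $ i)"
    by (rule smooth_on_congI[OF S]) (rule matrix_inv_entry[OF inv])
qed

lemma smooth_on_dual [smooth_intros]:
  "open S \<Longrightarrow> smooth_on S f \<Longrightarrow> (\<And>x. x \<in> S \<Longrightarrow> invertible (f x)) \<Longrightarrow> smooth_on S (\<lambda>x. dual (f x) i)"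
  unfolding dual_def column_def by (rule smooth_on_vecI) (auto intro!: smooth_intros)

section \<open>Derivatives along the frame dual to a coframe\<close>

definition fd :: "(real^5 \<Rightarrow> real^5^5) \<Rightarrow> 5 \<Rightarrow> (real^5 \<Rightarrow> real) \<Rightarrow> real^5 \<Rightarrow> real" where
  "fd w i F y = fder F y (dual (w y) i)"

lemma fd_cong: "open S \<Longrightarrow> y \<in> S \<Longrightarrow> (\<And>z. z \<in> S \<Longrightarrow> F z = G z) \<Longrightarrow> fd w i F y = fd w i G y"
  unfolding fd_def by (simp add: frechet_derivative_cong_open[of S y F G])

lemma fd_const [simp]: "fd w i (\<lambda>z. c) y = 0"
  unfolding fd_def by (simp add: frechet_derivative_const)

lemma fd_eqI: "(F has_derivative F') (at y) \<Longrightarrow> fd w i F y = F' (dual (w y) i)"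
  unfolding fd_def using frechet_derivative_at by metis

context
  fixes S and F G :: "real^5 \<Rightarrow> real" and y
  assumes S: "smooth_on S F" "smooth_on S G" "y \<in> S"
begin

lemma fd_add: "fd w i (\<lambda>z. F z + G z) y = fd w i F y + fd w i G y"
  using fd_eqI[OF has_derivative_add[OF smooth_on_derivative smooth_on_derivative]] S
  by (simp add: fd_def)

lemma fd_diff: "fd w i (\<lambda>z. F z - G z) y = fd w i F y - fd w i G y"
  using fd_eqI[OF has_derivative_diff[OF smooth_on_derivative smooth_on_derivative]] S
  by (simp add: fd_def)

lemma fd_mult: "fd w i (\<lambda>z. F z * G z) y = F y * fd w i G y + fd w i F y * G y"
  using fd_eqI[OF has_derivative_mult[OF smooth_on_derivative smooth_on_derivative]] S
  by (simp add: fd_def)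

end

lemma fd_minus: "smooth_on S F \<Longrightarrow> y \<in> S \<Longrightarrow> fd w i (\<lambda>z. - F z) y = - fd w i F y"
  using fd_eqI[OF has_derivative_minus[OF smooth_on_derivative]] by (simp add: fd_def)

lemma fd_cmult: "smooth_on S F \<Longrightarrow> y \<in> S \<Longrightarrow> fd w i (\<lambda>z. c * F z) y = c * fd w i F y"
  using fd_eqI[OF has_derivative_mult_right[OF smooth_on_derivative]] by (simp add: fd_def)

lemma fd_power: "smooth_on S F \<Longrightarrow> y \<in> S \<Longrightarrow> fd w i (\<lambda>z. F z ^ n) y = real n * F y ^ (n - 1) * fd w i F y"
  using fd_eqI[OF has_derivative_power[OF smooth_on_derivative]]
  by (simp add: fd_def mult.commute mult.left_commute)

lemma smooth_on_fd [smooth_intros]: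
  "open S \<Longrightarrow> smooth_on S w \<Longrightarrow> (\<And>x. x \<in> S \<Longrightarrow> invertible (w x)) \<Longrightarrow> smooth_on S F \<Longrightarrow> smooth_on S (fd w i F)"
  unfolding fd_def [abs_def] by (intro smooth_intros)

lemma ext_deriv_smooth:
  assumes "smooth_on S \<theta>" "y \<in> S"
  shows "ext_deriv \<theta> y u v =
    fder (\<lambda>z. \<theta> z \<bullet> v) y u - fder (\<lambda>z. \<theta> z \<bullet> u) y v"
proof -
  have "fder (\<lambda>z. \<theta> z \<bullet> v) y u = fder \<theta> y u \<bullet> v" for u v
    using frechet_derivative_at[OF has_derivative_inner_left[OF smooth_on_derivative[OF assms], of v]] by metis
  then show ?thesis by (simp add: ext_deriv_def)
qed

text \<open>From d(f_k w^k) = df_k \<and> w^k + f_k dw^k; on the dual vectors i and j the first term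
  picks out the coefficients \<open>f j\<close> and \<open>f i\<close>.\<close>

lemma ext_deriv_combination:
  assumes S: "open S" "y \<in> S" and w: "smooth_on S w" "\<And>x. x \<in> S \<Longrightarrow> invertible (w x)"
    and f: "\<And>k. smooth_on S (f k)" and \<theta>: "\<And>z. z \<in> S \<Longrightarrow> \<theta> z = (\<Sum>k\<in>UNIV. f k z *\<^sub>R w z $ k)"
  shows "ext_deriv \<theta> y (dual (w y) i) (dual (w y) j) = fd w i (f j) y - fd w j (f i) y +
    (\<Sum>k\<in>UNIV. f k y * ext_deriv (\<lambda>z. w z $ k) y (dual (w y) i) (dual (w y) j))"
proof -
  let ?E = "\<lambda>i. dual (w y) i"
  let ?w = "\<lambda>k. fder (\<lambda>z. w z $ k) y"
  have wk: "((\<lambda>z. w z $ k) has_derivative ?w k) (at y)" for k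
    by (rule smooth_on_derivative[OF smooth_on_vec_nth[OF S(1) w(1)] S(2)])
  have fk: "(f k has_derivative fder (f k) y) (at y)" for k
    by (rule smooth_on_derivative[OF f S(2)])
  have "((\<lambda>z. \<Sum>k\<in>UNIV. f k z *\<^sub>R w z $ k) has_derivative
      (\<lambda>u. \<Sum>k\<in>UNIV. f k y *\<^sub>R ?w k u + fder (f k) y u *\<^sub>R w y $ k)) (at y)"
    by (intro has_derivative_sum has_derivative_scaleR wk fk)
  from frechet_derivative_at[OF this, symmetric]
  have "fder (\<lambda>z. \<Sum>k\<in>UNIV. f k z *\<^sub>R w z $ k) y =
      (\<lambda>u. \<Sum>k\<in>UNIV. f k y *\<^sub>R ?w k u + fder (f k) y u *\<^sub>R w y $ k)" .
  then have 1: "fder \<theta> y u \<bullet> v =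
      (\<Sum>k\<in>UNIV. f k y * (?w k u \<bullet> v) + fder (f k) y u * (w y $ k \<bullet> v))" for u v
    using frechet_derivative_cong_open[OF S \<theta>] by (simp add: inner_sum_left inner_add_left)
  have 2: "fder \<theta> y u \<bullet> ?E j =
      (\<Sum>k\<in>UNIV. f k y * (?w k u \<bullet> ?E j)) + fder (f j) y u" for u j
    proof -
    have "(\<Sum>k\<in>UNIV. fder (f k) y u * (w y $ k \<bullet> ?E j)) =
        (\<Sum>k\<in>UNIV. if k = j then fder (f k) y u else 0)"
      by (rule sum.cong) (auto simp: inner_dual[OF w(2)[OF S(2)]])
    then show ?thesis unfolding 1 by (simp add: sum.distrib)
  qed
  show ?thesis
    unfolding ext_deriv_def 2 fd_def by (simp add: sum_subtractf algebra_simps)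
qed

text \<open>Expresses d(dF) = 0, with dF written in the coframe. In this form the structure
  equations become integrability conditions for functions.\<close>

lemma fd_commutator:
  assumes S: "open S" "y \<in> S" and w: "smooth_on S w" "\<And>x. x \<in> S \<Longrightarrow> invertible (w x)"
    and F: "smooth_on S F"
  shows "fd w i (fd w j F) y - fd w j (fd w i F) y =
    - (\<Sum>k\<in>UNIV. fd w k F y * ext_deriv (\<lambda>z. w z $ k) y (dual (w y) i) (dual (w y) j))"
proof -
  define G where "G z = (\<Sum>k\<in>UNIV. fd w k F z *\<^sub>R w z $ k)" for z
  have sm: "smooth_on S (fd w k F)" for k by (intro smooth_intros S w F)
  have G: "smooth_on S G" unfolding G_def[abs_def] by (intro smooth_intros S w F)
  have "G z \<bullet> v = fder F z v" if "z \<in> S" for z v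
  proof -
    have "fder F z v = fder F z (\<Sum>k\<in>UNIV. (w z $ k \<bullet> v) *\<^sub>R dual (w z) k)"
      by (rule arg_cong[OF dual_expand[OF w(2)[OF that]]])
    then show ?thesis
      using smooth_on_linear_derivative[OF F that]
      by (simp add: G_def fd_def linear_sum linear_scale inner_sum_left mult.commute)
  qed
  then have "fder (\<lambda>z. G z \<bullet> v) y u =
      fder (\<lambda>z. fder F z v) y u" for u v
    using frechet_derivative_cong_open[OF S, of "\<lambda>z. G z \<bullet> v"] by metis
  then have "ext_deriv G y u v = 0" for u v
    using ext_deriv_smooth[OF G S(2), of u v] smooth_on_symmetric[OF S F, of u v] by simp
  then show ?thesis
    using ext_deriv_combination[OF S w sm G_def, of i j] by simp
qed

text \<open>d(d\<phi>) = 0 on constant vector fields, where no brackets occur: the six second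
  derivatives cancel in pairs by symmetry.\<close>

lemma ext_deriv_closed:
  assumes S: "open S" "y \<in> S" and \<phi>: "smooth_on S \<phi>"
  shows "fder (\<lambda>z. ext_deriv \<phi> z v w) y u + fder (\<lambda>z. ext_deriv \<phi> z w u) y v +
    fder (\<lambda>z. ext_deriv \<phi> z u v) y w = 0"
proof -
  have s: "smooth_on S (\<lambda>z. \<phi> z \<bullet> v)" for v by (intro smooth_intros S \<phi>)
  let ?D = "\<lambda>v u. fder (\<lambda>z. fder (\<lambda>z. \<phi> z \<bullet> v) z u) y"
  have d: "((\<lambda>z. fder (\<lambda>z. \<phi> z \<bullet> v) z u) has_derivative ?D v u) (at y)" for u v
    by (rule smooth_on_derivative[OF smooth_on_frechet[OF s] S(2)])
  have "fder (\<lambda>z. ext_deriv \<phi> z v w) y u = ?D w v u - ?D v w u" for u v w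
  proof -
    have "fder (\<lambda>z. ext_deriv \<phi> z v w) y = frechet_derivative
      (\<lambda>z. fder (\<lambda>z. \<phi> z \<bullet> w) z v - fder (\<lambda>z. \<phi> z \<bullet> v) z w) (at y)"
      by (rule frechet_derivative_cong_open[OF S]) (rule ext_deriv_smooth[OF \<phi>])
    also have "\<dots> = (\<lambda>u. ?D w v u - ?D v w u)"
      by (rule frechet_derivative_at[symmetric]) (intro has_derivative_diff d)
    finally show ?thesis by simp
  qed
  then show ?thesis
    using smooth_on_symmetric[OF S s, of u v w] smooth_on_symmetric[OF S s, of v w u]
      smooth_on_symmetric[OF S s, of w u v] by simp
qed

text \<open>Applying d to d\<phi> = r \<theta> \<and> \<psi> gives d\<theta> \<and> \<psi> =
  \<theta> \<and> d\<psi>, and the right side contains \<theta> twice. The conclusion is d\<theta>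
  \<and> \<psi> = 0, evaluated on three vectors.\<close>

lemma wedge_closed:
  assumes S: "open S" "y \<in> S" and sm: "smooth_on S \<phi>" "smooth_on S \<theta>" "smooth_on S \<psi>"
    and d\<phi>: "\<And>z u v. z \<in> S \<Longrightarrow> ext_deriv \<phi> z u v = r * wedge (\<theta> z) (\<psi> z) u v"
    and d\<psi>: "\<And>u v. ext_deriv \<psi> y u v = s * wedge (\<theta> y) \<eta> u v" and r: "r \<noteq> 0"
  shows "ext_deriv \<theta> y u v * (\<psi> y \<bullet> w) + ext_deriv \<theta> y v w * (\<psi> y \<bullet> u) + ext_deriv \<theta> y w u * (\<psi> y \<bullet> v) = 0"
proof -
  let ?t = "fder \<theta> y" and ?p = "fder \<psi> y"
  have d: "(\<theta> has_derivative ?t) (at y)" "(\<psi> has_derivative ?p) (at y)"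
    using smooth_on_derivative[OF sm(2) S(2)] smooth_on_derivative[OF sm(3) S(2)] .
  have "fder (\<lambda>z. ext_deriv \<phi> z v w) y u =
      r * ((?t u \<bullet> v) * (\<psi> y \<bullet> w) + (\<theta> y \<bullet> v) * (?p u \<bullet> w) - (?t u \<bullet> w) * (\<psi> y \<bullet> v) - (\<theta> y \<bullet> w) * (?p u \<bullet> v))" for u v w
  proof -
    have "fder (\<lambda>z. ext_deriv \<phi> z v w) y =
        fder (\<lambda>z. r * ((\<theta> z \<bullet> v) * (\<psi> z \<bullet> w) - (\<theta> z \<bullet> w) * (\<psi> z \<bullet> v))) y"
      by (rule frechet_derivative_cong_open[OF S]) (simp add: d\<phi> wedge_def)
    also have "\<dots> = (\<lambda>u. r * ((\<theta> y \<bullet> v) * (?p u \<bullet> w) + (?t u \<bullet> v) * (\<psi> y \<bullet> w) -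
        ((\<theta> y \<bullet> w) * (?p u \<bullet> v) + (?t u \<bullet> w) * (\<psi> y \<bullet> v))))"
      by (rule frechet_derivative_at[symmetric])
        (intro has_derivative_mult_right has_derivative_diff has_derivative_mult has_derivative_inner_left d)
    finally show ?thesis by (simp add: algebra_simps)
  qed
  with ext_deriv_closed[OF S sm(1), of v w u]
  have "r * (((?t u \<bullet> v) * (\<psi> y \<bullet> w) + (\<theta> y \<bullet> v) * (?p u \<bullet> w) - (?t u \<bullet> w) * (\<psi> y \<bullet> v) - (\<theta> y \<bullet> w) * (?p u \<bullet> v)) +
    ((?t v \<bullet> w) * (\<psi> y \<bullet> u) + (\<theta> y \<bullet> w) * (?p v \<bullet> u) - (?t v \<bullet> u) * (\<psi> y \<bullet> w) - (\<theta> y \<bullet> u) * (?p v \<bullet> w)) +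
    ((?t w \<bullet> u) * (\<psi> y \<bullet> v) + (\<theta> y \<bullet> u) * (?p w \<bullet> v) - (?t w \<bullet> v) * (\<psi> y \<bullet> u) - (\<theta> y \<bullet> v) * (?p w \<bullet> u))) = 0"
    by (simp add: algebra_simps)
  then have "((?t u \<bullet> v) * (\<psi> y \<bullet> w) + (\<theta> y \<bullet> v) * (?p u \<bullet> w) - (?t u \<bullet> w) * (\<psi> y \<bullet> v) - (\<theta> y \<bullet> w) * (?p u \<bullet> v)) +
    ((?t v \<bullet> w) * (\<psi> y \<bullet> u) + (\<theta> y \<bullet> w) * (?p v \<bullet> u) - (?t v \<bullet> u) * (\<psi> y \<bullet> w) - (\<theta> y \<bullet> u) * (?p v \<bullet> w)) +
    ((?t w \<bullet> u) * (\<psi> y \<bullet> v) + (\<theta> y \<bullet> u) * (?p w \<bullet> v) - (?t w \<bullet> v) * (\<psi> y \<bullet> u) - (\<theta> y \<bullet> v) * (?p w \<bullet> u)) = 0"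
    using r by (simp only: mult_eq_0_iff) simp
  then have "ext_deriv \<theta> y u v * (\<psi> y \<bullet> w) + ext_deriv \<theta> y v w * (\<psi> y \<bullet> u) + ext_deriv \<theta> y w u * (\<psi> y \<bullet> v) =
     (\<theta> y \<bullet> u) * ext_deriv \<psi> y v w + (\<theta> y \<bullet> v) * ext_deriv \<psi> y w u + (\<theta> y \<bullet> w) * ext_deriv \<psi> y u v"
    unfolding ext_deriv_def by (simp add: algebra_simps)
  also have "\<dots> = 0"
    unfolding d\<psi> wedge_def by (simp add: algebra_simps)
  finally show ?thesis .
qed

section \<open>The structure equations in coordinates\<close>

text \<open>With \<open>\<theta> = 1/4 (b\<^sup>2 - 4 a c + M - P) \<omega>\<^sup>0 + c \<omega>\<^sup>1 - b \<omega>\<^sup>2 + a \<omega>\<^sup>3 - J \<omega>\<^sup>4\<close> the structure equations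
  become \<open>d\<omega>\<^sup>1 = 3 \<theta> \<and> \<omega>\<^sup>2\<close>, \<open>d\<omega>\<^sup>2 = 2 \<theta> \<and> \<omega>\<^sup>3\<close>, \<open>d\<omega>\<^sup>3 = \<theta> \<and> \<omega>\<^sup>4\<close> and \<open>d\<omega>\<^sup>4 = 0\<close>. This forces
  \<open>d\<theta> = 0\<close>, because \<open>d\<theta>\<close> is divisible by \<open>\<omega>\<^sup>2\<close>, \<open>\<omega>\<^sup>3\<close> and \<open>\<omega>\<^sup>4\<close>.\<close>

definition comb :: "(real^5 \<Rightarrow> real^5^5) \<Rightarrow> (5 \<Rightarrow> real^5 \<Rightarrow> real) \<Rightarrow> real^5 \<Rightarrow> real^5" where
  "comb w f y = (\<Sum>k\<in>UNIV. f k y *\<^sub>R w y $ k)"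

text \<open>The components \<open>\<theta> k\<close> refer to the coframe \<open>w\<close> itself.
  They are free parameters, so that a coframe whose \<theta> is known beforehand, such as one with
  \<theta> = - du, fits as well as one given through a, b, c, J, M, P.\<close>

definition local_se :: "(real^5) set \<Rightarrow> (real^5 \<Rightarrow> real^5^5) \<Rightarrow> (5 \<Rightarrow> real^5 \<Rightarrow> real) \<Rightarrow> bool" where
  "local_se S w \<theta> \<longleftrightarrow> open S \<and> smooth_on S w \<and> (\<forall>y\<in>S. invertible (w y)) \<and> (\<forall>k. smooth_on S (\<theta> k)) \<and>
     (\<forall>y\<in>S. \<forall>u v.
        ext_deriv (\<lambda>z. w z $ 0) y u v = wedge (w y $ 1) (w y $ 4) u v - 3 * wedge (w y $ 2) (w y $ 3) u v \<and>
        ext_deriv (\<lambda>z. w z $ 1) y u v = 3 * wedge (comb w \<theta> y) (w y $ 2) u v \<and>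
        ext_deriv (\<lambda>z. w z $ 2) y u v = 2 * wedge (comb w \<theta> y) (w y $ 3) u v \<and>
        ext_deriv (\<lambda>z. w z $ 3) y u v = wedge (comb w \<theta> y) (w y $ 4) u v \<and>
        ext_deriv (\<lambda>z. w z $ 4) y u v = 0)"

definition kron :: "5 \<Rightarrow> 5 \<Rightarrow> real" where
  "kron i j = (if i = j then 1 else 0)"

text \<open>The value of d\<omega>^k on the dual vectors i and j, where \<open>t\<close> holds the
  components of \<theta> at the point.\<close>

definition struct_coeff :: "(5 \<Rightarrow> real) \<Rightarrow> 5 \<Rightarrow> 5 \<Rightarrow> 5 \<Rightarrow> real" where
  "struct_coeff t k i j = (
     if k = 0 then kron 1 i * kron 4 j - kron 1 j * kron 4 i - 3 * (kron 2 i * kron 3 j - kron 2 j * kron 3 i)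
     else if k = 1 then 3 * (t i * kron 2 j - t j * kron 2 i)
     else if k = 2 then 2 * (t i * kron 3 j - t j * kron 3 i)
     else if k = 3 then t i * kron 4 j - t j * kron 4 i else 0)"

lemma comb_inner_dual: "invertible (w y) \<Longrightarrow> comb w f y \<bullet> dual (w y) i = f i y"
  by (simp add: comb_def inner_sum_left inner_dual if_distrib cong: if_cong)

context
  fixes S w \<theta>
  assumes se: "local_se S w \<theta>"
begin

lemma se_basic: "open S" "smooth_on S w" "\<And>y. y \<in> S \<Longrightarrow> invertible (w y)" "smooth_on S (\<theta> k)"
  using se by (auto simp: local_se_def)

lemma se_ext_deriv:
  assumes "y \<in> S"
  shows "ext_deriv (\<lambda>z. w z $ 0) y u v = wedge (w y $ 1) (w y $ 4) u v - 3 * wedge (w y $ 2) (w y $ 3) u v"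
    "ext_deriv (\<lambda>z. w z $ 1) y u v = 3 * wedge (comb w \<theta> y) (w y $ 2) u v"
    "ext_deriv (\<lambda>z. w z $ 2) y u v = 2 * wedge (comb w \<theta> y) (w y $ 3) u v"
    "ext_deriv (\<lambda>z. w z $ 3) y u v = wedge (comb w \<theta> y) (w y $ 4) u v"
    "ext_deriv (\<lambda>z. w z $ 4) y u v = 0"
  using se assms unfolding local_se_def by blast+

lemma se_struct_coeff:
  assumes y: "y \<in> S"
  shows "ext_deriv (\<lambda>z. w z $ k) y (dual (w y) i) (dual (w y) j) = struct_coeff (\<lambda>k. \<theta> k y) k i j"
proof -
  have "w y $ k \<bullet> dual (w y) i = kron k i" for k i
    using inner_dual[OF se_basic(3)[OF y]] by (simp add: kron_def)
  then show ?thesis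
    using exhaust_5[of k]
    by (auto simp: se_ext_deriv[OF y] struct_coeff_def wedge_def comb_inner_dual se_basic(3) y)
qed

lemma se_commutator:
  assumes "y \<in> S" "smooth_on S F"
  shows "fd w i (fd w j F) y - fd w j (fd w i F) y = - (\<Sum>k\<in>UNIV. fd w k F y * struct_coeff (\<lambda>k. \<theta> k y) k i j)"
  using fd_commutator[OF se_basic(1) assms(1) se_basic(2,3) assms(2)] se_struct_coeff[OF assms(1)] by simp

lemma se_smooth_comb: "smooth_on S (comb w \<theta>)"
  unfolding comb_def[abs_def] by (intro smooth_intros se_basic)

lemma se_theta_closed_frame:
  assumes y: "y \<in> S"
  shows "ext_deriv (comb w \<theta>) y (dual (w y) i) (dual (w y) j) = 0"
proof -
  let ?D = "\<lambda>i j. ext_deriv (comb w \<theta>) y (dual (w y) i) (dual (w y) j)"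
  have sw: "smooth_on S (\<lambda>z. w z $ k)" for k by (intro smooth_intros se_basic)
  have "ext_deriv (comb w \<theta>) y u v * (w y $ m \<bullet> x) + ext_deriv (comb w \<theta>) y v x * (w y $ m \<bullet> u) +
      ext_deriv (comb w \<theta>) y x u * (w y $ m \<bullet> v) = 0" if "m = 2 \<or> m = 3 \<or> m = 4" for m u v x
    using that
  proof (elim disjE)
    assume "m = 2"
    then show ?thesis
      using wedge_closed[OF se_basic(1) y sw[of 1] se_smooth_comb sw[of 2] se_ext_deriv(2) se_ext_deriv(3)[OF y]] by simp
  next
    assume "m = 3"
    then show ?thesis
      using wedge_closed[OF se_basic(1) y sw[of 2] se_smooth_comb sw[of 3] se_ext_deriv(3), of 1 "w y $ 4"] se_ext_deriv(4)[OF y] by simp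
  next
    assume "m = 4"
    then show ?thesis
      using wedge_closed[OF se_basic(1) y sw[of 3] se_smooth_comb sw[of 4], of 1 0 "w y $ 4"] se_ext_deriv(4) se_ext_deriv(5)[OF y] by simp
  qed
  note cyc = this
  \<comment> \<open>Two indices leave at least one m among 2, 3, 4 free. Evaluated on the dual
    vectors i, j, m, the equation d\<theta> \<and> \<omega>^m = 0 leaves only the term
    d\<theta>(e_i, e_j).\<close>
  have "2 \<noteq> i \<and> 2 \<noteq> j \<or> 3 \<noteq> i \<and> 3 \<noteq> j \<or> 4 \<noteq> i \<and> 4 \<noteq> j" by auto
  then obtain m where m: "m = 2 \<or> m = 3 \<or> m = 4" "m \<noteq> i" "m \<noteq> j" by blast
  show ?thesis
    using cyc[OF m(1), of "dual (w y) i" "dual (w y) j" "dual (w y) m"] m(2,3)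
    by (simp add: inner_dual se_basic(3) y)
qed

lemma se_theta_closed:
  assumes y: "y \<in> S"
  shows "ext_deriv (comb w \<theta>) y u v = 0"
proof -
  let ?t = "fder (comb w \<theta>) y"
  have l: "linear ?t" using smooth_on_linear_derivative[OF se_smooth_comb y] .
  have lin: "linear (\<lambda>u. ext_deriv (comb w \<theta>) y u v)" for v
    by (rule linearI) (simp_all add: ext_deriv_def linear_add[OF l] linear_scale[OF l] inner_add_left inner_add_right algebra_simps)
  have "ext_deriv (comb w \<theta>) y u v = (\<Sum>i\<in>UNIV. (w y $ i \<bullet> u) * ext_deriv (comb w \<theta>) y (dual (w y) i) v)" for u v
    using arg_cong[OF dual_expand[OF se_basic(3)[OF y], of u], of "\<lambda>u. ext_deriv (comb w \<theta>) y u v"]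
    unfolding linear_sum[OF lin] linear_scale[OF lin] by simp
  note 1 = this
  have anti: "ext_deriv (comb w \<theta>) y u v = - ext_deriv (comb w \<theta>) y v u" for u v
    by (simp add: ext_deriv_def)
  have "ext_deriv (comb w \<theta>) y (dual (w y) i) v = 0" for i v
    unfolding anti[of _ v] by (subst 1) (simp add: se_theta_closed_frame[OF y])
  then show ?thesis by (subst 1) simp
qed

text \<open>Closedness of \<theta> in components; it relates the first derivatives of the structure
  functions to each other.\<close>

lemma se_theta_commutator:
  assumes y: "y \<in> S"
  shows "fd w i (\<theta> j) y - fd w j (\<theta> i) y = - (\<Sum>k\<in>UNIV. \<theta> k y * struct_coeff (\<lambda>k. \<theta> k y) k i j)"
  using ext_deriv_combination[OF se_basic(1) y se_basic(2,3) se_basic(4), where \<theta> = "comb w \<theta>" and i = i and j = j]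
    se_theta_closed[OF y] se_struct_coeff[OF y]
  by (simp add: comb_def add_eq_0_iff)

end

section \<open>Change of the adapted coframe\<close>

text \<open>\<open>p = s\<^sub>5\<^sup>3\<close>, \<open>q = s\<^sub>7/s\<^sub>5\<close> and \<open>r = s\<^sub>8/s\<^sub>5\<close> are rational functions of the matrix entries, and
  \<open>s\<^sub>0 = p\<^sup>2 r\<^sup>3\<close> is forced by the first structure equation; \<open>t\<^sub>1, \<dots>, t\<^sub>4\<close> are the entries of the first
  column, transported back by the lower right block.\<close>

definition gauge_matrix :: "real \<Rightarrow> real \<Rightarrow> real \<Rightarrow> real \<Rightarrow> (5 \<Rightarrow> real) \<Rightarrow> real^5^5" where
  "gauge_matrix s p q r t = row5
     (row5 s 0 0 0 0)
     (row5 (p * t 1) p 0 0 0)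
     (row5 (p * (q * t 1 + r * t 2)) (p * q) (p * r) 0 0)
     (row5 (p * (q^2 * t 1 + 2 * q * r * t 2 + r^2 * t 3)) (p * q^2) (2 * p * q * r) (p * r^2) 0)
     (row5 (p * (q^3 * t 1 + 3 * q^2 * r * t 2 + 3 * q * r^2 * t 3 + r^3 * t 4))
        (p * q^3) (3 * p * q^2 * r) (3 * p * q * r^2) (p * r^3))"

text \<open>p, q, r are read off the second and third rows; then the first column is solved for
  \<open>t1\<close> to \<open>t4\<close> by forward substitution, which divides by powers of
  \<open>r\<close>.\<close>

lemma structure_group_gauge:
  assumes "B \<in> structure_group"
  defines "p \<equiv> B $ 1 $ 1"
  defines "q \<equiv> B $ 2 $ 1 / p"
  defines "r \<equiv> B $ 2 $ 2 / p"
  defines "t1 \<equiv> B $ 1 $ 0 / p"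
  defines "t2 \<equiv> (B $ 2 $ 0 / p - q * t1) / r"
  defines "t3 \<equiv> (B $ 3 $ 0 / p - q^2 * t1 - 2 * q * r * t2) / r^2"
  defines "t4 \<equiv> (B $ 4 $ 0 / p - q^3 * t1 - 3 * q^2 * r * t2 - 3 * q * r^2 * t3) / r^3"
  shows "p \<noteq> 0" "r \<noteq> 0" "B = gauge_matrix (B $ 0 $ 0) p q r ((\<lambda>_. 0)(1 := t1, 2 := t2, 3 := t3, 4 := t4))"
proof -
  obtain s0 s1 s2 s3 s4 s5 s7 s8 where s: "s0 * s5 * s8 \<noteq> 0" and B: "B = row5
     (row5 s0 0 0 0 0)
     (row5 s1 (s5^3) 0 0 0)
     (row5 s2 (s5^2 * s7) (s5^2 * s8) 0 0)
     (row5 s3 (s5 * s7^2) (2 * s5 * s7 * s8) (s5 * s8^2) 0)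
     (row5 s4 (s7^3) (3 * s7^2 * s8) (3 * s7 * s8^2) (s8^3))"
    using assms(1) unfolding structure_group_def by blast
  have nz: "s5 \<noteq> 0" "s8 \<noteq> 0" using s by auto
  have p: "p = s5^3" by (simp add: p_def B)
  have q: "q = s7 / s5" and r: "r = s8 / s5"
    using nz by (simp_all add: q_def r_def p B field_simps power2_eq_square power3_eq_cube)
  show p0: "p \<noteq> 0" and r0: "r \<noteq> 0" using nz by (simp_all add: p r)
  have t: "p * t1 = s1" "p * (q * t1 + r * t2) = s2" "p * (q^2 * t1 + 2 * q * r * t2 + r^2 * t3) = s3"
    "p * (q^3 * t1 + 3 * q^2 * r * t2 + 3 * q * r^2 * t3 + r^3 * t4) = s4"
    using p0 r0 by (simp_all add: t1_def t2_def t3_def t4_def B)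
  show "B = gauge_matrix (B $ 0 $ 0) p q r ((\<lambda>_. 0)(1 := t1, 2 := t2, 3 := t3, 4 := t4))"
    unfolding vec5_eq_iff gauge_matrix_def using nz
    by (simp add: t) (simp add: B p q r field_simps power2_eq_square power3_eq_cube)
qed

text \<open>\<open>Pj\<close>, \<open>Qj\<close>, \<open>Rj\<close> are derivatives of p, q, r;
  \<open>N1\<close> to \<open>N4\<close> and the \<open>b\<close> are values of differentials and of
  forms on frame vectors. Each of the hypotheses \<open>1\<close> to \<open>4\<close> is p times a
  binomial combination in q and r of the left sides of the conclusions, so that these split off one
  after the other on division by p and powers of r.\<close>

lemma gauge_rows_algebra:
  fixes p q r :: real
  assumes nz: "p \<noteq> 0" "r \<noteq> 0"
    and Pj: "Pj = p * (Aj + 3 * q * Hj)" and Pk: "Pk = p * (Ak + 3 * q * Hk)"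
    and Qj: "Qj = r * Cj - q^2 * Hj" and Qk: "Qk = r * Ck - q^2 * Hk"
    and Rj: "Rj = r * (Dj - 2 * q * Hj)" and Rk: "Rk = r * (Dk - 2 * q * Hk)"
    and 1: "p * N1 + (Pj * b1k - Pk * b1j) = 3 * p * (Hj * (q * b1k + r * b2k) - Hk * (q * b1j + r * b2j))"
    and 2: "p * (q * N1 + r * N2) + ((Pj * (q * b1k + r * b2k) + p * (Qj * b1k + Rj * b2k))
      - (Pk * (q * b1j + r * b2j) + p * (Qk * b1j + Rk * b2j))) =
      2 * p * (Hj * (q^2 * b1k + 2 * q * r * b2k + r^2 * b3k) - Hk * (q^2 * b1j + 2 * q * r * b2j + r^2 * b3j))"
    and 3: "p * (q^2 * N1 + 2 * q * r * N2 + r^2 * N3) +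
      ((Pj * (q^2 * b1k + 2 * q * r * b2k + r^2 * b3k)
        + p * (2 * q * Qj * b1k + 2 * (Qj * r + q * Rj) * b2k + 2 * r * Rj * b3k))
      - (Pk * (q^2 * b1j + 2 * q * r * b2j + r^2 * b3j)
        + p * (2 * q * Qk * b1j + 2 * (Qk * r + q * Rk) * b2j + 2 * r * Rk * b3j))) =
      p * (Hj * (q^3 * b1k + 3 * q^2 * r * b2k + 3 * q * r^2 * b3k + r^3 * b4k)
        - Hk * (q^3 * b1j + 3 * q^2 * r * b2j + 3 * q * r^2 * b3j + r^3 * b4j))"
    and 4: "p * (q^3 * N1 + 3 * q^2 * r * N2 + 3 * q * r^2 * N3 + r^3 * N4) +
      ((Pj * (q^3 * b1k + 3 * q^2 * r * b2k + 3 * q * r^2 * b3k + r^3 * b4k)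
        + p * (3 * q^2 * Qj * b1k + 3 * (2 * q * Qj * r + q^2 * Rj) * b2k
           + 3 * (Qj * r^2 + 2 * q * r * Rj) * b3k + 3 * r^2 * Rj * b4k))
      - (Pk * (q^3 * b1j + 3 * q^2 * r * b2j + 3 * q * r^2 * b3j + r^3 * b4j)
        + p * (3 * q^2 * Qk * b1j + 3 * (2 * q * Qk * r + q^2 * Rk) * b2j
           + 3 * (Qk * r^2 + 2 * q * r * Rk) * b3j + 3 * r^2 * Rk * b4j))) = 0"
  shows "N1 + (Aj * b1k - Ak * b1j) - 3 * r * (Hj * b2k - Hk * b2j) = 0" (is "?E1 = 0")
    "N2 + (Cj * b1k - Ck * b1j) + ((Aj + Dj) * b2k - (Ak + Dk) * b2j) - 2 * r * (Hj * b3k - Hk * b3j) = 0" (is "?E2 = 0")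
    "N3 + 2 * (Cj * b2k - Ck * b2j) + ((Aj + 2 * Dj) * b3k - (Ak + 2 * Dk) * b3j) - r * (Hj * b4k - Hk * b4j) = 0" (is "?E3 = 0")
    "N4 + 3 * (Cj * b3k - Ck * b3j) + ((Aj + 3 * Dj) * b4k - (Ak + 3 * Dk) * b4j) = 0" (is "?E4 = 0")
proof -
  have "p * ?E1 = 0" using 1 unfolding Pj Pk by algebra
  then show e1: "?E1 = 0" using nz by simp
  have "p * (q * ?E1 + r * ?E2) = 0" using 2 unfolding Pj Pk Qj Qk Rj Rk by algebra
  then show e2: "?E2 = 0" using nz unfolding e1 by simp
  have "p * (q^2 * ?E1 + 2 * q * r * ?E2 + r^2 * ?E3) = 0" using 3 unfolding Pj Pk Qj Qk Rj Rk by algebra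
  then show e3: "?E3 = 0" using nz unfolding e1 e2 by simp
  have "p * (q^3 * ?E1 + 3 * q^2 * r * ?E2 + 3 * q * r^2 * ?E3 + r^3 * ?E4) = 0"
    using 4 unfolding Pj Pk Qj Qk Rj Rk by algebra
  then show "?E4 = 0" using nz unfolding e1 e2 e3 by simp
qed

locale gauge_change =
  fixes S :: "(real^5) set" and w w' :: "real^5 \<Rightarrow> real^5^5" and \<theta> \<theta>' :: "5 \<Rightarrow> real^5 \<Rightarrow> real"
    and s p q r :: "real^5 \<Rightarrow> real" and t :: "5 \<Rightarrow> real^5 \<Rightarrow> real"
  assumes se: "local_se S w \<theta>" and se': "local_se S w' \<theta>'"
    and smooth: "smooth_on S s" "smooth_on S p" "smooth_on S q" "smooth_on S r" "\<And>k. smooth_on S (t k)"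
    and p0: "\<And>z. z \<in> S \<Longrightarrow> p z \<noteq> 0" and r0: "\<And>z. z \<in> S \<Longrightarrow> r z \<noteq> 0"
    and gauge: "\<And>z. z \<in> S \<Longrightarrow> w' z = gauge_matrix (s z) (p z) (q z) (r z) (\<lambda>k. t k z) ** w z"
begin

abbreviation "dd i F \<equiv> fd w i F"

abbreviation "dd' i F \<equiv> fd w' i F"

definition G :: "5 \<Rightarrow> 5 \<Rightarrow> real^5 \<Rightarrow> real" where
  "G i j z = gauge_matrix (s z) (p z) (q z) (r z) (\<lambda>k. t k z) $ i $ j"

text \<open>Components of the closed 1-form of the new coframe in the old one; all comparisons are
  made in the frame dual to \<open>w\<close>.\<close>

definition H :: "5 \<Rightarrow> real^5 \<Rightarrow> real" where
  "H j z = (\<Sum>i\<in>UNIV. \<theta>' i z * G i j z)"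

text \<open>Components of \<omega>^i + t_i \<omega>^0. In these forms, rows 1 to 4 of the new
  coframe are p times the binomial action of (q, r), without a first column.\<close>

definition \<beta> :: "5 \<Rightarrow> 5 \<Rightarrow> real^5 \<Rightarrow> real" where
  "\<beta> i k z = t i z * kron 0 k + kron i k"

lemma S: "open S"
  using se by (rule se_basic)

lemma G_rows:
  "G 0 k z = s z * kron 0 k"
  "G 1 k z = p z * \<beta> 1 k z"
  "G 2 k z = p z * (q z * \<beta> 1 k z + r z * \<beta> 2 k z)"
  "G 3 k z = p z * (q z ^ 2 * \<beta> 1 k z + 2 * q z * r z * \<beta> 2 k z + r z ^ 2 * \<beta> 3 k z)"
  "G 4 k z = p z * (q z ^ 3 * \<beta> 1 k z + 3 * q z ^ 2 * r z * \<beta> 2 k z + 3 * q z * r z ^ 2 * \<beta> 3 k z + r z ^ 3 * \<beta> 4 k z)"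
  using exhaust_5[of k]
  by (auto simp: G_def gauge_matrix_def \<beta>_def kron_def)

lemma smooth_\<beta>: "smooth_on S (\<beta> i k)"
  unfolding \<beta>_def[abs_def] by (intro smooth_intros S smooth)

lemma smooth_G: "smooth_on S (G i j)"
proof -
  have "smooth_on S (G 0 j)" "smooth_on S (G 1 j)" "smooth_on S (G 2 j)" "smooth_on S (G 3 j)" "smooth_on S (G 4 j)"
    unfolding G_rows[abs_def] by (intro smooth_intros S smooth smooth_\<beta>)+
  then show ?thesis using exhaust_5[of i] by metis
qed

lemma smooth_H: "smooth_on S (H j)"
  unfolding H_def[abs_def] by (intro smooth_intros S smooth_G se_basic(4)[OF se'])

lemma fd_\<beta>: "y \<in> S \<Longrightarrow> dd j (\<beta> i k) y = dd j (t i) y * kron 0 k"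
proof -
  assume y: "y \<in> S"
  have "dd j (\<beta> i k) y = dd j (\<lambda>z. t i z * kron 0 k) y + dd j (\<lambda>z. kron i k) y"
    unfolding \<beta>_def[abs_def] by (rule fd_add[OF _ _ y]) (intro smooth_intros S smooth)+
  also have "dd j (\<lambda>z. t i z * kron 0 k) y = dd j (t i) y * kron 0 k"
    using fd_mult[OF smooth(5)[of i] smooth_on_const[OF S, of "kron 0 k"] y] by simp
  finally show ?thesis by simp
qed

lemma w'_row: "z \<in> S \<Longrightarrow> w' z $ i = (\<Sum>k\<in>UNIV. G i k z *\<^sub>R w z $ k)"
  unfolding gauge G_def by (simp add: vec_eq_iff matrix_matrix_mult_def)

lemma w'_dual: "y \<in> S \<Longrightarrow> w' y $ i \<bullet> dual (w y) j = G i j y"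
  using comb_inner_dual[of w y "\<lambda>k. G i k" j] se_basic(3)[OF se] w'_row
  by (simp add: comb_def)

lemma comb'_dual: "y \<in> S \<Longrightarrow> comb w' \<theta>' y \<bullet> dual (w y) j = H j y"
  by (simp add: comb_def inner_sum_left w'_dual H_def)

lemma fd_change: "y \<in> S \<Longrightarrow> smooth_on S F \<Longrightarrow> dd j F y = (\<Sum>i\<in>UNIV. G i j y * dd' i F y)"
proof -
  assume y: "y \<in> S" and F: "smooth_on S F"
  have "dual (w y) j = (\<Sum>i\<in>UNIV. G i j y *\<^sub>R dual (w' y) i)"
    using dual_expand[OF se_basic(3)[OF se' y], of "dual (w y) j"] w'_dual[OF y] by simp
  then show ?thesis
    using smooth_on_linear_derivative[OF F y] by (simp add: fd_def linear_sum linear_scale)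
qed

lemma row_ext_deriv:
  "y \<in> S \<Longrightarrow> ext_deriv (\<lambda>z. w' z $ i) y (dual (w y) j) (dual (w y) k) =
    dd j (G i k) y - dd k (G i j) y + (\<Sum>m\<in>UNIV. G i m y * struct_coeff (\<lambda>k. \<theta> k y) m j k)"
  using ext_deriv_combination[OF S _ se_basic(2,3)[OF se] smooth_G[of i], where y = y and \<theta> = "\<lambda>z. w' z $ i" and i = j and j = k] w'_row
    se_struct_coeff[OF se] by simp

lemmas fd_rules = fd_add[where S = S] fd_mult[where S = S] fd_power[where S = S]
  fd_diff[where S = S] fd_minus[where S = S]

lemmas smooth_rules = smooth_intros[OF S] S smooth smooth_\<beta> smooth_H smooth_G

context
  fixes y assumes y: "y \<in> S"
begin

lemma H_closed: "dd i (H j) y - dd j (H i) y = - (\<Sum>k\<in>UNIV. H k y * struct_coeff (\<lambda>k. \<theta> k y) k i j)"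
proof -
  have "comb w' \<theta>' z = (\<Sum>k\<in>UNIV. H k z *\<^sub>R w z $ k)" if "z \<in> S" for z
  proof -
    have "comb w' \<theta>' z = (\<Sum>i\<in>UNIV. \<Sum>k\<in>UNIV. (\<theta>' i z * G i k z) *\<^sub>R w z $ k)"
      by (simp add: comb_def w'_row[OF that] scaleR_sum_right)
    also have "\<dots> = (\<Sum>k\<in>UNIV. H k z *\<^sub>R w z $ k)"
      by (subst sum.swap) (simp add: H_def scaleR_sum_left)
    finally show ?thesis .
  qed
  then show ?thesis
    using ext_deriv_combination[where f = H and \<theta> = "comb w' \<theta>'" and i = i and j = j, OF S y se_basic(2,3)[OF se] smooth_H]
      se_theta_closed[OF se' y] se_struct_coeff[OF se y] by simp
qed

text \<open>\<open>A\<close>, \<open>C\<close>, \<open>D\<close> are dlog p, dq / r and dlog r,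
  corrected by what \<theta>' contributes when it acts on the binomial rows. With exactly these
  corrections the row equations separate.\<close>

definition "A j = dd j p y / p y - 3 * q y * H j y"

definition "C j = (dd j q y + q y ^ 2 * H j y) / r y"

definition "D j = dd j r y / r y + 2 * q y * H j y"

text \<open>The differential of \<omega>^i + t_i \<omega>^0 on the dual vectors j and k.\<close>

definition "N i j k = dd j (t i) y * kron 0 k - dd k (t i) y * kron 0 j + t i y * struct_coeff (\<lambda>k. \<theta> k y) 0 j k
  + struct_coeff (\<lambda>k. \<theta> k y) i j k"

lemma fd_pqr:
  "dd j p y = p y * (A j + 3 * q y * H j y)"
  "dd j q y = r y * C j - q y ^ 2 * H j y"
  "dd j r y = r y * (D j - 2 * q y * H j y)"
  using p0[OF y] r0[OF y] by (simp_all add: A_def C_def D_def field_simps)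

text \<open>The differentials of the new rows are computed from the gauge and from the structure
  equations of \<open>w'\<close>. Compared, they say d\<beta>^1 + A \<and> \<beta>^1 = 3 r H \<and>
  \<beta>^2, d\<beta>^2 + C \<and> \<beta>^1 + (A + D) \<and> \<beta>^2 = 2 r H \<and> \<beta>^3,
  and so on in the pattern of binary cubics.\<close>

lemma gauge_rows:
  "N 1 j k + (A j * \<beta> 1 k y - A k * \<beta> 1 j y) - 3 * r y * (H j y * \<beta> 2 k y - H k y * \<beta> 2 j y) = 0"
  "N 2 j k + (C j * \<beta> 1 k y - C k * \<beta> 1 j y) + ((A j + D j) * \<beta> 2 k y - (A k + D k) * \<beta> 2 j y)
    - 2 * r y * (H j y * \<beta> 3 k y - H k y * \<beta> 3 j y) = 0"
  "N 3 j k + 2 * (C j * \<beta> 2 k y - C k * \<beta> 2 j y) + ((A j + 2 * D j) * \<beta> 3 k y - (A k + 2 * D k) * \<beta> 3 j y)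
    - r y * (H j y * \<beta> 4 k y - H k y * \<beta> 4 j y) = 0"
  "N 4 j k + 3 * (C j * \<beta> 3 k y - C k * \<beta> 3 j y) + ((A j + 3 * D j) * \<beta> 4 k y - (A k + 3 * D k) * \<beta> 4 j y) = 0"
proof -
  let ?sc = "struct_coeff (\<lambda>k. \<theta> k y)"
  note rules = G_rows[abs_def] fd_rules(1,2,4)[OF _ _ y] fd_rules(3,5)[OF _ y] smooth_rules fd_\<beta>[OF y]
  have 1: "p y * N 1 j k + (dd j p y * \<beta> 1 k y - dd k p y * \<beta> 1 j y) =
      3 * p y * (H j y * (q y * \<beta> 1 k y + r y * \<beta> 2 k y) - H k y * (q y * \<beta> 1 j y + r y * \<beta> 2 j y))"
  proof -
    have "(\<Sum>m\<in>UNIV. G 1 m y * ?sc m j k) = p y * (t 1 y * ?sc 0 j k + ?sc 1 j k)"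
      by (simp add: G_rows \<beta>_def sum_5 kron_def) (simp add: algebra_simps)?
    then show ?thesis
      using row_ext_deriv[OF y, of 1 j k]
      by (simp add: se_ext_deriv[OF se' y] wedge_def comb'_dual y w'_dual rules N_def) (simp add: algebra_simps)
  qed
  have 2: "p y * (q y * N 1 j k + r y * N 2 j k) +
      ((dd j p y * (q y * \<beta> 1 k y + r y * \<beta> 2 k y) + p y * (dd j q y * \<beta> 1 k y + dd j r y * \<beta> 2 k y))
      - (dd k p y * (q y * \<beta> 1 j y + r y * \<beta> 2 j y) + p y * (dd k q y * \<beta> 1 j y + dd k r y * \<beta> 2 j y))) =
      2 * p y * (H j y * (q y^2 * \<beta> 1 k y + 2 * q y * r y * \<beta> 2 k y + r y^2 * \<beta> 3 k y)
        - H k y * (q y^2 * \<beta> 1 j y + 2 * q y * r y * \<beta> 2 j y + r y^2 * \<beta> 3 j y))"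
  proof -
    have "(\<Sum>m\<in>UNIV. G 2 m y * ?sc m j k) = p y * (q y * (t 1 y * ?sc 0 j k + ?sc 1 j k) + r y * (t 2 y * ?sc 0 j k + ?sc 2 j k))"
      by (simp add: G_rows \<beta>_def sum_5 kron_def) (simp add: algebra_simps)?
    then show ?thesis
      using row_ext_deriv[OF y, of 2 j k]
      by (simp add: se_ext_deriv[OF se' y] wedge_def comb'_dual y w'_dual rules N_def) (simp add: algebra_simps)
  qed
  have 3: "p y * (q y^2 * N 1 j k + 2 * q y * r y * N 2 j k + r y^2 * N 3 j k) +
      ((dd j p y * (q y^2 * \<beta> 1 k y + 2 * q y * r y * \<beta> 2 k y + r y^2 * \<beta> 3 k y)
        + p y * (2 * q y * dd j q y * \<beta> 1 k y + 2 * (dd j q y * r y + q y * dd j r y) * \<beta> 2 k y + 2 * r y * dd j r y * \<beta> 3 k y))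
      - (dd k p y * (q y^2 * \<beta> 1 j y + 2 * q y * r y * \<beta> 2 j y + r y^2 * \<beta> 3 j y)
        + p y * (2 * q y * dd k q y * \<beta> 1 j y + 2 * (dd k q y * r y + q y * dd k r y) * \<beta> 2 j y + 2 * r y * dd k r y * \<beta> 3 j y))) =
      p y * (H j y * (q y^3 * \<beta> 1 k y + 3 * q y^2 * r y * \<beta> 2 k y + 3 * q y * r y^2 * \<beta> 3 k y + r y^3 * \<beta> 4 k y)
        - H k y * (q y^3 * \<beta> 1 j y + 3 * q y^2 * r y * \<beta> 2 j y + 3 * q y * r y^2 * \<beta> 3 j y + r y^3 * \<beta> 4 j y))"
  proof -
    have "(\<Sum>m\<in>UNIV. G 3 m y * ?sc m j k) = p y * (q y^2 * (t 1 y * ?sc 0 j k + ?sc 1 j k) +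
        2 * q y * r y * (t 2 y * ?sc 0 j k + ?sc 2 j k) + r y^2 * (t 3 y * ?sc 0 j k + ?sc 3 j k))"
      by (simp add: G_rows \<beta>_def sum_5 kron_def) (simp add: algebra_simps)?
    then show ?thesis
      using row_ext_deriv[OF y, of 3 j k]
      by (simp add: se_ext_deriv[OF se' y] wedge_def comb'_dual y w'_dual rules N_def) (simp add: algebra_simps power2_eq_square power3_eq_cube)
  qed
  have 4: "p y * (q y^3 * N 1 j k + 3 * q y^2 * r y * N 2 j k + 3 * q y * r y^2 * N 3 j k + r y^3 * N 4 j k) +
      ((dd j p y * (q y^3 * \<beta> 1 k y + 3 * q y^2 * r y * \<beta> 2 k y + 3 * q y * r y^2 * \<beta> 3 k y + r y^3 * \<beta> 4 k y)
        + p y * (3 * q y^2 * dd j q y * \<beta> 1 k y + 3 * (2 * q y * dd j q y * r y + q y^2 * dd j r y) * \<beta> 2 k y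
           + 3 * (dd j q y * r y^2 + 2 * q y * r y * dd j r y) * \<beta> 3 k y + 3 * r y^2 * dd j r y * \<beta> 4 k y))
      - (dd k p y * (q y^3 * \<beta> 1 j y + 3 * q y^2 * r y * \<beta> 2 j y + 3 * q y * r y^2 * \<beta> 3 j y + r y^3 * \<beta> 4 j y)
        + p y * (3 * q y^2 * dd k q y * \<beta> 1 j y + 3 * (2 * q y * dd k q y * r y + q y^2 * dd k r y) * \<beta> 2 j y
           + 3 * (dd k q y * r y^2 + 2 * q y * r y * dd k r y) * \<beta> 3 j y + 3 * r y^2 * dd k r y * \<beta> 4 j y))) = 0"
  proof -
    have "(\<Sum>m\<in>UNIV. G 4 m y * ?sc m j k) = p y * (q y^3 * (t 1 y * ?sc 0 j k + ?sc 1 j k) +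
        3 * q y^2 * r y * (t 2 y * ?sc 0 j k + ?sc 2 j k) + 3 * q y * r y^2 * (t 3 y * ?sc 0 j k + ?sc 3 j k)
        + r y^3 * (t 4 y * ?sc 0 j k + ?sc 4 j k))"
      by (simp add: G_rows \<beta>_def sum_5 kron_def) (simp add: algebra_simps)?
    then show ?thesis
      using row_ext_deriv[OF y, of 4 j k]
      by (simp add: se_ext_deriv[OF se' y] wedge_def comb'_dual y w'_dual rules N_def) (simp add: algebra_simps power2_eq_square power3_eq_cube)
  qed
  note * = gauge_rows_algebra[OF p0[OF y] r0[OF y] fd_pqr(1)[of j] fd_pqr(1)[of k] fd_pqr(2)[of j] fd_pqr(2)[of k]
      fd_pqr(3)[of j] fd_pqr(3)[of k] 1 2 3 4]
  show "N 1 j k + (A j * \<beta> 1 k y - A k * \<beta> 1 j y) - 3 * r y * (H j y * \<beta> 2 k y - H k y * \<beta> 2 j y) = 0"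
    "N 2 j k + (C j * \<beta> 1 k y - C k * \<beta> 1 j y) + ((A j + D j) * \<beta> 2 k y - (A k + D k) * \<beta> 2 j y)
    - 2 * r y * (H j y * \<beta> 3 k y - H k y * \<beta> 3 j y) = 0"
    "N 3 j k + 2 * (C j * \<beta> 2 k y - C k * \<beta> 2 j y) + ((A j + 2 * D j) * \<beta> 3 k y - (A k + 2 * D k) * \<beta> 3 j y)
    - r y * (H j y * \<beta> 4 k y - H k y * \<beta> 4 j y) = 0"
    "N 4 j k + 3 * (C j * \<beta> 3 k y - C k * \<beta> 3 j y) + ((A j + 3 * D j) * \<beta> 4 k y - (A k + 3 * D k) * \<beta> 4 j y) = 0"
    using * .
qed

text \<open>On pairs of indices from 1 to 4 the derivatives of the t_i drop out of \<open>N\<close>,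
  since they multiply components of \<omega>^0. What remains is a linear system for the components
  of \<open>A\<close>, \<open>C\<close>, \<open>D\<close> and \<open>H\<close>.\<close>

lemma gauge_first_order:
  "r y * H 1 y = \<theta> 1 y + t 3 y" "r y * H 2 y = \<theta> 2 y - 2 * t 2 y" "r y * H 3 y = \<theta> 3 y + t 1 y" "r y * H 4 y = \<theta> 4 y"
  "C 1 = 0" "C 2 = t 4 y" "C 3 = - 2 * t 3 y" "C 4 = t 2 y"
  "A 1 = 2 * t 4 y" "A 2 = - 3 * t 3 y" "A 3 = 0" "A 4 = t 1 y"
  "D 1 = - t 4 y" "D 2 = t 3 y" "D 3 = t 2 y" "D 4 = - t 1 y"
  using gauge_rows(1)[of 1 2] gauge_rows(1)[of 1 3] gauge_rows(1)[of 1 4] gauge_rows(1)[of 2 3] gauge_rows(1)[of 2 4]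
    gauge_rows(2)[of 1 2] gauge_rows(2)[of 1 3] gauge_rows(2)[of 1 4] gauge_rows(2)[of 2 3] gauge_rows(2)[of 2 4]
    gauge_rows(3)[of 1 2] gauge_rows(3)[of 1 3] gauge_rows(3)[of 1 4] gauge_rows(3)[of 2 3] gauge_rows(3)[of 2 4] gauge_rows(3)[of 3 4]
    gauge_rows(4)[of 1 3] gauge_rows(4)[of 1 4] gauge_rows(4)[of 2 3] gauge_rows(4)[of 2 4] gauge_rows(4)[of 3 4]
  by (simp_all add: N_def struct_coeff_def kron_def \<beta>_def)

lemma gauge_scale: "s y = p y ^ 2 * r y ^ 3"
proof -
  have "dd i (G 0 j) y = 0" if "j \<noteq> 0" for i j
    using that by (simp add: G_rows[abs_def] kron_def)
  then show ?thesis
    using row_ext_deriv[OF y, of 0 1 4]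
    by (simp add: se_ext_deriv[OF se' y] wedge_def w'_dual y G_rows sum_5 struct_coeff_def kron_def \<beta>_def
      power2_eq_square)
qed

end

end

section \<open>Second-order consequences of a change of coframe\<close>

context gauge_change
begin

text \<open>The pairs (j, 0) of the row equations are the ones that contain derivatives of the t_i.
  The components of \<open>A\<close>, \<open>C\<close>, \<open>D\<close>, \<open>H\<close> at index
  0 enter as further unknowns.\<close>

lemma fd_t:
  assumes y: "y \<in> S" and j: "j \<noteq> 0"
  shows "dd j (t 1) y = 3 * \<theta> 0 y * kron 2 j - A y j * t 1 y + A y 0 * kron 1 j + 3 * r y * (H j y * t 2 y - H 0 y * kron 2 j)"
    "dd j (t 2) y = 2 * \<theta> 0 y * kron 3 j - C y j * t 1 y + C y 0 * kron 1 j - (A y j + D y j) * t 2 y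
       + (A y 0 + D y 0) * kron 2 j + 2 * r y * (H j y * t 3 y - H 0 y * kron 3 j)"
    "dd j (t 3) y = \<theta> 0 y * kron 4 j - 2 * (C y j * t 2 y - C y 0 * kron 2 j) - (A y j + 2 * D y j) * t 3 y
       + (A y 0 + 2 * D y 0) * kron 3 j + r y * (H j y * t 4 y - H 0 y * kron 4 j)"
  using gauge_rows[OF y, of j 0] j exhaust_5[of j]
  by (auto simp: N_def y struct_coeff_def \<beta>_def kron_def algebra_simps)

lemma fd_q:
  assumes "z \<in> S"
  shows "dd 1 q z = - (q z ^ 2 * H 1 z)" "dd 2 q z = r z * t 4 z - q z ^ 2 * H 2 z"
    "dd 3 q z = - 2 * (r z * t 3 z) - q z ^ 2 * H 3 z" "dd 4 q z = r z * t 2 z - q z ^ 2 * H 4 z"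
  using fd_pqr(2)[OF assms] gauge_first_order(5-8)[OF assms] by simp_all

text \<open>The missing components at index 0 come from second derivatives of q: the commutators of
  e_4 with e_1, e_2, e_3 give C_0, D_0 and H_0 in turn, once the derivatives of \<open>H\<close> are
  eliminated by its closedness. No value is derived for \<open>A y 0\<close>; it occurs in the
  derivatives of t_1 and t_2 but cancels in the combination for Q.\<close>

lemma gauge_second_order:
  assumes y: "y \<in> S"
  shows "C y 0 = t 2 y * t 4 y - t 3 y ^ 2" "D y 0 = t 2 y * t 3 y - t 1 y * t 4 y"
    "r y * H 0 y = \<theta> 0 y - (t 2 y ^ 2 - t 1 y * t 3 y)"
proof -
  note rules = fd_rules(1,2,4)[OF _ _ y] fd_rules(3,5)[OF _ y] smooth_rules
  note first = gauge_first_order[OF y]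
  note comm = se_commutator[OF se y smooth(3)] H_closed[OF y]
  have q4: "dd i (dd 4 q) y = dd i (\<lambda>z. r z * t 2 z - q z ^ 2 * H 4 z) y" for i
    by (rule fd_cong[OF S y]) (rule fd_q)
  have q1: "dd i (dd 1 q) y = dd i (\<lambda>z. - (q z ^ 2 * H 1 z)) y" for i
    by (rule fd_cong[OF S y]) (rule fd_q)
  have q2: "dd i (dd 2 q) y = dd i (\<lambda>z. r z * t 4 z - q z ^ 2 * H 2 z) y" for i
    by (rule fd_cong[OF S y]) (rule fd_q)
  have q3: "dd i (dd 3 q) y = dd i (\<lambda>z. - 2 * (r z * t 3 z) - q z ^ 2 * H 3 z) y" for i
    by (rule fd_cong[OF S y]) (rule fd_q)
  have t4: "dd j (t 4) y = - 3 * (C y j * t 3 y - C y 0 * kron 3 j) - (A y j + 3 * D y j) * t 4 y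
      + (A y 0 + 3 * D y 0) * kron 4 j" if "j \<noteq> 0" for j
    using gauge_rows(4)[OF y, of j 0] that by (auto simp: N_def y struct_coeff_def \<beta>_def kron_def algebra_simps)
  note sc = struct_coeff_def kron_def sum_5
  have th: "\<theta> 1 y = r y * H 1 y - t 3 y" "\<theta> 2 y = r y * H 2 y + 2 * t 2 y" "\<theta> 3 y = r y * H 3 y - t 1 y"
    "\<theta> 4 y = r y * H 4 y"
    using first(1-4) by auto
  have q0: "dd 0 q y = r y * C y 0 - q y ^ 2 * H 0 y" by (rule fd_pqr(2)[OF y])
  have "2 * r y * (C y 0 - (t 2 y * t 4 y - t 3 y ^ 2)) = 0"
    using comm(1)[of 1 4] comm(2)[of 1 4] unfolding q4 q1
    by (simp add: rules sc fd_pqr(3)[OF y] fd_q[OF y] q0 fd_t[OF y] first(5-16) th) algebra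
  then show C0: "C y 0 = t 2 y * t 4 y - t 3 y ^ 2" using r0[OF y] by simp
  have "2 * r y * (D y 0 - (t 2 y * t 3 y - t 1 y * t 4 y)) = 0"
    using comm(1)[of 2 4] comm(2)[of 2 4] unfolding q4 q2
    by (simp add: rules sc fd_pqr(3)[OF y] fd_q[OF y] q0 fd_t[OF y] t4 first(5-16) th C0) algebra
  then show D0: "D y 0 = t 2 y * t 3 y - t 1 y * t 4 y" using r0[OF y] by simp
  have "r y * (r y * H 0 y - (\<theta> 0 y - (t 2 y ^ 2 - t 1 y * t 3 y))) = 0"
    using comm(1)[of 3 4] comm(2)[of 3 4] unfolding q4 q3
    by (simp add: rules sc fd_pqr(3)[OF y] fd_q[OF y] q0 fd_t[OF y] first(5-16) th C0 D0) algebra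
  then show "r y * H 0 y = \<theta> 0 y - (t 2 y ^ 2 - t 1 y * t 3 y)" using r0[OF y] by simp
qed

end

text \<open>With J = 0, closedness of \<theta> leaves six independent derivatives of \<theta>_1,
  \<theta>_2, \<theta>_3 along e_1, ..., e_4: those of \<theta>_3 along e_1, e_2, e_3, of \<theta>_2
  along e_2, and of \<theta>_1 along e_1, e_2. These are the ones that occur in the
  invariants.\<close>

lemma se_closure:
  assumes se: "local_se S w \<theta>" and J: "\<And>z. z \<in> S \<Longrightarrow> \<theta> 4 z = 0" and y: "y \<in> S"
  shows "fd w i (\<theta> 4) y = 0"
    "fd w 4 (\<theta> 3) y = \<theta> 3 y ^ 2" "fd w 4 (\<theta> 2) y = \<theta> 3 y * \<theta> 2 y" "fd w 4 (\<theta> 1) y = \<theta> 0 y + \<theta> 3 y * \<theta> 1 y"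
    "fd w 3 (\<theta> 2) y = fd w 2 (\<theta> 3) y + 2 * \<theta> 2 y ^ 2 - 3 * \<theta> 0 y - 3 * \<theta> 3 y * \<theta> 1 y"
    "fd w 3 (\<theta> 1) y = fd w 1 (\<theta> 3) y + 2 * \<theta> 2 y * \<theta> 1 y"
    "fd w 1 (\<theta> 2) y = fd w 2 (\<theta> 1) y - 3 * \<theta> 1 y ^ 2"
    "fd w 1 (\<theta> 0) y = fd w 0 (\<theta> 1) y" "fd w 2 (\<theta> 0) y = fd w 0 (\<theta> 2) y + 3 * \<theta> 0 y * \<theta> 1 y"
    "fd w 3 (\<theta> 0) y = fd w 0 (\<theta> 3) y + 2 * \<theta> 0 y * \<theta> 2 y" "fd w 4 (\<theta> 0) y = \<theta> 0 y * \<theta> 3 y"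
proof -
  have J': "fd w i (\<theta> 4) y = 0" for i
    using fd_cong[OF se_basic(1)[OF se] y, of "\<theta> 4" "\<lambda>z. 0" w i] J by simp
  then show "fd w i (\<theta> 4) y = 0" .
  note c = se_theta_commutator[OF se y]
  show "fd w 4 (\<theta> 3) y = \<theta> 3 y ^ 2" "fd w 4 (\<theta> 2) y = \<theta> 3 y * \<theta> 2 y" "fd w 4 (\<theta> 1) y = \<theta> 0 y + \<theta> 3 y * \<theta> 1 y"
    "fd w 3 (\<theta> 2) y = fd w 2 (\<theta> 3) y + 2 * \<theta> 2 y ^ 2 - 3 * \<theta> 0 y - 3 * \<theta> 3 y * \<theta> 1 y"
    "fd w 3 (\<theta> 1) y = fd w 1 (\<theta> 3) y + 2 * \<theta> 2 y * \<theta> 1 y"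
    "fd w 1 (\<theta> 2) y = fd w 2 (\<theta> 1) y - 3 * \<theta> 1 y ^ 2"
    "fd w 1 (\<theta> 0) y = fd w 0 (\<theta> 1) y" "fd w 2 (\<theta> 0) y = fd w 0 (\<theta> 2) y + 3 * \<theta> 0 y * \<theta> 1 y"
    "fd w 3 (\<theta> 0) y = fd w 0 (\<theta> 3) y + 2 * \<theta> 0 y * \<theta> 2 y" "fd w 4 (\<theta> 0) y = \<theta> 0 y * \<theta> 3 y"
    using c[of 3 4] c[of 2 4] c[of 1 4] c[of 2 3] c[of 1 3] c[of 1 2] c[of 0 1] c[of 0 2] c[of 0 3] c[of 0 4] J J' y
    by (simp_all add: struct_coeff_def kron_def sum_5 power2_eq_square algebra_simps)
qed

text \<open>The functions \<open>- J, L, M, P, Q, R, S\<close>.\<close>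

definition invariant :: "(real^5 \<Rightarrow> real^5^5) \<Rightarrow> (5 \<Rightarrow> real^5 \<Rightarrow> real) \<Rightarrow> nat \<Rightarrow> real^5 \<Rightarrow> real" where
  "invariant w \<theta> n y = [
     \<theta> 4 y,
     fd w 3 (\<theta> 3) y,
     3 * \<theta> 0 y + 3 * \<theta> 3 y * \<theta> 1 y + fd w 2 (\<theta> 3) y,
     \<theta> 2 y ^ 2 - \<theta> 0 y - \<theta> 3 y * \<theta> 1 y + fd w 2 (\<theta> 3) y,
     2 * fd w 1 (\<theta> 3) y + 3 * \<theta> 2 y * \<theta> 1 y + fd w 2 (\<theta> 2) y,
     \<theta> 1 y ^ 2 - fd w 2 (\<theta> 1) y,
     fd w 1 (\<theta> 1) y] ! n"

context gauge_change
begin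

lemma H_eq:
  assumes "z \<in> S"
  shows "H 4 z = p z * r z ^ 3 * \<theta>' 4 z" "H 3 z = p z * r z ^ 2 * (\<theta>' 3 z + 3 * q z * \<theta>' 4 z)"
    "H 2 z = p z * r z * (\<theta>' 2 z + 2 * q z * \<theta>' 3 z + 3 * q z ^ 2 * \<theta>' 4 z)"
    "H 1 z = p z * (\<theta>' 1 z + q z * \<theta>' 2 z + q z ^ 2 * \<theta>' 3 z + q z ^ 3 * \<theta>' 4 z)"
  by (simp_all add: H_def G_rows sum_5 \<beta>_def kron_def algebra_simps)

lemma J_change: "z \<in> S \<Longrightarrow> \<theta> 4 z = p z * r z ^ 4 * \<theta>' 4 z"
  using gauge_first_order(4)[of z] by (simp add: H_eq power4_eq_xxxx power3_eq_cube mult.left_commute mult.assoc)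

context
  assumes J': "\<And>z. z \<in> S \<Longrightarrow> \<theta>' 4 z = 0"
begin

text \<open>The first-order equations read as a transformation law: besides a linear action through
  p, q, r, the parameters t_1, t_2, t_3 shift \<theta>_3, \<theta>_2, \<theta>_1.\<close>

lemma theta_change:
  assumes z: "z \<in> S"
  shows "\<theta> 3 z = p z * r z ^ 3 * \<theta>' 3 z - t 1 z"
    "\<theta> 2 z = p z * r z ^ 2 * (\<theta>' 2 z + 2 * q z * \<theta>' 3 z) + 2 * t 2 z"
    "\<theta> 1 z = p z * r z * (\<theta>' 1 z + q z * \<theta>' 2 z + q z ^ 2 * \<theta>' 3 z) - t 3 z"
    "\<theta> 0 z = r z * (\<theta>' 0 z * p z ^ 2 * r z ^ 3 + \<theta>' 1 z * p z * t 1 z + \<theta>' 2 z * p z * (q z * t 1 z + r z * t 2 z) +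
      \<theta>' 3 z * p z * (q z ^ 2 * t 1 z + 2 * q z * r z * t 2 z + r z ^ 2 * t 3 z)) + t 2 z ^ 2 - t 1 z * t 3 z"
proof -
  note * = gauge_first_order(1-3)[OF z] gauge_second_order(3)[OF z] H_eq[OF z] J'[OF z]
  have "H 0 z = \<theta>' 0 z * p z ^ 2 * r z ^ 3 + \<theta>' 1 z * p z * t 1 z + \<theta>' 2 z * p z * (q z * t 1 z + r z * t 2 z) +
      \<theta>' 3 z * p z * (q z ^ 2 * t 1 z + 2 * q z * r z * t 2 z + r z ^ 2 * t 3 z)"
    by (simp add: H_def G_rows sum_5 \<beta>_def kron_def gauge_scale z J' algebra_simps)
  with * show "\<theta> 3 z = p z * r z ^ 3 * \<theta>' 3 z - t 1 z"
    "\<theta> 2 z = p z * r z ^ 2 * (\<theta>' 2 z + 2 * q z * \<theta>' 3 z) + 2 * t 2 z"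
    "\<theta> 1 z = p z * r z * (\<theta>' 1 z + q z * \<theta>' 2 z + q z ^ 2 * \<theta>' 3 z) - t 3 z"
    "\<theta> 0 z = r z * (\<theta>' 0 z * p z ^ 2 * r z ^ 3 + \<theta>' 1 z * p z * t 1 z + \<theta>' 2 z * p z * (q z * t 1 z + r z * t 2 z) +
      \<theta>' 3 z * p z * (q z ^ 2 * t 1 z + 2 * q z * r z * t 2 z + r z ^ 2 * t 3 z)) + t 2 z ^ 2 - t 1 z * t 3 z"
    by (simp_all add: power2_eq_square power3_eq_cube algebra_simps)
qed

text \<open>The transformation law of \<theta> is differentiated and the derivatives of the group
  parameters are inserted. The terms in the t_i cancel in the combinations \<open>invariant\<close>;
  what remains besides the scalar factor is removed by the vanishing of the earlier invariants, used
  to eliminate derivatives of \<theta>'.\<close>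

lemma invariant_change:
  assumes y: "y \<in> S"
  shows "invariant w \<theta> 1 y = p y ^ 2 * r y ^ 5 * invariant w' \<theta>' 1 y"
    "invariant w' \<theta>' 1 y = 0 \<Longrightarrow> invariant w \<theta> 2 y = p y ^ 2 * r y ^ 4 * invariant w' \<theta>' 2 y"
    "invariant w' \<theta>' 1 y = 0 \<Longrightarrow> invariant w' \<theta>' 2 y = 0 \<Longrightarrow>
      invariant w \<theta> 3 y = p y ^ 2 * r y ^ 4 * invariant w' \<theta>' 3 y"
    "invariant w' \<theta>' 1 y = 0 \<Longrightarrow> invariant w' \<theta>' 2 y = 0 \<Longrightarrow> invariant w' \<theta>' 3 y = 0 \<Longrightarrow>
      invariant w \<theta> 4 y = p y ^ 2 * r y ^ 3 * invariant w' \<theta>' 4 y"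
    "invariant w' \<theta>' 1 y = 0 \<Longrightarrow> invariant w' \<theta>' 2 y = 0 \<Longrightarrow> invariant w' \<theta>' 3 y = 0 \<Longrightarrow> invariant w' \<theta>' 4 y = 0 \<Longrightarrow>
      invariant w \<theta> 5 y = p y ^ 2 * r y ^ 2 * invariant w' \<theta>' 5 y"
    "invariant w' \<theta>' 1 y = 0 \<Longrightarrow> invariant w' \<theta>' 2 y = 0 \<Longrightarrow> invariant w' \<theta>' 3 y = 0 \<Longrightarrow> invariant w' \<theta>' 4 y = 0 \<Longrightarrow>
      invariant w' \<theta>' 5 y = 0 \<Longrightarrow> invariant w \<theta> 6 y = p y ^ 2 * r y * invariant w' \<theta>' 6 y"
proof -
  note rules = fd_rules(1,2,4)[OF _ _ y] fd_rules(3,5)[OF _ y] smooth_rules se_basic(4)[OF se']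
  have d3: "dd i (\<theta> 3) y = dd i (\<lambda>z. p z * r z ^ 3 * \<theta>' 3 z - t 1 z) y" for i
    by (rule fd_cong[OF S y]) (rule theta_change)
  have d2: "dd i (\<theta> 2) y = dd i (\<lambda>z. p z * r z ^ 2 * (\<theta>' 2 z + 2 * q z * \<theta>' 3 z) + 2 * t 2 z) y" for i
    by (rule fd_cong[OF S y]) (rule theta_change)
  have d1: "dd i (\<theta> 1) y = dd i (\<lambda>z. p z * r z * (\<theta>' 1 z + q z * \<theta>' 2 z + q z ^ 2 * \<theta>' 3 z) - t 3 z) y" for i
    by (rule fd_cong[OF S y]) (rule theta_change)
  note c = se_closure[OF se' J' y]
  have rH: "r y * H 0 y = \<theta> 0 y - (t 2 y ^ 2 - t 1 y * t 3 y)" by (rule gauge_second_order[OF y])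
  have "dd 2 (t 1) y = 3 * \<theta> 0 y - A y 2 * t 1 y + 3 * (r y * H 2 y * t 2 y - r y * H 0 y)"
    "dd 2 (t 2) y = - C y 2 * t 1 y - (A y 2 + D y 2) * t 2 y + (A y 0 + D y 0) + 2 * r y * (H 2 y * t 3 y)"
    "dd 2 (t 3) y = - 2 * (C y 2 * t 2 y - C y 0) - (A y 2 + 2 * D y 2) * t 3 y + r y * (H 2 y * t 4 y)"
    "dd 3 (t 1) y = - A y 3 * t 1 y + 3 * r y * (H 3 y * t 2 y)"
    "dd 1 (t 1) y = - A y 1 * t 1 y + A y 0 + 3 * r y * (H 1 y * t 2 y)"
    "dd 1 (t 3) y = - 2 * (C y 1 * t 2 y) - (A y 1 + 2 * D y 1) * t 3 y + r y * (H 1 y * t 4 y)"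
    by (simp_all add: fd_t[OF y] kron_def algebra_simps)
  note t = this[unfolded gauge_first_order[OF y] rH gauge_second_order(1,2)[OF y] H_eq[OF y] J'[OF y]]
  have pqr: "dd j p y = p y * (A y j + 3 * q y * H j y)" "dd j q y = r y * C y j - q y ^ 2 * H j y"
    "dd j r y = r y * (D y j - 2 * q y * H j y)" for j
    using fd_pqr[OF y] .
  note all = rules fd_change[OF y se_basic(4)[OF se']] sum_5 G_rows \<beta>_def kron_def pqr gauge_first_order(5-16)[OF y]
    H_eq[OF y] J'[OF y] c t
  note inv = invariant_def
  show 1: "invariant w \<theta> 1 y = p y ^ 2 * r y ^ 5 * invariant w' \<theta>' 1 y"
    unfolding inv d3 by (simp add: all) algebra
  have L: "dd' 3 (\<theta>' 3) y = 0" if "invariant w' \<theta>' 1 y = 0" using that by (simp add: inv)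
  have M: "dd' 2 (\<theta>' 3) y = - 3 * \<theta>' 0 y - 3 * \<theta>' 3 y * \<theta>' 1 y" if "invariant w' \<theta>' 2 y = 0"
    using that by (simp add: inv)
  have P: "\<theta>' 2 y ^ 2 = 4 * \<theta>' 0 y + 4 * \<theta>' 3 y * \<theta>' 1 y" if "invariant w' \<theta>' 2 y = 0" "invariant w' \<theta>' 3 y = 0"
    using that by (simp add: inv)
  have Q: "dd' 2 (\<theta>' 2) y = - 2 * dd' 1 (\<theta>' 3) y - 3 * \<theta>' 2 y * \<theta>' 1 y" if "invariant w' \<theta>' 4 y = 0"
    using that by (simp add: inv)
  have R: "dd' 2 (\<theta>' 1) y = \<theta>' 1 y ^ 2" if "invariant w' \<theta>' 5 y = 0"
    using that by (simp add: inv)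
  {
    assume 1: "invariant w' \<theta>' 1 y = 0"
    show "invariant w \<theta> 2 y = p y ^ 2 * r y ^ 4 * invariant w' \<theta>' 2 y"
      unfolding inv d3 by (simp add: all L[OF 1] theta_change[OF y]) algebra
    assume 2: "invariant w' \<theta>' 2 y = 0"
    show "invariant w \<theta> 3 y = p y ^ 2 * r y ^ 4 * invariant w' \<theta>' 3 y"
      unfolding inv d3 by (simp add: all L[OF 1] M[OF 2] theta_change[OF y]) algebra
    assume 3: "invariant w' \<theta>' 3 y = 0"
    show "invariant w \<theta> 4 y = p y ^ 2 * r y ^ 3 * invariant w' \<theta>' 4 y"
      unfolding inv d3 d2 using P[OF 2 3] by (simp add: all L[OF 1] M[OF 2] theta_change[OF y]) algebra
    assume 4: "invariant w' \<theta>' 4 y = 0"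
    show "invariant w \<theta> 5 y = p y ^ 2 * r y ^ 2 * invariant w' \<theta>' 5 y"
      unfolding inv d1 using P[OF 2 3] by (simp add: all L[OF 1] M[OF 2] Q[OF 4] theta_change[OF y]) algebra
    assume 5: "invariant w' \<theta>' 5 y = 0"
    show "invariant w \<theta> 6 y = p y ^ 2 * r y * invariant w' \<theta>' 6 y"
      proof -
      have "\<theta>' 0 y = \<theta>' 2 y ^ 2 / 4 - \<theta>' 3 y * \<theta>' 1 y" using P[OF 2 3] by (simp add: field_simps)
      then show ?thesis
        unfolding inv d1 by (simp add: all L[OF 1] M[OF 2] Q[OF 4] R[OF 5] theta_change[OF y])
          (simp add: field_simps power2_eq_square power3_eq_cube)
    qed
  }
qed

end

text \<open>The scalar factors have no zeros, so the vanishing climbs the list: each transformation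
  rule becomes available once the preceding invariants of \<open>w'\<close> are known to
  vanish.\<close>

lemma invariants_vanish:
  assumes "n < 7" "\<And>k z. k \<le> n \<Longrightarrow> z \<in> S \<Longrightarrow> invariant w \<theta> k z = 0" "z \<in> S" "k \<le> n"
  shows "invariant w' \<theta>' k z = 0"
proof -
  have J: "\<theta>' 4 z = 0" if "z \<in> S" for z
    using assms(2)[of 0 z] J_change[OF that] p0[OF that] r0[OF that] that by (simp add: invariant_def)
  have 0: "invariant w' \<theta>' 0 z = 0" using J[OF assms(3)] by (simp add: invariant_def)
  note ch = invariant_change[OF J assms(3)] p0[OF assms(3)] r0[OF assms(3)]
  have 1: "invariant w' \<theta>' 1 z = 0" if "1 \<le> n" using assms(2)[OF that assms(3)] ch by auto
  have 2: "invariant w' \<theta>' 2 z = 0" if "2 \<le> n" using assms(2)[OF that assms(3)] ch 1 that by auto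
  have 3: "invariant w' \<theta>' 3 z = 0" if "3 \<le> n" using assms(2)[OF that assms(3)] ch 1 2 that by auto
  have 4: "invariant w' \<theta>' 4 z = 0" if "4 \<le> n" using assms(2)[OF that assms(3)] ch 1 2 3 that by auto
  have 5: "invariant w' \<theta>' 5 z = 0" if "5 \<le> n" using assms(2)[OF that assms(3)] ch 1 2 3 4 that by auto
  have 6: "invariant w' \<theta>' 6 z = 0" if "6 \<le> n" using assms(2)[OF that assms(3)] ch 1 2 3 4 5 that by auto
  have "k = 0 \<or> k = 1 \<or> k = 2 \<or> k = 3 \<or> k = 4 \<or> k = 5 \<or> k = 6" using assms(1,4) by auto
  with 0 1 2 3 4 5 6 assms(4) show ?thesis by auto
qed

end

section \<open>Inverses in the structure group and symmetry of the vanishing conditions\<close>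

lemma structure_groupI:
  "s0 * s5 * s8 \<noteq> 0 \<Longrightarrow> row5
     (row5 s0 0 0 0 0)
     (row5 s1 (s5^3) 0 0 0)
     (row5 s2 (s5^2 * s7) (s5^2 * s8) 0 0)
     (row5 s3 (s5 * s7^2) (2 * s5 * s7 * s8) (s5 * s8^2) 0)
     (row5 s4 (s7^3) (3 * s7^2 * s8) (3 * s7 * s8^2) (s8^3)) \<in> structure_group"
  unfolding structure_group_def by blast

lemma structure_group_inverse:
  assumes "B \<in> structure_group"
  shows "\<exists>B'\<in>structure_group. B' ** B = mat 1 \<and> B ** B' = mat 1"
proof -
  obtain s0 s1 s2 s3 s4 s5 s7 s8 where s: "s0 * s5 * s8 \<noteq> 0" and B: "B = row5
     (row5 s0 0 0 0 0)
     (row5 s1 (s5^3) 0 0 0)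
     (row5 s2 (s5^2 * s7) (s5^2 * s8) 0 0)
     (row5 s3 (s5 * s7^2) (2 * s5 * s7 * s8) (s5 * s8^2) 0)
     (row5 s4 (s7^3) (3 * s7^2 * s8) (3 * s7 * s8^2) (s8^3))"
    using assms unfolding structure_group_def by blast
  have nz: "s0 \<noteq> 0" "s5 \<noteq> 0" "s8 \<noteq> 0" using s by auto
  \<comment> \<open>Entries of the inverse of the 2x2 matrix with rows (s5, 0) and (s7, s8); the
    lower right block of \<open>B'\<close> is the third symmetric power of that inverse.\<close>
  define a b c where "a = 1 / s5" and "b = - s7 / (s5 * s8)" and "c = 1 / s8"
  have abc: "s5 * a = 1" "s8 * c = 1" "s7 * a + s8 * b = 0"
    using nz by (simp_all add: a_def b_def c_def field_simps)
  define B' where "B' = row5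
     (row5 (1/s0) 0 0 0 0)
     (row5 (- (a^3 * s1) / s0) (a^3) 0 0 0)
     (row5 (- (a^2 * b * s1 + a^2 * c * s2) / s0) (a^2 * b) (a^2 * c) 0 0)
     (row5 (- (a * b^2 * s1 + 2 * a * b * c * s2 + a * c^2 * s3) / s0) (a * b^2) (2 * a * b * c) (a * c^2) 0)
     (row5 (- (b^3 * s1 + 3 * b^2 * c * s2 + 3 * b * c^2 * s3 + c^3 * s4) / s0) (b^3) (3 * b^2 * c) (3 * b * c^2) (c^3))"
  have "B' \<in> structure_group"
    unfolding B'_def
    by (rule structure_groupI) (use nz in \<open>simp add: a_def c_def\<close>)
  moreover have e: "B' ** B = mat 1"
    unfolding vec5_eq_iff matrix_matrix_5 using nz
    by (simp add: B B'_def mat_def) (simp add: a_def b_def c_def field_simps power2_eq_square power3_eq_cube)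
  moreover have "B ** B' = mat 1" using e matrix_left_right_inverse by blast
  ultimately show ?thesis by blast
qed

lemma gauge_change_obtain:
  assumes se: "local_se S w \<theta>" and se': "local_se S w' \<theta>'" and B: "smooth_on S B"
    "\<And>z. z \<in> S \<Longrightarrow> B z \<in> structure_group" and w': "\<And>z. z \<in> S \<Longrightarrow> w' z = B z ** w z"
  obtains s p q r t where "gauge_change S w w' \<theta> \<theta>' s p q r t"
proof -
  have S: "open S" using se by (rule se_basic)
  define p where "p z = B z $ 1 $ 1" for z
  define q where "q z = B z $ 2 $ 1 / p z" for z
  define r where "r z = B z $ 2 $ 2 / p z" for z
  define t1 where "t1 z = B z $ 1 $ 0 / p z" for z
  define t2 where "t2 z = (B z $ 2 $ 0 / p z - q z * t1 z) / r z" for z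
  define t3 where "t3 z = (B z $ 3 $ 0 / p z - q z^2 * t1 z - 2 * q z * r z * t2 z) / r z^2" for z
  define t4 where "t4 z = (B z $ 4 $ 0 / p z - q z^3 * t1 z - 3 * q z^2 * r z * t2 z - 3 * q z * r z^2 * t3 z) / r z^3" for z
  define t where "t = (\<lambda>(k::5) z. if k = 1 then t1 z else if k = 2 then t2 z else if k = 3 then t3 z else if k = 4 then t4 z else 0)"
  note defs = p_def q_def r_def t1_def t2_def t3_def t4_def
  have nz: "p z \<noteq> 0" "r z \<noteq> 0" if "z \<in> S" for z
    using structure_group_gauge(1,2)[OF B(2)[OF that]] unfolding defs .
  have g: "B z = gauge_matrix (B z $ 0 $ 0) (p z) (q z) (r z) (\<lambda>k. t k z)" if "z \<in> S" for z
  proof -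
    have "(\<lambda>k. t k z) = (\<lambda>_. 0)(1 := t1 z, 2 := t2 z, 3 := t3 z, 4 := t4 z)"
      by (auto simp: t_def fun_eq_iff)
    then show ?thesis using structure_group_gauge(3)[OF B(2)[OF that]] unfolding defs by metis
  qed
  have sB: "smooth_on S (\<lambda>z. B z $ i $ j)" for i j by (intro smooth_intros S B)
  have sp: "smooth_on S p" unfolding p_def[abs_def] by (rule sB)
  have sq: "smooth_on S q" unfolding q_def[abs_def] by (intro smooth_intros S sB sp nz)
  have sr: "smooth_on S r" unfolding r_def[abs_def] by (intro smooth_intros S sB sp nz)
  have st1: "smooth_on S t1" unfolding t1_def[abs_def] by (intro smooth_intros S sB sp nz)
  have st2: "smooth_on S t2" unfolding t2_def[abs_def] by (intro smooth_intros S sB sp sq sr st1 nz)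
  have st3: "smooth_on S t3" unfolding t3_def[abs_def]
    by (intro smooth_intros S sB sp sq sr st1 st2 nz power_not_zero)
  have st4: "smooth_on S t4" unfolding t4_def[abs_def]
    by (intro smooth_intros S sB sp sq sr st1 st2 st3 nz power_not_zero)
  have st: "smooth_on S (t k)" for k
    unfolding t_def using exhaust_5[of k] st1 st2 st3 st4 S by (auto intro: smooth_intros)
  have "gauge_change S w w' \<theta> \<theta>' (\<lambda>z. B z $ 0 $ 0) p q r t"
    by unfold_locales (use se se' sB sp sq sr st nz g w' in auto)
  then show ?thesis using that by blast
qed

text \<open>The one-sided statement is applied to \<open>B\<close> and to its pointwise inverse,
  which is again a smooth function with values in the group.\<close>

lemma invariants_vanish_iff:
  assumes se: "local_se S w \<theta>" and se': "local_se S w' \<theta>'" and B: "smooth_on S B"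
    "\<And>z. z \<in> S \<Longrightarrow> B z \<in> structure_group" and w': "\<And>z. z \<in> S \<Longrightarrow> w' z = B z ** w z" and n: "n < 7"
  shows "(\<forall>k\<le>n. \<forall>z\<in>S. invariant w \<theta> k z = 0) \<longleftrightarrow> (\<forall>k\<le>n. \<forall>z\<in>S. invariant w' \<theta>' k z = 0)"
proof -
  have S: "open S" using se by (rule se_basic)
  have inv: "invertible (B z)" "matrix_inv (B z) \<in> structure_group" if z: "z \<in> S" for z
  proof -
    obtain B' where B': "B' \<in> structure_group" "B' ** B z = mat 1" "B z ** B' = mat 1"
      using structure_group_inverse[OF B(2)[OF z]] by blast
    then show i: "invertible (B z)" unfolding invertible_def by blast
    have "matrix_inv (B z) = matrix_inv (B z) ** (B z ** B')" by (simp add: B')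
    also have "\<dots> = B'" by (simp add: matrix_mul_assoc matrix_inv_works[OF i])
    finally show "matrix_inv (B z) \<in> structure_group" using B' by simp
  qed
  have w: "w z = matrix_inv (B z) ** w' z" if "z \<in> S" for z
    using w'[OF that] matrix_inv_works(2)[OF inv(1)[OF that]] by (simp add: matrix_mul_assoc)
  have sB: "smooth_on S (\<lambda>z. matrix_inv (B z))" by (intro smooth_intros S B inv)
  obtain s p q r t where g: "gauge_change S w w' \<theta> \<theta>' s p q r t"
    using gauge_change_obtain[OF se se' B w'] by metis
  obtain s' p' q' r' t' where g': "gauge_change S w' w \<theta>' \<theta> s' p' q' r' t'"
    using gauge_change_obtain[OF se' se sB inv(2) w] by metis
  show ?thesis
    using gauge_change.invariants_vanish[OF g n] gauge_change.invariants_vanish[OF g' n] by blast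
qed

section \<open>Pullback\<close>

lemma jacobian_mult:
  fixes \<Phi> :: "real^'m \<Rightarrow> real^'n"
  assumes "smooth_on S \<Phi>" "y \<in> S"
  shows "jacobian \<Phi> (at y) *v u = fder \<Phi> y u"
  proof -
  have "\<Phi> differentiable (at y)" using smooth_on_derivative[OF assms] by (auto simp: differentiable_def)
  then have "(\<Phi> has_derivative (\<lambda>h. jacobian \<Phi> (at y) *v h)) (at y)" by (simp only: jacobian_works)
  from fun_cong[OF frechet_derivative_at[OF this], of u] show ?thesis by simp
qed

lemma smooth_on_jacobian [smooth_intros]:
  fixes \<Phi> :: "real^'m \<Rightarrow> real^'n"
  assumes "open S" "smooth_on S \<Phi>"
  shows "smooth_on S (\<lambda>y. jacobian \<Phi> (at y))"
  by (rule smooth_on_matrixI[OF assms(1)])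
    (auto simp: jacobian_def matrix_def intro!: smooth_intros smooth_on_frechet assms)

text \<open>Naturality of d: the second derivatives of \<open>\<Phi>\<close> enter symmetrically in
  u and v and cancel.\<close>

lemma ext_deriv_pullback:
  assumes S: "open S" "y \<in> S" and T: "open T" "\<Phi> ` S \<subseteq> T" and sm: "smooth_on S \<Phi>" "smooth_on T \<theta>" "smooth_on S \<psi>"
    and \<psi>: "\<And>z v. z \<in> S \<Longrightarrow> \<psi> z \<bullet> v = \<theta> (\<Phi> z) \<bullet> fder \<Phi> z v"
  shows "ext_deriv \<psi> y u v =
    ext_deriv \<theta> (\<Phi> y) (fder \<Phi> y u) (fder \<Phi> y v)"
proof -
  let ?D = "fder \<Phi> y" and ?t = "fder \<theta> (\<Phi> y)"
  let ?D2 = "\<lambda>v. fder (\<lambda>z. fder \<Phi> z v) y"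
  have t: "(\<theta> has_derivative ?t) (at (\<Phi> y))" using smooth_on_derivative[OF sm(2)] S T by blast
  have "fder (\<lambda>z. \<psi> z \<bullet> v) y u = \<theta> (\<Phi> y) \<bullet> ?D2 v u + ?t (?D u) \<bullet> ?D v" for u v
  proof -
    have "((\<lambda>z. \<theta> (\<Phi> z) \<bullet> fder \<Phi> z v) has_derivative
        (\<lambda>u. \<theta> (\<Phi> y) \<bullet> ?D2 v u + ?t (?D u) \<bullet> ?D v)) (at y)"
      by (intro has_derivative_inner has_derivative_compose[OF smooth_on_derivative[OF sm(1) S(2)] t]
          smooth_on_derivative[OF smooth_on_frechet[OF sm(1)] S(2)])
    from fun_cong[OF frechet_derivative_at[OF this, symmetric], of u]
    have "fder (\<lambda>z. \<theta> (\<Phi> z) \<bullet> fder \<Phi> z v) y u = \<theta> (\<Phi> y) \<bullet> ?D2 v u + ?t (?D u) \<bullet> ?D v" .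
    moreover have "fder (\<lambda>z. \<psi> z \<bullet> v) y =
        fder (\<lambda>z. \<theta> (\<Phi> z) \<bullet> fder \<Phi> z v) y"
      by (rule frechet_derivative_cong_open[OF S]) (rule \<psi>)
    ultimately show ?thesis by simp
  qed
  then show ?thesis
    using ext_deriv_smooth[OF sm(3) S(2), of u v] smooth_on_symmetric[OF S sm(1), of u v]
    by (simp add: ext_deriv_def)
qed

definition pullback :: "(real^5 \<Rightarrow> real^5) \<Rightarrow> (real^5 \<Rightarrow> real^5^5) \<Rightarrow> real^5 \<Rightarrow> real^5^5" where
  "pullback \<Phi> w y = w (\<Phi> y) ** jacobian \<Phi> (at y)"

context
  fixes S T \<Phi> w \<theta>
  assumes S: "open S" and se: "local_se T w \<theta>" and \<Phi>: "smooth_on S \<Phi>" "\<Phi> ` S \<subseteq> T"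
    and inv: "\<And>y. y \<in> S \<Longrightarrow> invertible (pullback \<Phi> w y)"
begin

lemma pullback_row: "y \<in> S \<Longrightarrow> pullback \<Phi> w y $ i \<bullet> v = w (\<Phi> y) $ i \<bullet> fder \<Phi> y v"
  using jacobian_mult[OF \<Phi>(1), of y v]
  by (metis matrix_vector_mul_assoc matrix_vector_mul_component pullback_def)

lemma smooth_on_pullback: "smooth_on S (pullback \<Phi> w)"
  unfolding pullback_def[abs_def]
  by (intro smooth_intros S \<Phi> smooth_on_compose[OF S se_basic(1)[OF se] \<Phi>(2,1) se_basic(2)[OF se]])

lemma comb_pullback:
  "y \<in> S \<Longrightarrow> comb (pullback \<Phi> w) (\<lambda>k z. \<theta> k (\<Phi> z)) y \<bullet> v = comb w \<theta> (\<Phi> y) \<bullet> fder \<Phi> y v"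
  by (simp add: comb_def inner_sum_left pullback_row)

lemma local_se_pullback: "local_se S (pullback \<Phi> w) (\<lambda>k z. \<theta> k (\<Phi> z))"
proof -
  have T: "open T" using se by (rule se_basic)
  have wedge: "wedge (pullback \<Phi> w y $ i) (pullback \<Phi> w y $ j) u v =
      wedge (w (\<Phi> y) $ i) (w (\<Phi> y) $ j) (fder \<Phi> y u) (fder \<Phi> y v)"
    "wedge (comb (pullback \<Phi> w) (\<lambda>k z. \<theta> k (\<Phi> z)) y) (pullback \<Phi> w y $ j) u v =
      wedge (comb w \<theta> (\<Phi> y)) (w (\<Phi> y) $ j) (fder \<Phi> y u) (fder \<Phi> y v)"
    if "y \<in> S" for y i j u v
    using that by (simp_all add: wedge_def pullback_row comb_pullback)
  have ext: "ext_deriv (\<lambda>z. pullback \<Phi> w z $ i) y u v =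
      ext_deriv (\<lambda>z. w z $ i) (\<Phi> y) (fder \<Phi> y u) (fder \<Phi> y v)"
    if "y \<in> S" for y i u v
    by (rule ext_deriv_pullback[OF S that T \<Phi>(2,1)])
      (auto intro!: smooth_intros T S se_basic(2)[OF se] smooth_on_pullback simp: pullback_row)
  show ?thesis
    unfolding local_se_def
  proof (intro conjI ballI allI)
    show "smooth_on S (\<lambda>z. \<theta> k (\<Phi> z))" for k
      by (rule smooth_on_compose[OF S T \<Phi>(2,1) se_basic(4)[OF se]])
  qed (use S smooth_on_pullback inv \<Phi>(2) in \<open>auto simp: ext wedge se_ext_deriv[OF se] image_subset_iff\<close>)
qed

text \<open>The derivative of \<open>\<Phi>\<close> maps the frame dual to the pulled back coframe
  to the frame dual to \<open>w\<close>, by uniqueness of dual vectors.\<close>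

lemma fd_pullback:
  assumes y: "y \<in> S" and F: "smooth_on T F"
  shows "fd (pullback \<Phi> w) i (\<lambda>z. F (\<Phi> z)) y = fd w i F (\<Phi> y)"
proof -
  have Ty: "\<Phi> y \<in> T" using y \<Phi>(2) by auto
  have "fder \<Phi> y (dual (pullback \<Phi> w y) i) = dual (w (\<Phi> y)) i"
    by (rule dual_unique[OF se_basic(3)[OF se Ty]])
      (simp add: pullback_row[OF y, symmetric] inner_dual[OF inv[OF y]])
  then show ?thesis
    using fd_eqI[OF has_derivative_compose[OF smooth_on_derivative[OF \<Phi>(1) y] smooth_on_derivative[OF F Ty]]]
    by (simp add: fd_def)
qed

lemma invariant_pullback:
  "y \<in> S \<Longrightarrow> n < 7 \<Longrightarrow> invariant (pullback \<Phi> w) (\<lambda>k z. \<theta> k (\<Phi> z)) n y = invariant w \<theta> n (\<Phi> y)"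
  by (simp add: invariant_def fd_pullback se_basic(4)[OF se])

end

section \<open>Charts\<close>

locale five_manifold =
  fixes U :: "'p::{t2_space,second_countable_topology} set" and A :: "'p chart set"
  assumes manifold: "manifold5 U A"
begin

lemma chart:
  assumes "\<kappa> \<in> A"
  shows "open (cdom \<kappa>)" "open (coord \<kappa> ` cdom \<kappa>)" "cdom \<kappa> \<subseteq> U"
    "continuous_on (cdom \<kappa>) (coord \<kappa>)" "continuous_on (coord \<kappa> ` cdom \<kappa>) (icoord \<kappa>)"
    "\<And>p. p \<in> cdom \<kappa> \<Longrightarrow> icoord \<kappa> (coord \<kappa> p) = p"
    "\<And>y. y \<in> coord \<kappa> ` cdom \<kappa> \<Longrightarrow> icoord \<kappa> y \<in> cdom \<kappa>"
    "\<And>y. y \<in> coord \<kappa> ` cdom \<kappa> \<Longrightarrow> coord \<kappa> (icoord \<kappa> y) = y"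
proof -
  have "\<forall>\<kappa>\<in>A. is_chart \<kappa>" "(\<Union>\<kappa>\<in>A. cdom \<kappa>) = U" using manifold unfolding manifold5_def by blast+
  then show "open (cdom \<kappa>)" "open (coord \<kappa> ` cdom \<kappa>)" "cdom \<kappa> \<subseteq> U"
    "continuous_on (cdom \<kappa>) (coord \<kappa>)" "continuous_on (coord \<kappa> ` cdom \<kappa>) (icoord \<kappa>)"
    "\<And>p. p \<in> cdom \<kappa> \<Longrightarrow> icoord \<kappa> (coord \<kappa> p) = p"
    "\<And>y. y \<in> coord \<kappa> ` cdom \<kappa> \<Longrightarrow> icoord \<kappa> y \<in> cdom \<kappa>"
    "\<And>y. y \<in> coord \<kappa> ` cdom \<kappa> \<Longrightarrow> coord \<kappa> (icoord \<kappa> y) = y"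
    using assms unfolding is_chart_def homeomorphism_def by (blast, blast, blast, blast, blast, blast, blast, blast)
qed

lemma chart_at: "p \<in> U \<Longrightarrow> \<exists>\<kappa>\<in>A. p \<in> cdom \<kappa>"
  using manifold unfolding manifold5_def by blast

lemma chart_image:
  assumes "\<kappa> \<in> A" "D \<subseteq> cdom \<kappa>"
  shows "coord \<kappa> ` D = {y \<in> coord \<kappa> ` cdom \<kappa>. icoord \<kappa> y \<in> D}"
  using assms chart(6)[OF assms(1)] by (auto 0 3 simp: image_iff subset_eq intro: bexI)

lemma chart_image_open:
  assumes "\<kappa> \<in> A" "open D" "D \<subseteq> cdom \<kappa>"
  shows "open (coord \<kappa> ` D)"
proof -
  have "open (coord \<kappa> ` cdom \<kappa> \<inter> icoord \<kappa> -` D)"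
    using chart(2,5)[OF assms(1)] assms(2) by (meson continuous_on_open_vimage inf_commute continuous_open_preimage)
  moreover have "coord \<kappa> ` D = coord \<kappa> ` cdom \<kappa> \<inter> icoord \<kappa> -` D"
    using chart_image[OF assms(1,3)] by auto
  ultimately show ?thesis by simp
qed

lemma chart_smooth_fun: "smooth_fun A f \<Longrightarrow> \<kappa> \<in> A \<Longrightarrow> smooth_on (coord \<kappa> ` cdom \<kappa>) (\<lambda>y. f (icoord \<kappa> y))"
  by (simp add: smooth_fun_def o_def)

lemma chart_transition:
  assumes "\<kappa> \<in> A" "\<mu> \<in> A"
  shows "smooth_on (coord \<kappa> ` (cdom \<kappa> \<inter> cdom \<mu>)) (\<lambda>y. coord \<mu> (icoord \<kappa> y))"
  proof -
  have "\<forall>\<kappa>\<in>A. \<forall>\<mu>\<in>A. compatible \<kappa> \<mu>" using manifold unfolding manifold5_def by blast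
  with assms have "compatible \<kappa> \<mu>" by blast
  then show ?thesis by (simp add: compatible_def o_def)
qed

end

lemma local_se_subset: "local_se S w \<theta> \<Longrightarrow> open T \<Longrightarrow> T \<subseteq> S \<Longrightarrow> local_se T w \<theta>"
  unfolding local_se_def by (meson smooth_on_subset subsetD)

definition theta_of ::
  "('p \<Rightarrow> real) \<Rightarrow> ('p \<Rightarrow> real) \<Rightarrow> ('p \<Rightarrow> real) \<Rightarrow> ('p \<Rightarrow> real) \<Rightarrow> ('p \<Rightarrow> real) \<Rightarrow> ('p \<Rightarrow> real) \<Rightarrow> 5 \<Rightarrow> 'p \<Rightarrow> real" where
  "theta_of a b c J M P k x = (if k = 0 then ((b x)\<^sup>2 - 4 * a x * c x + M x - P x) / 4
     else if k = 1 then c x else if k = 2 then - b x else if k = 3 then a x else - J x)"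

context five_manifold
begin

lemma chart_local_se:
  assumes "\<kappa> \<in> A" "coframe A W" "structure_equations A W a b c J M P"
  shows "local_se (coord \<kappa> ` cdom \<kappa>) (\<lambda>y. W \<kappa> (icoord \<kappa> y)) (\<lambda>k y. theta_of a b c J M P k (icoord \<kappa> y))"
    (is "local_se ?S ?w ?\<theta>")
proof -
  note ch = chart[OF assms(1)]
  have sm: "smooth_on ?S (\<lambda>y. f (icoord \<kappa> y))" if "f \<in> {a, b, c, J, M, P}" for f
    by (rule chart_smooth_fun[OF _ assms(1)]) (use that assms(3) in \<open>auto simp: structure_equations_def\<close>)
  have th: "smooth_on ?S (?\<theta> k)" for k
    proof -
    have "smooth_on ?S (\<lambda>y. a (icoord \<kappa> y))" "smooth_on ?S (\<lambda>y. b (icoord \<kappa> y))" "smooth_on ?S (\<lambda>y. c (icoord \<kappa> y))"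
      "smooth_on ?S (\<lambda>y. J (icoord \<kappa> y))" "smooth_on ?S (\<lambda>y. M (icoord \<kappa> y))" "smooth_on ?S (\<lambda>y. P (icoord \<kappa> y))"
      by (simp_all add: sm)
    then show ?thesis
      unfolding theta_of_def using exhaust_5[of k] by (auto intro!: smooth_intros ch)
  qed
  have eq: "ext_deriv (\<lambda>z. ?w z $ 0) y u v = wedge (?w y $ 1) (?w y $ 4) u v - 3 * wedge (?w y $ 2) (?w y $ 3) u v \<and>
        ext_deriv (\<lambda>z. ?w z $ 1) y u v = 3 * wedge (comb ?w ?\<theta> y) (?w y $ 2) u v \<and>
        ext_deriv (\<lambda>z. ?w z $ 2) y u v = 2 * wedge (comb ?w ?\<theta> y) (?w y $ 3) u v \<and>
        ext_deriv (\<lambda>z. ?w z $ 3) y u v = wedge (comb ?w ?\<theta> y) (?w y $ 4) u v \<and>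
        ext_deriv (\<lambda>z. ?w z $ 4) y u v = 0" if y: "y \<in> ?S" for y u v
  proof -
    obtain x where x: "x \<in> cdom \<kappa>" "y = coord \<kappa> x" using y by blast
    have i: "icoord \<kappa> y = x" using x ch(6) by simp
    have "let K = (b x)\<^sup>2 - 4 * a x * c x + M x - P x;
           \<theta> = (\<lambda>i j. wedge (W \<kappa> x $ i) (W \<kappa> x $ j) u v);
           d = (\<lambda>i. ext_deriv (\<lambda>y. W \<kappa> (icoord \<kappa> y) $ i) (coord \<kappa> x) u v)
       in
         d 0 = \<theta> 1 4 - 3 * \<theta> 2 3 \<and>
         d 1 = 3/4 * K * \<theta> 0 2 + 3 * c x * \<theta> 1 2 - 3 * a x * \<theta> 2 3 + 3 * J x * \<theta> 2 4 \<and>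
         d 2 = 1/2 * K * \<theta> 0 3 + 2 * c x * \<theta> 1 3 - 2 * b x * \<theta> 2 3 + 2 * J x * \<theta> 3 4 \<and>
         d 3 = 1/4 * K * \<theta> 0 4 + c x * \<theta> 1 4 - b x * \<theta> 2 4 + a x * \<theta> 3 4 \<and>
         d 4 = 0"
      using assms(1,3) x(1) unfolding structure_equations_def by blast
    note eqs = this[unfolded Let_def, folded x(2)]
    have cw: "wedge (comb ?w ?\<theta> y) (W \<kappa> x $ j) u v = ((b x)\<^sup>2 - 4 * a x * c x + M x - P x) / 4 * wedge (W \<kappa> x $ 0) (W \<kappa> x $ j) u v
        + c x * wedge (W \<kappa> x $ 1) (W \<kappa> x $ j) u v - b x * wedge (W \<kappa> x $ 2) (W \<kappa> x $ j) u v
        + a x * wedge (W \<kappa> x $ 3) (W \<kappa> x $ j) u v - J x * wedge (W \<kappa> x $ 4) (W \<kappa> x $ j) u v" for j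
      by (simp add: i comb_def sum_5 theta_of_def wedge_def inner_add_left algebra_simps)
    have anti: "wedge (W \<kappa> x $ 3) (W \<kappa> x $ 2) u v = - wedge (W \<kappa> x $ 2) (W \<kappa> x $ 3) u v"
      "wedge (W \<kappa> x $ 4) (W \<kappa> x $ 2) u v = - wedge (W \<kappa> x $ 2) (W \<kappa> x $ 4) u v"
      "wedge (W \<kappa> x $ 4) (W \<kappa> x $ 3) u v = - wedge (W \<kappa> x $ 3) (W \<kappa> x $ 4) u v"
      "wedge (W \<kappa> x $ j) (W \<kappa> x $ j) u v = 0" for j
      by (simp_all add: wedge_def)
    show ?thesis
      unfolding i cw anti using eqs by (simp add: field_simps)
  qed
  show ?thesis
    unfolding local_se_def
  proof (intro conjI ballI allI)
    show "open ?S" by (rule ch)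
    show "smooth_on ?S ?w" using assms(1,2) unfolding coframe_def o_def by blast
    show "invertible (?w y)" if "y \<in> ?S" for y using assms(1,2) ch(7)[OF that] unfolding coframe_def by blast
    show "smooth_on ?S (?\<theta> k)" for k by (rule th)
  qed (use eq in blast)+
qed

text \<open>\<theta>_0 contains M and P only through M - P, and the derivative of a along e_2 only
  through M + 3 P; the combinations with index 2 and 3 separate the two, and the terms in a, b, c
  cancel.\<close>

lemma chart_invariant:
  assumes "\<kappa> \<in> A" "coframe A W" "structure_equations A W a b c J M P"
    "derived_functions A W a b c M P L Q R S" "x \<in> cdom \<kappa>" "n < 7"
  shows "invariant (\<lambda>y. W \<kappa> (icoord \<kappa> y)) (\<lambda>k y. theta_of a b c J M P k (icoord \<kappa> y)) n (coord \<kappa> x) =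
    [- J x, L x, M x, P x, Q x, R x, S x] ! n"
proof -
  let ?w = "\<lambda>y. W \<kappa> (icoord \<kappa> y)" and ?y = "coord \<kappa> x"
  note ch = chart[OF assms(1)]
  have i: "icoord \<kappa> ?y = x" using ch(6)[OF assms(5)] .
  have y: "?y \<in> coord \<kappa> ` cdom \<kappa>" using assms(5) by auto
  have fd: "fd ?w i (\<lambda>y. f (icoord \<kappa> y)) ?y = coframe_deriv \<kappa> W f i x" for i f
    by (simp add: fd_def coframe_deriv_def dual_def o_def i)
  have sm: "smooth_on (coord \<kappa> ` cdom \<kappa>) (\<lambda>y. b (icoord \<kappa> y))"
    by (rule chart_smooth_fun[OF _ assms(1)]) (use assms(3) in \<open>auto simp: structure_equations_def\<close>)
  have d: "coframe_deriv \<kappa> W a 2 x = 1/4 * (- 3 * (b x)\<^sup>2 + M x + 3 * P x)"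
        "L x = coframe_deriv \<kappa> W a 3 x"
        "Q x = 2 * coframe_deriv \<kappa> W a 1 x - 3 * b x * c x - coframe_deriv \<kappa> W b 2 x"
        "R x = (c x)\<^sup>2 - coframe_deriv \<kappa> W c 2 x"
        "S x = coframe_deriv \<kappa> W c 1 x"
    using assms(1,4,5) unfolding derived_functions_def by blast+
  have "n = 0 \<or> n = 1 \<or> n = 2 \<or> n = 3 \<or> n = 4 \<or> n = 5 \<or> n = 6" using assms(6) by auto
  then show ?thesis
    by (elim disjE) (simp_all add: invariant_def theta_of_def fd fd_minus[OF sm y] i d field_simps)
qed

section \<open>Invariance of the vanishing conditions\<close>

text \<open>In a chart around p, the pullback of \<open>W\<close> by \<open>\<phi>\<close> and the
  coframe \<open>W'\<close> live on the same open subset of the coordinate space and differ by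
  \<open>B\<close>. This is why the functions of \<open>W\<close> appear at
  \<open>\<phi> x\<close>.\<close>

lemma local_invariants_iff:
  assumes \<phi>: "diffeo U A \<phi>" and B: "smooth_fun A B" "\<And>p. p \<in> U \<Longrightarrow> B p \<in> structure_group"
    and W: "coframe A W" "structure_equations A W a b c J M P" "derived_functions A W a b c M P L Q R S"
    and W': "coframe A W'" "structure_equations A W' a' b' c' J' M' P'" "derived_functions A W' a' b' c' M' P' L' Q' R' S'"
    and trans: "transformed_coframe A B \<phi> W W'" and p: "p \<in> U" and n: "n < 7"
  shows "\<exists>D. p \<in> D \<and> D \<subseteq> U \<and>
    ((\<forall>k\<le>n. \<forall>x\<in>D. ([J, L, M, P, Q, R, S] ! k) (\<phi> x) = 0) \<longleftrightarrow> (\<forall>k\<le>n. \<forall>x\<in>D. ([J', L', M', P', Q', R', S'] ! k) x = 0))"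
proof -
  have \<phi>U: "\<phi> ` U \<subseteq> U" "continuous_on U \<phi>"
    and \<phi>s: "\<And>\<kappa> \<mu>. \<kappa> \<in> A \<Longrightarrow> \<mu> \<in> A \<Longrightarrow>
      smooth_on (coord \<kappa> ` {p \<in> cdom \<kappa>. \<phi> p \<in> cdom \<mu>}) (\<lambda>y. coord \<mu> (\<phi> (icoord \<kappa> y)))"
    using \<phi> by (auto simp: diffeo_def smooth_self_map_def o_def)
  obtain \<kappa> where \<kappa>: "\<kappa> \<in> A" "p \<in> cdom \<kappa>" using chart_at[OF p] by auto
  obtain \<mu> where \<mu>: "\<mu> \<in> A" "\<phi> p \<in> cdom \<mu>" using chart_at \<phi>U(1) p by blast
  define D where "D = {x \<in> cdom \<kappa>. \<phi> x \<in> cdom \<mu>}"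
  define \<Phi> where "\<Phi> y = coord \<mu> (\<phi> (icoord \<kappa> y))" for y
  define S1 where "S1 = coord \<kappa> ` D"
  let ?w = "\<lambda>y. W \<mu> (icoord \<mu> y)" and ?w' = "\<lambda>y. W' \<kappa> (icoord \<kappa> y)"
  let ?\<theta> = "\<lambda>k y. theta_of a b c J M P k (icoord \<mu> y)" and ?\<theta>' = "\<lambda>k y. theta_of a' b' c' J' M' P' k (icoord \<kappa> y)"
  note ch = chart[OF \<kappa>(1)] and ch' = chart[OF \<mu>(1)]
  have "continuous_on (cdom \<kappa>) \<phi>" using continuous_on_subset[OF \<phi>U(2) ch(3)] .
  then have "open (cdom \<kappa> \<inter> \<phi> -` cdom \<mu>)" using ch(1) ch'(1) by (rule continuous_open_preimage)
  moreover have "D = cdom \<kappa> \<inter> \<phi> -` cdom \<mu>" by (auto simp: D_def)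
  ultimately have D: "open D" "D \<subseteq> cdom \<kappa>" by auto
  have S1: "open S1" unfolding S1_def by (rule chart_image_open[OF \<kappa>(1) D])
  have S1D: "icoord \<kappa> y \<in> D" "y \<in> coord \<kappa> ` cdom \<kappa>" if "y \<in> S1" for y
    using that D ch(6) by (auto simp: S1_def)
  have \<Phi>: "smooth_on S1 \<Phi>" "\<Phi> ` S1 \<subseteq> coord \<mu> ` cdom \<mu>"
    using \<phi>s[OF \<kappa>(1) \<mu>(1)] S1D(1) unfolding S1_def D_def \<Phi>_def[abs_def] by auto
  have rel: "?w' y = B (icoord \<kappa> y) ** pullback \<Phi> ?w y" if y: "y \<in> S1" for y
  proof -
    have x: "icoord \<kappa> y \<in> cdom \<kappa>" "\<phi> (icoord \<kappa> y) \<in> cdom \<mu>" using S1D(1)[OF y] by (auto simp: D_def)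
    have "W' \<kappa> (icoord \<kappa> y) = B (icoord \<kappa> y) ** (W \<mu> (\<phi> (icoord \<kappa> y)) ** tangent_map \<kappa> \<mu> \<phi> (icoord \<kappa> y))"
      using trans \<kappa>(1) \<mu>(1) x unfolding transformed_coframe_def by blast
    moreover have "tangent_map \<kappa> \<mu> \<phi> (icoord \<kappa> y) = jacobian \<Phi> (at y)"
      using ch(8)[OF S1D(2)[OF y]] by (simp add: tangent_map_def \<Phi>_def[abs_def] o_def)
    moreover have "icoord \<mu> (\<Phi> y) = \<phi> (icoord \<kappa> y)" using ch'(6) x by (simp add: \<Phi>_def)
    ultimately show ?thesis by (simp add: pullback_def)
  qed
  have inv: "invertible (pullback \<Phi> ?w y)" if y: "y \<in> S1" for y
  proof -
    have "invertible (?w' y)" using W'(1) \<kappa>(1) S1D(1)[OF y] D(2) by (auto simp: coframe_def)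
    then obtain X where "X ** ?w' y = mat 1" unfolding invertible_def by blast
    then have "(X ** B (icoord \<kappa> y)) ** pullback \<Phi> ?w y = mat 1"
      by (simp add: rel[OF y] matrix_mul_assoc)
    then show ?thesis using invertible_left_inverse by blast
  qed
  note se0 = chart_local_se[OF \<mu>(1) W(1,2)]
  have se: "local_se S1 (pullback \<Phi> ?w) (\<lambda>k z. ?\<theta> k (\<Phi> z))"
    by (rule local_se_pullback[OF S1 se0 \<Phi> inv])
  have se': "local_se S1 ?w' ?\<theta>'"
    by (rule local_se_subset[OF chart_local_se[OF \<kappa>(1) W'(1,2)] S1]) (use S1D(2) in auto)
  have sB: "smooth_on S1 (\<lambda>y. B (icoord \<kappa> y))"
    by (rule smooth_on_subset[OF chart_smooth_fun[OF B(1) \<kappa>(1)]]) (use S1D(2) in auto)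
  have BG: "B (icoord \<kappa> y) \<in> structure_group" if "y \<in> S1" for y
    using B(2) S1D(1)[OF that] D(2) ch(3) by auto
  note iff = invariants_vanish_iff[OF se se' sB BG rel n]
  have 1: "invariant (pullback \<Phi> ?w) (\<lambda>k z. ?\<theta> k (\<Phi> z)) k y = 0 \<longleftrightarrow>
      ([J, L, M, P, Q, R, S] ! k) (\<phi> (icoord \<kappa> y)) = 0" if "y \<in> S1" "k \<le> n" for y k
  proof -
    have x: "\<phi> (icoord \<kappa> y) \<in> cdom \<mu>" using S1D(1)[OF that(1)] by (simp add: D_def)
    have "invariant (pullback \<Phi> ?w) (\<lambda>k z. ?\<theta> k (\<Phi> z)) k y = invariant ?w ?\<theta> k (\<Phi> y)"
      by (rule invariant_pullback[OF S1 se0 \<Phi> inv that(1)]) (use that n in auto)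
    also have "\<dots> = [- J (\<phi> (icoord \<kappa> y)), L (\<phi> (icoord \<kappa> y)), M (\<phi> (icoord \<kappa> y)), P (\<phi> (icoord \<kappa> y)),
        Q (\<phi> (icoord \<kappa> y)), R (\<phi> (icoord \<kappa> y)), S (\<phi> (icoord \<kappa> y))] ! k"
      unfolding \<Phi>_def by (rule chart_invariant[OF \<mu>(1) W x]) (use that n in auto)
    moreover have "k = 0 \<or> k = 1 \<or> k = 2 \<or> k = 3 \<or> k = 4 \<or> k = 5 \<or> k = 6" using that n by auto
    ultimately show ?thesis by (elim disjE) simp_all
  qed
  have 2: "invariant ?w' ?\<theta>' k y = 0 \<longleftrightarrow> ([J', L', M', P', Q', R', S'] ! k) (icoord \<kappa> y) = 0" if "y \<in> S1" "k \<le> n" for y k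
  proof -
    have x: "icoord \<kappa> y \<in> cdom \<kappa>" "coord \<kappa> (icoord \<kappa> y) = y" using S1D[OF that(1)] ch(8) D(2) by auto
    have "invariant ?w' ?\<theta>' k (coord \<kappa> (icoord \<kappa> y)) = [- J' (icoord \<kappa> y), L' (icoord \<kappa> y), M' (icoord \<kappa> y), P' (icoord \<kappa> y),
        Q' (icoord \<kappa> y), R' (icoord \<kappa> y), S' (icoord \<kappa> y)] ! k"
      by (rule chart_invariant[OF \<kappa>(1) W' x(1)]) (use that n in auto)
    moreover have "k = 0 \<or> k = 1 \<or> k = 2 \<or> k = 3 \<or> k = 4 \<or> k = 5 \<or> k = 6" using that n by auto
    ultimately show ?thesis unfolding x(2) by (elim disjE) simp_all
  qed
  have "(\<forall>y\<in>S1. X (icoord \<kappa> y)) \<longleftrightarrow> (\<forall>x\<in>D. X x)" for X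
    using S1D(1) D(2) ch(6) by (auto simp: S1_def subset_iff)
  note * = this
  have "(\<forall>k\<le>n. \<forall>x\<in>D. ([J, L, M, P, Q, R, S] ! k) (\<phi> x) = 0) \<longleftrightarrow> (\<forall>k\<le>n. \<forall>x\<in>D. ([J', L', M', P', Q', R', S'] ! k) x = 0)"
    unfolding *[symmetric] using iff 1 2 by simp
  moreover have "p \<in> D" using \<kappa> \<mu> by (simp add: D_def)
  moreover have "D \<subseteq> U" using D ch(3) by auto
  ultimately show ?thesis by blast
qed

text \<open>The local equivalences concern the values at \<open>\<phi> x\<close>; since
  \<open>\<phi>\<close> maps onto \<open>U\<close>, these reach every point.\<close>

lemma global_invariants_iff:
  assumes \<phi>: "diffeo U A \<phi>" and B: "smooth_fun A B" "\<And>p. p \<in> U \<Longrightarrow> B p \<in> structure_group"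
    and W: "coframe A W" "structure_equations A W a b c J M P" "derived_functions A W a b c M P L Q R S"
    and W': "coframe A W'" "structure_equations A W' a' b' c' J' M' P'" "derived_functions A W' a' b' c' M' P' L' Q' R' S'"
    and trans: "transformed_coframe A B \<phi> W W'" and n: "n < 7"
  shows "vanish_on U (take (Suc n) [J, L, M, P, Q, R, S]) \<longleftrightarrow> vanish_on U (take (Suc n) [J', L', M', P', Q', R', S'])"
proof -
  have v: "vanish_on U (take (Suc n) fs) \<longleftrightarrow> (\<forall>k\<le>n. \<forall>x\<in>U. (fs ! k) x = 0)" if "length fs = 7" for fs
    using that n by (auto simp: vanish_on_def all_set_conv_all_nth less_Suc_eq_le)
  have surj: "\<phi> ` U = U" using \<phi> by (auto simp: diffeo_def bij_betw_def)
  have loc: "\<exists>D. x \<in> D \<and> D \<subseteq> U \<and> ((\<forall>k\<le>n. \<forall>x\<in>D. ([J, L, M, P, Q, R, S] ! k) (\<phi> x) = 0) \<longleftrightarrow>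
      (\<forall>k\<le>n. \<forall>x\<in>D. ([J', L', M', P', Q', R', S'] ! k) x = 0))" if "x \<in> U" for x
    by (rule local_invariants_iff[OF \<phi> B W W' trans that n])
  have vJ: "vanish_on U (take (Suc n) [J, L, M, P, Q, R, S]) \<longleftrightarrow> (\<forall>k\<le>n. \<forall>x\<in>U. ([J, L, M, P, Q, R, S] ! k) x = 0)"
    "vanish_on U (take (Suc n) [J', L', M', P', Q', R', S']) \<longleftrightarrow> (\<forall>k\<le>n. \<forall>x\<in>U. ([J', L', M', P', Q', R', S'] ! k) x = 0)"
    by (rule v, simp)+
  show ?thesis unfolding vJ
  proof
    assume *: "\<forall>k\<le>n. \<forall>x\<in>U. ([J, L, M, P, Q, R, S] ! k) x = 0"
    show "\<forall>k\<le>n. \<forall>x\<in>U. ([J', L', M', P', Q', R', S'] ! k) x = 0"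
    proof (intro allI impI ballI)
      fix k x assume kx: "k \<le> n" "x \<in> U"
      obtain D where D: "x \<in> D" "D \<subseteq> U" "(\<forall>k\<le>n. \<forall>x\<in>D. ([J, L, M, P, Q, R, S] ! k) (\<phi> x) = 0) \<longleftrightarrow>
        (\<forall>k\<le>n. \<forall>x\<in>D. ([J', L', M', P', Q', R', S'] ! k) x = 0)"
        using loc[OF kx(2)] by blast
      have "\<forall>k\<le>n. \<forall>x\<in>D. ([J, L, M, P, Q, R, S] ! k) (\<phi> x) = 0" using * surj D(2) by blast
      then show "([J', L', M', P', Q', R', S'] ! k) x = 0" using D kx by blast
    qed
  next
    assume *: "\<forall>k\<le>n. \<forall>x\<in>U. ([J', L', M', P', Q', R', S'] ! k) x = 0"
    show "\<forall>k\<le>n. \<forall>x\<in>U. ([J, L, M, P, Q, R, S] ! k) x = 0"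
    proof (intro allI impI ballI)
      fix k x assume kx: "k \<le> n" "x \<in> U"
      then obtain x' where x': "x' \<in> U" "x = \<phi> x'" using surj by blast
      obtain D where D: "x' \<in> D" "D \<subseteq> U" "(\<forall>k\<le>n. \<forall>x\<in>D. ([J, L, M, P, Q, R, S] ! k) (\<phi> x) = 0) \<longleftrightarrow>
        (\<forall>k\<le>n. \<forall>x\<in>D. ([J', L', M', P', Q', R', S'] ! k) x = 0)"
        using loc[OF x'(1)] by blast
      have "\<forall>k\<le>n. \<forall>x\<in>D. ([J', L', M', P', Q', R', S'] ! k) x = 0" using * D(2) by blast
      then show "([J, L, M, P, Q, R, S] ! k) x = 0" using D kx x' by blast
    qed
  qed
qed

end

section \<open>Adapted coframes\<close>

text \<open>The separate scalar k makes room for rescaling a point of the cone without extracting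
  cube roots.\<close>

definition cone_point :: "real \<Rightarrow> real \<Rightarrow> real \<Rightarrow> real^5" where
  "cone_point k x y = row5 0 (k * x^3) (k * (x^2 * y)) (k * (x * y^2)) (k * y^3)"

text \<open>Where z_1 = 0 the quadrics force z_2 = z_3 = 0, which leaves the point (0 : 1);
  elsewhere z_2 / z_1 is the parameter of the curve.\<close>

lemma quadric_cone:
  "z $ 0 = 0 \<and> z $ 1 * z $ 3 - (z $ 2)\<^sup>2 = 0 \<and> z $ 2 * z $ 4 - (z $ 3)\<^sup>2 = 0 \<and> z $ 2 * z $ 3 - z $ 1 * z $ 4 = 0
    \<longleftrightarrow> (\<exists>k x y. z = cone_point k x y)"
proof
  assume z: "z $ 0 = 0 \<and> z $ 1 * z $ 3 - (z $ 2)\<^sup>2 = 0 \<and> z $ 2 * z $ 4 - (z $ 3)\<^sup>2 = 0 \<and> z $ 2 * z $ 3 - z $ 1 * z $ 4 = 0"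
  show "\<exists>k x y. z = cone_point k x y"
  proof (cases "z $ 1 = 0")
    case True
    then have "z $ 2 = 0" "z $ 3 = 0" using z by auto
    then have "z = cone_point (z $ 4) 0 1" using z True by (simp add: vec5_eq_iff cone_point_def)
    then show ?thesis by blast
  next
    case False
    have 3: "z $ 3 = (z $ 2)\<^sup>2 / z $ 1" using z False by (simp add: field_simps)
    have 4: "z $ 4 = z $ 2 * z $ 3 / z $ 1" using z False by (simp add: field_simps)
    have "z = cone_point (z $ 1) 1 (z $ 2 / z $ 1)"
      using z False unfolding vec5_eq_iff cone_point_def
      by (simp add: 4 3 power2_eq_square power3_eq_cube)
    then show ?thesis by blast
  qed
qed (auto simp: cone_point_def power2_eq_square power3_eq_cube)

lemma adapted_cubic_iff:
  "adapted_cubic w C G \<longleftrightarrow> C = {v. (w *v v) $ 0 = 0} \<and> G = {v. \<exists>k x y. w *v v = cone_point k x y}"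
  unfolding adapted_cubic_def Let_def quadric_cone ..

lemma adapted_mark_iff: "adapted_mark w l \<longleftrightarrow> l = {v. \<exists>k. w *v v = cone_point k 0 1}"
proof -
  have "(z $ 0 = 0 \<and> z $ 1 = 0 \<and> z $ 2 = 0 \<and> z $ 3 = 0) \<longleftrightarrow> (\<exists>k. z = cone_point k 0 1)" for z
    by (auto simp: vec5_eq_iff cone_point_def)
  then show ?thesis by (simp add: adapted_mark_def Let_def)
qed

lemma polynomial_6_eq_0:
  fixes c0 c1 c2 c3 c4 c5 c6 :: real
  assumes "\<And>s. c0 + c1 * s + c2 * s^2 + c3 * s^3 + c4 * s^4 + c5 * s^5 + c6 * s^6 = 0"
  shows "c0 = 0" "c1 = 0" "c2 = 0" "c3 = 0" "c4 = 0" "c5 = 0" "c6 = 0"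
  using assms[of 0] assms[of 1] assms[of "-1"] assms[of 2] assms[of "-2"] assms[of 3] assms[of "-3"]
  by simp_all

text \<open>Both coframes describe the same twisted cubic with the same marked point, so the matrix relating
  them maps the curve \<open>s \<mapsto> (s\<^sup>3, s\<^sup>2, s, 1)\<close> to the cone. Comparing the coefficients of \<open>s\<close> in the
  quadrics shows first that the matrix is lower triangular and then that it has the required shape.\<close>

lemma cone_automorphism:
  fixes B :: "real^5^5"
  assumes inv: "invertible B"
    and row: "\<And>z. z $ 0 = 0 \<Longrightarrow> (B *v z) $ 0 = 0"
    and cone: "\<And>k x y. \<exists>k' x' y'. B *v cone_point k x y = cone_point k' x' y'"
    and mark: "\<And>k. \<exists>k'. B *v cone_point k 0 1 = cone_point k' 0 1"
  shows "B $ 0 $ 1 = 0" "B $ 0 $ 2 = 0" "B $ 0 $ 3 = 0" "B $ 0 $ 4 = 0"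
    "B $ 1 $ 2 = 0" "B $ 1 $ 3 = 0" "B $ 1 $ 4 = 0" "B $ 2 $ 3 = 0" "B $ 2 $ 4 = 0" "B $ 3 $ 4 = 0"
    "(B $ 2 $ 1)\<^sup>2 = B $ 1 $ 1 * B $ 3 $ 1" "2 * B $ 2 $ 1 * B $ 2 $ 2 = B $ 1 $ 1 * B $ 3 $ 2"
    "(B $ 2 $ 2)\<^sup>2 = B $ 1 $ 1 * B $ 3 $ 3"
    "B $ 1 $ 1 * B $ 4 $ 1 = B $ 2 $ 1 * B $ 3 $ 1"
    "B $ 1 $ 1 * B $ 4 $ 2 = B $ 2 $ 1 * B $ 3 $ 2 + B $ 2 $ 2 * B $ 3 $ 1"
    "B $ 1 $ 1 * B $ 4 $ 3 = B $ 2 $ 1 * B $ 3 $ 3 + B $ 2 $ 2 * B $ 3 $ 2"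
    "B $ 1 $ 1 * B $ 4 $ 4 = B $ 2 $ 2 * B $ 3 $ 3"
proof -
  have e: "B *v axis j 1 = (\<chi> i. B $ i $ j)" for j
    by (simp add: matrix_vector_mult_basis column_def)
  show r0: "B $ 0 $ 1 = 0" "B $ 0 $ 2 = 0" "B $ 0 $ 3 = 0" "B $ 0 $ 4 = 0"
    proof -
    have "B $ 0 $ j = 0" if "j \<noteq> 0" for j
      using row[of "axis j 1"] that unfolding e by (simp add: axis_def)
    then show "B $ 0 $ 1 = 0" "B $ 0 $ 2 = 0" "B $ 0 $ 3 = 0" "B $ 0 $ 4 = 0" by simp_all
  qed
  obtain k' where k': "B *v cone_point 1 0 1 = cone_point k' 0 1" using mark by blast
  then show c4: "B $ 1 $ 4 = 0" "B $ 2 $ 4 = 0" "B $ 3 $ 4 = 0"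
    by (simp_all add: vec5_eq_iff matrix_vector_5) (simp_all add: cone_point_def)
  \<comment> \<open>The marked vector goes to a multiple of itself, and an invertible matrix cannot
    annihilate it.\<close>
  have b44: "B $ 4 $ 4 \<noteq> 0"
  proof
    assume "B $ 4 $ 4 = 0"
    then have "B *v axis 4 1 = 0" using c4 r0 by (simp add: e vec5_eq_iff)
    moreover obtain X where "X ** B = mat 1" using inv unfolding invertible_def by blast
    ultimately have "(axis 4 1 :: real^5) = 0"
      by (metis matrix_vector_mul_assoc matrix_vector_mul_lid matrix_vector_mult_0_right)
    then show False by (simp add: axis_eq_0_iff)
  qed
  \<comment> \<open>On the image of the curve the quadrics are polynomials of degree at most 6 in s.
    The lowest coefficients of the second and third are multiples of \<open>B $ 4 $ 4\<close> by the
    entries above the diagonal, which therefore vanish; the higher ones determine the shape of the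
    matrix.\<close>
  define z where "z i s = B $ i $ 1 * s^3 + B $ i $ 2 * s^2 + B $ i $ 3 * s + B $ i $ 4" for i s
  have z: "z 1 s * z 3 s - (z 2 s)\<^sup>2 = 0 \<and> z 2 s * z 4 s - (z 3 s)\<^sup>2 = 0 \<and> z 2 s * z 3 s - z 1 s * z 4 s = 0" for s
  proof -
    have "(B *v cone_point 1 s 1) $ i = z i s" for i
      by (simp add: matrix_vector_5 cone_point_def z_def)
    then show ?thesis
      using quadric_cone[of "B *v cone_point 1 s 1"] cone[of 1 s 1] by simp
  qed
  show b23: "B $ 2 $ 3 = 0"
  proof -
    have "0 + (B $ 2 $ 3 * B $ 4 $ 4) * s + (B $ 2 $ 2 * B $ 4 $ 4 + B $ 2 $ 3 * B $ 4 $ 3 - (B $ 3 $ 3)\<^sup>2) * s^2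
      + (B $ 2 $ 1 * B $ 4 $ 4 + B $ 2 $ 2 * B $ 4 $ 3 + B $ 2 $ 3 * B $ 4 $ 2 - 2 * B $ 3 $ 2 * B $ 3 $ 3) * s^3
      + (B $ 2 $ 1 * B $ 4 $ 3 + B $ 2 $ 2 * B $ 4 $ 2 + B $ 2 $ 3 * B $ 4 $ 1 - (B $ 3 $ 2)\<^sup>2 - 2 * B $ 3 $ 1 * B $ 3 $ 3) * s^4
      + (B $ 2 $ 1 * B $ 4 $ 2 + B $ 2 $ 2 * B $ 4 $ 1 - 2 * B $ 3 $ 1 * B $ 3 $ 2) * s^5
      + (B $ 2 $ 1 * B $ 4 $ 1 - (B $ 3 $ 1)\<^sup>2) * s^6 = 0" for s
      using z[of s] unfolding z_def c4 by algebra
    from polynomial_6_eq_0(2)[OF this] show ?thesis using b44 by simp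
  qed
  have "0 + (- B $ 1 $ 3 * B $ 4 $ 4) * s + (- B $ 1 $ 2 * B $ 4 $ 4 - B $ 1 $ 3 * B $ 4 $ 3) * s^2
      + (B $ 2 $ 2 * B $ 3 $ 3 - B $ 1 $ 1 * B $ 4 $ 4 - B $ 1 $ 2 * B $ 4 $ 3 - B $ 1 $ 3 * B $ 4 $ 2) * s^3
      + (B $ 2 $ 1 * B $ 3 $ 3 + B $ 2 $ 2 * B $ 3 $ 2 - B $ 1 $ 1 * B $ 4 $ 3 - B $ 1 $ 2 * B $ 4 $ 2 - B $ 1 $ 3 * B $ 4 $ 1) * s^4
      + (B $ 2 $ 1 * B $ 3 $ 2 + B $ 2 $ 2 * B $ 3 $ 1 - B $ 1 $ 1 * B $ 4 $ 2 - B $ 1 $ 2 * B $ 4 $ 1) * s^5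
      + (B $ 2 $ 1 * B $ 3 $ 1 - B $ 1 $ 1 * B $ 4 $ 1) * s^6 = 0" for s
    using z[of s] unfolding z_def c4 b23 by algebra
  note p = polynomial_6_eq_0[OF this]
  show b13: "B $ 1 $ 3 = 0" using p(2) b44 by simp
  then show b12: "B $ 1 $ 2 = 0" using p(3) b44 by simp
  show "B $ 1 $ 1 * B $ 4 $ 1 = B $ 2 $ 1 * B $ 3 $ 1"
    "B $ 1 $ 1 * B $ 4 $ 2 = B $ 2 $ 1 * B $ 3 $ 2 + B $ 2 $ 2 * B $ 3 $ 1"
    "B $ 1 $ 1 * B $ 4 $ 3 = B $ 2 $ 1 * B $ 3 $ 3 + B $ 2 $ 2 * B $ 3 $ 2"
    "B $ 1 $ 1 * B $ 4 $ 4 = B $ 2 $ 2 * B $ 3 $ 3"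
    using p(4-7) b12 b13 by auto
  have "0 + 0 * s + 0 * s^2 + 0 * s^3
      + (B $ 1 $ 1 * B $ 3 $ 3 - (B $ 2 $ 2)\<^sup>2) * s^4
      + (B $ 1 $ 1 * B $ 3 $ 2 - 2 * B $ 2 $ 1 * B $ 2 $ 2) * s^5
      + (B $ 1 $ 1 * B $ 3 $ 1 - (B $ 2 $ 1)\<^sup>2) * s^6 = 0" for s
    using z[of s] unfolding z_def c4 b23 b12 b13 by algebra
  note p = polynomial_6_eq_0[OF this]
  show "(B $ 2 $ 1)\<^sup>2 = B $ 1 $ 1 * B $ 3 $ 1" "2 * B $ 2 $ 1 * B $ 2 $ 2 = B $ 1 $ 1 * B $ 3 $ 2"
    "(B $ 2 $ 2)\<^sup>2 = B $ 1 $ 1 * B $ 3 $ 3"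
    using p(5-7) by auto
qed

text \<open>Turns the purely pointwise condition of being adapted into membership in the structure
  group, so that any two adapted coframes are related by a gauge transformation.\<close>

lemma adapted_structure_group:
  fixes w w' :: "real^5^5"
  assumes w: "invertible w" "adapted_cubic w C G" "adapted_mark w l"
    and w': "invertible w'" "adapted_cubic w' C G" "adapted_mark w' l"
  shows "w' ** matrix_inv w \<in> structure_group"
proof -
  let ?B = "w' ** matrix_inv w" and ?B' = "w ** matrix_inv w'"
  have auto': "invertible (x' ** matrix_inv x) \<and>
      (\<forall>z. z $ 0 = 0 \<longrightarrow> ((x' ** matrix_inv x) *v z) $ 0 = 0) \<and>
      (\<forall>k a b. \<exists>k' a' b'. (x' ** matrix_inv x) *v cone_point k a b = cone_point k' a' b') \<and>
      (\<forall>k. \<exists>k'. (x' ** matrix_inv x) *v cone_point k 0 1 = cone_point k' 0 1)"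
    if x: "invertible x" "adapted_cubic x C G" "adapted_mark x l"
      and x': "invertible x'" "adapted_cubic x' C G" "adapted_mark x' l" for x x' :: "real^5^5"
  proof -
    have i: "x *v (matrix_inv x *v z) = z" for z
      by (simp add: matrix_vector_mul_assoc matrix_inv_works(1)[OF x(1)])
    have C: "(x *v v) $ 0 = 0 \<longleftrightarrow> (x' *v v) $ 0 = 0" for v
      using x(2) x'(2) unfolding adapted_cubic_iff by blast
    have G: "(\<exists>k a b. x *v v = cone_point k a b) \<longleftrightarrow> (\<exists>k a b. x' *v v = cone_point k a b)" for v
      using x(2) x'(2) unfolding adapted_cubic_iff by blast
    have l: "(\<exists>k. x *v v = cone_point k 0 1) \<longleftrightarrow> (\<exists>k. x' *v v = cone_point k 0 1)" for v
      using x(3) x'(3) unfolding adapted_mark_iff by blast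
    have "invertible (matrix_inv x)" using matrix_inv_works[OF x(1)] unfolding invertible_def by blast
    then have 1: "invertible (x' ** matrix_inv x)" using invertible_mult[OF x'(1)] by blast
    have 2: "\<exists>k' a' b'. x' *v (matrix_inv x *v cone_point k a b) = cone_point k' a' b'" for k a b
      using G[of "matrix_inv x *v cone_point k a b"] unfolding i by blast
    have 3: "\<exists>k'. x' *v (matrix_inv x *v cone_point k 0 1) = cone_point k' 0 1" for k
      using l[of "matrix_inv x *v cone_point k 0 1"] unfolding i by blast
    have 4: "(x' *v (matrix_inv x *v z)) $ 0 = 0" if "z $ 0 = 0" for z
      using C[of "matrix_inv x *v z"] that unfolding i by blast
    show ?thesis using 1 2 3 4 by (simp add: matrix_vector_mul_assoc)
  qed
  note B = auto'[OF w w'] and B' = auto'[OF w' w]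
  have "invertible ?B" "\<And>z. z $ 0 = 0 \<Longrightarrow> (?B *v z) $ 0 = 0" using B by auto
  have tB: "\<And>k x y. \<exists>k' x' y'. ?B *v cone_point k x y = cone_point k' x' y'"
    "\<And>k. \<exists>k'. ?B *v cone_point k 0 1 = cone_point k' 0 1" using B by blast+
  note t = cone_automorphism[OF \<open>invertible ?B\<close> \<open>\<And>z. z $ 0 = 0 \<Longrightarrow> (?B *v z) $ 0 = 0\<close> tB]
  have "invertible ?B'" "\<And>z. z $ 0 = 0 \<Longrightarrow> (?B' *v z) $ 0 = 0"
    "\<And>k x y. \<exists>k' x' y'. ?B' *v cone_point k x y = cone_point k' x' y'"
    "\<And>k. \<exists>k'. ?B' *v cone_point k 0 1 = cone_point k' 0 1" using B' by blast+
  note t' = cone_automorphism[OF this]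
  have "?B ** ?B' = w' ** (matrix_inv w ** w) ** matrix_inv w'" by (simp only: matrix_mul_assoc)
  also have "\<dots> = mat 1" by (simp add: matrix_inv_works w(1) w'(1))
  finally have BB: "(?B ** ?B') $ i $ i = 1" for i by (simp add: mat_def)
  define b where "b = ?B"
  define b' where "b' = ?B'"
  note t = t[folded b_def] and t' = t'[folded b'_def] and BB = BB[folded b_def b'_def]
  \<comment> \<open>Both matrices are lower triangular, so the diagonal of their product consists of
    products of diagonal entries, each equal to 1.\<close>
  have nz: "b $ 0 $ 0 \<noteq> 0" "b $ 1 $ 1 \<noteq> 0" "b $ 2 $ 2 \<noteq> 0"
    using BB[of 0] BB[of 1] BB[of 2] t t' by (auto simp: matrix_matrix_5)
  \<comment> \<open>A real cube root always exists. With \<open>s5\<close>, \<open>s7\<close>,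
    \<open>s8\<close> read off from two rows, the quadric relations give the remaining entries after
    cancelling \<open>s5^3\<close>.\<close>
  define s5 where "s5 = root 3 (b $ 1 $ 1)"
  define s7 where "s7 = b $ 2 $ 1 / s5^2"
  define s8 where "s8 = b $ 2 $ 2 / s5^2"
  have p: "b $ 1 $ 1 = s5^3" by (simp add: s5_def odd_real_root_pow)
  then have s5: "s5 \<noteq> 0" using nz by auto
  have 2: "b $ 2 $ 1 = s5^2 * s7" "b $ 2 $ 2 = s5^2 * s8" using s5 by (simp_all add: s7_def s8_def)
  then have s8: "s8 \<noteq> 0" using nz by auto
  have "s5^3 * b $ 3 $ 1 = s5^3 * (s5 * s7^2)" using t(11) unfolding p 2 by algebra
  then have 31: "b $ 3 $ 1 = s5 * s7^2" using s5 by simp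
  have "s5^3 * b $ 3 $ 2 = s5^3 * (2 * s5 * s7 * s8)" using t(12) unfolding p 2 by algebra
  then have 32: "b $ 3 $ 2 = 2 * s5 * s7 * s8" using s5 by simp
  have "s5^3 * b $ 3 $ 3 = s5^3 * (s5 * s8^2)" using t(13) unfolding p 2 by algebra
  then have 33: "b $ 3 $ 3 = s5 * s8^2" using s5 by simp
  have "s5^3 * b $ 4 $ 1 = s5^3 * s7^3" using t(14) unfolding p 2 31 by algebra
  then have 41: "b $ 4 $ 1 = s7^3" using s5 by simp
  have "s5^3 * b $ 4 $ 2 = s5^3 * (3 * s7^2 * s8)" using t(15) unfolding p 2 31 32 by algebra
  then have 42: "b $ 4 $ 2 = 3 * s7^2 * s8" using s5 by simp
  have "s5^3 * b $ 4 $ 3 = s5^3 * (3 * s7 * s8^2)" using t(16) unfolding p 2 32 33 by algebra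
  then have 43: "b $ 4 $ 3 = 3 * s7 * s8^2" using s5 by simp
  have "s5^3 * b $ 4 $ 4 = s5^3 * s8^3" using t(17) unfolding p 2 33 by algebra
  then have 44: "b $ 4 $ 4 = s8^3" using s5 by simp
  have "b = row5
     (row5 (b $ 0 $ 0) 0 0 0 0)
     (row5 (b $ 1 $ 0) (s5^3) 0 0 0)
     (row5 (b $ 2 $ 0) (s5^2 * s7) (s5^2 * s8) 0 0)
     (row5 (b $ 3 $ 0) (s5 * s7^2) (2 * s5 * s7 * s8) (s5 * s8^2) 0)
     (row5 (b $ 4 $ 0) (s7^3) (3 * s7^2 * s8) (3 * s7 * s8^2) (s8^3))"
    unfolding vec5_eq_iff using t(1-10) p 2 31 32 33 41 42 43 44 by simp
  moreover have "\<dots> \<in> structure_group" by (rule structure_groupI) (use nz s5 s8 in simp)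
  ultimately show ?thesis unfolding b_def by metis
qed

section \<open>Marked Engel structures in coordinates\<close>

text \<open>The coframe obtained from the Engel coframe by the shear that moves the marked direction with
  parameters \<open>(u, 1)\<close> to the last frame vector. It satisfies the structure equations with
  \<open>\<theta> = - du\<close>, for every function \<open>u\<close>.\<close>

definition sheared_engel :: "real \<Rightarrow> real^5 \<Rightarrow> real^5^5" where
  "sheared_engel u x = row5
     (row5 1 0 0 (- 3 * x $ 2) (x $ 1))
     (row5 0 1 (- 3 * u) (3 * u^2) (- (u^3)))
     (row5 0 0 1 (- 2 * u) (u^2))
     (row5 0 0 0 1 (- u))
     (row5 0 0 0 0 1)"

lemma sheared_engel_0: "sheared_engel 0 x = engel_coframe x"
  by (simp add: sheared_engel_def engel_coframe_def)

definition sheared_dual :: "real \<Rightarrow> real^5 \<Rightarrow> 5 \<Rightarrow> real^5" where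
  "sheared_dual u x k = row5 (row5 1 0 0 0 0) (row5 0 1 0 0 0) (row5 0 (3 * u) 1 0 0)
     (row5 (3 * x $ 2) (3 * u^2) (2 * u) 1 0) (row5 (3 * u * x $ 2 - x $ 1) (u^3) (u^2) u 1) $ k"

lemma sheared_engel_dual_inner: "sheared_engel u x $ k \<bullet> sheared_dual u x i = (if k = i then 1 else 0)"
  using exhaust_5[of k] exhaust_5[of i]
  by (elim disjE; simp add: sheared_engel_def sheared_dual_def inner_5)
    (simp_all add: power2_eq_square power3_eq_cube algebra_simps)

lemma invertible_sheared_engel: "invertible (sheared_engel u x)"
proof -
  have "sheared_engel u x ** transpose (\<chi> k. sheared_dual u x k) = mat 1"
    by (simp add: vec_eq_iff mat_def matrix_matrix_mult_def transpose_def
        sheared_engel_dual_inner[unfolded inner_vec_def inner_real_def])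
  then show ?thesis using invertible_right_inverse by blast
qed

lemma dual_sheared_engel: "dual (sheared_engel u x) k = sheared_dual u x k"
  using dual_unique[OF invertible_sheared_engel sheared_engel_dual_inner] by metis

lemma has_derivative_row5:
  assumes "(f0 has_derivative f0') F" "(f1 has_derivative f1') F" "(f2 has_derivative f2') F"
    "(f3 has_derivative f3') F" "(f4 has_derivative f4') F"
  shows "((\<lambda>z. row5 (f0 z) (f1 z) (f2 z) (f3 z) (f4 z) :: real^5) has_derivative
    (\<lambda>v. row5 (f0' v) (f1' v) (f2' v) (f3' v) (f4' v))) F"
  proof -
  have e: "row5 a b c d e = axis 0 a + axis 1 b + axis 2 c + axis 3 d + axis 4 e" for a b c d e :: real
    by (simp add: vec5_eq_iff axis_def)
  show ?thesis
    unfolding e by (intro has_derivative_add bounded_linear.has_derivative[OF bounded_linear_axis] assms)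
qed

lemma fd_divide_const:
  assumes "smooth_on S F" "y \<in> S"
  shows "fd w i (\<lambda>z. F z / c) y = fd w i F y / c"
  using fd_cmult[OF assms, of w i "1 / c"] by simp

lemma sum_fd:
  assumes "smooth_on S F" "y \<in> S" "invertible (w y)"
  shows "(\<Sum>k\<in>UNIV. fd w k F y * (w y $ k \<bullet> v)) = fder F y v"
proof -
  have "fder F y v = fder F y (\<Sum>k\<in>UNIV. (w y $ k \<bullet> v) *\<^sub>R dual (w y) k)"
    by (rule arg_cong[OF dual_expand[OF assms(3)]])
  then show ?thesis
    using smooth_on_linear_derivative[OF assms(1,2)] by (simp add: fd_def linear_sum linear_scale mult.commute)
qed

text \<open>Differentiating the polynomial coefficients of one row produces the next row: for
  instance \<omega>^1 = dx^1 - 3 u dx^2 + 3 u^2 dx^3 - u^3 dx^4 has d\<omega>^1 = - 3 du \<and>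
  \<omega>^2. The shear leaves \<omega>^1 \<and> \<omega>^4 - 3 \<omega>^2 \<and> \<omega>^3
  unchanged, which settles d\<omega>^0.\<close>

lemma local_se_sheared_engel:
  assumes S: "open S" and u: "smooth_on S u"
  shows "local_se S (\<lambda>y. sheared_engel (u y) y) (\<lambda>k y. - fd (\<lambda>y. sheared_engel (u y) y) k u y)"
    (is "local_se S ?w ?\<theta>")
proof -
  have id: "smooth_on S (\<lambda>y. y)" by (intro smooth_intros S)
  have w: "smooth_on S ?w"
    unfolding sheared_engel_def by (intro smooth_intros S u id)
  have th: "smooth_on S (?\<theta> k)" for k
    by (intro smooth_intros S w invertible_sheared_engel u)
  have c: "comb ?w ?\<theta> y \<bullet> v = - fder u y v" if "y \<in> S" for y v
    using sum_fd[where v = v and w = ?w, OF u that invertible_sheared_engel]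
    by (simp add: comb_def inner_sum_left sum_negf)
  have eq: "ext_deriv (\<lambda>z. ?w z $ 0) y a b = wedge (?w y $ 1) (?w y $ 4) a b - 3 * wedge (?w y $ 2) (?w y $ 3) a b"
    "ext_deriv (\<lambda>z. ?w z $ 1) y a b = 3 * wedge (comb ?w ?\<theta> y) (?w y $ 2) a b"
    "ext_deriv (\<lambda>z. ?w z $ 2) y a b = 2 * wedge (comb ?w ?\<theta> y) (?w y $ 3) a b"
    "ext_deriv (\<lambda>z. ?w z $ 3) y a b = wedge (comb ?w ?\<theta> y) (?w y $ 4) a b"
    "ext_deriv (\<lambda>z. ?w z $ 4) y a b = 0" if y: "y \<in> S" for y a b
  proof -
    let ?u = "fder u y"
    have du: "(u has_derivative ?u) (at y)" using smooth_on_derivative[OF u y] .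
    have x: "((\<lambda>z::real^5. z $ i) has_derivative (\<lambda>v. v $ i)) (at y)" for i
      using has_derivative_ident by (rule bounded_linear.has_derivative[OF bounded_linear_vec_nth])
    have "((\<lambda>z. ?w z $ 0) has_derivative (\<lambda>v. row5 0 0 0 (- 3 * v $ 2) (v $ 1))) (at y)"
      unfolding sheared_engel_def row5_nth by (rule has_derivative_row5) (auto intro!: derivative_eq_intros x)
    note 0 = frechet_derivative_at[OF this, symmetric]
    have "((\<lambda>z. ?w z $ 1) has_derivative (\<lambda>v. row5 0 0 (- 3 * ?u v) (6 * u y * ?u v) (- 3 * u y^2 * ?u v))) (at y)"
      unfolding sheared_engel_def row5_nth by (rule has_derivative_row5) (auto intro!: derivative_eq_intros du)
    note 1 = frechet_derivative_at[OF this, symmetric]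
    have "((\<lambda>z. ?w z $ 2) has_derivative (\<lambda>v. row5 0 0 0 (- 2 * ?u v) (2 * u y * ?u v))) (at y)"
      unfolding sheared_engel_def row5_nth by (rule has_derivative_row5) (auto intro!: derivative_eq_intros du)
    note 2 = frechet_derivative_at[OF this, symmetric]
    have "((\<lambda>z. ?w z $ 3) has_derivative (\<lambda>v. row5 0 0 0 0 (- ?u v))) (at y)"
      unfolding sheared_engel_def row5_nth by (rule has_derivative_row5) (auto intro!: derivative_eq_intros du)
    note 3 = frechet_derivative_at[OF this, symmetric]
    have "((\<lambda>z. ?w z $ 4) has_derivative (\<lambda>v. row5 0 0 0 0 0)) (at y)"
      unfolding sheared_engel_def row5_nth by (rule has_derivative_row5) auto
    note 4 = frechet_derivative_at[OF this, symmetric]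
    show "ext_deriv (\<lambda>z. ?w z $ 0) y a b = wedge (?w y $ 1) (?w y $ 4) a b - 3 * wedge (?w y $ 2) (?w y $ 3) a b"
      unfolding ext_deriv_def 0 wedge_def by (simp add: sheared_engel_def inner_5) algebra
    show "ext_deriv (\<lambda>z. ?w z $ 1) y a b = 3 * wedge (comb ?w ?\<theta> y) (?w y $ 2) a b"
      unfolding ext_deriv_def 1 wedge_def c[OF y] by (simp add: sheared_engel_def inner_5) algebra
    show "ext_deriv (\<lambda>z. ?w z $ 2) y a b = 2 * wedge (comb ?w ?\<theta> y) (?w y $ 3) a b"
      unfolding ext_deriv_def 2 wedge_def c[OF y] by (simp add: sheared_engel_def inner_5) algebra
    show "ext_deriv (\<lambda>z. ?w z $ 3) y a b = wedge (comb ?w ?\<theta> y) (?w y $ 4) a b"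
      unfolding ext_deriv_def 3 wedge_def c[OF y] by (simp add: sheared_engel_def inner_5)
    show "ext_deriv (\<lambda>z. ?w z $ 4) y a b = 0"
      unfolding ext_deriv_def 4 by (simp add: inner_5)
  qed
  show ?thesis
    unfolding local_se_def by (intro conjI ballI allI S w th invertible_sheared_engel eq)
qed

lemma engel_local_se: "open S \<Longrightarrow> local_se S engel_coframe (\<lambda>k y. 0)"
  using local_se_sheared_engel[OF _ smooth_on_const, of S 0] by (simp add: sheared_engel_0)

text \<open>The \<open>7\<close>-dimensional representation of \<open>G\<^sub>2\<close> on functions on the Engel structure: for a vector with
  components \<open>ys, yt, zp, z0, zm, wp, wm\<close> these are the two functions defining the marked direction
  \<open>(s : t)\<close> by \<open>s Ys + t Yt = 0\<close>.\<close>

definition Ys :: "real \<Rightarrow> real \<Rightarrow> real \<Rightarrow> real \<Rightarrow> real \<Rightarrow> real \<Rightarrow> real^5 \<Rightarrow> real" where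
  "Ys ys zp z0 zm wp wm x = ys - zm * x $ 2 + z0 * x $ 3 - zp * x $ 4 + wm * (x $ 0 - x $ 2 * x $ 3)
     + wp * ((x $ 3)^2 - x $ 2 * x $ 4)"

definition Yt :: "real \<Rightarrow> real \<Rightarrow> real \<Rightarrow> real \<Rightarrow> real \<Rightarrow> real \<Rightarrow> real^5 \<Rightarrow> real" where
  "Yt yt zp z0 zm wp wm x = yt + zm * x $ 1 - z0 * x $ 2 + zp * x $ 3 + wm * (x $ 1 * x $ 3 - (x $ 2)^2)
     + wp * (x $ 0 + x $ 1 * x $ 4 - 2 * x $ 2 * x $ 3)"

section \<open>Markings with vanishing invariants\<close>

locale flat_function =
  fixes S :: "(real^5) set" and u :: "real^5 \<Rightarrow> real"
  assumes S: "open S" and u: "smooth_on S u"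
    and vanish: "\<And>n y. n < 7 \<Longrightarrow> y \<in> S \<Longrightarrow>
      invariant (\<lambda>y. sheared_engel (u y) y) (\<lambda>k y. - fd (\<lambda>y. sheared_engel (u y) y) k u y) n y = 0"
begin

definition "w y = sheared_engel (u y) y"

definition "\<theta> k y = - fd w k u y"

text \<open>The derivative that the vanishing of the invariants leaves undetermined; it is treated
  as a further unknown function.\<close>

definition "f = fd w 1 (\<theta> 3)"

lemma se: "local_se S w \<theta>"
  using local_se_sheared_engel[OF S u] unfolding w_def[abs_def] \<theta>_def[abs_def] .

lemma smooth_f: "smooth_on S f"
  unfolding f_def by (intro smooth_intros se_basic[OF se])

context
  fixes y assumes y: "y \<in> S"
begin

lemma inv0: "\<theta> 4 y = 0" "fd w 3 (\<theta> 3) y = 0" "fd w 2 (\<theta> 3) y = - 3 * \<theta> 0 y - 3 * \<theta> 3 y * \<theta> 1 y"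
  "\<theta> 0 y = (\<theta> 2 y ^ 2) / 4 - \<theta> 3 y * \<theta> 1 y" "fd w 2 (\<theta> 2) y = - 2 * f y - 3 * \<theta> 2 y * \<theta> 1 y"
  "fd w 2 (\<theta> 1) y = \<theta> 1 y ^ 2" "fd w 1 (\<theta> 1) y = 0"
proof -
  have v: "invariant w \<theta> n y = 0" if "n < 7" for n
    using vanish[OF that y] unfolding w_def[abs_def] \<theta>_def[abs_def] .
  show "\<theta> 4 y = 0" "fd w 3 (\<theta> 3) y = 0" "fd w 2 (\<theta> 3) y = - 3 * \<theta> 0 y - 3 * \<theta> 3 y * \<theta> 1 y"
    "\<theta> 0 y = (\<theta> 2 y ^ 2) / 4 - \<theta> 3 y * \<theta> 1 y" "fd w 2 (\<theta> 2) y = - 2 * f y - 3 * \<theta> 2 y * \<theta> 1 y"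
    "fd w 2 (\<theta> 1) y = \<theta> 1 y ^ 2" "fd w 1 (\<theta> 1) y = 0"
    using v[of 0] v[of 1] v[of 2] v[of 3] v[of 4] v[of 5] v[of 6] by (simp_all add: invariant_def f_def)
qed

end

lemma closure:
  assumes y: "y \<in> S"
  shows "fd w 1 (\<theta> 3) y = f y" "fd w 2 (\<theta> 3) y = - 3 / 4 * \<theta> 2 y ^ 2" "fd w 3 (\<theta> 3) y = 0" "fd w 4 (\<theta> 3) y = \<theta> 3 y ^ 2"
    "fd w 1 (\<theta> 2) y = - 2 * \<theta> 1 y ^ 2" "fd w 2 (\<theta> 2) y = - 2 * f y - 3 * \<theta> 2 y * \<theta> 1 y"
    "fd w 3 (\<theta> 2) y = \<theta> 2 y ^ 2 / 2" "fd w 4 (\<theta> 2) y = \<theta> 3 y * \<theta> 2 y"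
    "fd w 1 (\<theta> 1) y = 0" "fd w 2 (\<theta> 1) y = \<theta> 1 y ^ 2" "fd w 3 (\<theta> 1) y = f y + 2 * \<theta> 2 y * \<theta> 1 y"
    "fd w 4 (\<theta> 1) y = \<theta> 2 y ^ 2 / 4"
  using se_closure[OF se inv0(1) y] inv0[OF y] by (simp_all add: f_def)

lemma fd_theta_0:
  assumes y: "y \<in> S"
  shows "fd w k (\<theta> 0) y = \<theta> 2 y * fd w k (\<theta> 2) y / 2 - \<theta> 3 y * fd w k (\<theta> 1) y - fd w k (\<theta> 3) y * \<theta> 1 y"
proof -
  have "fd w k (\<theta> 0) y = fd w k (\<lambda>z. (1/4) * \<theta> 2 z ^ 2 - \<theta> 3 z * \<theta> 1 z) y"
    by (rule fd_cong[OF S y]) (simp add: inv0(4))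
  also have "\<dots> = \<theta> 2 y * fd w k (\<theta> 2) y / 2 - \<theta> 3 y * fd w k (\<theta> 1) y - fd w k (\<theta> 3) y * \<theta> 1 y"
    using se_basic(4)[OF se]
    by (simp add: fd_diff[where S = S] fd_mult[where S = S] fd_divide_const[where S = S] fd_power[where S = S] y
       smooth_intros S)
  finally show ?thesis .
qed

text \<open>M = P = 0 makes \<theta>_0 a quadratic polynomial in \<theta>_1, \<theta>_2, \<theta>_3.
  Differentiating it and comparing with d\<theta> = 0 yields the derivatives along e_0.\<close>

lemma fd_0:
  assumes y: "y \<in> S"
  shows "fd w 0 (\<theta> 1) y = - (\<theta> 2 y * \<theta> 1 y ^ 2) - f y * \<theta> 1 y"
    "fd w 0 (\<theta> 3) y = - (\<theta> 2 y ^ 3 / 4) - \<theta> 3 y * f y"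
    "fd w 0 (\<theta> 2) y = - (\<theta> 2 y * f y) - 3 / 2 * \<theta> 2 y ^ 2 * \<theta> 1 y + 2 * \<theta> 3 y * \<theta> 1 y ^ 2"
  using se_closure(8-10)[OF se inv0(1) y] inv0(4)[OF y] fd_theta_0[OF y, of 1] fd_theta_0[OF y, of 2] fd_theta_0[OF y, of 3]
    closure[OF y]
  by (simp_all add: field_simps power2_eq_square power3_eq_cube)

text \<open>Prolongation: [e_1, e_3] on \<theta>_1, then [e_1, e_2], [e_1, e_3], [e_1, e_4] on
  \<theta>_3 give the derivatives of f along e_1, ..., e_4, and [e_1, e_4] on f gives the one along
  e_0. Thereby the system is closed.\<close>

lemma fd_f:
  assumes y: "y \<in> S"
  shows "fd w 1 f y = 2 * \<theta> 1 y ^ 3" "fd w 2 f y = 3 * \<theta> 1 y * f y + 3 * \<theta> 2 y * \<theta> 1 y ^ 2"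
    "fd w 3 f y = - 3 / 2 * \<theta> 2 y ^ 2 * \<theta> 1 y" "fd w 4 f y = \<theta> 3 y * f y - \<theta> 2 y ^ 3 / 4"
    "fd w 0 f y = - (f y ^ 2) - 2 * \<theta> 3 y * \<theta> 1 y ^ 3 + 3 / 2 * \<theta> 2 y ^ 2 * \<theta> 1 y ^ 2"
proof -
  note sm = se_basic(4)[OF se]
  note rules = fd_add[where S = S] fd_diff[where S = S] fd_minus[where S = S] fd_mult[where S = S] fd_divide_const[where S = S] fd_power[where S = S]
    smooth_intros S sm smooth_f
  note sc = struct_coeff_def kron_def sum_5
  note comm = se_commutator[OF se]
  have c3: "fd w k (fd w 3 (\<theta> 1)) z = fd w k (\<lambda>y. f y + 2 * (\<theta> 2 y * \<theta> 1 y)) z" if "z \<in> S" for k z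
    by (rule fd_cong[OF S that]) (simp add: closure)
  have c1: "fd w k (fd w 1 (\<theta> 1)) z = 0" if "z \<in> S" for k z
    using fd_cong[OF S that, of "fd w 1 (\<theta> 1)" "\<lambda>_. 0"] by (simp add: closure)
  have f1: "fd w 1 f z = 2 * \<theta> 1 z ^ 3" if z: "z \<in> S" for z
    using comm[OF z sm[of 1], of 1 3] c3[OF z, of 1] c1[OF z, of 3]
    by (simp add: rules z sc closure[OF z] power2_eq_square power3_eq_cube)
  show "fd w 1 f y = 2 * \<theta> 1 y ^ 3" by (rule f1[OF y])
  have a2: "fd w k (fd w 2 (\<theta> 3)) z = fd w k (\<lambda>y. - 3 / 4 * (\<theta> 2 y ^ 2)) z" if "z \<in> S" for k z
    by (rule fd_cong[OF S that]) (simp add: closure)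
  have a3: "fd w k (fd w 3 (\<theta> 3)) z = 0" if "z \<in> S" for k z
    using fd_cong[OF S that, of "fd w 3 (\<theta> 3)" "\<lambda>_. 0"] by (simp add: closure)
  have a4: "fd w k (fd w 4 (\<theta> 3)) z = fd w k (\<lambda>y. \<theta> 3 y ^ 2) z" if "z \<in> S" for k z
    by (rule fd_cong[OF S that]) (simp add: closure)
  show "fd w 2 f y = 3 * \<theta> 1 y * f y + 3 * \<theta> 2 y * \<theta> 1 y ^ 2"
    using comm[OF y sm[of 3], of 1 2] a2[OF y, of 1]
    by (simp add: f_def[symmetric] rules y sc closure[OF y] power2_eq_square power3_eq_cube algebra_simps)
  show "fd w 3 f y = - 3 / 2 * \<theta> 2 y ^ 2 * \<theta> 1 y"
    using comm[OF y sm[of 3], of 1 3] a3[OF y, of 1]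
    by (simp add: f_def[symmetric] rules y sc closure[OF y] power2_eq_square power3_eq_cube field_simps)
  have f4: "fd w 4 f z = \<theta> 3 z * f z - \<theta> 2 z ^ 3 / 4" if z: "z \<in> S" for z
    using comm[OF z sm[of 3], of 1 4] a4[OF z, of 1] fd_0[OF z]
    by (simp add: f_def[symmetric] rules z sc closure[OF z] power2_eq_square power3_eq_cube field_simps)
  show "fd w 4 f y = \<theta> 3 y * f y - \<theta> 2 y ^ 3 / 4" by (rule f4[OF y])
  have g4: "fd w k (fd w 4 f) y = fd w k (\<lambda>y. \<theta> 3 y * f y - (1/4) * (\<theta> 2 y ^ 3)) y" for k
    by (rule fd_cong[OF S y]) (simp add: f4)
  have g1: "fd w k (fd w 1 f) y = fd w k (\<lambda>y. 2 * (\<theta> 1 y ^ 3)) y" for k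
    by (rule fd_cong[OF S y]) (simp add: f1)
  have f3: "fd w 3 f y = - 3 / 2 * \<theta> 2 y ^ 2 * \<theta> 1 y" by fact
  show "fd w 0 f y = - (f y ^ 2) - 2 * \<theta> 3 y * \<theta> 1 y ^ 3 + 3 / 2 * \<theta> 2 y ^ 2 * \<theta> 1 y ^ 2"
    using comm[OF y smooth_f, of 1 4] g4[of 1] g1[of 4] f3 f1[OF y]
    by (simp add: rules y sc closure[OF y] field_simps power2_eq_square power3_eq_cube)
qed

end

context flat_function
begin

text \<open>\<open>zp\<close>, \<open>z0\<close>, \<open>zm\<close> are \<theta>_3, \<theta>_2,
  \<theta>_1 with the shear by u undone, up to sign; \<open>wm\<close> and \<open>wp\<close> involve
  f and \<theta>_0. The letters follow the splitting of the seven components into a doublet Y, a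
  triplet Z and a doublet W.\<close>

definition "zm = \<theta> 1"

definition "z0 y = 2 * u y * \<theta> 1 y - \<theta> 2 y"

definition "zp y = \<theta> 3 y - \<theta> 2 y * u y + \<theta> 1 y * u y ^ 2"

definition "wm y = f y + \<theta> 2 y * \<theta> 1 y"

definition "wp y = \<theta> 0 y - u y * wm y"

text \<open>The prefix n marks components carried from the point y to the origin; the multiples of
  \<open>wm\<close> and \<open>wp\<close> compensate for the translation.\<close>

definition "nzp y = zp y - wm y * y $ 1 - wp y * y $ 2"

definition "nz0 y = z0 y - 2 * wm y * y $ 2 - 2 * wp y * y $ 3"

definition "nzm y = zm y - wm y * y $ 3 - wp y * y $ 4"

text \<open>\<open>nt\<close> and \<open>ns\<close> solve Yt = - u and Ys = 1 at y for the constant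
  terms, so that the vector describes the marked direction (u : 1).\<close>

definition "nt y = - u y - (nzm y * y $ 1 - nz0 y * y $ 2 + nzp y * y $ 3 + wm y * (y $ 1 * y $ 3 - (y $ 2)^2)
  + wp y * (y $ 0 + y $ 1 * y $ 4 - 2 * y $ 2 * y $ 3))"

definition "ns y = 1 + nzm y * y $ 2 - nz0 y * y $ 3 + nzp y * y $ 4 - wm y * (y $ 0 - y $ 2 * y $ 3)
  - wp y * ((y $ 3)^2 - y $ 2 * y $ 4)"

text \<open>The common negative logarithmic derivative of all seven components along the frame
  vector k.\<close>

definition "weight k y = row5 (wm y) 0 (- \<theta> 1 y) (- \<theta> 2 y) (- \<theta> 3 y) $ k"

lemma smooth_coord: "smooth_on S (\<lambda>y. y $ i)"
  by (intro smooth_intros S)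

lemma fd_coord: "fd w k (\<lambda>y. y $ i) y = sheared_dual (u y) y k $ i"
  proof -
  have "((\<lambda>y::real^5. y $ i) has_derivative (\<lambda>v. v $ i)) (at y)"
    by (rule bounded_linear_imp_has_derivative[OF bounded_linear_vec_nth])
  from fd_eqI[OF this, of w k] show ?thesis by (simp add: w_def dual_sheared_engel)
qed

lemmas smooth_rules = S smooth_intros smooth_coord smooth_f u se_basic(4)[OF se]

lemma smooth_n: "smooth_on S zm" "smooth_on S z0" "smooth_on S zp" "smooth_on S wm" "smooth_on S wp"
proof -
  show 1: "smooth_on S zm" unfolding zm_def by (intro smooth_rules)
  show 2: "smooth_on S z0" unfolding z0_def[abs_def] by (intro smooth_rules)
  show 3: "smooth_on S zp" unfolding zp_def[abs_def] by (intro smooth_rules)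
  show 4: "smooth_on S wm" unfolding wm_def[abs_def] by (intro smooth_rules)
  show 5: "smooth_on S wp" unfolding wp_def[abs_def] by (intro smooth_rules 4)
qed

lemma smooth_n': "smooth_on S nzp" "smooth_on S nz0" "smooth_on S nzm" "smooth_on S nt" "smooth_on S ns"
proof -
  show 1: "smooth_on S nzp" unfolding nzp_def[abs_def] by (intro smooth_rules smooth_n)
  show 2: "smooth_on S nz0" unfolding nz0_def[abs_def] by (intro smooth_rules smooth_n)
  show 3: "smooth_on S nzm" unfolding nzm_def[abs_def] by (intro smooth_rules smooth_n)
  show 4: "smooth_on S nt" unfolding nt_def[abs_def] by (intro smooth_rules smooth_n 1 2 3)
  show 5: "smooth_on S ns" unfolding ns_def[abs_def] by (intro smooth_rules smooth_n 1 2 3)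
qed

text \<open>A direct check from the closed system. The dependence on the coordinates built into the
  components is such that all inhomogeneous terms cancel.\<close>

lemma fd_n:
  assumes y: "y \<in> S"
  shows "fd w k wm y = - weight k y * wm y" "fd w k wp y = - weight k y * wp y"
    "fd w k nzp y = - weight k y * nzp y" "fd w k nz0 y = - weight k y * nz0 y"
    "fd w k nzm y = - weight k y * nzm y" "fd w k nt y = - weight k y * nt y" "fd w k ns y = - weight k y * ns y"
proof -
  note rules = fd_add[where S = S] fd_diff[where S = S] fd_minus[where S = S] fd_mult[where S = S] fd_power[where S = S]
    smooth_rules smooth_n smooth_n' y
  have fu: "fd w k u y = - \<theta> k y" for k by (simp add: \<theta>_def)
  note fds = fu closure[OF y] fd_0[OF y] fd_f[OF y] fd_theta_0[OF y] inv0[OF y]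
  have f0: "fd w 0 (\<theta> 0) y = \<theta> 2 y * fd w 0 (\<theta> 2) y / 2 - \<theta> 3 y * fd w 0 (\<theta> 1) y - fd w 0 (\<theta> 3) y * \<theta> 1 y"
    by (rule fd_theta_0[OF y])
  note e = exhaust_5[of k]
  have wm: "fd w k wm y = - weight k y * wm y" for k
    unfolding wm_def[abs_def] weight_def using exhaust_5[of k]
    by (elim disjE; simp add: rules fds; simp add: wm_def field_simps power2_eq_square power3_eq_cube)
  then show "fd w k wm y = - weight k y * wm y" .
  have wp: "fd w k wp y = - weight k y * wp y" for k
    unfolding wp_def[abs_def] weight_def using exhaust_5[of k]
    by (elim disjE; simp add: rules fds wm; simp add: weight_def wm_def field_simps power2_eq_square power3_eq_cube)
  then show "fd w k wp y = - weight k y * wp y" .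
  note c = fd_coord sheared_dual_def
  have zp: "fd w k nzp y = - weight k y * nzp y" for k
    unfolding nzp_def[abs_def] zp_def[abs_def] weight_def using exhaust_5[of k]
    by (elim disjE; simp add: rules fds wm wp c; simp add: weight_def wp_def wm_def inv0[OF y] field_simps power2_eq_square power3_eq_cube)
  then show "fd w k nzp y = - weight k y * nzp y" .
  have z0: "fd w k nz0 y = - weight k y * nz0 y" for k
    unfolding nz0_def[abs_def] z0_def[abs_def] weight_def using exhaust_5[of k]
    by (elim disjE; simp add: rules fds wm wp c; simp add: weight_def wp_def wm_def inv0[OF y] field_simps power2_eq_square power3_eq_cube)
  then show "fd w k nz0 y = - weight k y * nz0 y" .
  have zm: "fd w k nzm y = - weight k y * nzm y" for k
    unfolding nzm_def[abs_def] zm_def weight_def using exhaust_5[of k]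
    by (elim disjE; simp add: rules fds wm wp c; simp add: weight_def wp_def wm_def inv0[OF y] field_simps power2_eq_square power3_eq_cube)
  then show "fd w k nzm y = - weight k y * nzm y" .
  show "fd w k nt y = - weight k y * nt y"
    unfolding nt_def[abs_def] using e
    by (elim disjE; simp add: rules fu inv0[OF y] wm wp zp z0 zm c; simp add: nzp_def nz0_def nzm_def zp_def z0_def zm_def weight_def wp_def wm_def inv0[OF y] field_simps power2_eq_square power3_eq_cube)
  show "fd w k ns y = - weight k y * ns y"
    unfolding ns_def[abs_def] using e
    by (elim disjE; simp add: rules fu inv0[OF y] wm wp zp z0 zm c; simp add: nzp_def nz0_def nzm_def zp_def z0_def zm_def weight_def wp_def wm_def inv0[OF y] field_simps power2_eq_square power3_eq_cube)
qed

text \<open>All components of the vector \<open>n\<close> satisfy the same first order equations, so that their ratios are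
  constant.\<close>

lemma fd_ratio_zero:
  assumes y: "y \<in> S" "ns y \<noteq> 0" and F: "smooth_on S F" "\<And>k. fd w k F y = - weight k y * F y"
  shows "((\<lambda>y. F y / ns y) has_derivative (\<lambda>v. 0)) (at y)"
proof -
  let ?F = "fder F y" and ?N = "fder ns y"
  have "invertible (w y)" by (simp add: w_def invertible_sheared_engel)
  note sum = sum_fd[where w = w and F = F, OF F(1) y(1) this, symmetric]
    sum_fd[where w = w and F = ns, OF smooth_n'(5) y(1) this, symmetric]
  define W where "W v = (\<Sum>k\<in>UNIV. weight k y * (w y $ k \<bullet> v))" for v
  have d: "?F v = - W v * F y" "?N v = - W v * ns y" for v
    unfolding sum F(2) fd_n(7)[OF y(1)] W_def
    by (simp_all add: sum_distrib_left sum_distrib_right sum_negf[symmetric] ac_simps)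
  have "((\<lambda>y. F y / ns y) has_derivative
      (\<lambda>v. - F y * (inverse (ns y) * ?N v * inverse (ns y)) + ?F v / ns y)) (at y)"
    by (rule has_derivative_divide[OF smooth_on_derivative[OF F(1) y(1)] smooth_on_derivative[OF smooth_n'(5) y(1)] y(2)])
  moreover have "- F y * (inverse (ns y) * ?N v * inverse (ns y)) + ?F v / ns y = 0" for v
    unfolding d using y(2) by (simp add: field_simps)
  ultimately show ?thesis by simp
qed

text \<open>At the origin \<open>ns\<close> is 1 and \<open>nt\<close> is 0 because u vanishes
  there, so the constant ratios are the values of the components at 0. The value of
  \<open>wp\<close> in terms of the others is the null condition.\<close>

lemma flat_function_form:
  assumes 0: "0 \<in> S" "u 0 = 0"
  shows "\<exists>r>0. \<exists>zp z0 zm wm. ball 0 r \<subseteq> S \<and>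
    (\<forall>y\<in>ball 0 r. u y * Ys 1 zp z0 zm ((z0^2 - 4 * zp * zm) / 4) wm y + Yt 0 zp z0 zm ((z0^2 - 4 * zp * zm) / 4) wm y = 0)"
proof -
  have "ns 0 = 1" by (simp add: ns_def)
  have "isCont ns 0"
    using smooth_on_continuous[OF smooth_n'(5)] S 0 by (simp add: continuous_on_eq_continuous_at)
  then obtain d where d: "d > 0" "\<And>y. dist y 0 < d \<Longrightarrow> dist (ns y) (ns 0) < 1"
    unfolding continuous_at_eps_delta by (metis zero_less_one)
  obtain e where e: "e > 0" "ball 0 e \<subseteq> S" using S 0 open_contains_ball by blast
  define r where "r = min d e"
  have r: "r > 0" "ball 0 r \<subseteq> S" using d e by (auto simp: r_def)
  have nz: "ns y \<noteq> 0" if "y \<in> ball 0 r" for y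
    using d(2)[of y] that \<open>ns 0 = 1\<close> by (auto simp: r_def dist_commute dist_real_def)
  have const: "F y = F 0 * ns y" if F: "smooth_on S F" "\<And>k y. y \<in> S \<Longrightarrow> fd w k F y = - weight k y * F y" and y: "y \<in> ball 0 r" for F y
  proof -
    have "\<exists>c. \<forall>y\<in>ball 0 r. F y / ns y = c"
    proof (rule has_derivative_zero_constant)
      fix x :: "real^5" assume x: "x \<in> ball 0 r"
      then have "((\<lambda>y. F y / ns y) has_derivative (\<lambda>v. 0)) (at x)"
        using r nz F by (intro fd_ratio_zero) auto
      then show "((\<lambda>y. F y / ns y) has_derivative (\<lambda>v. 0)) (at x within ball 0 r)"
        by (rule has_derivative_at_withinI)
    qed simp
    then obtain c where c: "\<And>y. y \<in> ball 0 r \<Longrightarrow> F y / ns y = c" by blast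
    have "F 0 = c" using c[of 0] r \<open>ns 0 = 1\<close> by simp
    then show ?thesis using c[OF y] nz[OF y] by (simp add: field_simps)
  qed
  have null: "wp 0 = ((nz0 0)^2 - 4 * nzp 0 * nzm 0) / 4"
    using inv0(4)[OF 0(1)] 0(2) by (simp add: wp_def nz0_def nzp_def nzm_def z0_def zp_def zm_def field_simps)
  have nt0: "nt 0 = 0" using 0(2) by (simp add: nt_def)
  have "u y * Ys 1 (nzp 0) (nz0 0) (nzm 0) (wp 0) (wm 0) y + Yt 0 (nzp 0) (nz0 0) (nzm 0) (wp 0) (wm 0) y = 0"
    if y: "y \<in> ball 0 r" for y
  proof -
    note c = const[OF smooth_n'(1) fd_n(3) y] const[OF smooth_n'(2) fd_n(4) y] const[OF smooth_n'(3) fd_n(5) y]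
      const[OF smooth_n'(4) fd_n(6) y] const[OF smooth_n(4) fd_n(1) y] const[OF smooth_n(5) fd_n(2) y]
    have "1 = Ys (ns y) (nzp y) (nz0 y) (nzm y) (wp y) (wm y) y"
      by (simp add: Ys_def ns_def algebra_simps)
    then have 1: "ns y * Ys 1 (nzp 0) (nz0 0) (nzm 0) (wp 0) (wm 0) y = 1"
      using c unfolding Ys_def by algebra
    have "- u y = Yt (nt y) (nzp y) (nz0 y) (nzm y) (wp y) (wm y) y"
      by (simp add: Yt_def nt_def algebra_simps)
    then have 2: "ns y * Yt 0 (nzp 0) (nz0 0) (nzm 0) (wp 0) (wm 0) y = - u y"
      using c nt0 unfolding Yt_def by algebra
    have "ns y * (u y * Ys 1 (nzp 0) (nz0 0) (nzm 0) (wp 0) (wm 0) y + Yt 0 (nzp 0) (nz0 0) (nzm 0) (wp 0) (wm 0) y) = 0"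
      using 1 2 by algebra
    then show ?thesis using nz[OF y] by simp
  qed
  then show ?thesis unfolding null using r by blast
qed

end

section \<open>Engel charts\<close>

text \<open>H acts on the parameters (x, y) of the cubic by an invertible 2x2 matrix, up to the
  scale c, and scales the contact component.\<close>

definition cone_map :: "real^5^5 \<Rightarrow> real \<Rightarrow> real \<Rightarrow> real \<Rightarrow> real \<Rightarrow> bool" where
  "cone_map H a11 a12 a21 a22 \<longleftrightarrow> invertible H \<and> H $ 0 $ 0 \<noteq> 0 \<and> (\<forall>z. (H *v z) $ 0 = H $ 0 $ 0 * z $ 0) \<and>
     a11 * a22 - a12 * a21 \<noteq> 0 \<and>
     (\<exists>c. c \<noteq> 0 \<and> (\<forall>k x y. H *v cone_point k x y = cone_point (c * k) (a11 * x + a12 * y) (a21 * x + a22 * y)))"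

definition cone_line :: "real^5^5 \<Rightarrow> real \<Rightarrow> real \<Rightarrow> (real^5) set" where
  "cone_line w x y = {v. \<exists>k. w *v v = cone_point k x y}"

lemma cone_map_inj: "cone_map H a11 a12 a21 a22 \<Longrightarrow> H *v z = H *v z' \<Longrightarrow> z = z'"
  unfolding cone_map_def invertible_def by (metis matrix_vector_mul_assoc matrix_vector_mul_lid)

lemma adapted_cubic_cone_map:
  assumes w: "adapted_cubic w C G" and H: "cone_map H a11 a12 a21 a22"
  shows "adapted_cubic (H ** w) C G"
proof -
  define d where "d = a11 * a22 - a12 * a21"
  obtain c where c: "c \<noteq> 0" "\<And>k x y. H *v cone_point k x y = cone_point (c * k) (a11 * x + a12 * y) (a21 * x + a22 * y)"
    and d: "d \<noteq> 0" and H0: "H $ 0 $ 0 \<noteq> 0" "\<And>z. (H *v z) $ 0 = H $ 0 $ 0 * z $ 0"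
    using H unfolding cone_map_def d_def by blast
  have "(\<exists>k x y. z = cone_point k x y) \<longleftrightarrow> (\<exists>k x y. H *v z = cone_point k x y)" for z
  proof
    assume "\<exists>k x y. H *v z = cone_point k x y"
    then obtain k x y where z: "H *v z = cone_point k x y" by blast
    \<comment> \<open>The preimage of a point of the cone is found with the adjugate of the 2x2
      matrix.\<close>
    have "H *v cone_point (k / c) ((a22 * x - a12 * y) / d) ((a11 * y - a21 * x) / d) = cone_point k x y"
    proof -
      have "a11 * ((a22 * x - a12 * y) / d) + a12 * ((a11 * y - a21 * x) / d) = x * (a11 * a22 - a12 * a21) / d"
        "a21 * ((a22 * x - a12 * y) / d) + a22 * ((a11 * y - a21 * x) / d) = y * (a11 * a22 - a12 * a21) / d"
        by (simp_all add: add_divide_distrib[symmetric] algebra_simps)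
      then show ?thesis using c(1) d by (simp add: c(2) d_def[symmetric])
    qed
    then show "\<exists>k x y. z = cone_point k x y" using cone_map_inj[OF H] z by metis
  qed (use c(2) in blast)
  then show ?thesis
    using w H0 unfolding adapted_cubic_iff by (simp add: matrix_vector_mul_assoc[symmetric])
qed

lemma cone_line_cone_map:
  assumes H: "cone_map H a11 a12 a21 a22"
  shows "cone_line (H ** w) (a11 * x + a12 * y) (a21 * x + a22 * y) = cone_line w x y"
proof -
  obtain c where c: "c \<noteq> 0" "\<And>k x y. H *v cone_point k x y = cone_point (c * k) (a11 * x + a12 * y) (a21 * x + a22 * y)"
    using H unfolding cone_map_def by blast
  have "(\<exists>k. H *v z = cone_point k (a11 * x + a12 * y) (a21 * x + a22 * y)) \<longleftrightarrow> (\<exists>k. z = cone_point k x y)" for z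
  proof
    assume "\<exists>k. H *v z = cone_point k (a11 * x + a12 * y) (a21 * x + a22 * y)"
    then obtain k where "H *v z = cone_point k (a11 * x + a12 * y) (a21 * x + a22 * y)" by blast
    then have "H *v z = H *v cone_point (k / c) x y" using c by simp
    then show "\<exists>k. z = cone_point k x y" using cone_map_inj[OF H] by blast
  qed (use c in auto)
  then show ?thesis by (simp add: cone_line_def matrix_vector_mul_assoc[symmetric])
qed

lemma image_invertible:
  fixes J :: "real^'n^'n"
  assumes "invertible J"
  shows "(\<lambda>v. J *v v) ` {v. P (w ** J *v v)} = {v. P (w *v v)}"
proof -
  obtain K where K: "J ** K = mat 1" using assms unfolding invertible_def by blast
  have "J *v (K *v v) = v" for v by (simp add: matrix_vector_mul_assoc K)
  then show ?thesis by (auto simp: matrix_vector_mul_assoc[symmetric] image_iff) metis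
qed

lemma adapted_cubic_image:
  assumes "invertible J" "adapted_cubic (w ** J) C G"
  shows "adapted_cubic w ((\<lambda>v. J *v v) ` C) ((\<lambda>v. J *v v) ` G)"
  using assms(2) image_invertible[OF assms(1), of "\<lambda>z. z $ 0 = 0" w]
    image_invertible[OF assms(1), of "\<lambda>z. \<exists>k x y. z = cone_point k x y" w]
  unfolding adapted_cubic_iff by simp

lemma cone_line_image:
  assumes "invertible J"
  shows "(\<lambda>v. J *v v) ` cone_line (w ** J) x y = cone_line w x y"
  using image_invertible[OF assms, of "\<lambda>z. \<exists>k. z = cone_point k x y" w] by (simp add: cone_line_def)

definition diffeo_pair :: "(real^5 \<Rightarrow> real^5) \<Rightarrow> (real^5 \<Rightarrow> real^5) \<Rightarrow> (real^5) set \<Rightarrow> (real^5) set \<Rightarrow> bool" where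
  "diffeo_pair F F' D E \<longleftrightarrow> open D \<and> open E \<and> smooth_on D F \<and> smooth_on E F' \<and>
     (\<forall>x\<in>D. F x \<in> E \<and> F' (F x) = x) \<and> (\<forall>y\<in>E. F' y \<in> D \<and> F (F' y) = y)"

text \<open>F pulls the Engel coframe back to H times itself, with H preserving the cone: a local
  automorphism of the Engel structure, together with its action on the parameters of marks.\<close>

definition engel_map :: "(real^5 \<Rightarrow> real^5) \<Rightarrow> (real^5 \<Rightarrow> real^5^5) \<Rightarrow> (real^5) set \<Rightarrow>
  (real^5 \<Rightarrow> real) \<Rightarrow> (real^5 \<Rightarrow> real) \<Rightarrow> (real^5 \<Rightarrow> real) \<Rightarrow> (real^5 \<Rightarrow> real) \<Rightarrow> bool" where
  "engel_map F H D a11 a12 a21 a22 \<longleftrightarrow> (\<forall>x\<in>D.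
     engel_coframe (F x) ** jacobian F (at x) = H x ** engel_coframe x \<and> cone_map (H x) (a11 x) (a12 x) (a21 x) (a22 x))"

lemma invertible_engel: "invertible (engel_coframe x)"
  using invertible_sheared_engel[of 0 x] by (simp add: sheared_engel_0)

context five_manifold
begin

text \<open>A chart followed by a diffeomorphism between open subsets of the coordinate space is
  compatible with every member of the atlas, hence belongs to it by maximality.\<close>

lemma new_chart:
  assumes \<kappa>: "\<kappa> \<in> A" and F: "diffeo_pair F F' D0 E0"
  defines "D \<equiv> {q \<in> cdom \<kappa>. coord \<kappa> q \<in> D0}"
  defines "\<kappa>' \<equiv> Chart D (\<lambda>q. F (coord \<kappa> q))"
  shows "\<kappa>' \<in> A" "cdom \<kappa>' = D" "\<And>q. q \<in> D \<Longrightarrow> tangent_map \<kappa> \<kappa>' id q = jacobian F (at (coord \<kappa> q))"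
proof -
  note ch = chart[OF \<kappa>]
  have F1: "open D0" "open E0" "smooth_on D0 F" "smooth_on E0 F'"
    and F2: "\<And>x. x \<in> D0 \<Longrightarrow> F x \<in> E0" "\<And>x. x \<in> D0 \<Longrightarrow> F' (F x) = x"
    "\<And>y. y \<in> E0 \<Longrightarrow> F' y \<in> D0" "\<And>y. y \<in> E0 \<Longrightarrow> F (F' y) = y"
    using F by (auto simp: diffeo_pair_def)
  have "D = cdom \<kappa> \<inter> coord \<kappa> -` D0" by (auto simp: D_def)
  then have D: "open D" "D \<subseteq> cdom \<kappa>" using continuous_open_preimage[OF ch(4,1) F1(1)] by auto
  have im: "coord \<kappa>' ` X = {e \<in> E0. F' e \<in> coord \<kappa> ` X}" if "X \<subseteq> D" for X
    using that F2 by (auto simp: \<kappa>'_def D_def image_iff subset_iff) metis+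
  have imo: "open (coord \<kappa>' ` X)" if X: "open X" "X \<subseteq> D" for X
  proof -
    have "coord \<kappa>' ` X = E0 \<inter> F' -` (coord \<kappa> ` X)" using im[OF X(2)] by auto
    moreover have "open (coord \<kappa> ` X)" using chart_image_open[OF \<kappa> X(1)] X(2) D(2) by blast
    ultimately show ?thesis
      using continuous_open_preimage[OF smooth_on_continuous[OF F1(4)] F1(2)] by simp
  qed
  have inj: "inj_on (coord \<kappa>') D"
  proof (rule inj_onI)
    fix x y assume "x \<in> D" "y \<in> D" "coord \<kappa>' x = coord \<kappa>' y"
    then have "coord \<kappa> x = coord \<kappa> y" using F2(2) by (metis (mono_tags, lifting) D_def \<kappa>'_def chart.sel(2) mem_Collect_eq)
    then show "x = y" using ch(6) \<open>x \<in> D\<close> \<open>y \<in> D\<close> D(2) by (metis subsetD)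
  qed
  have c': "cdom \<kappa>' = D" by (simp add: \<kappa>'_def)
  have ic: "icoord \<kappa>' (coord \<kappa>' q) = q" if "q \<in> D" for q
    using inv_into_f_f[OF inj that] by (simp add: icoord_def c')
  have ic': "icoord \<kappa>' e = icoord \<kappa> (F' e)" if e: "e \<in> coord \<kappa>' ` D" for e
  proof -
    obtain q where q: "q \<in> D" "e = coord \<kappa>' q" using e by blast
    then have "F' e = coord \<kappa> q" using F2(2) by (simp add: \<kappa>'_def D_def)
    then show ?thesis using q ic ch(6) D(2) by auto
  qed
  have cont: "continuous_on D (coord \<kappa>')"
  proof -
    have "continuous_on D (\<lambda>q. F (coord \<kappa> q))"
      by (rule continuous_on_compose2[OF smooth_on_continuous[OF F1(3)] continuous_on_subset[OF ch(4) D(2)]])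
        (auto simp: D_def)
    then show ?thesis by (simp add: \<kappa>'_def)
  qed
  have cont': "continuous_on (coord \<kappa>' ` D) (icoord \<kappa>')"
  proof -
    have "continuous_on (coord \<kappa>' ` D) (\<lambda>e. icoord \<kappa> (F' e))"
      by (rule continuous_on_compose2[OF ch(5) continuous_on_subset[OF smooth_on_continuous[OF F1(4)]]])
        (use im[of D] D(2) in auto)
    then show ?thesis using ic' by (simp cong: continuous_on_cong)
  qed
  have "homeomorphism D (coord \<kappa>' ` D) (coord \<kappa>') (icoord \<kappa>')"
    unfolding homeomorphism_def using cont cont' ic by (auto simp: image_image)
  then have isch: "is_chart \<kappa>'" unfolding is_chart_def c' using D(1) imo[OF D(1)] by simp
  have comp: "compatible \<kappa>' \<mu>" if \<mu>: "\<mu> \<in> A" for \<mu>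
    unfolding compatible_def c'
  proof
    let ?X = "D \<inter> cdom \<mu>"
    note ch' = chart[OF \<mu>]
    have X: "open ?X" "?X \<subseteq> D" using D ch'(1) by auto
    have o1: "open (coord \<kappa>' ` ?X)" by (rule imo[OF X])
    have o2: "open (coord \<kappa> ` ?X)" by (rule chart_image_open[OF \<kappa> X(1)]) (use D in auto)
    have o3: "open (coord \<mu> ` ?X)" by (rule chart_image_open[OF \<mu> X(1)]) auto
    have "smooth_on (coord \<kappa>' ` ?X) (\<lambda>e. coord \<mu> (icoord \<kappa> (F' e)))"
    proof (rule smooth_on_compose[where f = F' and g = "\<lambda>y. coord \<mu> (icoord \<kappa> y)", OF o1 o2])
      show "F' ` coord \<kappa>' ` ?X \<subseteq> coord \<kappa> ` ?X" using im[OF X(2)] by auto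
      show "smooth_on (coord \<kappa>' ` ?X) F'" by (rule smooth_on_subset[OF F1(4)]) (use im[OF X(2)] in auto)
      show "smooth_on (coord \<kappa> ` ?X) (\<lambda>y. coord \<mu> (icoord \<kappa> y))"
        by (rule smooth_on_subset[OF chart_transition[OF \<kappa> \<mu>]]) (use D in auto)
    qed
    then show "smooth_on (coord \<kappa>' ` ?X) (coord \<mu> \<circ> icoord \<kappa>')"
      by (rule smooth_on_congI[OF o1]) (use ic' in auto)
    have "smooth_on (coord \<mu> ` ?X) (\<lambda>y. F (coord \<kappa> (icoord \<mu> y)))"
    proof (rule smooth_on_compose[where f = "\<lambda>y. coord \<kappa> (icoord \<mu> y)" and g = F, OF o3 F1(1)])
      show "(\<lambda>y. coord \<kappa> (icoord \<mu> y)) ` coord \<mu> ` ?X \<subseteq> D0" using ch'(6) by (auto simp: D_def)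
      show "smooth_on (coord \<mu> ` ?X) (\<lambda>y. coord \<kappa> (icoord \<mu> y))"
        by (rule smooth_on_subset[OF chart_transition[OF \<mu> \<kappa>]]) (use D in auto)
    qed (rule F1)
    then show "smooth_on (coord \<mu> ` ?X) (coord \<kappa>' \<circ> icoord \<mu>)"
      by (simp add: \<kappa>'_def o_def)
  qed
  have "\<forall>\<kappa>. is_chart \<kappa> \<and> cdom \<kappa> \<subseteq> U \<and> (\<forall>\<mu>\<in>A. compatible \<kappa> \<mu>) \<longrightarrow> \<kappa> \<in> A"
    using manifold unfolding manifold5_def by blast
  then show "\<kappa>' \<in> A" using isch comp D(2) ch(3) c' by blast
  show "cdom \<kappa>' = D" by (rule c')
  show "tangent_map \<kappa> \<kappa>' id q = jacobian F (at (coord \<kappa> q))" if q: "q \<in> D" for q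
  proof -
    have o: "open (coord \<kappa> ` D)" by (rule chart_image_open[OF \<kappa> D])
    have "fder (coord \<kappa>' \<circ> id \<circ> icoord \<kappa>) (coord \<kappa> q) = fder F (coord \<kappa> q)"
      by (rule frechet_derivative_cong_open[OF o]) (use q ch(6) D(2) in \<open>auto simp: \<kappa>'_def subset_iff\<close>)
    then show ?thesis by (simp add: tangent_map_def jacobian_def)
  qed
qed

end

section \<open>Charts in which the cubic has the standard Engel form\<close>

locale twisted_cubic_manifold = five_manifold U A
  for U :: "'p::{t2_space,second_countable_topology} set" and A :: "'p chart set" +
  fixes C G l :: "'p tangent_sets"
  assumes sets: "tangent_sets A C" "tangent_sets A G" "tangent_sets A l"
begin

definition engel_chart :: "'p chart \<Rightarrow> bool" where
  "engel_chart \<kappa> \<longleftrightarrow> \<kappa> \<in> A \<and> (\<forall>q\<in>cdom \<kappa>. adapted_cubic (engel_coframe (coord \<kappa> q)) (C \<kappa> q) (G \<kappa> q))"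

text \<open>Composition with an automorphism of the Engel structure keeps the cubic in standard form
  and changes only the parameters of the mark, by the 2x2 matrix belonging to
  \<open>H\<close>.\<close>

lemma new_engel_chart:
  assumes \<kappa>: "engel_chart \<kappa>" and F: "diffeo_pair F F' D0 E0" "engel_map F H D0 a11 a12 a21 a22"
  shows "\<exists>\<kappa>'. engel_chart \<kappa>' \<and> cdom \<kappa>' = {q \<in> cdom \<kappa>. coord \<kappa> q \<in> D0} \<and>
    (\<forall>q\<in>cdom \<kappa>'. coord \<kappa>' q = F (coord \<kappa> q)) \<and>
    (\<forall>q\<in>cdom \<kappa>'. \<forall>x y. l \<kappa> q = cone_line (engel_coframe (coord \<kappa> q)) x y \<longrightarrow>
       l \<kappa>' q = cone_line (engel_coframe (coord \<kappa>' q))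
         (a11 (coord \<kappa> q) * x + a12 (coord \<kappa> q) * y) (a21 (coord \<kappa> q) * x + a22 (coord \<kappa> q) * y))"
proof -
  define D where "D = {q \<in> cdom \<kappa>. coord \<kappa> q \<in> D0}"
  define \<kappa>' where "\<kappa>' = Chart D (\<lambda>q. F (coord \<kappa> q))"
  have \<kappa>A: "\<kappa> \<in> A" using \<kappa> by (simp add: engel_chart_def)
  note nc = new_chart[OF \<kappa>A F(1), folded D_def, folded \<kappa>'_def]
  have main: "adapted_cubic (engel_coframe (F (coord \<kappa> q))) (C \<kappa>' q) (G \<kappa>' q) \<and>
    (\<forall>x y. l \<kappa> q = cone_line (engel_coframe (coord \<kappa> q)) x y \<longrightarrow>
       l \<kappa>' q = cone_line (engel_coframe (F (coord \<kappa> q)))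
         (a11 (coord \<kappa> q) * x + a12 (coord \<kappa> q) * y) (a21 (coord \<kappa> q) * x + a22 (coord \<kappa> q) * y))" if q: "q \<in> D" for q
  proof -
    let ?x = "coord \<kappa> q"
    let ?J = "jacobian F (at ?x)"
    have q': "q \<in> cdom \<kappa>" "?x \<in> D0" "q \<in> cdom \<kappa> \<inter> cdom \<kappa>'" using q nc(2) by (auto simp: D_def)
    have e: "engel_coframe (F ?x) ** ?J = H ?x ** engel_coframe ?x"
      and cm: "cone_map (H ?x) (a11 ?x) (a12 ?x) (a21 ?x) (a22 ?x)"
      using F(2) q'(2) unfolding engel_map_def by blast+
    have "invertible (H ?x ** engel_coframe ?x)"
      using invertible_mult invertible_engel cm unfolding cone_map_def by blast
    then obtain X where "X ** (engel_coframe (F ?x) ** ?J) = mat 1" unfolding e[symmetric] invertible_def by blast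
    then have J: "invertible ?J" using invertible_left_inverse by (metis matrix_mul_assoc)
    have tr: "Y \<kappa>' q = (\<lambda>v. ?J *v v) ` Y \<kappa> q" if "tangent_sets A Y" for Y
      using that \<kappa>A nc(1) q'(3) nc(3)[OF q] unfolding tangent_sets_def by metis
    have "adapted_cubic (engel_coframe (F ?x) ** ?J) (C \<kappa> q) (G \<kappa> q)"
      unfolding e using adapted_cubic_cone_map[OF _ cm] \<kappa> q'(1) unfolding engel_chart_def by blast
    then have "adapted_cubic (engel_coframe (F ?x)) (C \<kappa>' q) (G \<kappa>' q)"
      unfolding tr[OF sets(1)] tr[OF sets(2)] by (rule adapted_cubic_image[OF J])
    moreover have "l \<kappa>' q = cone_line (engel_coframe (F ?x)) (a11 ?x * x + a12 ?x * y) (a21 ?x * x + a22 ?x * y)"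
      if lq: "l \<kappa> q = cone_line (engel_coframe ?x) x y" for x y
    proof -
      have 1: "l \<kappa> q = cone_line (engel_coframe (F ?x) ** ?J) (a11 ?x * x + a12 ?x * y) (a21 ?x * x + a22 ?x * y)"
        unfolding lq by (simp add: e cone_line_cone_map[OF cm])
      show ?thesis unfolding tr[OF sets(3)] 1 by (rule cone_line_image[OF J])
    qed
    ultimately show ?thesis by blast
  qed
  have c: "coord \<kappa>' q = F (coord \<kappa> q)" for q by (simp add: \<kappa>'_def)
  show ?thesis
    using nc(1,2) main by (intro exI[of _ \<kappa>']) (auto simp: engel_chart_def c D_def)
qed

end

section \<open>Symmetries of the Engel structure used to normalise a marking\<close>

text \<open>Moves c to the origin; the terms added in coordinate 0 absorb the change that the shift
  of x_1 and x_2 causes in the contact form.\<close>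

definition translate :: "real^5 \<Rightarrow> real^5 \<Rightarrow> real^5" where
  "translate c x = row5 (x $ 0 - c $ 0 + c $ 1 * (x $ 4 - c $ 4) - 3 * c $ 2 * (x $ 3 - c $ 3))
     (x $ 1 - c $ 1) (x $ 2 - c $ 2) (x $ 3 - c $ 3) (x $ 4 - c $ 4)"

definition translate_back :: "real^5 \<Rightarrow> real^5 \<Rightarrow> real^5" where
  "translate_back c x = row5 (x $ 0 + c $ 0 - c $ 1 * x $ 4 + 3 * c $ 2 * x $ 3)
     (x $ 1 + c $ 1) (x $ 2 + c $ 2) (x $ 3 + c $ 3) (x $ 4 + c $ 4)"

text \<open>Lifts the map (x : y) to (y : -x) of the cubic to the Engel structure; its fourth power
  is the identity, so its cube serves as inverse.\<close>

definition quarter_turn :: "real^5 \<Rightarrow> real^5" where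
  "quarter_turn x = row5 (x $ 0 + x $ 1 * x $ 4 - 3 * x $ 2 * x $ 3) (x $ 4) (- x $ 3) (x $ 2) (- x $ 1)"

text \<open>Lifts the map (x : y) to (x - k y : y) of the cubic; the quadratic terms in coordinate 0
  restore the contact form.\<close>

definition shear :: "real \<Rightarrow> real^5 \<Rightarrow> real^5" where
  "shear k x = row5 (x $ 0 - 3 * k * (x $ 3)^2 + 3 * k^2 * x $ 3 * x $ 4 - k^3 * (x $ 4)^2)
     (x $ 1 - 3 * k * x $ 2 + 3 * k^2 * x $ 3 - k^3 * x $ 4) (x $ 2 - 2 * k * x $ 3 + k^2 * x $ 4) (x $ 3 - k * x $ 4) (x $ 4)"

text \<open>The flow of the vector field \<open>x\<^sub>1\<^sup>2 \<partial>\<^sub>1 + x\<^sub>1 x\<^sub>2 \<partial>\<^sub>2 + x\<^sub>2\<^sup>2 \<partial>\<^sub>3 + x\<^sub>0 \<partial>\<^sub>4 + 2 x\<^sub>2\<^sup>3 \<partial>\<^sub>0\<close> of positive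
  degree in the contact grading of the Lie algebra of type \<open>G\<^sub>2\<close>.\<close>

definition inversion :: "real \<Rightarrow> real^5 \<Rightarrow> real^5" where
  "inversion a x = row5 (x $ 0 + (x $ 2)^3 * (2 * a - a^2 * x $ 1) * inverse (1 - a * x $ 1) * inverse (1 - a * x $ 1))
     (x $ 1 * inverse (1 - a * x $ 1)) (x $ 2 * inverse (1 - a * x $ 1)) (x $ 3 + a * (x $ 2)^2 * inverse (1 - a * x $ 1))
     (x $ 4 + a * x $ 0 + a^2 * (x $ 2)^3 * inverse (1 - a * x $ 1))"

lemma cone_map_mat_1: "cone_map (mat 1) 1 0 0 1"
proof -
  have "(mat 1 :: real^5^5) $ 0 $ 0 = 1" by (simp add: mat_def)
  moreover have "invertible (mat 1 :: real^5^5)" unfolding invertible_def using matrix_mul_lid by blast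
  ultimately show ?thesis unfolding cone_map_def by (auto intro!: exI[of _ 1])
qed

definition quarter_turn_matrix :: "real^5^5" where
  "quarter_turn_matrix = row5 (row5 1 0 0 0 0) (row5 0 0 0 0 1) (row5 0 0 0 (-1) 0) (row5 0 0 1 0 0) (row5 0 (-1) 0 0 0)"

lemma cone_map_quarter_turn: "cone_map quarter_turn_matrix 0 1 (-1) 0"
proof -
  have "quarter_turn_matrix ** row5 (row5 1 0 0 0 0) (row5 0 0 0 0 (-1)) (row5 0 0 0 1 0) (row5 0 0 (-1) 0 0) (row5 0 1 0 0 0) = mat 1"
    unfolding vec5_eq_iff matrix_matrix_5 by (simp add: quarter_turn_matrix_def mat_def)
  then have "invertible quarter_turn_matrix" using invertible_right_inverse by blast
  then show ?thesis
    unfolding cone_map_def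
    by (auto intro!: exI[of _ 1] simp: vec5_eq_iff matrix_vector_5 cone_point_def)
      (simp_all add: quarter_turn_matrix_def)
qed

definition shear_matrix :: "real \<Rightarrow> real^5^5" where
  "shear_matrix k = row5 (row5 1 0 0 0 0) (row5 0 1 (- 3 * k) (3 * k^2) (- (k^3))) (row5 0 0 1 (- 2 * k) (k^2))
     (row5 0 0 0 1 (- k)) (row5 0 0 0 0 1)"

lemma sheared_engel_shear: "sheared_engel u x = shear_matrix u ** engel_coframe x"
  unfolding vec5_eq_iff matrix_matrix_5 by (simp add: sheared_engel_def shear_matrix_def engel_coframe_def)

lemma cone_map_shear: "cone_map (shear_matrix k) 1 (- k) 0 1"
proof -
  have "shear_matrix k ** shear_matrix (- k) = mat 1"
    unfolding vec5_eq_iff matrix_matrix_5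
    by (simp add: shear_matrix_def mat_def) (simp add: power2_eq_square power3_eq_cube algebra_simps)
  then have "invertible (shear_matrix k)" using invertible_right_inverse by blast
  moreover have "shear_matrix k *v cone_point c x y = cone_point c (x - k * y) y" for c x y
    unfolding vec5_eq_iff matrix_vector_5
    by (simp add: shear_matrix_def cone_point_def) (simp add: power2_eq_square power3_eq_cube algebra_simps)
  moreover have "(shear_matrix k *v z) $ 0 = z $ 0" "shear_matrix k $ 0 $ 0 = 1" for z
    by (simp_all add: matrix_vector_5 shear_matrix_def)
  ultimately show ?thesis unfolding cone_map_def by (auto intro!: exI[of _ 1])
qed

definition inversion_matrix :: "real \<Rightarrow> real \<Rightarrow> real \<Rightarrow> real^5^5" where
  "inversion_matrix m q a = row5
     (row5 m 0 0 0 0)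
     (row5 0 (m^2) 0 0 0)
     (row5 0 (m^2 * q) m 0 0)
     (row5 0 (m^2 * q^2) (2 * m * q) 1 0)
     (row5 a (m^2 * q^3) (3 * m * q^2) (3 * q) (inverse m))"

lemma cone_map_inversion:
  assumes m: "m \<noteq> 0"
  shows "cone_map (inversion_matrix m q a) 1 0 q (inverse m)"
proof -
  have "inversion_matrix m q a ** row5
     (row5 (inverse m) 0 0 0 0)
     (row5 0 (inverse m^2) 0 0 0)
     (row5 0 (- (q * inverse m)) (inverse m) 0 0)
     (row5 0 (q^2) (- 2 * q) 1 0)
     (row5 (- a) (- (m * q^3)) (3 * m * q^2) (- 3 * m * q) m) = mat 1"
    unfolding vec5_eq_iff matrix_matrix_5 using m
    by (simp add: inversion_matrix_def mat_def) (simp add: power2_eq_square power3_eq_cube field_simps)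
  then have "invertible (inversion_matrix m q a)" using invertible_right_inverse by blast
  moreover have "inversion_matrix m q a *v cone_point c x y = cone_point (m^2 * c) x (q * x + inverse m * y)" for c x y
    unfolding vec5_eq_iff matrix_vector_5 using m
    by (simp add: inversion_matrix_def cone_point_def) (simp add: power2_eq_square power3_eq_cube field_simps)
  moreover have "(inversion_matrix m q a *v z) $ 0 = m * z $ 0" "inversion_matrix m q a $ 0 $ 0 = m" for z
    by (simp_all add: matrix_vector_5 inversion_matrix_def)
  ultimately show ?thesis unfolding cone_map_def using m by (auto intro!: exI[of _ "m^2"])
qed

lemma has_derivative_coord: "((\<lambda>x::real^5. x $ i) has_derivative (\<lambda>v. v $ i)) F"
  by (rule bounded_linear_imp_has_derivative[OF bounded_linear_vec_nth])

lemma engel_map_eqI: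
  assumes "(F has_derivative F') (at x)" "\<And>v. engel_coframe (F x) *v F' v = H *v (engel_coframe x *v v)"
  shows "engel_coframe (F x) ** jacobian F (at x) = H ** engel_coframe x"
proof -
  have "jacobian F (at x) *v v = F' v" for v
  proof -
    have "F differentiable (at x)" using assms(1) by (auto simp: differentiable_def)
    then have "(F has_derivative (\<lambda>h. jacobian F (at x) *v h)) (at x)" by (simp only: jacobian_works)
    from fun_cong[OF has_derivative_unique[OF this assms(1)], of v] show ?thesis .
  qed
  then show ?thesis
    using assms(2) by (simp add: matrix_eq matrix_vector_mul_assoc[symmetric])
qed

lemma translate:
  "diffeo_pair (translate c) (translate_back c) UNIV UNIV"
  "engel_map (translate c) (\<lambda>_. mat 1) UNIV (\<lambda>_. 1) (\<lambda>_. 0) (\<lambda>_. 0) (\<lambda>_. 1)"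
proof -
  have "smooth_on UNIV (translate c)" "smooth_on UNIV (translate_back c)"
    unfolding translate_def[abs_def] translate_back_def[abs_def] by (intro smooth_intros open_UNIV)+
  then show "diffeo_pair (translate c) (translate_back c) UNIV UNIV"
    by (auto simp: diffeo_pair_def vec5_eq_iff translate_def translate_back_def algebra_simps)
  have "engel_coframe (translate c x) ** jacobian (translate c) (at x) = mat 1 ** engel_coframe x" for x
  proof (rule engel_map_eqI)
    show "(translate c has_derivative (\<lambda>v. row5 (v $ 0 + c $ 1 * v $ 4 - 3 * c $ 2 * v $ 3) (v $ 1) (v $ 2) (v $ 3) (v $ 4))) (at x)"
      unfolding translate_def[abs_def]
      by (rule has_derivative_row5) (auto intro!: derivative_eq_intros has_derivative_coord)
    show "engel_coframe (translate c x) *v row5 (v $ 0 + c $ 1 * v $ 4 - 3 * c $ 2 * v $ 3) (v $ 1) (v $ 2) (v $ 3) (v $ 4) =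
      mat 1 *v (engel_coframe x *v v)" for v
      unfolding matrix_vector_mul_lid vec5_eq_iff matrix_vector_5 by (simp add: engel_coframe_def translate_def algebra_simps)
  qed
  then show "engel_map (translate c) (\<lambda>_. mat 1) UNIV (\<lambda>_. 1) (\<lambda>_. 0) (\<lambda>_. 0) (\<lambda>_. 1)"
    using cone_map_mat_1 by (simp add: engel_map_def)
qed

lemma quarter_turn:
  "diffeo_pair quarter_turn (\<lambda>x. quarter_turn (quarter_turn (quarter_turn x))) UNIV UNIV"
  "engel_map quarter_turn (\<lambda>_. quarter_turn_matrix) UNIV (\<lambda>_. 0) (\<lambda>_. 1) (\<lambda>_. -1) (\<lambda>_. 0)"
proof -
  have s: "smooth_on UNIV quarter_turn"
    unfolding quarter_turn_def[abs_def] by (intro smooth_intros open_UNIV)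
  have c: "smooth_on UNIV (\<lambda>x. quarter_turn (f x))" if "smooth_on UNIV f" for f :: "real^5 \<Rightarrow> real^5"
    by (rule smooth_on_compose[where f = f and g = quarter_turn, OF open_UNIV open_UNIV subset_UNIV that s])
  have "smooth_on UNIV (\<lambda>x. quarter_turn (quarter_turn (quarter_turn x)))" by (intro c s)
  then show "diffeo_pair quarter_turn (\<lambda>x. quarter_turn (quarter_turn (quarter_turn x))) UNIV UNIV"
    using s by (auto simp: diffeo_pair_def vec5_eq_iff quarter_turn_def algebra_simps)
  have "engel_coframe (quarter_turn x) ** jacobian quarter_turn (at x) = quarter_turn_matrix ** engel_coframe x" for x
  proof (rule engel_map_eqI)
    show "(quarter_turn has_derivative (\<lambda>v. row5 (v $ 0 + (x $ 1 * v $ 4 + v $ 1 * x $ 4) - 3 * (x $ 2 * v $ 3 + v $ 2 * x $ 3))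
        (v $ 4) (- v $ 3) (v $ 2) (- v $ 1))) (at x)"
      unfolding quarter_turn_def[abs_def]
      by (rule has_derivative_row5) (auto intro!: derivative_eq_intros has_derivative_coord simp: algebra_simps)
    show "engel_coframe (quarter_turn x) *v row5 (v $ 0 + (x $ 1 * v $ 4 + v $ 1 * x $ 4) - 3 * (x $ 2 * v $ 3 + v $ 2 * x $ 3))
        (v $ 4) (- v $ 3) (v $ 2) (- v $ 1) = quarter_turn_matrix *v (engel_coframe x *v v)" for v
      unfolding vec5_eq_iff matrix_vector_5 by (simp add: engel_coframe_def quarter_turn_def quarter_turn_matrix_def algebra_simps)
  qed
  then show "engel_map quarter_turn (\<lambda>_. quarter_turn_matrix) UNIV (\<lambda>_. 0) (\<lambda>_. 1) (\<lambda>_. -1) (\<lambda>_. 0)"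
    using cone_map_quarter_turn by (simp add: engel_map_def)
qed

lemma shear:
  "diffeo_pair (shear k) (shear (- k)) UNIV UNIV"
  "engel_map (shear k) (\<lambda>_. shear_matrix k) UNIV (\<lambda>_. 1) (\<lambda>_. - k) (\<lambda>_. 0) (\<lambda>_. 1)"
proof -
  have "smooth_on UNIV (shear k)" for k
    unfolding shear_def[abs_def] by (intro smooth_intros open_UNIV)
  moreover have "shear k (shear (- k) x) = x" for k x
    unfolding vec5_eq_iff by (simp add: shear_def) (simp add: algebra_simps power2_eq_square power3_eq_cube)
  note this[of k] this[of "- k"]
  ultimately show "diffeo_pair (shear k) (shear (- k)) UNIV UNIV" by (simp add: diffeo_pair_def)
  have "engel_coframe (shear k x) ** jacobian (shear k) (at x) = shear_matrix k ** engel_coframe x" for x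
  proof (rule engel_map_eqI)
    show "(shear k has_derivative (\<lambda>v. row5 (v $ 0 - 6 * k * x $ 3 * v $ 3 + 3 * k^2 * (x $ 3 * v $ 4 + v $ 3 * x $ 4) - 2 * k^3 * x $ 4 * v $ 4)
     (v $ 1 - 3 * k * v $ 2 + 3 * k^2 * v $ 3 - k^3 * v $ 4) (v $ 2 - 2 * k * v $ 3 + k^2 * v $ 4) (v $ 3 - k * v $ 4) (v $ 4))) (at x)"
      unfolding shear_def[abs_def]
      by (rule has_derivative_row5) (auto intro!: derivative_eq_intros has_derivative_coord simp: algebra_simps)
    show "engel_coframe (shear k x) *v row5 (v $ 0 - 6 * k * x $ 3 * v $ 3 + 3 * k^2 * (x $ 3 * v $ 4 + v $ 3 * x $ 4) - 2 * k^3 * x $ 4 * v $ 4)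
     (v $ 1 - 3 * k * v $ 2 + 3 * k^2 * v $ 3 - k^3 * v $ 4) (v $ 2 - 2 * k * v $ 3 + k^2 * v $ 4) (v $ 3 - k * v $ 4) (v $ 4)
     = shear_matrix k *v (engel_coframe x *v v)" for v
      unfolding vec5_eq_iff matrix_vector_5
      by (simp add: engel_coframe_def shear_def shear_matrix_def) (simp add: algebra_simps power2_eq_square power3_eq_cube)
  qed
  then show "engel_map (shear k) (\<lambda>_. shear_matrix k) UNIV (\<lambda>_. 1) (\<lambda>_. - k) (\<lambda>_. 0) (\<lambda>_. 1)"
    using cone_map_shear by (simp add: engel_map_def)
qed

lemma inversion:
  defines "D \<equiv> \<lambda>a. {x :: real^5. 1 - a * x $ 1 \<noteq> 0}"
  shows "diffeo_pair (inversion a) (inversion (- a)) (D a) (D (- a))"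
    "engel_map (inversion a) (\<lambda>x. inversion_matrix (inverse (1 - a * x $ 1)) (a * x $ 2) a) (D a)
      (\<lambda>_. 1) (\<lambda>_. 0) (\<lambda>x. a * x $ 2) (\<lambda>x. 1 - a * x $ 1)"
proof -
  have o: "open (D a)" for a
    unfolding D_def by (intro open_Collect_neq continuous_intros)
  have s: "smooth_on (D a) (inversion a)" for a
    unfolding inversion_def[abs_def] by (intro smooth_intros o) (auto simp: D_def)
  have inv: "inversion a x \<in> D (- a) \<and> inversion (- a) (inversion a x) = x" if x: "x \<in> D a" for a x
  proof -
    define m where "m = inverse (1 - a * x $ 1)"
    have m: "m * (1 - a * x $ 1) = 1" using x by (simp add: D_def m_def)
    \<comment> \<open>The left side is the denominator of the inverse map at the image point; it is
      the reciprocal of the denominator at x, hence nonzero.\<close>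
    have e: "1 + a * (x $ 1 * m) = m" using m by algebra
    have e': "inverse m = 1 - a * x $ 1" by (simp add: m_def)
    have f: "inversion a x = row5 (x $ 0 + (x $ 2)^3 * (2 * a - a^2 * x $ 1) * m * m)
      (x $ 1 * m) (x $ 2 * m) (x $ 3 + a * (x $ 2)^2 * m) (x $ 4 + a * x $ 0 + a^2 * (x $ 2)^3 * m)"
      by (simp add: inversion_def m_def)
    have "inversion (- a) (inversion a x) = x"
      unfolding vec5_eq_iff inversion_def[of "- a"] f
      by (simp add: e e'; intro conjI; use m in algebra)
    moreover have "m \<noteq> 0" using m by auto
    then have "1 - (- a) * inversion a x $ 1 \<noteq> 0" unfolding f using e by simp
    then have "inversion a x \<in> D (- a)" unfolding D_def by blast
    ultimately show ?thesis by blast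
  qed
  show "diffeo_pair (inversion a) (inversion (- a)) (D a) (D (- a))"
    unfolding diffeo_pair_def using o s inv[of _ a] inv[of _ "- a"] by simp
  have "engel_coframe (inversion a x) ** jacobian (inversion a) (at x) =
      inversion_matrix (inverse (1 - a * x $ 1)) (a * x $ 2) a ** engel_coframe x" if x: "x \<in> D a" for x
  proof (rule engel_map_eqI)
    define m where "m = inverse (1 - a * x $ 1)"
    have m0: "1 - a * x $ 1 \<noteq> 0" using x by (simp add: D_def)
    have dm: "((\<lambda>x. inverse (1 - a * x $ 1)) has_derivative (\<lambda>v. a * m^2 * v $ 1)) (at x)"
      unfolding m_def using m0
      by (auto intro!: derivative_eq_intros has_derivative_coord simp: power2_eq_square)
    show "(inversion a has_derivative (\<lambda>v. row5
        (v $ 0 + (3 * (x $ 2)^2 * v $ 2 * (2 * a - a^2 * x $ 1) * m^2 - (x $ 2)^3 * a^2 * v $ 1 * m^2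
           + 2 * (x $ 2)^3 * (2 * a - a^2 * x $ 1) * m * (a * m^2 * v $ 1)))
        (v $ 1 * m + x $ 1 * (a * m^2 * v $ 1)) (v $ 2 * m + x $ 2 * (a * m^2 * v $ 1))
        (v $ 3 + a * (2 * x $ 2 * v $ 2 * m + (x $ 2)^2 * (a * m^2 * v $ 1)))
        (v $ 4 + a * v $ 0 + a^2 * (3 * (x $ 2)^2 * v $ 2 * m + (x $ 2)^3 * (a * m^2 * v $ 1))))) (at x)"
      unfolding inversion_def[abs_def]
      by (rule has_derivative_row5)
        (use m0 in \<open>auto intro!: derivative_eq_intros has_derivative_coord dm simp: m_def[symmetric] power2_eq_square power3_eq_cube algebra_simps\<close>)
    have m: "m * (1 - a * x $ 1) = 1" "m \<noteq> 0" "inverse m = 1 - a * x $ 1" using m0 by (simp_all add: m_def)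
    have am: "a * x $ 1 * m = m - 1" using m(1) by (simp add: algebra_simps)
    show "engel_coframe (inversion a x) *v row5
        (v $ 0 + (3 * (x $ 2)^2 * v $ 2 * (2 * a - a^2 * x $ 1) * m^2 - (x $ 2)^3 * a^2 * v $ 1 * m^2
           + 2 * (x $ 2)^3 * (2 * a - a^2 * x $ 1) * m * (a * m^2 * v $ 1)))
        (v $ 1 * m + x $ 1 * (a * m^2 * v $ 1)) (v $ 2 * m + x $ 2 * (a * m^2 * v $ 1))
        (v $ 3 + a * (2 * x $ 2 * v $ 2 * m + (x $ 2)^2 * (a * m^2 * v $ 1)))
        (v $ 4 + a * v $ 0 + a^2 * (3 * (x $ 2)^2 * v $ 2 * m + (x $ 2)^3 * (a * m^2 * v $ 1)))
      = inversion_matrix (inverse (1 - a * x $ 1)) (a * x $ 2) a *v (engel_coframe x *v v)" for v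
      unfolding vec5_eq_iff matrix_vector_5 engel_coframe_def inversion_def inversion_matrix_def m_def[symmetric] m(3) row5_nth
      proof (intro conjI)
    qed (use m(1) in algebra, use m(1) in algebra, algebra+)
  qed
  then show "engel_map (inversion a) (\<lambda>x. inversion_matrix (inverse (1 - a * x $ 1)) (a * x $ 2) a) (D a)
      (\<lambda>_. 1) (\<lambda>_. 0) (\<lambda>x. a * x $ 2) (\<lambda>x. 1 - a * x $ 1)"
    using cone_map_inversion[of "inverse (1 - a * _ $ 1)"] by (auto simp: engel_map_def D_def)
qed

section \<open>Flatness\<close>

lemma cone_line_rescale: "y \<noteq> 0 \<Longrightarrow> cone_line w 0 y = cone_line w 0 1"
proof -
  assume y: "y \<noteq> 0"
  have "cone_point k 0 y = cone_point (k * y^3) 0 1" "cone_point k 0 1 = cone_point (k / y^3) 0 y" for k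
    using y by (simp_all add: cone_point_def)
  then show ?thesis unfolding cone_line_def by metis
qed

lemma adapted_mark_cone_line: "adapted_mark w l \<longleftrightarrow> l = cone_line w 0 1"
  by (simp add: adapted_mark_iff cone_line_def)

text \<open>The linear action on the seven parameters that belongs to the automorphism.
  \<open>Ys\<close> and \<open>Yt\<close> transform contragrediently to the parameters (x, y) of the
  mark, so that x Ys + y Yt = 0 is carried along.\<close>

lemma inversion_action:
  assumes "1 - a * x $ 1 \<noteq> 0"
  shows "Ys ys zp z0 zm wp wm x = Ys ys zp z0 (zm + a * yt) wp (wm + a * zp) (inversion a x)
      + a * x $ 2 * Yt yt zp z0 (zm + a * yt) wp (wm + a * zp) (inversion a x)"
    "Yt yt zp z0 zm wp wm x = (1 - a * x $ 1) * Yt yt zp z0 (zm + a * yt) wp (wm + a * zp) (inversion a x)"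
proof -
  define m where "m = inverse (1 - a * x $ 1)"
  have m: "m * (1 - a * x $ 1) = 1" using assms by (simp add: m_def)
  have f: "inversion a x = row5 (x $ 0 + (x $ 2)^3 * (2 * a - a^2 * x $ 1) * m * m)
      (x $ 1 * m) (x $ 2 * m) (x $ 3 + a * (x $ 2)^2 * m) (x $ 4 + a * x $ 0 + a^2 * (x $ 2)^3 * m)"
    by (simp add: inversion_def m_def)
  show "Ys ys zp z0 zm wp wm x = Ys ys zp z0 (zm + a * yt) wp (wm + a * zp) (inversion a x)
      + a * x $ 2 * Yt yt zp z0 (zm + a * yt) wp (wm + a * zp) (inversion a x)"
    "Yt yt zp z0 zm wp wm x = (1 - a * x $ 1) * Yt yt zp z0 (zm + a * yt) wp (wm + a * zp) (inversion a x)"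
    unfolding f Ys_def Yt_def row5_nth using m by algebra+
qed

lemma quarter_turn_action:
  "Ys yt zm (- z0) zp (- wm) wp (quarter_turn x) = Yt yt zp z0 zm wp wm x"
  "Yt (- ys) zm (- z0) zp (- wm) wp (quarter_turn x) = - Ys ys zp z0 zm wp wm x"
  unfolding Ys_def Yt_def quarter_turn_def row5_nth by algebra+

lemma shear_action:
  "Ys ys (zp - k * z0 + k^2 * zm) (z0 - 2 * k * zm) zm (wp + k * wm) wm (shear k x) = Ys ys zp z0 zm wp wm x"
  "Yt (yt + k * ys) (zp - k * z0 + k^2 * zm) (z0 - 2 * k * zm) zm (wp + k * wm) wm (shear k x) =
    Yt yt zp z0 zm wp wm x + k * Ys ys zp z0 zm wp wm x"
  unfolding Ys_def Yt_def shear_def row5_nth by algebra+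

section \<open>Normal form of the null vector that describes a marking\<close>

context twisted_cubic_manifold
begin

text \<open>The mark is kept in homogeneous parameters (x, y) rather than as a function u, because a
  quarter turn exchanges finite and infinite values of u.\<close>

definition marked_by :: "'p \<Rightarrow> real \<Rightarrow> real \<Rightarrow> real \<Rightarrow> real \<Rightarrow> real \<Rightarrow> real \<Rightarrow> real \<Rightarrow> bool" where
  "marked_by p ys yt zp z0 zm wp wm \<longleftrightarrow> (\<exists>\<kappa>. engel_chart \<kappa> \<and> p \<in> cdom \<kappa> \<and> coord \<kappa> p = 0 \<and>
     (\<forall>q\<in>cdom \<kappa>. \<exists>x y. (x \<noteq> 0 \<or> y \<noteq> 0) \<and> l \<kappa> q = cone_line (engel_coframe (coord \<kappa> q)) x y \<and>
        x * Ys ys zp z0 zm wp wm (coord \<kappa> q) + y * Yt yt zp z0 zm wp wm (coord \<kappa> q) = 0))"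

text \<open>\<open>act\<close> states that the linear equation of the mark is transported together
  with its parameters; invertibility of the 2x2 matrix keeps the new parameters from vanishing
  simultaneously.\<close>

lemma marked_by_map:
  assumes m: "marked_by p ys yt zp z0 zm wp wm"
    and F: "diffeo_pair F F' D E" "engel_map F H D a11 a12 a21 a22" and 0: "0 \<in> D" "F 0 = 0"
    and act: "\<And>v x y. v \<in> D \<Longrightarrow> x * Ys ys zp z0 zm wp wm v + y * Yt yt zp z0 zm wp wm v = 0 \<Longrightarrow>
      (a11 v * x + a12 v * y) * Ys ys' zp' z0' zm' wp' wm' (F v) + (a21 v * x + a22 v * y) * Yt yt' zp' z0' zm' wp' wm' (F v) = 0"
  shows "marked_by p ys' yt' zp' z0' zm' wp' wm'"
proof -
  obtain \<kappa> where \<kappa>: "engel_chart \<kappa>" "p \<in> cdom \<kappa>" "coord \<kappa> p = 0"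
    and l: "\<And>q. q \<in> cdom \<kappa> \<Longrightarrow> \<exists>x y. (x \<noteq> 0 \<or> y \<noteq> 0) \<and> l \<kappa> q = cone_line (engel_coframe (coord \<kappa> q)) x y \<and>
        x * Ys ys zp z0 zm wp wm (coord \<kappa> q) + y * Yt yt zp z0 zm wp wm (coord \<kappa> q) = 0"
    using m unfolding marked_by_def by blast
  obtain \<kappa>' where \<kappa>': "engel_chart \<kappa>'" "cdom \<kappa>' = {q \<in> cdom \<kappa>. coord \<kappa> q \<in> D}"
    "\<And>q. q \<in> cdom \<kappa>' \<Longrightarrow> coord \<kappa>' q = F (coord \<kappa> q)"
    and l': "\<And>q x y. q \<in> cdom \<kappa>' \<Longrightarrow> l \<kappa> q = cone_line (engel_coframe (coord \<kappa> q)) x y \<Longrightarrow>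
       l \<kappa>' q = cone_line (engel_coframe (coord \<kappa>' q))
         (a11 (coord \<kappa> q) * x + a12 (coord \<kappa> q) * y) (a21 (coord \<kappa> q) * x + a22 (coord \<kappa> q) * y)"
    using new_engel_chart[OF \<kappa>(1) F] by blast
  have p: "p \<in> cdom \<kappa>'" "coord \<kappa>' p = 0" using \<kappa> \<kappa>' 0 by auto
  have "\<exists>x y. (x \<noteq> 0 \<or> y \<noteq> 0) \<and> l \<kappa>' q = cone_line (engel_coframe (coord \<kappa>' q)) x y \<and>
        x * Ys ys' zp' z0' zm' wp' wm' (coord \<kappa>' q) + y * Yt yt' zp' z0' zm' wp' wm' (coord \<kappa>' q) = 0"
    if q: "q \<in> cdom \<kappa>'" for q
  proof -
    let ?v = "coord \<kappa> q"
    have qq: "q \<in> cdom \<kappa>" "?v \<in> D" using q \<kappa>' by auto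
    obtain x y where xy: "x \<noteq> 0 \<or> y \<noteq> 0" "l \<kappa> q = cone_line (engel_coframe ?v) x y"
      "x * Ys ys zp z0 zm wp wm ?v + y * Yt yt zp z0 zm wp wm ?v = 0" using l[OF qq(1)] by blast
    have "a11 ?v * a22 ?v - a12 ?v * a21 ?v \<noteq> 0" using F(2) qq(2) unfolding engel_map_def cone_map_def by blast
    moreover have "(a11 ?v * a22 ?v - a12 ?v * a21 ?v) * x = a22 ?v * (a11 ?v * x + a12 ?v * y) - a12 ?v * (a21 ?v * x + a22 ?v * y)"
      "(a11 ?v * a22 ?v - a12 ?v * a21 ?v) * y = a11 ?v * (a21 ?v * x + a22 ?v * y) - a21 ?v * (a11 ?v * x + a12 ?v * y)"
      by (simp_all add: algebra_simps)
    ultimately have "a11 ?v * x + a12 ?v * y \<noteq> 0 \<or> a21 ?v * x + a22 ?v * y \<noteq> 0" using xy(1) by fastforce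
    then show ?thesis using l'[OF q xy(2)] act[OF qq(2) xy(3)] \<kappa>'(3)[OF q] by metis
  qed
  then show ?thesis unfolding marked_by_def using \<kappa>'(1) p by blast
qed

lemma marked_by_inversion:
  assumes "marked_by p ys yt zp z0 zm wp wm"
  shows "marked_by p ys yt zp z0 (zm + a * yt) wp (wm + a * zp)"
proof (rule marked_by_map[OF assms inversion(1,2)[of a]])
  show "inversion a 0 = 0" by (simp add: inversion_def vec5_eq_iff)
  fix v x y assume "v \<in> {x. 1 - a * x $ 1 \<noteq> 0}" "x * Ys ys zp z0 zm wp wm v + y * Yt yt zp z0 zm wp wm v = 0"
  then show "(1 * x + 0 * y) * Ys ys zp z0 (zm + a * yt) wp (wm + a * zp) (inversion a v) +
    (a * v $ 2 * x + (1 - a * v $ 1) * y) * Yt yt zp z0 (zm + a * yt) wp (wm + a * zp) (inversion a v) = 0"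
    using inversion_action(1)[of a v ys zp z0 zm wp wm yt] inversion_action(2)[of a v yt zp z0 zm wp wm]
    by (simp add: algebra_simps)
qed simp

lemma marked_by_quarter_turn:
  assumes "marked_by p ys yt zp z0 zm wp wm"
  shows "marked_by p yt (- ys) zm (- z0) zp (- wm) wp"
  by (rule marked_by_map[OF assms quarter_turn])
    (simp_all add: quarter_turn_action, simp_all add: quarter_turn_def vec5_eq_iff)

lemma marked_by_shear:
  assumes "marked_by p ys yt zp z0 zm wp wm"
  shows "marked_by p ys (yt + k * ys) (zp - k * z0 + k^2 * zm) (z0 - 2 * k * zm) zm (wp + k * wm) wm"
  by (rule marked_by_map[OF assms shear[of k]])
    (simp_all add: shear_action, simp_all add: shear_def vec5_eq_iff algebra_simps)

text \<open>The inversion conjugated by the quarter turn, three further turns completing the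
  rotation. It shifts \<open>zp\<close> by a multiple of \<open>ys\<close> and so remains effective
  when \<open>ys\<close> = 1 and \<open>yt\<close> = 0.\<close>

lemma marked_by_J:
  assumes "marked_by p ys yt zp z0 zm wp wm"
  shows "marked_by p ys yt (zp - a * ys) z0 zm (wp + a * zm) wm"
  using marked_by_quarter_turn[OF marked_by_quarter_turn[OF marked_by_quarter_turn[OF
    marked_by_inversion[OF marked_by_quarter_turn[OF assms], of a]]]]
  by (simp add: algebra_simps)

text \<open>The shear conjugated by the quarter turn, that is, the opposite shear; for
  \<open>yt\<close> = 0 it leaves \<open>ys\<close> and \<open>yt\<close> alone.\<close>

lemma marked_by_S:
  assumes "marked_by p ys yt zp z0 zm wp wm"
  shows "marked_by p (ys - k * yt) yt zp (z0 + 2 * k * zp) (zm + k * z0 + k^2 * zp) wp (wm - k * wp)"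
  using marked_by_quarter_turn[OF marked_by_quarter_turn[OF marked_by_quarter_turn[OF
    marked_by_shear[OF marked_by_quarter_turn[OF assms], of k]]]]
  by (simp add: algebra_simps)

text \<open>Conjugates of \<open>marked_by_J\<close> by the opposite shear. They move (zp, z0, zm)
  by multiples of (-1, 2 k, -k^2), and three values of k give independent directions.\<close>

lemma marked_by_K:
  assumes "marked_by p 1 0 zp z0 zm wp wm"
  shows "marked_by p 1 0 (zp - a) (z0 + 2 * k * a) (zm - k^2 * a) (wp + a * (zm + k * z0 + k^2 * zp))
    (wm + k * a * (zm + k * z0 + k^2 * zp))"
  using marked_by_S[OF marked_by_J[OF marked_by_S[OF assms, of k], of a], of "- k"]
  by (simp add: algebra_simps power2_eq_square)

text \<open>Three moves \<open>marked_by_K\<close> bring zp, z0, zm to 0, and then \<open>wp\<close>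
  is 0 because the vector is null. They add to \<open>wm\<close> an amount f that does not depend on
  \<open>wm\<close>; an inversion beforehand, which changes \<open>wm\<close> alone when
  \<open>yt\<close> = 0, sets it to - f.\<close>

lemma marked_by_normal_form:
  assumes "marked_by p 1 0 zp z0 zm ((z0^2 - 4 * zp * zm) / 4) wm"
  shows "marked_by p 1 0 0 0 0 0 0"
proof -
  have kill: "\<exists>f. \<forall>wm. marked_by p 1 0 zp z0 zm ((z0^2 - 4 * zp * zm) / 4) wm \<longrightarrow> marked_by p 1 0 0 0 0 0 (wm + f)" for zp z0 zm
  proof -
    \<comment> \<open>The solution of the linear system for the moves with k = 1, -1, 0: a1 + a2 =
      zm, a2 - a1 = z0 / 2, a0 = zp - a1 - a2.\<close>
    define a1 a2 a0 where "a1 = (zm - z0 / 2) / 2" and "a2 = (zm + z0 / 2) / 2" and "a0 = zp - zm"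
    define f where "f = a1 * (zm + z0 + zp) - a2 * ((zm - a1) - (z0 + 2 * a1) + (zp - a1))"
    have "marked_by p 1 0 0 0 0 0 (wm + f)" if m: "marked_by p 1 0 zp z0 zm ((z0^2 - 4 * zp * zm) / 4) wm" for wm
    proof -
      have cong: "marked_by p 1 0 zp z0 zm wp wm \<Longrightarrow> zp = 0 \<Longrightarrow> z0 = 0 \<Longrightarrow> zm = 0 \<Longrightarrow> wp = 0 \<Longrightarrow> wm = wm' \<Longrightarrow>
        marked_by p 1 0 0 0 0 0 wm'" for zp z0 zm wp wm wm' by simp
      show ?thesis
        by (rule cong[OF marked_by_K[OF marked_by_K[OF marked_by_K[OF m, of a1 1], of a2 "- 1"], of a0 0]])
          (simp_all add: f_def a1_def a2_def a0_def field_simps power2_eq_square)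
    qed
    then show ?thesis by blast
  qed
  have pos: "marked_by p 1 0 0 0 0 0 0" if m: "marked_by p 1 0 zp z0 zm ((z0^2 - 4 * zp * zm) / 4) wm" and zp: "zp \<noteq> 0" for zp z0 zm wm
  proof -
    obtain f where f: "\<And>wm. marked_by p 1 0 zp z0 zm ((z0^2 - 4 * zp * zm) / 4) wm \<Longrightarrow> marked_by p 1 0 0 0 0 0 (wm + f)"
      using kill by blast
    have "marked_by p 1 0 zp z0 zm ((z0^2 - 4 * zp * zm) / 4) (- f)"
      using marked_by_inversion[OF m, of "(- f - wm) / zp"] zp by simp
    from f[OF this] show ?thesis by simp
  qed
  show ?thesis
  proof (cases "zp = 0")
    case True
    \<comment> \<open>The inversion changes \<open>wm\<close> by a multiple of \<open>zp\<close>, so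
      \<open>zp\<close> is first made nonzero; the vector stays null.\<close>
    have "marked_by p 1 0 1 z0 zm ((z0^2 - 4 * 1 * zm) / 4) wm"
      using marked_by_J[OF assms, of "- 1"] True by (simp add: field_simps)
    then show ?thesis by (rule pos) simp
  qed (use pos[OF assms] in simp)
qed

lemma marked_by_flat:
  assumes "marked_by p 1 0 0 0 0 0 0"
  shows "\<exists>\<kappa>\<in>A. p \<in> cdom \<kappa> \<and> (\<forall>q\<in>cdom \<kappa>. adapted_cubic (engel_coframe (coord \<kappa> q)) (C \<kappa> q) (G \<kappa> q) \<and>
    adapted_mark (engel_coframe (coord \<kappa> q)) (l \<kappa> q))"
proof -
  obtain \<kappa> where \<kappa>: "engel_chart \<kappa>" "p \<in> cdom \<kappa>"
    and l: "\<And>q. q \<in> cdom \<kappa> \<Longrightarrow> \<exists>x y. (x \<noteq> 0 \<or> y \<noteq> 0) \<and> l \<kappa> q = cone_line (engel_coframe (coord \<kappa> q)) x y \<and>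
        x * Ys 1 0 0 0 0 0 (coord \<kappa> q) + y * Yt 0 0 0 0 0 0 (coord \<kappa> q) = 0"
    using assms unfolding marked_by_def by blast
  have "adapted_mark (engel_coframe (coord \<kappa> q)) (l \<kappa> q)" if q: "q \<in> cdom \<kappa>" for q
    proof -
    obtain x y where xy: "x \<noteq> 0 \<or> y \<noteq> 0" "l \<kappa> q = cone_line (engel_coframe (coord \<kappa> q)) x y"
      "x * Ys 1 0 0 0 0 0 (coord \<kappa> q) + y * Yt 0 0 0 0 0 0 (coord \<kappa> q) = 0" using l[OF q] by blast
    from xy(3) have "x = 0" by (simp add: Ys_def Yt_def)
    then show ?thesis using xy(1,2) cone_line_rescale unfolding adapted_mark_cone_line by metis
  qed
  then show ?thesis using \<kappa> unfolding engel_chart_def by blast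
qed

end

section \<open>Flatness compared with the vanishing of the invariants\<close>

lemma smooth_on_engel_coframe: "open S \<Longrightarrow> smooth_on S engel_coframe"
  unfolding engel_coframe_def[abs_def] by (intro smooth_intros)

lemma dual_in_cone_line:
  assumes "invertible w"
  shows "w *v dual w 4 = cone_point 1 0 1"
proof -
  have "(w *v dual w 4) $ i = (if i = 4 then 1 else 0)" for i
    using inner_dual[OF assms, of i 4] by (simp add: matrix_vector_mul_component)
  then show ?thesis by (simp add: vec5_eq_iff cone_point_def)
qed

context twisted_cubic_manifold
begin

context
  fixes W a b c J M P L Q R S
  assumes W: "adapted_coframe A C G l W" "structure_equations A W a b c J M P" "derived_functions A W a b c M P L Q R S"
begin

lemma W_coframe: "coframe A W"
  using W(1) by (simp add: adapted_coframe_def)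

lemma W_adapted:
  assumes "\<kappa> \<in> A" "q \<in> cdom \<kappa>"
  shows "invertible (W \<kappa> q)" "adapted_cubic (W \<kappa> q) (C \<kappa> q) (G \<kappa> q)" "adapted_mark (W \<kappa> q) (l \<kappa> q)"
  using W(1) assms unfolding adapted_coframe_def coframe_def by blast+

text \<open>Two adapted coframes differ by a function with values in the structure group, and this
  quotient is smooth. Hence any adapted coframe satisfying the structure equations may be used to
  test the vanishing.\<close>

lemma invariants_adapted:
  assumes \<kappa>: "\<kappa> \<in> A" and S1: "open S1" "S1 \<subseteq> coord \<kappa> ` cdom \<kappa>" and se: "local_se S1 \<beta> \<theta>"
    and ad: "\<And>y. y \<in> S1 \<Longrightarrow> adapted_cubic (\<beta> y) (C \<kappa> (icoord \<kappa> y)) (G \<kappa> (icoord \<kappa> y))"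
      "\<And>y. y \<in> S1 \<Longrightarrow> adapted_mark (\<beta> y) (l \<kappa> (icoord \<kappa> y))"
    and n: "n < 7"
  shows "(\<forall>k\<le>n. \<forall>y\<in>S1. invariant \<beta> \<theta> k y = 0) \<longleftrightarrow> (\<forall>k\<le>n. \<forall>y\<in>S1. ([J, L, M, P, Q, R, S] ! k) (icoord \<kappa> y) = 0)"
proof -
  note ch = chart[OF \<kappa>]
  let ?w = "\<lambda>y. W \<kappa> (icoord \<kappa> y)" and ?\<theta> = "\<lambda>k y. theta_of a b c J M P k (icoord \<kappa> y)"
  define B where "B y = ?w y ** matrix_inv (\<beta> y)" for y
  have q: "icoord \<kappa> y \<in> cdom \<kappa>" "coord \<kappa> (icoord \<kappa> y) = y" if "y \<in> S1" for y
    using that S1(2) ch(7,8) by auto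
  have se': "local_se S1 ?w ?\<theta>"
    by (rule local_se_subset[OF chart_local_se[OF \<kappa> W_coframe W(2)] S1])
  have sB: "smooth_on S1 B"
    unfolding B_def[abs_def]
    by (intro smooth_intros S1(1) se_basic(2)[OF se] se_basic(3)[OF se] se_basic(2)[OF se'])
  have BG: "B y \<in> structure_group" if "y \<in> S1" for y
    unfolding B_def using adapted_structure_group[OF se_basic(3)[OF se that] ad[OF that] W_adapted[OF \<kappa> q(1)[OF that]]] .
  have Bw: "?w y = B y ** \<beta> y" if "y \<in> S1" for y
    using matrix_inv_works(2)[OF se_basic(3)[OF se that]] by (simp add: B_def matrix_mul_assoc[symmetric])
  have inv: "invariant ?w ?\<theta> k y = 0 \<longleftrightarrow> ([J, L, M, P, Q, R, S] ! k) (icoord \<kappa> y) = 0" if "y \<in> S1" "k \<le> n" for y k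
  proof -
    have "invariant ?w ?\<theta> k (coord \<kappa> (icoord \<kappa> y)) = [- J (icoord \<kappa> y), L (icoord \<kappa> y), M (icoord \<kappa> y), P (icoord \<kappa> y),
        Q (icoord \<kappa> y), R (icoord \<kappa> y), S (icoord \<kappa> y)] ! k"
      by (rule chart_invariant[OF \<kappa> W_coframe W(2,3) q(1)]) (use that n in auto)
    moreover have "k = 0 \<or> k = 1 \<or> k = 2 \<or> k = 3 \<or> k = 4 \<or> k = 5 \<or> k = 6" using that n by auto
    ultimately show ?thesis unfolding q(2)[OF that(1)] by (elim disjE) simp_all
  qed
  show ?thesis using invariants_vanish_iff[OF se se' sB BG Bw n] inv by simp
qed

text \<open>In a flat chart the Engel coframe itself is adapted, and its \<theta> is 0.\<close>

lemma flat_imp_vanish: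
  assumes "flat U A C G l"
  shows "vanish_on U [J, L, M, P, Q, R, S]"
proof -
  have "([J, L, M, P, Q, R, S] ! k) p = 0" if p: "p \<in> U" and k: "k \<le> 6" for p k
  proof -
    obtain \<kappa> where \<kappa>: "\<kappa> \<in> A" "p \<in> cdom \<kappa>"
      and ad: "\<And>q. q \<in> cdom \<kappa> \<Longrightarrow> adapted_cubic (engel_coframe (coord \<kappa> q)) (C \<kappa> q) (G \<kappa> q)"
        "\<And>q. q \<in> cdom \<kappa> \<Longrightarrow> adapted_mark (engel_coframe (coord \<kappa> q)) (l \<kappa> q)"
      using assms p unfolding flat_def by blast
    note ch = chart[OF \<kappa>(1)]
    let ?S = "coord \<kappa> ` cdom \<kappa>"
    have "(\<forall>k\<le>6. \<forall>y\<in>?S. invariant engel_coframe (\<lambda>k y. 0) k y = 0) \<longleftrightarrow>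
        (\<forall>k\<le>6. \<forall>y\<in>?S. ([J, L, M, P, Q, R, S] ! k) (icoord \<kappa> y) = 0)"
      by (rule invariants_adapted[OF \<kappa>(1) ch(2) order_refl engel_local_se[OF ch(2)]])
        (use ad ch(6) in auto)
    moreover have "invariant engel_coframe (\<lambda>k y. 0) k y = 0" if "k \<le> 6" for k y
    proof -
      have "k = 0 \<or> k = 1 \<or> k = 2 \<or> k = 3 \<or> k = 4 \<or> k = 5 \<or> k = 6" using that by auto
      then show ?thesis by (elim disjE) (simp_all add: invariant_def)
    qed
    ultimately have "([J, L, M, P, Q, R, S] ! k) (icoord \<kappa> (coord \<kappa> p)) = 0" using \<kappa>(2) k by blast
    then show ?thesis using ch(6)[OF \<kappa>(2)] by simp
  qed
  note * = this
  show ?thesis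
    using *[of _ 0] *[of _ 1] *[of _ 2] *[of _ 3] *[of _ 4] *[of _ 5] *[of _ 6] by (simp add: vanish_on_def)
qed

text \<open>The last dual vector of \<open>W\<close> spans the mark and depends smoothly on the
  point; its Engel components supply smooth parameters of the mark.\<close>

lemma mark_vector:
  assumes \<kappa>: "engel_chart \<kappa>" "q \<in> cdom \<kappa>"
  defines "z \<equiv> engel_coframe (coord \<kappa> q) *v dual (W \<kappa> q) 4"
  shows "\<exists>k x y. z = cone_point k x y" "z \<noteq> 0"
    "z = cone_point k x y \<Longrightarrow> l \<kappa> q = cone_line (engel_coframe (coord \<kappa> q)) x y"
    "l \<kappa> q = cone_line (engel_coframe (coord \<kappa> q)) x y \<Longrightarrow> \<exists>k. z = cone_point k x y"
proof -
  have \<kappa>A: "\<kappa> \<in> A" using \<kappa> by (simp add: engel_chart_def)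
  let ?w = "W \<kappa> q" and ?e = "engel_coframe (coord \<kappa> q)"
  define v where "v = dual ?w 4"
  note ad = W_adapted[OF \<kappa>A \<kappa>(2)]
  have adE: "adapted_cubic ?e (C \<kappa> q) (G \<kappa> q)" using \<kappa> by (simp add: engel_chart_def)
  have wv: "?w *v v = cone_point 1 0 1" unfolding v_def by (rule dual_in_cone_line[OF ad(1)])
  have "v \<in> G \<kappa> q" using ad(2) wv unfolding adapted_cubic_iff by blast
  then show ex: "\<exists>k x y. z = cone_point k x y" using adE unfolding adapted_cubic_iff z_def v_def by blast
  have inj: "u = 0" if "x *v u = 0" "invertible x" for x :: "real^5^5" and u
    using that unfolding invertible_def by (metis matrix_vector_mul_assoc matrix_vector_mul_lid matrix_vector_mult_0_right)
  have "v \<noteq> 0"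
  proof
    assume "v = 0"
    then have "cone_point 1 0 1 = 0" using wv by simp
    then show False by (simp add: cone_point_def vec5_eq_iff)
  qed
  then show z0: "z \<noteq> 0" using inj[OF _ invertible_engel] unfolding z_def v_def by blast
  have lv: "l \<kappa> q = range (\<lambda>k. k *\<^sub>R v)"
  proof -
    have "?w *v u = cone_point k 0 1 \<longleftrightarrow> u = k *\<^sub>R v" for u k
    proof
      assume "?w *v u = cone_point k 0 1"
      then have "?w *v (u - k *\<^sub>R v) = 0"
        by (simp add: matrix_vector_mult_diff_distrib matrix_vector_mult_scaleR wv cone_point_def vec5_eq_iff)
      then show "u = k *\<^sub>R v" using inj[OF _ ad(1)] by fastforce
    next
      assume "u = k *\<^sub>R v"
      then have "?w *v u = k *\<^sub>R cone_point 1 0 1" by (simp add: matrix_vector_mult_scaleR wv)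
      then show "?w *v u = cone_point k 0 1" by (simp add: cone_point_def vec5_eq_iff)
    qed
    then show ?thesis using ad(3) unfolding adapted_mark_iff by auto
  qed
  show l1: "l \<kappa> q = cone_line ?e x y" if z: "z = cone_point k x y" for k x y
  proof -
    have k: "k \<noteq> 0" using z z0 by (auto simp: cone_point_def vec5_eq_iff)
    have sc: "cone_point (j * k) x y = j *\<^sub>R cone_point k x y" for j by (simp add: cone_point_def vec5_eq_iff)
    have "?e *v u = cone_point j x y \<longleftrightarrow> u = (j / k) *\<^sub>R v" for u j
    proof -
      have c: "cone_point j x y = (j / k) *\<^sub>R (?e *v v)"
        using sc[of "j / k"] k z unfolding z_def v_def by simp
      show ?thesis
      proof
        assume "?e *v u = cone_point j x y"
        then have "?e *v (u - (j / k) *\<^sub>R v) = 0" unfolding c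
          by (simp add: matrix_vector_mult_diff_distrib matrix_vector_mult_scaleR)
        then show "u = (j / k) *\<^sub>R v" using inj[OF _ invertible_engel] by fastforce
      qed (simp add: c matrix_vector_mult_scaleR)
    qed
    then have "cone_line ?e x y = {(j / k) *\<^sub>R v | j. True}" unfolding cone_line_def by auto
    also have "\<dots> = range (\<lambda>j. j *\<^sub>R v)"
    proof -
      have "j *\<^sub>R v = ((j * k) / k) *\<^sub>R v" for j using k by simp
      then show ?thesis by blast
    qed
    finally show ?thesis using lv by simp
  qed
  show "\<exists>k. z = cone_point k x y" if "l \<kappa> q = cone_line ?e x y"
  proof -
    have "v \<in> l \<kappa> q" unfolding lv by (metis rangeI scaleR_one)
    then show ?thesis using that unfolding cone_line_def z_def v_def by blast
  qed
qed

text \<open>Prepares a description of the mark by a finite function u with u(0) = 0: a translation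
  centres the chart, a quarter turn is inserted if the mark lies at (1 : 0), and a shear moves it to
  (0 : 1).\<close>

lemma normalised_chart:
  assumes \<kappa>: "engel_chart \<kappa>" "p \<in> cdom \<kappa>"
  shows "\<exists>\<kappa>'. engel_chart \<kappa>' \<and> p \<in> cdom \<kappa>' \<and> coord \<kappa>' p = 0 \<and> l \<kappa>' p = cone_line (engel_coframe 0) 0 1"
proof -
  obtain \<kappa>1 where \<kappa>1: "engel_chart \<kappa>1" "p \<in> cdom \<kappa>1" "coord \<kappa>1 p = translate (coord \<kappa> p) (coord \<kappa> p)"
    using new_engel_chart[OF \<kappa>(1) translate[of "coord \<kappa> p"]] \<kappa>(2) by auto
  have 1: "coord \<kappa>1 p = 0" unfolding \<kappa>1(3) by (simp add: translate_def vec5_eq_iff)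
  obtain k x y where z: "engel_coframe (coord \<kappa>1 p) *v dual (W \<kappa>1 p) 4 = cone_point k x y"
    using mark_vector(1)[OF \<kappa>1(1,2)] by blast
  note l1 = mark_vector(3)[OF \<kappa>1(1,2) z]
  have xy: "x \<noteq> 0 \<or> y \<noteq> 0" using mark_vector(2)[OF \<kappa>1(1,2)] z by (auto simp: cone_point_def vec5_eq_iff)
  have "\<exists>\<kappa>' x y. engel_chart \<kappa>' \<and> p \<in> cdom \<kappa>' \<and> coord \<kappa>' p = 0 \<and> y \<noteq> 0 \<and> l \<kappa>' p = cone_line (engel_coframe (coord \<kappa>' p)) x y"
  proof (cases "y = 0")
    case True
    obtain \<kappa>2 where \<kappa>2: "engel_chart \<kappa>2" "p \<in> cdom \<kappa>2" "coord \<kappa>2 p = quarter_turn (coord \<kappa>1 p)"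
      "l \<kappa>2 p = cone_line (engel_coframe (coord \<kappa>2 p)) (0 * x + 1 * y) (- 1 * x + 0 * y)"
      using new_engel_chart[OF \<kappa>1(1) quarter_turn] \<kappa>1(2) l1 by auto
    have "coord \<kappa>2 p = 0" unfolding \<kappa>2(3) 1 by (simp add: quarter_turn_def vec5_eq_iff)
    then show ?thesis using \<kappa>2 xy True by (metis add_0 add.right_neutral mult_eq_0_iff mult_zero_left zero_neq_neg_one)
  next
    case False
    then show ?thesis using \<kappa>1 1 l1 by blast
  qed
  then obtain \<kappa>2 x y where \<kappa>2: "engel_chart \<kappa>2" "p \<in> cdom \<kappa>2" "coord \<kappa>2 p = 0" "y \<noteq> 0"
    "l \<kappa>2 p = cone_line (engel_coframe (coord \<kappa>2 p)) x y" by blast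
  obtain \<kappa>3 where \<kappa>3: "engel_chart \<kappa>3" "p \<in> cdom \<kappa>3" "coord \<kappa>3 p = shear (x / y) (coord \<kappa>2 p)"
    "l \<kappa>3 p = cone_line (engel_coframe (coord \<kappa>3 p)) (1 * x + - (x / y) * y) (0 * x + 1 * y)"
    using new_engel_chart[OF \<kappa>2(1) shear[of "x / y"]] \<kappa>2(2,5) by auto
  have 3: "coord \<kappa>3 p = 0" unfolding \<kappa>3(3) \<kappa>2(3) by (simp add: shear_def vec5_eq_iff)
  have "l \<kappa>3 p = cone_line (engel_coframe 0) 0 1"
    using \<kappa>3(4) \<kappa>2(4) cone_line_rescale[OF \<kappa>2(4)] by (simp add: 3)
  then show ?thesis using \<kappa>3 3 by blast
qed

lemma vanish_imp_marked:
  assumes v: "vanish_on U [J, L, M, P, Q, R, S]" and \<kappa>0: "engel_chart \<kappa>0" "p \<in> cdom \<kappa>0"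
  shows "\<exists>zp z0 zm wm. marked_by p 1 0 zp z0 zm ((z0^2 - 4 * zp * zm) / 4) wm"
proof -
  obtain \<kappa> where \<kappa>: "engel_chart \<kappa>" "p \<in> cdom \<kappa>" "coord \<kappa> p = 0" "l \<kappa> p = cone_line (engel_coframe 0) 0 1"
    using normalised_chart[OF \<kappa>0] by blast
  have \<kappa>A: "\<kappa> \<in> A" using \<kappa> by (simp add: engel_chart_def)
  note ch = chart[OF \<kappa>A]
  let ?S = "coord \<kappa> ` cdom \<kappa>"
  define z where "z y = engel_coframe y *v dual (W \<kappa> (icoord \<kappa> y)) 4" for y
  note se' = chart_local_se[OF \<kappa>A W_coframe W(2)]
  have sz: "smooth_on ?S z"
    unfolding z_def[abs_def] by (intro smooth_intros ch(2) smooth_on_engel_coframe se_basic(2)[OF se'] se_basic(3)[OF se'])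
  have qz: "icoord \<kappa> y \<in> cdom \<kappa>" "coord \<kappa> (icoord \<kappa> y) = y"
    "z y = engel_coframe (coord \<kappa> (icoord \<kappa> y)) *v dual (W \<kappa> (icoord \<kappa> y)) 4" if "y \<in> ?S" for y
    using ch(7,8)[OF that] by (simp_all add: z_def)
  define D where "D = {y \<in> ?S. z y $ 4 \<noteq> 0}"
  have "continuous_on ?S (\<lambda>y. z y $ 4)" using smooth_on_continuous[OF smooth_on_vec_nth[OF ch(2) sz]] .
  then have "open (?S \<inter> (\<lambda>y. z y $ 4) -` (- {0}))" by (rule continuous_open_preimage) (auto simp: ch(2))
  moreover have "D = ?S \<inter> (\<lambda>y. z y $ 4) -` (- {0})" by (auto simp: D_def)
  ultimately have D: "open D" "D \<subseteq> ?S" by auto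
  \<comment> \<open>On the cone z is a multiple of (u^3, u^2, u, 1), so the last two components
    recover u.\<close>
  define u where "u y = z y $ 3 / z y $ 4" for y
  have su: "smooth_on D u"
    unfolding u_def[abs_def]
    by (intro smooth_intros D(1) smooth_on_subset[OF sz D(2)]) (auto simp: D_def)
  have zD: "z y = cone_point (z y $ 4) (u y) 1" if y: "y \<in> D" for y
  proof -
    have yS: "y \<in> ?S" and nz: "z y $ 4 \<noteq> 0" using y by (auto simp: D_def)
    obtain k a b where k: "z y = cone_point k a b"
      using mark_vector(1)[OF \<kappa>(1) qz(1)[OF yS]] unfolding qz(3)[OF yS, symmetric] by blast
    then have kb: "k \<noteq> 0" "b \<noteq> 0" using nz by (auto simp: cone_point_def)
    have "u y = a / b" using kb by (simp add: u_def k cone_point_def power2_eq_square power3_eq_cube)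
    then show ?thesis using kb
      by (simp add: k) (simp add: cone_point_def vec5_eq_iff power2_eq_square power3_eq_cube)
  qed
  have lD: "l \<kappa> (icoord \<kappa> y) = cone_line (engel_coframe y) (u y) 1" if y: "y \<in> D" for y
  proof -
    have yS: "y \<in> ?S" using y D(2) by auto
    from zD[OF y] have "engel_coframe (coord \<kappa> (icoord \<kappa> y)) *v dual (W \<kappa> (icoord \<kappa> y)) 4 = cone_point (z y $ 4) (u y) 1"
      unfolding qz(3)[OF yS, symmetric] .
    from mark_vector(3)[OF \<kappa>(1) qz(1)[OF yS] this] show ?thesis unfolding qz(2)[OF yS] .
  qed
  have 0: "0 \<in> ?S" "icoord \<kappa> 0 = p" using \<kappa>(2,3) ch(6)[OF \<kappa>(2)] by (force simp: image_iff)+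
  have z0: "\<exists>k. z 0 = cone_point k 0 1" "z 0 \<noteq> 0"
    using mark_vector(4)[OF \<kappa>(1,2), of 0 1] mark_vector(2)[OF \<kappa>(1,2)] \<kappa>(3,4) 0 by (simp_all add: z_def)
  then have "z 0 $ 4 \<noteq> 0" "z 0 $ 3 = 0" by (auto simp: cone_point_def vec5_eq_iff)
  then have 0: "0 \<in> D" "u 0 = 0" using 0 by (auto simp: D_def u_def)
  let ?\<beta> = "\<lambda>y. sheared_engel (u y) y" and ?\<theta> = "\<lambda>k y. - fd (\<lambda>y. sheared_engel (u y) y) k u y"
  note se = local_se_sheared_engel[OF D(1) su]
  have ad: "adapted_cubic (?\<beta> y) (C \<kappa> (icoord \<kappa> y)) (G \<kappa> (icoord \<kappa> y))" "adapted_mark (?\<beta> y) (l \<kappa> (icoord \<kappa> y))"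
    if y: "y \<in> D" for y
  proof -
    have yS: "y \<in> ?S" using y D(2) by auto
    have "adapted_cubic (engel_coframe y) (C \<kappa> (icoord \<kappa> y)) (G \<kappa> (icoord \<kappa> y))"
      using \<kappa>(1) qz(1,2)[OF yS] unfolding engel_chart_def by metis
    then show "adapted_cubic (?\<beta> y) (C \<kappa> (icoord \<kappa> y)) (G \<kappa> (icoord \<kappa> y))"
      unfolding sheared_engel_shear by (rule adapted_cubic_cone_map[OF _ cone_map_shear])
    show "adapted_mark (?\<beta> y) (l \<kappa> (icoord \<kappa> y))"
      using cone_line_cone_map[OF cone_map_shear[of "u y"], of "engel_coframe y" "u y" 1]
      unfolding adapted_mark_cone_line lD[OF y] sheared_engel_shear by simp
  qed
  have "([J, L, M, P, Q, R, S] ! k) (icoord \<kappa> y) = 0" if "y \<in> D" "k \<le> 6" for y k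
  proof -
    have "icoord \<kappa> y \<in> U" using qz(1) that(1) D(2) ch(3) by blast
    moreover have "[J, L, M, P, Q, R, S] ! k \<in> set [J, L, M, P, Q, R, S]" by (rule nth_mem) (use that in simp)
    ultimately show ?thesis using v unfolding vanish_on_def by blast
  qed
  then have "\<forall>k\<le>6. \<forall>y\<in>D. invariant ?\<beta> ?\<theta> k y = 0"
    using invariants_adapted[OF \<kappa>A D se ad, of 6] by simp
  then have "flat_function D u" using D(1) su by unfold_locales auto
  from flat_function.flat_function_form[OF this 0] obtain r zp z0 zm wm where r: "r > 0" "ball 0 r \<subseteq> D"
    and form: "\<And>y. y \<in> ball 0 r \<Longrightarrow> u y * Ys 1 zp z0 zm ((z0^2 - 4 * zp * zm) / 4) wm y + Yt 0 zp z0 zm ((z0^2 - 4 * zp * zm) / 4) wm y = 0"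
    by blast
  \<comment> \<open>The translation by 0 is the identity; it serves to restrict the chart to the
    ball on which the explicit form of u holds.\<close>
  have t0: "translate 0 y = y" "translate_back 0 y = y" for y by (simp_all add: translate_def translate_back_def vec5_eq_iff)
  have dp: "diffeo_pair (translate 0) (translate_back 0) (ball 0 r) (ball 0 r)"
    using translate(1)[of 0] by (auto simp: diffeo_pair_def t0 intro: smooth_on_subset)
  have em: "engel_map (translate 0) (\<lambda>_. mat 1) (ball 0 r) (\<lambda>_. 1) (\<lambda>_. 0) (\<lambda>_. 0) (\<lambda>_. 1)"
    using translate(2)[of 0] by (simp add: engel_map_def)
  obtain \<kappa>' where \<kappa>': "engel_chart \<kappa>'" "cdom \<kappa>' = {q \<in> cdom \<kappa>. coord \<kappa> q \<in> ball 0 r}"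
    "\<And>q. q \<in> cdom \<kappa>' \<Longrightarrow> coord \<kappa>' q = translate 0 (coord \<kappa> q)"
    "\<And>q x y. q \<in> cdom \<kappa>' \<Longrightarrow> l \<kappa> q = cone_line (engel_coframe (coord \<kappa> q)) x y \<Longrightarrow>
       l \<kappa>' q = cone_line (engel_coframe (coord \<kappa>' q)) (1 * x + 0 * y) (0 * x + 1 * y)"
    using new_engel_chart[OF \<kappa>(1) dp em] by blast
  have "marked_by p 1 0 zp z0 zm ((z0^2 - 4 * zp * zm) / 4) wm"
    unfolding marked_by_def
  proof (intro exI[of _ \<kappa>'] conjI ballI)
    show "engel_chart \<kappa>'" "p \<in> cdom \<kappa>'" using \<kappa>' \<kappa> r(1) by auto
    then show "coord \<kappa>' p = 0" using \<kappa>'(3) \<kappa>(3) t0 by simp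
    fix q assume q: "q \<in> cdom \<kappa>'"
    let ?y = "coord \<kappa> q"
    have qq: "q \<in> cdom \<kappa>" "?y \<in> ball 0 r" using q \<kappa>'(2) by auto
    have "l \<kappa> q = cone_line (engel_coframe ?y) (u ?y) 1"
      using lD[of ?y] qq r(2) ch(6)[OF qq(1)] by auto
    from \<kappa>'(4)[OF q this] have "l \<kappa>' q = cone_line (engel_coframe (coord \<kappa>' q)) (u ?y) 1" by simp
    then show "\<exists>x y. (x \<noteq> 0 \<or> y \<noteq> 0) \<and> l \<kappa>' q = cone_line (engel_coframe (coord \<kappa>' q)) x y \<and>
        x * Ys 1 zp z0 zm ((z0^2 - 4 * zp * zm) / 4) wm (coord \<kappa>' q) + y * Yt 0 zp z0 zm ((z0^2 - 4 * zp * zm) / 4) wm (coord \<kappa>' q) = 0"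
      using form[OF qq(2)] \<kappa>'(3)[OF q] t0 by (intro exI[of _ "u ?y"] exI[of _ 1]) simp
  qed
  then show ?thesis by blast
qed

lemma vanish_imp_flat:
  assumes v: "vanish_on U [J, L, M, P, Q, R, S]" and e: "\<And>p. p \<in> U \<Longrightarrow> \<exists>\<kappa>. engel_chart \<kappa> \<and> p \<in> cdom \<kappa>"
  shows "flat U A C G l"
  unfolding flat_def
proof
  fix p assume "p \<in> U"
  then obtain \<kappa> where "engel_chart \<kappa>" "p \<in> cdom \<kappa>" using e by blast
  from vanish_imp_marked[OF v this] marked_by_normal_form marked_by_flat
  show "\<exists>\<kappa>\<in>A. p \<in> cdom \<kappa> \<and> (\<forall>q\<in>cdom \<kappa>. adapted_cubic (engel_coframe (coord \<kappa> q)) (C \<kappa> q) (G \<kappa> q) \<and>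
    adapted_mark (engel_coframe (coord \<kappa> q)) (l \<kappa> q))" by blast
qed

end

end

section \<open>Differential equations\<close>

lemma Ck_on_local:
  assumes "\<And>x. x \<in> S \<Longrightarrow> \<exists>T. open T \<and> x \<in> T \<and> Ck_on k T f"
  shows "Ck_on k S f"
  using assms
proof (induction k arbitrary: f)
  case 0
  show ?case unfolding Ck_on.simps
  proof (rule continuous_at_imp_continuous_on, rule ballI)
    fix x assume "x \<in> S"
    then obtain T where "open T" "x \<in> T" "Ck_on 0 T f" using 0 by blast
    then show "isCont f x" by (simp add: continuous_on_eq_continuous_at)
  qed
next
  case (Suc k)
  show ?case unfolding Ck_on.simps
  proof (intro conjI ballI allI)
    fix x assume "x \<in> S"
    then obtain T where "x \<in> T" "Ck_on (Suc k) T f" using Suc.prems by blast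
    then show "f differentiable (at x)" by simp
  next
    fix v show "Ck_on k S (\<lambda>x. fder f x v)"
    proof (rule Suc.IH)
      fix x assume "x \<in> S"
      then obtain T where "open T" "x \<in> T" "Ck_on (Suc k) T f" using Suc.prems by blast
      then show "\<exists>T. open T \<and> x \<in> T \<and> Ck_on k T (\<lambda>x. fder f x v)" by auto
    qed
  qed
qed

text \<open>Fixed point in the space of bounded continuous functions of (t, y). Time is clamped to
  [-\<epsilon>, \<epsilon>] by \<open>\<tau>\<close>, and the integral from 0 to t is rescaled to
  [0, 1], so that joint continuity follows from continuity of integrals in parameters. The bound
  \<epsilon> L \<le> 1/2 makes the map a contraction.\<close>

lemma picard_existence:
  fixes f :: "real \<Rightarrow> 'p::metric_space \<Rightarrow> 'e::euclidean_space \<Rightarrow> 'e"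
  assumes cont: "continuous_on UNIV (\<lambda>(t, y, x). f t y x)" and bnd: "\<And>t y. norm (f t y 0) \<le> K"
    and lip: "\<And>t y x x'. norm (f t y x - f t y x') \<le> L * norm (x - x')" and g: "continuous_on UNIV g" "bounded (range g)"
    and \<epsilon>: "0 < \<epsilon>" "\<epsilon> * L \<le> 1/2"
  shows "\<exists>u. continuous_on UNIV (\<lambda>(t, y). u t y) \<and> (\<forall>y. u 0 y = g y) \<and>
    (\<forall>t y. \<bar>t\<bar> < \<epsilon> \<longrightarrow> ((\<lambda>s. u s y) has_vector_derivative f t y (u t y)) (at t))"
proof -
  obtain b :: 'e where b: "b \<in> Basis" using nonempty_Basis by blast
  have L: "0 \<le> L" using order_trans[OF norm_ge_zero lip[of 0 undefined b 0]] b by simp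
  define \<tau> where "\<tau> t = max (- \<epsilon>) (min \<epsilon> t)" for t :: real
  have \<tau>: "\<bar>\<tau> t\<bar> \<le> \<epsilon>" for t using \<epsilon>(1) by (auto simp: \<tau>_def)
  have \<tau>c: "continuous_on UNIV \<tau>" unfolding \<tau>_def[abs_def] by (intro continuous_intros)
  define I where "I u z = integral {0..1} (\<lambda>\<sigma>. f (\<sigma> * \<tau> (fst z)) (snd z) (apply_bcontfun u (\<sigma> * \<tau> (fst z), snd z)))"
    for u :: "(real \<times> 'p) \<Rightarrow>\<^sub>C 'e" and z :: "real \<times> 'p"
  define G where "G u z = g (snd z) + \<tau> (fst z) *\<^sub>R I u z" for u z
  have cf: "continuous_on (UNIV \<times> cbox 0 1)
      (\<lambda>(z, \<sigma>). f (\<sigma> * \<tau> (fst z)) (snd z) (apply_bcontfun u (\<sigma> * \<tau> (fst z), snd z)))" for u :: "(real \<times> 'p) \<Rightarrow>\<^sub>C 'e"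
  proof -
    have "continuous_on (UNIV \<times> cbox 0 1) (\<lambda>q::(real \<times> 'p) \<times> real. (snd q * \<tau> (fst (fst q)), snd (fst q),
        apply_bcontfun u (snd q * \<tau> (fst (fst q)), snd (fst q))))"
      by (intro continuous_intros continuous_on_compose2[OF \<tau>c] continuous_on_compose2[OF continuous_on_apply_bcontfun[of UNIV u]] subset_UNIV)
    from continuous_on_compose2[OF cont this] show ?thesis by (simp add: case_prod_beta)
  qed
  have cz: "continuous_on {0..1} (\<lambda>\<sigma>. f (\<sigma> * \<tau> (fst z)) (snd z) (apply_bcontfun u (\<sigma> * \<tau> (fst z), snd z)))" for u z
    proof -
    have "Pair z ` {0..1::real} \<subseteq> UNIV \<times> cbox 0 1" by auto
    from continuous_on_compose2[OF cf[of u] _ this] show ?thesis by (simp add: continuous_on_Pair)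
  qed
  have int: "(\<lambda>\<sigma>. f (\<sigma> * \<tau> (fst z)) (snd z) (apply_bcontfun u (\<sigma> * \<tau> (fst z), snd z))) integrable_on {0..1}" for u z
    by (rule integrable_continuous_real)
      (rule cz)
  have Gc: "continuous_on UNIV (G u)" for u
    unfolding G_def[abs_def] I_def
    using integral_continuous_on_param[OF cf[of u]]
    by (intro continuous_intros continuous_on_compose2[OF g(1)] continuous_on_compose2[OF \<tau>c] subset_UNIV) auto
  have Gb: "bounded (range (G u))" for u
  proof -
    obtain B where B: "\<And>z. norm (apply_bcontfun u z) \<le> B"
      using bounded_apply_bcontfun[of u] by (auto simp: bounded_iff)
    obtain B' where B': "\<And>y. norm (g y) \<le> B'" using g(2) by (auto simp: bounded_iff)
    have fb: "norm (f t y (apply_bcontfun u z)) \<le> K + L * B" for t y z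
    proof -
      have "norm (f t y (apply_bcontfun u z)) \<le> norm (f t y 0) + norm (f t y (apply_bcontfun u z) - f t y 0)" by norm
      also have "\<dots> \<le> K + L * norm (apply_bcontfun u z)" using bnd[of t y] lip[of t y "apply_bcontfun u z" 0] by simp
      finally show ?thesis using mult_left_mono[OF B L, of z] by simp
    qed
    have Ib: "norm (I u z) \<le> K + L * B" for z
      using integral_bound[of 0 1, OF _ cz[of z u] fb] by (simp add: I_def)
    have "norm (G u z) \<le> B' + \<epsilon> * (K + L * B)" for z
      unfolding G_def using B'[of "snd z"] \<tau>[of "fst z"] Ib[of z]
      by (intro order_trans[OF norm_triangle_ineq] add_mono) (simp_all add: mult_mono)
    then show ?thesis by (auto simp: bounded_iff)
  qed
  have GB: "apply_bcontfun (Bcontfun (G u)) = G u" for u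
    using Gc Gb by (intro Bcontfun_inverse) (simp add: bcontfun_def)
  have contr: "dist (Bcontfun (G u)) (Bcontfun (G v)) \<le> 1/2 * dist u v" for u v
  proof (rule dist_bound)
    fix z
    have "norm (f t y (apply_bcontfun u w) - f t y (apply_bcontfun v w)) \<le> L * dist u v" for t y w
      using lip[of t y "apply_bcontfun u w" "apply_bcontfun v w"] mult_left_mono[OF dist_bounded[of u w v] L]
      by (simp add: dist_norm)
    then have "norm (I u z - I v z) \<le> L * dist u v"
      unfolding I_def integral_diff[OF int int, symmetric]
      using integral_bound[of 0 1 "\<lambda>\<sigma>. f (\<sigma> * \<tau> (fst z)) (snd z) (apply_bcontfun u (\<sigma> * \<tau> (fst z), snd z)) -
         f (\<sigma> * \<tau> (fst z)) (snd z) (apply_bcontfun v (\<sigma> * \<tau> (fst z), snd z))" "L * dist u v"]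
        cz[of z u] cz[of z v] by (simp add: continuous_on_diff)
    then have "norm (\<tau> (fst z) *\<^sub>R (I u z - I v z)) \<le> \<epsilon> * (L * dist u v)"
      using \<tau>[of "fst z"] \<epsilon>(1) by (auto intro!: mult_mono)
    also have "\<dots> \<le> 1/2 * dist u v" using mult_right_mono[OF \<epsilon>(2), of "dist u v"] by (simp add: mult.assoc)
    finally show "dist (apply_bcontfun (Bcontfun (G u)) z) (apply_bcontfun (Bcontfun (G v)) z) \<le> 1/2 * dist u v"
      unfolding GB by (simp add: G_def dist_norm scaleR_diff_right)
  qed
  obtain u where u: "Bcontfun (G u) = u"
    using banach_fix_type[of "1/2" "\<lambda>u. Bcontfun (G u)"] contr by auto
  have GBu: "apply_bcontfun u = G u" using GB[of u] unfolding u .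
  define U where "U t y = apply_bcontfun u (t, y)" for t y
  have UG: "U t y = g y + \<tau> t *\<^sub>R integral {0..1} (\<lambda>\<sigma>. f (\<sigma> * \<tau> t) y (U (\<sigma> * \<tau> t) y))" for t y
    unfolding U_def fun_cong[OF GBu, of "(t, y)"] G_def I_def fst_conv snd_conv ..
  have Uc: "continuous_on UNIV (\<lambda>(t, y). U t y)"
    using Gc[of u] unfolding GBu[symmetric] U_def case_prod_beta by simp
  have "((\<lambda>s. U s y) has_vector_derivative f t y (U t y)) (at t)" if t: "\<bar>t\<bar> < \<epsilon>" for t y
  proof -
    have "continuous_on UNIV (\<lambda>s. (s, y, U s y))"
      by (intro continuous_intros) (use continuous_on_compose2[OF Uc, of UNIV "\<lambda>s. (s, y)"] in \<open>simp add: continuous_on_Pair\<close>)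
    from continuous_on_compose2[OF cont this] have F: "continuous_on UNIV (\<lambda>s. f s y (U s y))" by simp
    \<comment> \<open>An antiderivative along the solution itself; substituting \<sigma> s for the
      time identifies the rescaled integral with \<open>H s - H 0\<close>.\<close>
    obtain H where H: "\<And>s. s \<in> {-\<epsilon>..\<epsilon>} \<Longrightarrow> (H has_vector_derivative f s y (U s y)) (at s within {-\<epsilon>..\<epsilon>})"
      using antiderivative_continuous[OF continuous_on_subset[OF F subset_UNIV, of "{-\<epsilon>..\<epsilon>}"]] by blast
    have UH: "U s y = g y - H 0 + H s" if s: "\<bar>s\<bar> \<le> \<epsilon>" for s
    proof -
      have "((\<lambda>\<sigma>. H (\<sigma> * s)) has_vector_derivative s *\<^sub>R f (\<sigma> * s) y (U (\<sigma> * s) y)) (at \<sigma> within {0..1})"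
        if \<sigma>: "\<sigma> \<in> {0..1}" for \<sigma>
      proof -
        have m: "x * s \<in> {-\<epsilon>..\<epsilon>}" if "x \<in> {0..1}" for x
        proof -
          have "\<bar>x * s\<bar> \<le> 1 * \<epsilon>" unfolding abs_mult using that s by (intro mult_mono) auto
          then show ?thesis by auto
        qed
        have "((\<lambda>\<sigma>. \<sigma> * s) has_vector_derivative s) (at \<sigma> within {0..1})"
          by (auto intro!: derivative_eq_intros simp: has_real_derivative_iff_has_vector_derivative[symmetric])
        from vector_diff_chain_within[OF this has_vector_derivative_within_subset[OF H[OF m[OF \<sigma>]]]] m
        show ?thesis by (simp add: o_def image_subset_iff)
      qed
      from fundamental_theorem_of_calculus[OF _ this]
      have "((\<lambda>\<sigma>. s *\<^sub>R f (\<sigma> * s) y (U (\<sigma> * s) y)) has_integral H s - H 0) {0..1}" by simp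
      then have "s *\<^sub>R integral {0..1} (\<lambda>\<sigma>. f (\<sigma> * s) y (U (\<sigma> * s) y)) = H s - H 0"
        by (simp add: integral_cmul integral_unique flip: integral_cmul)
      moreover have "\<tau> s = s" using s by (auto simp: \<tau>_def)
      ultimately show ?thesis using UG[of s y] by simp
    qed
    have ti: "t \<in> {-\<epsilon><..<\<epsilon>}" using t by auto
    have "(H has_vector_derivative f t y (U t y)) (at t)"
      using H[of t] ti at_within_interior[of t "{-\<epsilon>..\<epsilon>}"] by simp
    then have "((\<lambda>s. g y - H 0 + H s) has_vector_derivative f t y (U t y)) (at t)"
      by (auto intro!: derivative_eq_intros)
    then show ?thesis
      by (rule has_vector_derivative_transform_within_open[where S = "{-\<epsilon><..<\<epsilon>}"]) (use ti UH in auto)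
  qed
  moreover have "U 0 y = g y" for y using UG[of 0 y] \<epsilon>(1) by (simp add: \<tau>_def)
  ultimately show ?thesis using Uc by blast
qed

text \<open>A replacement for Gronwall's inequality: at a maximum of the norm on [-t, t] the mean
  value inequality bounds that maximum by the initial value, 3/4 of itself and t \<beta>. Absorbing
  it gives the factor 4.\<close>

lemma small_time_estimate:
  fixes R :: "real \<Rightarrow> 'e::real_normed_vector"
  assumes R: "\<And>s. \<bar>s\<bar> \<le> t \<Longrightarrow> (R has_vector_derivative R' s) (at s)"
    and bound: "\<And>s. \<bar>s\<bar> \<le> t \<Longrightarrow> norm (R' s) \<le> \<alpha> * norm (R s) + \<beta>"
    and t: "0 \<le> t" "0 \<le> \<alpha>" "t * \<alpha> \<le> 3/4" and s: "\<bar>s\<bar> \<le> t"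
  shows "norm (R s) \<le> 4 * (norm (R 0) + t * \<beta>)"
proof -
  have cont: "continuous_on {-t..t} (\<lambda>s. norm (R s))"
    by (intro continuous_on_norm continuous_at_imp_continuous_on ballI has_vector_derivative_continuous[OF R]) auto
  obtain m where m: "m \<in> {-t..t}" "\<And>s. s \<in> {-t..t} \<Longrightarrow> norm (R s) \<le> norm (R m)"
    using continuous_attains_sup[OF compact_Icc _ cont] t(1) by fastforce
  have b: "norm (R' s) \<le> \<alpha> * norm (R m) + \<beta>" if "s \<in> {-t..t}" for s
    using bound[of s] mult_left_mono[OF m(2)[OF that] t(2)] that by fastforce
  have nn: "0 \<le> \<alpha> * norm (R m) + \<beta>" using b[OF m(1)] norm_ge_zero order_trans by blast
  have "norm (R m - R 0) \<le> (\<alpha> * norm (R m) + \<beta>) * norm (m - 0)"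
  proof (rule differentiable_bound[of "{-t..t}"])
    fix s assume s: "s \<in> {-t..t}"
    show "(R has_derivative (\<lambda>h. h *\<^sub>R R' s)) (at s within {-t..t})"
      using R[of s] s by (auto simp: has_vector_derivative_def intro: has_derivative_at_withinI)
    show "onorm (\<lambda>h. h *\<^sub>R R' s) \<le> \<alpha> * norm (R m) + \<beta>"
      by (rule onorm_bound[OF nn]) (use b[OF s] in \<open>simp add: mult.commute mult_left_mono\<close>)
  qed (use t m in auto)
  also have "\<dots> \<le> (\<alpha> * norm (R m) + \<beta>) * t" using m(1) nn by (intro mult_left_mono) auto
  also have "\<dots> = (t * \<alpha>) * norm (R m) + t * \<beta>" by (simp add: algebra_simps)
  also have "\<dots> \<le> 3/4 * norm (R m) + t * \<beta>" using mult_right_mono[OF t(3) norm_ge_zero[of "R m"]] by simp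
  finally have "norm (R m) \<le> norm (R 0) + 3/4 * norm (R m) + t * \<beta>"
    using norm_triangle_sub[of "R m" "R 0"] by linarith
  then show ?thesis using m(2)[of s] s by (auto simp: abs_le_iff)
qed

text \<open>By compactness the derivative varies uniformly little near \<open>K\<close>; the mean
  value inequality then yields one \<delta> for the linear approximation at all points of
  \<open>K\<close>.\<close>

lemma uniformly_differentiable:
  fixes f :: "'a::euclidean_space \<Rightarrow> 'b::euclidean_space"
  assumes \<Omega>: "open \<Omega>" "Ck_on 1 \<Omega> f" and K: "compact K" "K \<subseteq> \<Omega>" and \<eta>: "0 < \<eta>"
  shows "\<exists>\<delta>>0. \<forall>z\<in>K. \<forall>k. norm k < \<delta> \<longrightarrow> norm (f (z + k) - f z - fder f z k) \<le> \<eta> * norm k"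
proof -
  let ?D = "\<lambda>z. fder f z"
  have der: "(f has_derivative ?D z) (at z)" if "z \<in> \<Omega>" for z using Ck_on_derivative[of 0 \<Omega> f] \<Omega>(2) that by simp
  have Dc: "continuous_on \<Omega> (\<lambda>z. ?D z b)" for b using \<Omega>(2) by simp
  have lin: "linear (?D z)" if "z \<in> \<Omega>" for z using der[OF that] has_derivative_linear by blast
  \<comment> \<open>Continuity of the derivative is known on single basis vectors; their errors add
    up, hence the division by the dimension.\<close>
  define \<eta>' where "\<eta>' = \<eta> / real (card (Basis::'a set))"
  have \<eta>': "0 < \<eta>'" using \<eta> by (simp add: \<eta>'_def)
  have "\<exists>\<delta>>0. \<forall>z\<in>K. \<forall>k. norm k < \<delta> \<longrightarrow> z + k \<in> \<Omega> \<and> (\<forall>b\<in>Basis. norm (?D (z + k) b - ?D z b) \<le> \<eta>')"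
  proof (rule ccontr)
    assume "\<not> ?thesis"
    then have "\<forall>n. \<exists>z k. z \<in> K \<and> norm k < inverse (real (Suc n)) \<and>
      \<not> (z + k \<in> \<Omega> \<and> (\<forall>b\<in>Basis. norm (?D (z + k) b - ?D z b) \<le> \<eta>'))" by (meson inverse_positive_iff_positive of_nat_0_less_iff zero_less_Suc)
    then obtain z k where zk: "\<And>n. z n \<in> K" "\<And>n. norm (k n) < inverse (real (Suc n))"
      and bad: "\<And>n. \<not> (z n + k n \<in> \<Omega> \<and> (\<forall>b\<in>Basis. norm (?D (z n + k n) b - ?D (z n) b) \<le> \<eta>'))" by metis
    obtain y r where y: "y \<in> K" "strict_mono r" "(z \<circ> r) \<longlonglongrightarrow> y"
      using K(1) zk(1) unfolding compact_def by blast
    have "(\<lambda>n. inverse (real (Suc n))) \<longlonglongrightarrow> 0" by (rule LIMSEQ_inverse_real_of_nat)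
    then have k0: "k \<longlonglongrightarrow> 0" by (rule Lim_null_comparison[rotated]) (use zk(2) less_imp_le in \<open>auto intro!: always_eventually\<close>)
    have zy: "(\<lambda>n. z (r n)) \<longlonglongrightarrow> y" using y(3) by (simp add: o_def)
    have ky: "(\<lambda>n. z (r n) + k (r n)) \<longlonglongrightarrow> y"
      using tendsto_add[OF zy LIMSEQ_subseq_LIMSEQ[OF k0 y(2), unfolded o_def]] by simp
    have y\<Omega>: "y \<in> \<Omega>" using y(1) K(2) by auto
    have ic: "isCont (\<lambda>z. ?D z b) y" for b using Dc[of b] y\<Omega> \<Omega>(1) by (simp add: continuous_on_eq_continuous_at)
    have "(\<lambda>n. norm (?D (z (r n) + k (r n)) b - ?D (z (r n)) b)) \<longlonglongrightarrow> 0" for b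
      using tendsto_norm[OF tendsto_diff[OF isCont_tendsto_compose[OF ic[of b] ky] isCont_tendsto_compose[OF ic[of b] zy]]] by simp
    then have "\<forall>\<^sub>F n in sequentially. norm (?D (z (r n) + k (r n)) b - ?D (z (r n)) b) < \<eta>'" for b
      using order_tendstoD(2) \<eta>' by blast
    then have "\<forall>\<^sub>F n in sequentially. \<forall>b\<in>Basis. norm (?D (z (r n) + k (r n)) b - ?D (z (r n)) b) < \<eta>'"
      by (intro eventually_ball_finite) auto
    moreover have "\<forall>\<^sub>F n in sequentially. z (r n) + k (r n) \<in> \<Omega>" using topological_tendstoD[OF ky \<Omega>(1) y\<Omega>] .
    ultimately have "\<forall>\<^sub>F n in sequentially. False" by eventually_elim (use bad less_imp_le in blast)
    then show False by simp
  qed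
  then obtain \<delta> where \<delta>: "\<delta> > 0" "\<And>z k. z \<in> K \<Longrightarrow> norm k < \<delta> \<Longrightarrow> z + k \<in> \<Omega>"
    "\<And>z k b. z \<in> K \<Longrightarrow> norm k < \<delta> \<Longrightarrow> b \<in> Basis \<Longrightarrow> norm (?D (z + k) b - ?D z b) \<le> \<eta>'" by blast
  have "norm (f (z + k) - f z - ?D z k) \<le> \<eta> * norm k" if z: "z \<in> K" and k: "norm k < \<delta>" for z k
  proof -
    have in\<Omega>: "x \<in> \<Omega>" if "x \<in> ball z \<delta>" for x
      using \<delta>(2)[OF z, of "x - z"] that by (simp add: dist_norm norm_minus_commute)
    have "norm (f (z + k) - f z - ?D z (z + k - z)) \<le> norm (z + k - z) * \<eta>"
    proof (rule differentiable_bound_linearization[where S = "ball z \<delta>" and f' = ?D])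
      fix t :: real assume t: "t \<in> {0..1}"
      have "norm (t *\<^sub>R k) \<le> 1 * norm k" unfolding norm_scaleR using t by (intro mult_right_mono) auto
      then show "z + t *\<^sub>R (z + k - z) \<in> ball z \<delta>" using k by (simp add: dist_norm)
    next
      fix x assume x: "x \<in> ball z \<delta>"
      then show "(f has_derivative ?D x) (at x within ball z \<delta>)" using der in\<Omega> has_derivative_at_withinI by blast
      show "onorm (?D x - ?D z) \<le> \<eta>"
      proof (rule onorm_bound)
        fix v
        have l: "linear (\<lambda>v. ?D x v - ?D z v)"
          using linear_compose_sub[OF lin lin] in\<Omega>[OF x] z K(2) by auto
        have "norm ((?D x - ?D z) v) = norm (\<Sum>b\<in>Basis. (v \<bullet> b) *\<^sub>R (?D x b - ?D z b))"
          using linear_euclidean_sum[OF l, of v] by simp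
        also have "\<dots> \<le> (\<Sum>b\<in>(Basis::'a set). norm v * \<eta>')"
        proof (rule sum_norm_le)
          fix b :: 'a assume b: "b \<in> Basis"
          have "norm (?D (z + (x - z)) b - ?D z b) \<le> \<eta>'" by (rule \<delta>(3)[OF z _ b]) (use x in \<open>simp add: dist_norm norm_minus_commute\<close>)
          then show "norm ((v \<bullet> b) *\<^sub>R (?D x b - ?D z b)) \<le> norm v * \<eta>'"
            unfolding norm_scaleR using Basis_le_norm[OF b, of v] by (intro mult_mono) auto
        qed
        also have "\<dots> = \<eta> * norm v" by (simp add: \<eta>'_def)
        finally show "norm ((?D x - ?D z) v) \<le> \<eta> * norm v" .
      qed (use \<eta> in auto)
    qed (use \<delta> in auto)
    then show ?thesis by (simp add: mult.commute)
  qed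
  then show ?thesis using \<delta>(1) by blast
qed

text \<open>The candidate W solves the linearised equation. The remainder u(s, y + h) - u(s, y) -
  W(s, h) satisfies a linear differential inequality whose inhomogeneity is of order \<eta> |h|, so
  \<open>small_time_estimate\<close> makes it small compared with h.\<close>

lemma parameter_derivative:
  fixes u :: "real \<Rightarrow> 'p::euclidean_space \<Rightarrow> 'e::euclidean_space" and f :: "real \<times> 'p \<times> 'e \<Rightarrow> 'e"
  assumes \<Omega>: "open \<Omega>" "Ck_on 1 \<Omega> f" and D: "open D" "y \<in> D"
    and graph: "\<And>s y. \<bar>s\<bar> < \<epsilon> \<Longrightarrow> y \<in> D \<Longrightarrow> (s, y, u s y) \<in> \<Omega>"
    and cont: "continuous_on ({-\<epsilon><..<\<epsilon>} \<times> D) (\<lambda>(s, y). u s y)"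
    and ode: "\<And>s y. \<bar>s\<bar> < \<epsilon> \<Longrightarrow> y \<in> D \<Longrightarrow> ((\<lambda>s. u s y) has_vector_derivative f (s, y, u s y)) (at s)"
    and g: "(u 0 has_derivative g') (at y)"
    and w: "\<And>s b. \<bar>s\<bar> < \<epsilon> \<Longrightarrow> b \<in> Basis \<Longrightarrow>
      ((\<lambda>s. w s b) has_vector_derivative fder f (s, y, u s y) (0, b, w s b)) (at s)"
      "\<And>b. b \<in> Basis \<Longrightarrow> w 0 b = g' b"
    and L: "\<And>s k. \<bar>s\<bar> < \<epsilon> \<Longrightarrow> norm (fder f (s, y, u s y) (0, 0, k)) \<le> L * norm k"
    and \<epsilon>: "\<epsilon> * L \<le> 1/2" "0 \<le> L" and t: "\<bar>t\<bar> < \<epsilon>"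
  shows "((\<lambda>y. u t y) has_derivative (\<lambda>v. \<Sum>b\<in>Basis. (v \<bullet> b) *\<^sub>R w t b)) (at y)"
proof -
  let ?Df = "\<lambda>s. fder f (s, y, u s y)"
  have \<epsilon>0: "0 < \<epsilon>" using t by linarith
  define T where "T = (\<bar>t\<bar> + \<epsilon>) / 2"
  have T: "\<bar>t\<bar> \<le> T" "T < \<epsilon>" "0 < T" using t \<epsilon>0 by (auto simp: T_def)
  have TI: "\<bar>s\<bar> < \<epsilon>" if "s \<in> {-T..T}" for s using that T by auto
  obtain r where r: "r > 0" "cball y r \<subseteq> D" using D open_contains_cball by blast
  define W where "W s v = (\<Sum>b\<in>Basis. (v \<bullet> b) *\<^sub>R w s b)" for s v
  have Dlin: "linear (?Df s)" if "\<bar>s\<bar> < \<epsilon>" for s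
    by (rule has_derivative_linear[OF Ck_on_derivative[of 0 \<Omega> f]]) (use \<Omega>(2) graph[OF that D(2)] in simp_all)
  have Wder: "((\<lambda>s. W s v) has_vector_derivative ?Df s (0, v, W s v)) (at s)" if s: "\<bar>s\<bar> < \<epsilon>" for s v
  proof -
    have "(0, v, W s v) = (\<Sum>b\<in>Basis. (v \<bullet> b) *\<^sub>R (0::real, b, w s b))"
      by (simp add: W_def prod_eq_iff fst_sum snd_sum euclidean_representation)
    then have "?Df s (0, v, W s v) = (\<Sum>b\<in>Basis. (v \<bullet> b) *\<^sub>R ?Df s (0, b, w s b))"
      by (simp only: linear_sum[OF Dlin[OF s]] linear_scale[OF Dlin[OF s]])
    then show ?thesis unfolding W_def
      by (auto intro!: derivative_eq_intros has_vector_derivative_sum w(1)[OF s] simp: has_vector_derivative_scaleR)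
  qed
  have gl: "linear g'" using g has_derivative_linear by blast
  have W0: "W 0 v = g' v" for v unfolding W_def using linear_euclidean_sum[OF gl, of v] w(2) by simp
  have "continuous_on {-T..T} (\<lambda>s. \<Sum>b\<in>Basis. norm (w s b))"
    by (intro continuous_on_sum continuous_on_norm continuous_at_imp_continuous_on ballI
        has_vector_derivative_continuous[OF w(1)] TI)
  then have "bounded ((\<lambda>s. \<Sum>b\<in>Basis. norm (w s b)) ` {-T..T})"
    using compact_continuous_image compact_Icc compact_imp_bounded by blast
  then obtain C where C0: "C > 0" and C: "\<And>s. s \<in> {-T..T} \<Longrightarrow> (\<Sum>b\<in>Basis. norm (w s b)) \<le> C"
    unfolding bounded_pos by (force simp: abs_le_iff)
  have WC: "norm (W s v) \<le> C * norm v" if "s \<in> {-T..T}" for s v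
  proof -
    have "norm (W s v) \<le> (\<Sum>b\<in>Basis. norm v * norm (w s b))"
      unfolding W_def by (rule sum_norm_le) (auto intro!: mult_right_mono Basis_le_norm)
    also have "\<dots> \<le> norm v * C" unfolding sum_distrib_left[symmetric] using C[OF that] by (intro mult_left_mono) auto
    finally show ?thesis by (simp add: mult.commute)
  qed
  define K where "K = (\<lambda>s. (s, y, u s y)) ` {-T..T}"
  have "continuous_on {-T..T} (\<lambda>s. u s y)"
    by (intro continuous_at_imp_continuous_on ballI has_vector_derivative_continuous[OF ode] TI D(2))
  then have K: "compact K" "K \<subseteq> \<Omega>"
    unfolding K_def using graph[OF _ D(2)] TI by (auto intro!: compact_continuous_image continuous_intros)
  have "continuous_on ({-T..T} \<times> cball y r) (\<lambda>(s, y). u s y)"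
    by (rule continuous_on_subset[OF cont]) (use TI r T in auto)
  then have uc: "uniformly_continuous_on ({-T..T} \<times> cball y r) (\<lambda>(s, y). u s y)"
    by (intro compact_uniformly_continuous compact_Times) auto
  \<comment> \<open>Collects the constants of \<open>small_time_estimate\<close>: 4 times the
    initial error and the accumulated inhomogeneity, both per unit of \<eta> |h|.\<close>
  define N where "N = 4 * (1 + T * (1 + C))"
  have N: "N > 0" using T C0 by (simp add: N_def add_pos_pos)
  have main: "\<exists>d>0. \<forall>h. norm h < d \<longrightarrow> norm (u t (y + h) - u t y - W t h) \<le> e * norm h" if e: "e > 0" for e
  proof -
    \<comment> \<open>The first bound gives the final error e |h|; the second gives T (L + \<eta>)
      \<le> 1/2 + 1/4, the 3/4 required by \<open>small_time_estimate\<close>.\<close>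
    define \<eta> where "\<eta> = min (e / N) (1 / (4 * \<epsilon>))"
    have \<eta>: "\<eta> > 0" "\<eta> * N \<le> e" "\<epsilon> * \<eta> \<le> 1/4"
      using e N \<epsilon>0 by (auto simp: \<eta>_def min_def field_simps)
    obtain d1 where d1: "d1 > 0" "\<And>z k. z \<in> K \<Longrightarrow> norm k < d1 \<Longrightarrow>
        norm (f (z + k) - f z - fder f z k) \<le> \<eta> * norm k"
      using uniformly_differentiable[OF \<Omega> K \<eta>(1)] by blast
    obtain d2 where d2: "d2 > 0" "\<And>h. norm h < d2 \<Longrightarrow> norm (u 0 (y + h) - u 0 y - g' h) \<le> \<eta> * norm h"
    proof -
      obtain d where "d > 0" "\<And>x. norm (x - y) < d \<Longrightarrow> norm (u 0 x - u 0 y - g' (x - y)) \<le> \<eta> * norm (x - y)"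
        using g \<eta>(1) unfolding has_derivative_at_alt by blast
      from this(1) this(2)[of "y + _"] show ?thesis by (intro that) auto
    qed
    obtain d3 where d3: "d3 > 0" "\<And>z z'. z \<in> {-T..T} \<times> cball y r \<Longrightarrow> z' \<in> {-T..T} \<times> cball y r \<Longrightarrow> dist z' z < d3 \<Longrightarrow>
        dist (case z' of (s, y) \<Rightarrow> u s y) (case z of (s, y) \<Rightarrow> u s y) < d1 / 2"
      using uc d1(1) unfolding uniformly_continuous_on_def by (metis half_gt_zero)
    define d where "d = min (min r d3) (min d2 (d1 / 2))"
    have "norm (u t (y + h) - u t y - W t h) \<le> e * norm h" if h: "norm h < d" for h
    proof -
      define R where "R s = u s (y + h) - u s y - W s h" for s
      have yh: "y + h \<in> cball y r" "y + h \<in> D" using h r by (auto simp: d_def dist_norm)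
      have du: "norm (u s (y + h) - u s y) < d1 / 2" if "s \<in> {-T..T}" for s
        using d3(2)[of "(s, y)" "(s, y + h)"] that yh r(1) h by (simp add: dist_norm dist_Pair_Pair d_def)
      let ?R' = "\<lambda>s. f (s, y + h, u s (y + h)) - f (s, y, u s y) - ?Df s (0, h, W s h)"
      have R: "(R has_vector_derivative ?R' s) (at s)" if "\<bar>s\<bar> \<le> T" for s
        unfolding R_def[abs_def]
        by (intro has_vector_derivative_diff ode Wder) (use that T D yh in auto)
      have R': "norm (?R' s) \<le> (L + \<eta>) * norm (R s) + \<eta> * (1 + C) * norm h" if s: "\<bar>s\<bar> \<le> T" for s
      proof -
        have sI: "s \<in> {-T..T}" "\<bar>s\<bar> < \<epsilon>" using s T by auto
        let ?z = "(s, y, u s y)" and ?k = "(0::real, h, u s (y + h) - u s y)"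
        have nk: "norm ?k \<le> norm h + norm (u s (y + h) - u s y)"
          by (simp add: norm_Pair) (metis norm_Pair norm_Pair_le)
        also have "\<dots> < d1" using du[OF sI(1)] h by (simp add: d_def)
        finally have 1: "norm (f (?z + ?k) - f ?z - ?Df s ?k) \<le> \<eta> * norm ?k"
          using d1(2)[of ?z ?k] sI(1) by (simp add: K_def)
        have "norm (u s (y + h) - u s y) \<le> norm (R s) + C * norm h"
        proof -
          have "u s (y + h) - u s y = R s + W s h" by (simp add: R_def)
          then show ?thesis using norm_triangle_ineq[of "R s" "W s h"] WC[OF sI(1), of h] by simp
        qed
        then have 2: "norm ?k \<le> norm h + (norm (R s) + C * norm h)" using nk by linarith
        have 3: "?R' s = (f (?z + ?k) - f ?z - ?Df s ?k) + ?Df s (0, 0, R s)"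
        proof -
          have "?k = (0, h, W s h) + (0, 0, R s)" by (simp add: R_def)
          then have "?Df s ?k = ?Df s (0, h, W s h) + ?Df s (0, 0, R s)" using linear_add[OF Dlin[OF sI(2)]] by metis
          then show ?thesis by simp
        qed
        have "norm (?R' s) \<le> \<eta> * norm ?k + L * norm (R s)"
          unfolding 3 by (rule order_trans[OF norm_triangle_ineq add_mono[OF 1 L[OF sI(2)]]])
        also have "\<dots> \<le> \<eta> * (norm h + (norm (R s) + C * norm h)) + L * norm (R s)"
          using 2 \<eta>(1) by (intro add_right_mono mult_left_mono) auto
        finally show ?thesis by (simp add: algebra_simps)
      qed
      have R0: "norm (R 0) \<le> \<eta> * norm h" using d2(2)[of h] h by (simp add: R_def W0 d_def)
      have TL: "T * (L + \<eta>) \<le> 3/4"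
      proof -
        have "T * (L + \<eta>) \<le> \<epsilon> * (L + \<eta>)" using T \<epsilon>(2) \<eta>(1) by (intro mult_right_mono) auto
        then show ?thesis using \<epsilon>(1) \<eta>(3) by (simp add: distrib_left)
      qed
      have "norm (R t) \<le> 4 * (norm (R 0) + T * (\<eta> * (1 + C) * norm h))"
        by (rule small_time_estimate[OF R R' _ _ TL T(1)]) (use T \<epsilon>(2) \<eta>(1) in auto)
      also have "\<dots> \<le> (\<eta> * N) * norm h" using R0 by (simp add: N_def algebra_simps)
      also have "\<dots> \<le> e * norm h" using \<eta>(2) by (intro mult_right_mono) auto
      finally show ?thesis by (simp add: R_def)
    qed
    moreover have "d > 0" using r d1 d2 d3 by (simp add: d_def)
    ultimately show ?thesis by blast
  qed
  have "bounded_linear (W t)"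
    unfolding W_def[abs_def] by (intro bounded_linear_sum bounded_linear_scaleR_left[THEN bounded_linear_compose] bounded_linear_inner_left)
  moreover have "\<exists>d>0. \<forall>x. norm (x - y) < d \<longrightarrow> norm (u t x - u t y - W t (x - y)) \<le> e * norm (x - y)" if "e > 0" for e
    using main[OF that] by (metis add_diff_cancel_left' diff_add_cancel add.commute)
  ultimately have "(u t has_derivative W t) (at y)" unfolding has_derivative_at_alt by blast
  then show ?thesis unfolding W_def .
qed

text \<open>Difference quotients along one direction bound the derivative in that direction; this
  turns the Lipschitz condition in x into a bound on the partial derivative.\<close>

lemma directional_bound:
  fixes f :: "'a::real_normed_vector \<Rightarrow> 'b::real_normed_vector"
  assumes f: "(f has_derivative f') (at z)" and d: "0 < d"
    and b: "\<And>\<tau>. 0 < \<tau> \<Longrightarrow> \<tau> * c < d \<Longrightarrow> norm (f (z + \<tau> *\<^sub>R v) - f z) \<le> \<tau> * B"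
  shows "norm (f' v) \<le> B"
proof (rule field_le_epsilon)
  fix e :: real assume e: "0 < e"
  define e' where "e' = e / (1 + norm v)"
  have e': "0 < e'" "e' * norm v \<le> e" using e by (auto simp: e'_def field_simps add_pos_nonneg)
  obtain \<delta> where \<delta>: "\<delta> > 0" "\<And>y. norm (y - z) < \<delta> \<Longrightarrow> norm (f y - f z - f' (y - z)) \<le> e' * norm (y - z)"
    using f e'(1) unfolding has_derivative_at_alt by blast
  define \<tau> where "\<tau> = min \<delta> d / (2 * (1 + \<bar>c\<bar> + norm v))"
  have p: "1 + \<bar>c\<bar> + norm v > 0" by (simp add: add_pos_nonneg)
  have q: "x / (2 * N) * N = x / 2" if "N > 0" for x N :: real using that by (simp add: field_simps)
  have \<tau>0: "\<tau> > 0" using \<delta>(1) d p by (simp add: \<tau>_def)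
  have "\<tau> * (1 + \<bar>c\<bar> + norm v) = min \<delta> d / 2"
    using q[OF p] by (simp add: \<tau>_def)
  moreover have "\<tau> * c \<le> \<tau> * (1 + \<bar>c\<bar> + norm v)" "\<tau> * norm v \<le> \<tau> * (1 + \<bar>c\<bar> + norm v)"
    using \<tau>0 norm_ge_zero[of v] abs_ge_self[of c] by (intro mult_left_mono; linarith)+
  moreover have "min \<delta> d / 2 < \<delta>" "min \<delta> d / 2 < d" using \<delta>(1) d by auto
  ultimately have \<tau>: "\<tau> * c < d" "\<tau> * norm v < \<delta>" by linarith+
  have "norm (f (z + \<tau> *\<^sub>R v) - f z - f' (\<tau> *\<^sub>R v)) \<le> e' * (\<tau> * norm v)"
    using \<delta>(2)[of "z + \<tau> *\<^sub>R v"] \<tau> \<tau>0 by simp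
  then have "norm (f' (\<tau> *\<^sub>R v)) \<le> \<tau> * B + e' * (\<tau> * norm v)"
    using b[OF \<tau>0 \<tau>(1)] norm_triangle_sub[of "f' (\<tau> *\<^sub>R v)" "f (z + \<tau> *\<^sub>R v) - f z"]
    by (simp add: norm_minus_commute)
  also have "f' (\<tau> *\<^sub>R v) = \<tau> *\<^sub>R f' v" using has_derivative_linear[OF f] linear_scale by blast
  finally have "\<tau> * norm (f' v) \<le> \<tau> * (B + e' * norm v)" using \<tau>0 by (simp add: algebra_simps)
  then have "norm (f' v) \<le> B + e' * norm v" using \<tau>0 by simp
  then show "norm (f' v) \<le> B + e" using e'(2) by linarith
qed

text \<open>The derivatives of \<open>u\<close> with respect to the parameters solve the linearised equation, whose coefficients
  are as smooth as \<open>f'\<close> and \<open>u\<close>; this gives one more derivative of \<open>u\<close>.\<close>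

theorem solution_Ck:
  fixes u :: "real \<Rightarrow> 'p::euclidean_space \<Rightarrow> 'e::euclidean_space" and f :: "real \<times> 'p \<times> 'e \<Rightarrow> 'e"
  assumes "open \<Omega>" "Ck_on k \<Omega> f" "open D"
    and "\<And>s y. \<bar>s\<bar> < \<epsilon> \<Longrightarrow> y \<in> D \<Longrightarrow> (s, y, u s y) \<in> \<Omega>"
    and "continuous_on ({-\<epsilon><..<\<epsilon>} \<times> D) (\<lambda>(s, y). u s y)"
    and "\<And>s y. \<bar>s\<bar> < \<epsilon> \<Longrightarrow> y \<in> D \<Longrightarrow> ((\<lambda>s. u s y) has_vector_derivative f (s, y, u s y)) (at s)"
    and "Ck_on k D (u 0)"
    and "\<And>s y x x'. \<bar>s\<bar> < \<epsilon> \<Longrightarrow> y \<in> D \<Longrightarrow> (s, y, x) \<in> \<Omega> \<Longrightarrow> (s, y, x') \<in> \<Omega> \<Longrightarrow>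
      norm (f (s, y, x) - f (s, y, x')) \<le> L * norm (x - x')"
    and \<epsilon>: "\<epsilon> * L \<le> 1/2" "0 \<le> L"
  shows "Ck_on k ({-\<epsilon><..<\<epsilon>} \<times> D) (\<lambda>(s, y). u s y)"
  using assms(1-8) \<epsilon>(1)
proof (induction k arbitrary: \<Omega> f D u \<epsilon>)
  case 0
  then show ?case by simp
next
  case (Suc k)
  note \<Omega> = Suc.prems(1,2) and D = Suc.prems(3) and graph = Suc.prems(4) and cont = Suc.prems(5)
    and ode = Suc.prems(6) and g = Suc.prems(7) and lip = Suc.prems(8) and \<epsilon>L = Suc.prems(9)
  let ?I = "{-\<epsilon><..<\<epsilon>}"
  let ?Df = "\<lambda>z. fder f z"
  have op: "open (?I \<times> D)" using D by (simp add: open_Times)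
  have fk: "Ck_on k \<Omega> f" "Ck_on 1 \<Omega> f" using Ck_on_SucD[OF \<Omega>(2)] Ck_on_le[OF \<Omega>(2), of 1] by (simp_all del: Ck_on.simps)
  have uk: "Ck_on k (?I \<times> D) (\<lambda>(s, y). u s y)"
    by (rule Suc.IH[OF \<Omega>(1) fk(1) D graph cont ode Ck_on_SucD[OF g] lip \<epsilon>L])
  have curve: "Ck_on k (?I \<times> D) (\<lambda>z. (fst z, snd z, u (fst z) (snd z)))"
  proof -
    have "Ck_on k (?I \<times> D) (\<lambda>z. (fst z, snd z, 0) + (0, 0, case z of (s, y) \<Rightarrow> u s y))"
      by (intro Ck_on_add[OF op] Ck_on_linear_comp[OF op _ uk] Ck_on_linear[OF op] bounded_linear_Pair
          bounded_linear_fst bounded_linear_snd bounded_linear_zero bounded_linear_ident)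
    then show ?thesis by (simp add: case_prod_beta)
  qed
  have curve_\<Omega>: "(\<lambda>z. (fst z, snd z, u (fst z) (snd z))) ` (?I \<times> D) \<subseteq> \<Omega>" using graph by auto
  have Dfk: "Ck_on k (?I \<times> D) (\<lambda>z. ?Df (fst z, snd z, u (fst z) (snd z)) v)" for v
    using Ck_on_compose[OF op \<Omega>(1) curve_\<Omega> curve, of "\<lambda>z. ?Df z v"] \<Omega>(2) by (auto simp del: split_paired_All)
  have fuk: "Ck_on k (?I \<times> D) (\<lambda>z. f (fst z, snd z, u (fst z) (snd z)))"
    by (rule Ck_on_compose[OF op \<Omega>(1) curve_\<Omega> curve fk(1)])
  have Dlin: "linear (?Df z)" if "z \<in> \<Omega>" for z
    by (rule has_derivative_linear[OF Ck_on_derivative[of 0 \<Omega> f]]) (use fk(2) that in simp_all)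
  have L: "norm (?Df (s, y, u s y) (0, 0, h)) \<le> L * norm h" if sy: "\<bar>s\<bar> < \<epsilon>" "y \<in> D" for s y h
  proof -
    obtain d where d: "d > 0" "ball (s, y, u s y) d \<subseteq> \<Omega>" using \<Omega>(1) graph[OF sy] open_contains_ball by blast
    have "norm (f ((s, y, u s y) + \<tau> *\<^sub>R (0, 0, h)) - f (s, y, u s y)) \<le> \<tau> * (L * norm h)"
      if \<tau>: "0 < \<tau>" "\<tau> * norm h < d" for \<tau>
    proof -
      have "(s, y, u s y + \<tau> *\<^sub>R h) \<in> \<Omega>" using d(2) \<tau> by (auto simp: dist_Pair_Pair dist_norm)
      from lip[OF sy this graph[OF sy]] show ?thesis using \<tau>(1) by (simp add: algebra_simps)
    qed
    moreover have "(f has_derivative ?Df (s, y, u s y)) (at (s, y, u s y))"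
      using Ck_on_derivative[of 0 \<Omega> f] fk(2) graph[OF sy] by simp
    ultimately show ?thesis using directional_bound[OF _ d(1), where f = f] by blast
  qed
  show ?case
  proof (rule Ck_on_local)
    fix z0 assume z0: "z0 \<in> ?I \<times> D"
    then obtain t0 y0 where t0: "z0 = (t0, y0)" "\<bar>t0\<bar> < \<epsilon>" "y0 \<in> D" by auto
    obtain r where r: "r > 0" "cball y0 r \<subseteq> D" using D t0(3) open_contains_cball by blast
    define T where "T = (\<bar>t0\<bar> + \<epsilon>) / 2"
    have T: "\<bar>t0\<bar> < T" "T < \<epsilon>" "0 < T" using t0(2) by (auto simp: T_def)
    have TL: "T * L \<le> 1/2" using mult_right_mono[OF less_imp_le[OF T(2)] \<epsilon>(2)] \<epsilon>L by linarith
    \<comment> \<open>Retractions of time and parameter to a compact box: the coefficients of the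
      linearised equation become globally defined and bounded, as \<open>picard_existence\<close>
      demands, and are unchanged near the point.\<close>
    define \<tau> where "\<tau> s = max (-T) (min T s)" for s :: real
    define \<pi> where "\<pi> y = closest_point (cball y0 r) y" for y :: 'p
    have \<tau>: "\<tau> s \<in> {-T..T}" "\<bar>\<tau> s\<bar> < \<epsilon>" for s using T by (auto simp: \<tau>_def)
    have \<pi>: "\<pi> y \<in> cball y0 r" for y unfolding \<pi>_def using r(1) by (intro closest_point_in_set) auto
    have \<tau>\<pi>: "\<tau> s = s" "\<pi> y = y" if "\<bar>s\<bar> < T" "y \<in> ball y0 r" for s y
      using that by (auto simp: \<tau>_def \<pi>_def intro!: closest_point_self)
    have \<tau>\<pi>c: "continuous_on S \<tau>" "continuous_on S' \<pi>" for S S'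
      unfolding \<tau>_def[abs_def] \<pi>_def[abs_def] using r(1)
      by (auto intro!: continuous_intros continuous_on_subset[OF continuous_on_closest_point])
    have cpt: "compact ({-T..T} \<times> cball y0 r)" "{-T..T} \<times> cball y0 r \<subseteq> ?I \<times> D"
      using r T by (auto intro: compact_Times)
    let ?c = "\<lambda>z. (fst z, snd z, u (fst z) (snd z))"
    have Dfc: "continuous_on (?I \<times> D) (\<lambda>z. ?Df (?c z) v)" for v using Ck_on_le[OF Dfk, of 0] by simp
    have in_ID: "(\<tau> s, \<pi> y) \<in> ?I \<times> D" for s y using \<tau>(2)[of s] \<pi>[of y] r by auto
    have c\<tau>\<pi>: "continuous_on UNIV (\<lambda>q::real \<times> 'p \<times> 'e. (\<tau> (fst q), \<pi> (fst (snd q))))"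
      by (intro continuous_intros continuous_on_compose2[OF \<tau>\<pi>c(1)[of UNIV]] continuous_on_compose2[OF \<tau>\<pi>c(2)[of UNIV]] subset_UNIV)
    have retract: "continuous_on UNIV (\<lambda>q::real \<times> 'p \<times> 'e. ?Df (?c (\<tau> (fst q), \<pi> (fst (snd q)))) v)" for v
      by (rule continuous_on_compose2[OF Dfc[of v] c\<tau>\<pi>]) (use in_ID in blast)
    have gder: "(u 0 has_derivative fder (u 0) y) (at y)" if "y \<in> D" for y
      using Ck_on_derivative[OF g that] .
    have gc: "continuous_on D (\<lambda>y. fder (u 0) y v)" for v
      using Ck_on_le[of k D "\<lambda>y. fder (u 0) y v" 0] g by simp
    let ?F = "\<lambda>b s y x. ?Df (?c (s, y)) (0, b, x)"
    have Fx: "?F b s y x = ?Df (?c (s, y)) (0, b, 0) + (\<Sum>e\<in>Basis. (x \<bullet> e) *\<^sub>R ?Df (?c (s, y)) (0, 0, e))"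
      if "(s, y) \<in> ?I \<times> D" for b s y x
    proof -
      have l: "linear (?Df (?c (s, y)))" using Dlin graph that by auto
      have 1: "linear (\<lambda>x. ?Df (?c (s, y)) (0, 0, x))"
        using linear_compose[OF _ l, of "\<lambda>x. (0, 0, x)"] by (simp add: o_def linear_iff)
      have "(0, b, x) = (0, b, 0) + (0::real, 0, x)" by simp
      then have "?F b s y x = ?Df (?c (s, y)) (0, b, 0) + ?Df (?c (s, y)) (0, 0, x)" using linear_add[OF l] by metis
      then show ?thesis using linear_euclidean_sum[OF 1, of x] by simp
    qed
    have FD: "?F b s y x - ?F b s y x' = ?Df (?c (s, y)) (0, 0, x - x')" if "(s, y) \<in> ?I \<times> D" for b s y x x'
    proof -
      have l: "linear (?Df (?c (s, y)))" using Dlin graph that by auto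
      show ?thesis using linear_diff[OF l, of "(0, b, x)" "(0, b, x')"] by simp
    qed
    have "\<exists>w. continuous_on UNIV (\<lambda>(s, y). w s y) \<and> (\<forall>y. w 0 y = fder (u 0) (\<pi> y) b) \<and>
      (\<forall>s y. \<bar>s\<bar> < T \<longrightarrow> ((\<lambda>s. w s y) has_vector_derivative ?F b (\<tau> s) (\<pi> y) (w s y)) (at s))" for b
    proof -
      have "continuous_on ({-T..T} \<times> cball y0 r) (\<lambda>z. norm (?Df (?c z) (0, b, 0)))"
        by (intro continuous_on_norm continuous_on_subset[OF Dfc cpt(2)])
      then have "bounded ((\<lambda>z. norm (?Df (?c z) (0, b, 0))) ` ({-T..T} \<times> cball y0 r))"
        using compact_continuous_image cpt(1) compact_imp_bounded by blast
      then obtain K where K: "\<And>z. z \<in> {-T..T} \<times> cball y0 r \<Longrightarrow> norm (?Df (?c z) (0, b, 0)) \<le> K"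
        unfolding bounded_iff ball_simps real_norm_def abs_norm_cancel by blast
      show ?thesis
      proof (rule picard_existence[where K = K and L = L])
        show "continuous_on UNIV (\<lambda>(s, y, x). ?F b (\<tau> s) (\<pi> y) x)"
        proof -
          have "(\<lambda>(s, y, x). ?F b (\<tau> s) (\<pi> y) x) = (\<lambda>q. ?Df (?c (\<tau> (fst q), \<pi> (fst (snd q)))) (0, b, 0) +
              (\<Sum>e\<in>Basis. (snd (snd q) \<bullet> e) *\<^sub>R ?Df (?c (\<tau> (fst q), \<pi> (fst (snd q)))) (0, 0, e)))"
            unfolding case_prod_beta by (rule ext) (rule Fx[OF in_ID])
          then show ?thesis by (simp only:) (intro continuous_intros retract)
        qed
        show "norm (?F b (\<tau> s) (\<pi> y) 0) \<le> K" for s y using K[of "(\<tau> s, \<pi> y)"] \<tau> \<pi> by auto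
        show "norm (?F b (\<tau> s) (\<pi> y) x - ?F b (\<tau> s) (\<pi> y) x') \<le> L * norm (x - x')" for s y x x'
          unfolding FD[OF in_ID] using L[of "\<tau> s" "\<pi> y" "x - x'"] in_ID[of s y] by auto
        show gy: "continuous_on UNIV (\<lambda>y. fder (u 0) (\<pi> y) b)"
          by (rule continuous_on_compose2[OF gc \<tau>\<pi>c(2)]) (use \<pi> r in auto)
        have "bounded ((\<lambda>y. fder (u 0) y b) ` cball y0 r)"
          by (intro compact_imp_bounded compact_continuous_image continuous_on_subset[OF gc] r(2)) auto
        then show "bounded (range (\<lambda>y. fder (u 0) (\<pi> y) b))"
          by (rule bounded_subset) (use \<pi> in auto)
      qed (use T TL in auto)
    qed
    then obtain w where wc: "\<And>b. continuous_on UNIV (\<lambda>(s, y). w b s y)"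
      and w0: "\<And>b y. w b 0 y = fder (u 0) (\<pi> y) b"
      and w: "\<And>b s y. \<bar>s\<bar> < T \<Longrightarrow> ((\<lambda>s. w b s y) has_vector_derivative ?F b (\<tau> s) (\<pi> y) (w b s y)) (at s)" by metis
    let ?B = "ball y0 r" and ?J = "{-T<..<T}"
    have BD: "?B \<subseteq> D" "?J \<times> ?B \<subseteq> ?I \<times> D" using r T by auto
    have opJ: "open (?J \<times> ?B)" by (simp add: open_Times)
    have w': "((\<lambda>s. w b s y) has_vector_derivative ?F b s y (w b s y)) (at s)" if "\<bar>s\<bar> < T" "y \<in> ?B" for b s y
      using w[OF that(1), of b y] \<tau>\<pi>[OF that] by simp
    \<comment> \<open>The induction hypothesis is applied to the linearised equation, a different
      equation on a different domain with the same Lipschitz constant; hence its generality.\<close>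
    have wk: "Ck_on k (?J \<times> ?B) (\<lambda>(s, y). w b s y)" for b
    proof (rule Suc.IH[where f = "\<lambda>q. ?F b (fst q) (fst (snd q)) (snd (snd q))" and \<Omega> = "?J \<times> ?B \<times> UNIV"])
      let ?\<Omega> = "?J \<times> ?B \<times> (UNIV :: 'e set)"
      show o: "open ?\<Omega>" by (simp add: open_Times)
      have Dq: "Ck_on k ?\<Omega> (\<lambda>q. ?Df (?c (fst q, fst (snd q))) v)" for v
        using Ck_on_compose[OF o op _ _ Dfk[of v], of "\<lambda>q. (fst q, fst (snd q))"] BD(2)
          Ck_on_linear[OF o bounded_linear_Pair[OF bounded_linear_fst bounded_linear_compose[OF bounded_linear_fst bounded_linear_snd]], of k]
        by force
      have Bl: "bounded_linear (\<lambda>q::real \<times> 'p \<times> 'e. snd (snd q) \<bullet> e)" for e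
        by (intro bounded_linear_compose[OF bounded_linear_inner_left] bounded_linear_compose[OF bounded_linear_snd] bounded_linear_snd)
      have "Ck_on k ?\<Omega> (\<lambda>q. ?Df (?c (fst q, fst (snd q))) (0, b, 0) +
          (\<Sum>e\<in>Basis. (snd (snd q) \<bullet> e) *\<^sub>R ?Df (?c (fst q, fst (snd q))) (0, 0, e)))"
        by (intro Ck_on_add[OF o] Ck_on_sum[OF o] Ck_on_bilinear[OF o bounded_bilinear_scaleR] Dq Ck_on_linear[OF o Bl])
      then show "Ck_on k ?\<Omega> (\<lambda>q. ?F b (fst q) (fst (snd q)) (snd (snd q)))"
        by (rule Ck_on_congI[OF o _ Fx]) (use BD(2) in auto)
      show "continuous_on (?J \<times> ?B) (\<lambda>(s, y). w b s y)" using wc continuous_on_subset by blast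
      have "Ck_on k D (\<lambda>y. fder (u 0) y b)" using g by simp
      then show "Ck_on k ?B (w b 0)"
        by (intro Ck_on_congI[OF open_ball Ck_on_subset[OF _ BD(1)]]) (use \<tau>\<pi>(2)[of 0] T w0 in auto)
      show "norm (?F b (fst (s, y, x)) (fst (snd (s, y, x))) (snd (snd (s, y, x))) -
          ?F b (fst (s, y, x')) (fst (snd (s, y, x'))) (snd (snd (s, y, x')))) \<le> L * norm (x - x')"
        if "\<bar>s\<bar> < T" "y \<in> ?B" for s y x x'
        using FD[of s y b x x'] L[of s y "x - x'"] that BD(1) T by fastforce
    qed (use w' TL in auto)
    have uy: "((\<lambda>y. u s y) has_derivative (\<lambda>v. \<Sum>b\<in>Basis. (v \<bullet> b) *\<^sub>R w b s y)) (at y)"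
      if sy: "\<bar>s\<bar> < T" "y \<in> ?B" for s y
    proof (rule parameter_derivative[where w = "\<lambda>s b. w b s y" and D = ?B and \<epsilon> = T and g' = "fder (u 0) y"])
      show "open \<Omega>" "Ck_on 1 \<Omega> f" using \<Omega> fk by auto
      show "continuous_on (?J \<times> ?B) (\<lambda>(s, y). u s y)" by (rule continuous_on_subset[OF cont BD(2)])
      show "(u 0 has_derivative fder (u 0) y) (at y)" using gder sy BD(1) by blast
      show "w b 0 y = fder (u 0) y b" for b using w0 \<tau>\<pi>(2)[OF sy] by simp
    qed (use sy T TL \<epsilon>(2) BD(1) graph ode L w'[OF _ sy(2)] in auto)
    have uz: "((\<lambda>z. u (fst z) (snd z)) has_derivative
        (\<lambda>v. fst v *\<^sub>R f (?c z) + (\<Sum>b\<in>Basis. (snd v \<bullet> b) *\<^sub>R w b (fst z) (snd z)))) (at z)"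
      if z: "z \<in> ?J \<times> ?B" for z
    proof -
      obtain s y where sy: "z = (s, y)" "\<bar>s\<bar> < T" "y \<in> ?B" using z by auto
      have fc: "continuous_on (?I \<times> D) (\<lambda>z. f (?c z))" using Ck_on_le[OF fuk, of 0] by simp
      \<comment> \<open>Joint differentiability from the partial derivative in y and a continuous
        partial derivative in s; the pair is swapped so that the continuous one comes
        second.\<close>
      have "((\<lambda>(y, s). u s y) has_derivative
          (\<lambda>(ty, ts). (\<Sum>b\<in>Basis. (ty \<bullet> b) *\<^sub>R w b s y) + blinfun_apply (blinfun_scaleR_left (f (?c (s, y)))) ts)) (at (y, s) within ?B \<times> ?J)"
      proof (rule has_derivative_partialsI)
        show "(u s has_derivative (\<lambda>v. \<Sum>b\<in>Basis. (v \<bullet> b) *\<^sub>R w b s y)) (at y within ?B)"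
          using uy[OF sy(2,3)] has_derivative_at_withinI by blast
        fix y' s' assume ys': "y' \<in> ?B" "s' \<in> ?J"
        then have "((\<lambda>s. u s y') has_vector_derivative f (?c (s', y'))) (at s')" using ode[of s' y'] T BD(1) by auto
        then show "((\<lambda>s. u s y') has_derivative blinfun_apply (blinfun_scaleR_left (f (?c (s', y'))))) (at s' within ?J)"
          by (auto simp: has_vector_derivative_def intro: has_derivative_at_withinI)
      next
        have "continuous_on (?B \<times> ?J) (\<lambda>(y, s). blinfun_scaleR_left (f (?c (s, y))))"
          unfolding case_prod_beta
          by (intro bounded_linear.continuous_on[OF bounded_linear_blinfun_scaleR_left] continuous_on_compose2[OF fc] continuous_intros)
            (use BD(2) in auto)
        then show "continuous (at (y, s) within ?B \<times> ?J) (\<lambda>(y, s). blinfun_scaleR_left (f (?c (s, y))))"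
          unfolding continuous_on_eq_continuous_within by (rule bspec) (use sy(2,3) in auto)
      qed (use sy in auto)
      then have "((\<lambda>(y, s). u s y) has_derivative
          (\<lambda>v. (\<Sum>b\<in>Basis. (fst v \<bullet> b) *\<^sub>R w b s y) + snd v *\<^sub>R f (?c (s, y)))) (at (y, s))"
        unfolding case_prod_beta blinfun_scaleR_left.rep_eq
        by (subst (asm) at_within_open[of "(y, s)" "?B \<times> ?J"]) (use sy(2,3) in \<open>auto simp: open_Times\<close>)
      then have h: "((\<lambda>q. u (snd q) (fst q)) has_derivative
          (\<lambda>v. (\<Sum>b\<in>Basis. (fst v \<bullet> b) *\<^sub>R w b s y) + snd v *\<^sub>R f (?c (s, y)))) (at (prod.swap z))"
        unfolding sy(1) case_prod_beta by simp
      have "(prod.swap has_derivative prod.swap) (at z)"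
        by (rule bounded_linear_imp_has_derivative)
          (simp add: prod.swap_def[abs_def] bounded_linear_Pair bounded_linear_fst bounded_linear_snd)
      from has_derivative_compose[OF this h] show ?thesis by (simp add: sy(1) add.commute)
    qed
    have "Ck_on (Suc k) (?J \<times> ?B) (\<lambda>z. u (fst z) (snd z))"
    proof (rule Ck_on_SucI[OF opJ uz])
      fix v
      have "Ck_on k (?J \<times> ?B) (\<lambda>z. w b (fst z) (snd z))" for b using wk[of b] unfolding case_prod_beta .
      then show "Ck_on k (?J \<times> ?B) (\<lambda>z. fst v *\<^sub>R f (?c z) + (\<Sum>b\<in>Basis. (snd v \<bullet> b) *\<^sub>R w b (fst z) (snd z)))"
        by (intro Ck_on_add[OF opJ] Ck_on_sum[OF opJ] Ck_on_linear_comp[OF opJ bounded_linear_scaleR_right] Ck_on_subset[OF fuk BD(2)])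
    qed
    then show "\<exists>T. open T \<and> z0 \<in> T \<and> Ck_on (Suc k) T (\<lambda>(s, y). u s y)"
      using opJ t0 T r(1) unfolding case_prod_beta
      by (intro exI[of _ "?J \<times> ?B"] conjI) auto
  qed
qed

lemma derivative_bounded_on_compact:
  fixes X :: "'a::euclidean_space \<Rightarrow> 'b::euclidean_space"
  assumes X: "smooth_on \<Omega> X" and K: "compact K" "K \<subseteq> \<Omega>"
  shows "\<exists>L\<ge>0. \<forall>x\<in>K. onorm (fder X x) \<le> L"
proof -
  have "continuous_on K (\<lambda>x. \<Sum>b\<in>Basis. norm (fder X x b))"
    by (intro continuous_intros continuous_on_subset[OF smooth_on_continuous[OF smooth_on_frechet[OF X]] K(2)])
  then have "bounded ((\<lambda>x. \<Sum>b\<in>Basis. norm (fder X x b)) ` K)"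
    using compact_continuous_image K(1) compact_imp_bounded by blast
  then obtain L where L: "L > 0" "\<And>x. x \<in> K \<Longrightarrow> norm (\<Sum>b\<in>Basis. norm (fder X x b)) \<le> L"
    unfolding bounded_pos by blast
  have "onorm (fder X x) \<le> L" if x: "x \<in> K" for x
  proof (rule onorm_bound)
    fix v
    have l: "linear (fder X x)" using smooth_on_linear_derivative[OF X] x K(2) by blast
    have "norm (fder X x v) \<le> (\<Sum>b\<in>Basis. norm v * norm (fder X x b))"
      unfolding linear_euclidean_sum[OF l, of v]
      by (rule sum_norm_le) (auto intro!: mult_right_mono Basis_le_norm)
    also have "\<dots> = norm v * (\<Sum>b\<in>Basis. norm (fder X x b))" by (simp add: sum_distrib_left)
    also have "\<dots> \<le> norm v * L" using L(2)[OF x] by (intro mult_left_mono) auto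
    finally show "norm (fder X x v) \<le> L * norm v" by (simp add: mult.commute)
  qed (use L in auto)
  then show ?thesis using L(1) less_imp_le by blast
qed

text \<open>Composing X with the closest-point retraction to a closed ball makes it globally
  Lipschitz and bounded. For short times, solutions that start in the half ball do not leave the
  ball, where the retraction is the identity.\<close>

theorem euclidean_flow:
  fixes X :: "'a::euclidean_space \<Rightarrow> 'a"
  assumes X: "open \<Omega>" "smooth_on \<Omega> X" and y0: "y0 \<in> \<Omega>"
  shows "\<exists>\<epsilon>>0. \<exists>r>0. \<exists>u. ball y0 r \<subseteq> \<Omega> \<and> smooth_on ({-\<epsilon><..<\<epsilon>} \<times> ball y0 r) (\<lambda>(s, y). u s y) \<and>
    (\<forall>y\<in>ball y0 r. u 0 y = y) \<and>
    (\<forall>s. \<forall>y\<in>ball y0 r. \<bar>s\<bar> < \<epsilon> \<longrightarrow> u s y \<in> \<Omega> \<and> ((\<lambda>s. u s y) has_vector_derivative X (u s y)) (at s))"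
proof -
  obtain R where R: "R > 0" "cball y0 R \<subseteq> \<Omega>" using X(1) y0 open_contains_cball by blast
  obtain L where L: "L \<ge> 0" "\<And>x. x \<in> cball y0 R \<Longrightarrow> onorm (fder X x) \<le> L"
    using derivative_bounded_on_compact[OF X(2) compact_cball R(2)] by blast
  have lip: "norm (X x - X x') \<le> L * norm (x - x')" if "x \<in> cball y0 R" "x' \<in> cball y0 R" for x x'
    proof (rule differentiable_bound[of "cball y0 R" X "\<lambda>x. fder X x"])
    fix z assume z: "z \<in> cball y0 R"
    then have "z \<in> \<Omega>" using R(2) by blast
    then show "(X has_derivative fder X z) (at z within cball y0 R)"
      by (rule has_derivative_at_withinI[OF smooth_on_derivative[OF X(2)]])
  qed (use that L(2) in auto)
  have "bounded (X ` cball y0 R)"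
    by (intro compact_imp_bounded compact_continuous_image continuous_on_subset[OF smooth_on_continuous[OF X(2)] R(2)] compact_cball)
  then obtain K where K: "K > 0" "\<And>x. x \<in> cball y0 R \<Longrightarrow> norm (X x) \<le> K" unfolding bounded_pos by blast
  define \<pi> where "\<pi> r = closest_point (cball y0 r)" for r
  have \<pi>: "\<pi> r x \<in> cball y0 r" "x \<in> cball y0 r \<Longrightarrow> \<pi> r x = x" "continuous_on UNIV (\<pi> r)"
    "norm (\<pi> r x - \<pi> r x') \<le> norm (x - x')" if "r > 0" for r x x'
  proof -
    have ne: "cball y0 r \<noteq> {}" using that by simp
    show "\<pi> r x \<in> cball y0 r" "x \<in> cball y0 r \<Longrightarrow> \<pi> r x = x" "continuous_on UNIV (\<pi> r)"
      unfolding \<pi>_def using closest_point_in_set[OF closed_cball ne] closest_point_self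
        continuous_on_closest_point[OF convex_cball closed_cball ne] by blast+
    show "norm (\<pi> r x - \<pi> r x') \<le> norm (x - x')"
      using closest_point_lipschitz[OF convex_cball closed_cball ne, of x x'] by (simp add: \<pi>_def dist_norm)
  qed
  \<comment> \<open>The first bound makes the Picard map contract; the second keeps the
    displacement, at most \<epsilon> K, below R / 2.\<close>
  define \<epsilon> where "\<epsilon> = min (1 / (2 * (L + 1))) (R / (4 * K))"
  have \<epsilon>: "\<epsilon> > 0" "\<epsilon> * L \<le> 1/2" "\<epsilon> * K < R / 2"
  proof -
    show "\<epsilon> > 0" using L K R by (simp add: \<epsilon>_def)
    have "\<epsilon> * L \<le> 1 / (2 * (L + 1)) * L" using L by (intro mult_right_mono) (auto simp: \<epsilon>_def)
    also have "\<dots> \<le> 1/2" using L by (simp add: field_simps)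
    finally show "\<epsilon> * L \<le> 1/2" .
    have "\<epsilon> * K \<le> R / (4 * K) * K" using K by (intro mult_right_mono) (auto simp: \<epsilon>_def)
    also have "\<dots> < R / 2" using K R by simp
    finally show "\<epsilon> * K < R / 2" .
  qed
  have Xc: "continuous_on UNIV (\<lambda>x. X (\<pi> R x))"
    by (rule continuous_on_compose2[OF smooth_on_continuous[OF X(2)] \<pi>(3)[OF R(1)]]) (use \<pi>(1)[OF R(1)] R(2) in blast)
  have "\<exists>u. continuous_on UNIV (\<lambda>(t, y). u t y) \<and> (\<forall>y. u 0 y = \<pi> (R/2) y) \<and>
    (\<forall>t y. \<bar>t\<bar> < \<epsilon> \<longrightarrow> ((\<lambda>s. u s y) has_vector_derivative X (\<pi> R (u t y))) (at t))"
  proof (rule picard_existence[where K = K and L = L])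
    show "continuous_on UNIV (\<lambda>(t::real, y::'a, x). X (\<pi> R x))"
      unfolding case_prod_beta by (intro continuous_on_compose2[OF Xc] continuous_intros subset_UNIV)
    show "norm (X (\<pi> R 0)) \<le> K" using K(2) \<pi>(1)[OF R(1)] by blast
    show "norm (X (\<pi> R x) - X (\<pi> R x')) \<le> L * norm (x - x')" for x x'
      using order_trans[OF lip[OF \<pi>(1)[OF R(1)] \<pi>(1)[OF R(1)]] mult_left_mono[OF \<pi>(4)[OF R(1)] L(1)]] .
    show "continuous_on UNIV (\<pi> (R/2))" using \<pi>(3) R(1) by simp
    show "bounded (range (\<pi> (R/2)))"
      by (rule bounded_subset[OF bounded_cball[of y0 "R/2"]]) (use \<pi>(1)[of "R/2"] R(1) in auto)
  qed (use \<epsilon> in auto)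
  then obtain u where uc: "continuous_on UNIV (\<lambda>(t, y). u t y)" and u0: "\<And>y. u 0 y = \<pi> (R/2) y"
    and u: "\<And>t y. \<bar>t\<bar> < \<epsilon> \<Longrightarrow> ((\<lambda>s. u s y) has_vector_derivative X (\<pi> R (u t y))) (at t)" by blast
  let ?B = "ball y0 (R/2)"
  have u0': "u 0 y = y" if "y \<in> ?B" for y using u0 \<pi>(2)[of "R/2" y] R(1) that by simp
  have stay: "u t y \<in> ball y0 R" if t: "\<bar>t\<bar> < \<epsilon>" and y: "y \<in> ?B" for t y
  proof -
    have "norm (u t y - u 0 y) \<le> K * norm (t - 0)"
    proof (rule differentiable_bound[of "{-\<epsilon><..<\<epsilon>}"])
      fix s assume "s \<in> {-\<epsilon><..<\<epsilon>}"
      then have s: "\<bar>s\<bar> < \<epsilon>" by auto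
      show "((\<lambda>s. u s y) has_derivative (\<lambda>h. h *\<^sub>R X (\<pi> R (u s y)))) (at s within {-\<epsilon><..<\<epsilon>})"
        using u[OF s, of y] by (auto simp: has_vector_derivative_def intro: has_derivative_at_withinI)
      have "norm (X (\<pi> R (u s y))) \<le> K" using K(2) \<pi>(1)[OF R(1)] by blast
      then show "onorm (\<lambda>h. h *\<^sub>R X (\<pi> R (u s y))) \<le> K"
        by (intro onorm_bound) (use K(1) in \<open>auto simp: mult.commute[of K] mult_left_mono\<close>)
    qed (use t \<epsilon> in auto)
    also have "\<dots> \<le> \<epsilon> * K" using t K(1) by (simp add: mult.commute mult_left_mono)
    also have "\<dots> < R / 2" by (rule \<epsilon>)
    finally show ?thesis
      using u0'[OF y] y norm_triangle_ineq[of "u t y - y" "y - y0"] by (simp add: dist_norm norm_minus_commute)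
  qed
  have uX: "((\<lambda>s. u s y) has_vector_derivative X (u t y)) (at t)" if t: "\<bar>t\<bar> < \<epsilon>" and y: "y \<in> ?B" for t y
    using u[OF t, of y] \<pi>(2)[OF R(1), of "u t y"] stay[OF that] by simp
  have "Ck_on k ({-\<epsilon><..<\<epsilon>} \<times> ?B) (\<lambda>(s, y). u s y)" for k
  proof (rule solution_Ck[where \<Omega> = "UNIV \<times> UNIV \<times> ball y0 R" and f = "\<lambda>q. X (snd (snd q))" and L = L])
    show o: "open (UNIV \<times> UNIV \<times> ball y0 R :: (real \<times> 'a \<times> 'a) set)" by (simp add: open_Times)
    have "smooth_on (UNIV \<times> UNIV \<times> ball y0 R :: (real \<times> 'a \<times> 'a) set) (\<lambda>q. X (snd (snd q)))"
      by (rule smooth_on_compose[OF o open_ball[of y0 R] _ _ smooth_on_subset[OF X(2)]])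
        (use R(2) in \<open>auto intro!: smooth_intros o\<close>)
    then show "Ck_on k (UNIV \<times> UNIV \<times> ball y0 R :: (real \<times> 'a \<times> 'a) set) (\<lambda>q. X (snd (snd q)))" by (rule smooth_onD)
    show "continuous_on ({-\<epsilon><..<\<epsilon>} \<times> ?B) (\<lambda>(s, y). u s y)" using uc continuous_on_subset by blast
    show "Ck_on k ?B (u 0)" by (rule Ck_on_congI[OF open_ball Ck_on_linear[OF open_ball bounded_linear_ident] u0'])
  qed (use stay uX lip L \<epsilon> in auto)
  moreover have "?B \<subseteq> \<Omega>" "ball y0 R \<subseteq> \<Omega>" using R by auto
  ultimately show ?thesis
    using \<epsilon>(1) R(1) u0' stay uX unfolding smooth_on_def
    by (intro exI[of _ \<epsilon>] conjI exI[of _ "R/2"] exI[of _ u]) auto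
qed

section \<open>Local flows on the manifold\<close>

context five_manifold
begin

lemma chart_image_open': "\<kappa> \<in> A \<Longrightarrow> open V \<Longrightarrow> open (coord \<kappa> ` (cdom \<kappa> \<inter> V))"
  by (rule chart_image_open) (auto intro: chart)

lemma transition_derivative:
  assumes \<kappa>: "\<kappa> \<in> A" "\<mu> \<in> A" and p: "p \<in> cdom \<kappa> \<inter> cdom \<mu>"
  shows "((\<lambda>y. coord \<mu> (icoord \<kappa> y)) has_derivative (\<lambda>v. tangent_map \<kappa> \<mu> id p *v v)) (at (coord \<kappa> p))"
proof -
  have y: "coord \<kappa> p \<in> coord \<kappa> ` (cdom \<kappa> \<inter> cdom \<mu>)" using p by blast
  note tr = chart_transition[OF \<kappa>]
  show ?thesis
    using smooth_on_derivative[OF tr y] jacobian_mult[OF tr y] by (simp add: tangent_map_def o_def)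
qed

text \<open>The flow is built in the coordinates of \<open>\<kappa>\<close> and kept inside this
  chart; smoothness and the differential equation in all other charts follow from the transition
  maps.\<close>

lemma local_flow_exists:
  assumes V: "open V" and X: "vector_field A V X" and \<kappa>: "\<kappa> \<in> A" and p: "p \<in> cdom \<kappa> \<inter> V"
  shows "\<exists>\<epsilon> D \<Phi>. p \<in> D \<and> D \<subseteq> cdom \<kappa> \<and> (\<forall>q\<in>D. \<forall>t. \<bar>t\<bar> < \<epsilon> \<longrightarrow> \<Phi> t q \<in> cdom \<kappa>) \<and> local_flow A V X \<epsilon> D \<Phi>"
proof -
  note ch = chart[OF \<kappa>]
  let ?\<Omega> = "coord \<kappa> ` (cdom \<kappa> \<inter> V)"
  have \<Omega>: "open ?\<Omega>" "?\<Omega> \<subseteq> coord \<kappa> ` cdom \<kappa>" using chart_image_open'[OF \<kappa> V] by auto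
  have sX: "smooth_on ?\<Omega> (X \<kappa> \<circ> icoord \<kappa>)" using X \<kappa> unfolding vector_field_def by blast
  have "coord \<kappa> p \<in> ?\<Omega>" using p by blast
  from euclidean_flow[OF \<Omega>(1) sX this] obtain \<epsilon> r u where \<epsilon>: "\<epsilon> > 0" "r > 0" and B: "ball (coord \<kappa> p) r \<subseteq> ?\<Omega>"
    and us: "smooth_on ({-\<epsilon><..<\<epsilon>} \<times> ball (coord \<kappa> p) r) (\<lambda>(s, y). u s y)"
    and u0: "\<And>y. y \<in> ball (coord \<kappa> p) r \<Longrightarrow> u 0 y = y"
    and u: "\<And>s y. \<bar>s\<bar> < \<epsilon> \<Longrightarrow> y \<in> ball (coord \<kappa> p) r \<Longrightarrow> u s y \<in> ?\<Omega>"
      "\<And>s y. \<bar>s\<bar> < \<epsilon> \<Longrightarrow> y \<in> ball (coord \<kappa> p) r \<Longrightarrow> ((\<lambda>s. u s y) has_vector_derivative X \<kappa> (icoord \<kappa> (u s y))) (at s)"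
    unfolding o_def by blast
  let ?B = "ball (coord \<kappa> p) r"
  define D where "D = {q \<in> cdom \<kappa>. coord \<kappa> q \<in> ?B}"
  define \<Phi> where "\<Phi> t q = icoord \<kappa> (u t (coord \<kappa> q))" for t q
  have D: "open D" "D \<subseteq> cdom \<kappa> \<inter> V" "p \<in> D"
  proof -
    have "D = cdom \<kappa> \<inter> coord \<kappa> -` ?B" by (auto simp: D_def)
    then show "open D" using continuous_open_preimage[OF ch(4) ch(1) open_ball] by simp
    show "D \<subseteq> cdom \<kappa> \<inter> V"
    proof
      fix q assume "q \<in> D"
      then have q: "q \<in> cdom \<kappa>" "coord \<kappa> q \<in> ?\<Omega>" using B by (auto simp: D_def)
      then obtain q' where "q' \<in> cdom \<kappa> \<inter> V" "coord \<kappa> q = coord \<kappa> q'" by blast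
      then show "q \<in> cdom \<kappa> \<inter> V" using q(1) ch(6) by (metis IntD1 IntD2 IntI)
    qed
    show "p \<in> D" using p \<epsilon> by (simp add: D_def)
  qed
  have DB: "coord \<kappa> q \<in> ?B" if "q \<in> D" for q using that by (simp add: D_def)
  have \<Phi>V: "\<Phi> t q \<in> cdom \<kappa> \<inter> V" "coord \<kappa> (\<Phi> t q) = u t (coord \<kappa> q)" if qD: "q \<in> D" and t: "\<bar>t\<bar> < \<epsilon>" for t q
  proof -
    obtain q' where "q' \<in> cdom \<kappa> \<inter> V" "u t (coord \<kappa> q) = coord \<kappa> q'" using u(1)[OF t DB[OF qD]] by blast
    then show "\<Phi> t q \<in> cdom \<kappa> \<inter> V" "coord \<kappa> (\<Phi> t q) = u t (coord \<kappa> q)" using ch(6) by (auto simp: \<Phi>_def)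
  qed
  let ?IB = "{-\<epsilon><..<\<epsilon>} \<times> ?B"
  have IB: "open ?IB" by (simp add: open_Times)
  have smooth: "smooth_on {(t, y). \<bar>t\<bar> < \<epsilon> \<and> y \<in> coord \<kappa>' ` (cdom \<kappa>' \<inter> D) \<and> \<Phi> t (icoord \<kappa>' y) \<in> cdom \<mu>}
          (\<lambda>(t, y). coord \<mu> (\<Phi> t (icoord \<kappa>' y)))" (is "smooth_on ?S _") if \<kappa>': "\<kappa>' \<in> A" and \<mu>: "\<mu> \<in> A" for \<kappa>' \<mu>
  proof -
    note ch' = chart[OF \<kappa>']
    let ?O = "coord \<kappa>' ` (cdom \<kappa>' \<inter> D)" and ?h = "\<lambda>z. u (fst z) (coord \<kappa> (icoord \<kappa>' (snd z)))"
    let ?T = "coord \<kappa> ` (cdom \<kappa> \<inter> cdom \<mu>)"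
    have O: "open ?O" by (rule chart_image_open'[OF \<kappa>' D(1)])
    have O1: "open ({-\<epsilon><..<\<epsilon>} \<times> ?O)" using O by (simp add: open_Times)
    have ic: "icoord \<kappa>' y \<in> cdom \<kappa>' \<inter> D" if "y \<in> ?O" for y using that ch'(6) by auto
    have "smooth_on ?O (\<lambda>y. coord \<kappa> (icoord \<kappa>' y))"
      by (rule smooth_on_subset[OF chart_transition[OF \<kappa>' \<kappa>]]) (use D(2) in blast)
    then have "smooth_on ({-\<epsilon><..<\<epsilon>} \<times> ?O) (\<lambda>z. coord \<kappa> (icoord \<kappa>' (snd z)))"
      by (intro smooth_on_compose[OF O1 O _ smooth_on_snd[OF O1 smooth_on_id[OF O1]]]) auto
    then have "smooth_on ({-\<epsilon><..<\<epsilon>} \<times> ?O) (\<lambda>z. (fst z, coord \<kappa> (icoord \<kappa>' (snd z))))"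
      by (intro smooth_intros O1)
    moreover have "(\<lambda>z. (fst z, coord \<kappa> (icoord \<kappa>' (snd z)))) ` ({-\<epsilon><..<\<epsilon>} \<times> ?O) \<subseteq> ?IB"
    proof
      fix x assume "x \<in> (\<lambda>z. (fst z, coord \<kappa> (icoord \<kappa>' (snd z)))) ` ({-\<epsilon><..<\<epsilon>} \<times> ?O)"
      then obtain s y where "s \<in> {-\<epsilon><..<\<epsilon>}" "y \<in> ?O" "x = (s, coord \<kappa> (icoord \<kappa>' y))" by force
      then show "x \<in> ?IB" using DB ic by blast
    qed
    ultimately have h: "smooth_on ({-\<epsilon><..<\<epsilon>} \<times> ?O) ?h"
      using smooth_on_compose[OF O1 IB _ _ us, of "\<lambda>z. (fst z, coord \<kappa> (icoord \<kappa>' (snd z)))"] by (simp add: case_prod_beta)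
    have T: "open ?T" using chart_image_open'[OF \<kappa> chart(1)[OF \<mu>]] .
    have hT: "?h (s, y) \<in> ?T \<longleftrightarrow> \<Phi> s (icoord \<kappa>' y) \<in> cdom \<mu>" if "\<bar>s\<bar> < \<epsilon>" "y \<in> ?O" for s y
    proof -
      have q: "icoord \<kappa>' y \<in> D" using ic that by blast
      have e: "?h (s, y) = coord \<kappa> (\<Phi> s (icoord \<kappa>' y))"
        using \<Phi>V(2)[OF q that(1)] by simp
      have m: "\<Phi> s (icoord \<kappa>' y) \<in> cdom \<kappa>" using \<Phi>V(1)[OF q that(1)] by blast
      show ?thesis
      proof
        assume "?h (s, y) \<in> ?T"
        then obtain x where x: "x \<in> cdom \<kappa>" "x \<in> cdom \<mu>" "coord \<kappa> (\<Phi> s (icoord \<kappa>' y)) = coord \<kappa> x" unfolding e by blast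
        have "\<Phi> s (icoord \<kappa>' y) = x" by (rule trans[OF ch(6)[OF m, unfolded x(3), symmetric] ch(6)[OF x(1)]])
        with x(2) show "\<Phi> s (icoord \<kappa>' y) \<in> cdom \<mu>" by simp
      next
        assume "\<Phi> s (icoord \<kappa>' y) \<in> cdom \<mu>"
        then show "?h (s, y) \<in> ?T" unfolding e using m by blast
      qed
    qed
    have S: "?S = ({-\<epsilon><..<\<epsilon>} \<times> ?O) \<inter> ?h -` ?T"
    proof (rule set_eqI)
      fix z show "z \<in> ?S \<longleftrightarrow> z \<in> ({-\<epsilon><..<\<epsilon>} \<times> ?O) \<inter> ?h -` ?T"
        using hT[of "fst z" "snd z"] by (cases z) auto
    qed
    have So: "open ?S" unfolding S by (rule continuous_open_preimage[OF smooth_on_continuous[OF h] O1 T])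
    have "smooth_on ?S (\<lambda>z. coord \<mu> (icoord \<kappa> (?h z)))"
      by (rule smooth_on_compose[OF So T _ smooth_on_subset[OF h] chart_transition[OF \<kappa> \<mu>]]) (use S in blast)+
    then show ?thesis unfolding \<Phi>_def case_prod_beta .
  qed
  have "local_flow A V X \<epsilon> D \<Phi>"
    unfolding local_flow_def
  proof (intro conjI allI ballI impI)
    show "0 < \<epsilon>" "open D" "D \<subseteq> V" using \<epsilon> D by auto
    show "\<Phi> t q \<in> V" if "q \<in> D" "\<bar>t\<bar> < \<epsilon>" for t q using \<Phi>V(1) that by blast
    show "\<Phi> 0 q = q" if "q \<in> D" for q using u0 DB[OF that] that ch(6) by (simp add: \<Phi>_def D_def)
    have uc: "continuous_on ?IB (\<lambda>(s, y). u s y)" by (rule smooth_on_continuous[OF us])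
    have S: "{(t, q). \<bar>t\<bar> < \<epsilon> \<and> q \<in> D} = {-\<epsilon><..<\<epsilon>} \<times> D" by auto
    have cc: "continuous_on ({-\<epsilon><..<\<epsilon>} \<times> D) (\<lambda>z. (fst z, coord \<kappa> (snd z)))"
      by (intro continuous_intros continuous_on_compose2[OF ch(4)]) (use D(2) in auto)
    have "continuous_on ({-\<epsilon><..<\<epsilon>} \<times> D) (\<lambda>z. u (fst z) (coord \<kappa> (snd z)))"
    proof -
      have "(\<lambda>z. (fst z, coord \<kappa> (snd z))) ` ({-\<epsilon><..<\<epsilon>} \<times> D) \<subseteq> ?IB" using DB by auto
      from continuous_on_compose2[OF uc cc this] show ?thesis by (simp add: case_prod_beta)
    qed
    then have "continuous_on ({-\<epsilon><..<\<epsilon>} \<times> D) (\<lambda>z. icoord \<kappa> (u (fst z) (coord \<kappa> (snd z))))"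
      by (rule continuous_on_compose2[OF ch(5)]) (use u(1) DB in \<open>force simp del: mem_ball\<close>)
    then show "continuous_on {(t, q). \<bar>t\<bar> < \<epsilon> \<and> q \<in> D} (\<lambda>(t, q). \<Phi> t q)"
      unfolding S by (simp add: \<Phi>_def case_prod_beta)
    fix q t \<mu> assume q: "q \<in> D" and \<mu>: "\<mu> \<in> A" and t: "\<bar>t\<bar> < \<epsilon> \<and> \<Phi> t q \<in> cdom \<mu>"
    have in\<kappa>: "\<Phi> t q \<in> cdom \<kappa> \<inter> cdom \<mu>" "\<Phi> t q \<in> V" using \<Phi>V(1)[OF q] t by auto
    have "((\<lambda>s. u s (coord \<kappa> q)) has_vector_derivative X \<kappa> (\<Phi> t q)) (at t)"
      using u(2)[of t "coord \<kappa> q"] t DB[OF q] by (simp add: \<Phi>_def)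
    then have "((\<lambda>s. coord \<mu> (icoord \<kappa> (u s (coord \<kappa> q)))) has_vector_derivative
        tangent_map \<kappa> \<mu> id (\<Phi> t q) *v X \<kappa> (\<Phi> t q)) (at t)"
      using transition_derivative[OF \<kappa> \<mu> in\<kappa>(1)] \<Phi>V(2)[OF q, of t] t
        vector_derivative_diff_chain_within[of "\<lambda>s. u s (coord \<kappa> q)" _ t UNIV "\<lambda>y. coord \<mu> (icoord \<kappa> y)"]
      by (simp add: o_def has_derivative_at_withinI)
    moreover have "X \<mu> (\<Phi> t q) = tangent_map \<kappa> \<mu> id (\<Phi> t q) *v X \<kappa> (\<Phi> t q)"
      using X \<kappa> \<mu> in\<kappa> unfolding vector_field_def by blast
    ultimately show "((\<lambda>s. coord \<mu> (\<Phi> s q)) has_vector_derivative X \<mu> (\<Phi> t q)) (at t)" by (simp add: \<Phi>_def)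
  qed (rule smooth)
  then show ?thesis using D \<Phi>V(1) by blast
qed

end

section \<open>Infinitesimal symmetries of the flat model\<close>

text \<open>On the interval, both vanishing and not vanishing persist near each point: the former by
  \<open>small_time_estimate\<close> without inhomogeneity, the latter by continuity. Connectedness
  of the interval does the rest.\<close>

lemma linear_ode_zero:
  fixes R :: "real \<Rightarrow> real^5"
  assumes M: "continuous_on {-\<epsilon><..<\<epsilon>} M"
    and R: "\<And>s. \<bar>s\<bar> < \<epsilon> \<Longrightarrow> (R has_vector_derivative M s *v R s) (at s)"
    and t: "\<bar>s\<bar> < \<epsilon>" "\<bar>t\<bar> < \<epsilon>" and 0: "R s = 0"
  shows "R t = 0"
proof -
  have loc: "\<forall>\<^sub>F b in at a within {-\<epsilon><..<\<epsilon>}. (R a = 0) = (R b = 0)" if a: "a \<in> {-\<epsilon><..<\<epsilon>}" for a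
  proof (cases "R a = 0")
    case False
    have "(R \<longlongrightarrow> R a) (at a)"
      using has_vector_derivative_continuous[OF R[of a]] a by (auto simp: isCont_def)
    then have "\<forall>\<^sub>F b in at a. R b \<noteq> 0" using False tendsto_imp_eventually_ne by blast
    then show ?thesis using False by (auto simp: eventually_at_filter elim: eventually_mono)
  next
    case True
    obtain d where d: "d > 0" "cball a d \<subseteq> {-\<epsilon><..<\<epsilon>}" using a open_contains_cball open_greaterThanLessThan by blast
    have "continuous_on (cball a d) (\<lambda>s. \<Sum>i\<in>UNIV. \<Sum>j\<in>UNIV. \<bar>M s $ i $ j\<bar>)"
      by (intro continuous_intros continuous_on_subset[OF M d(2)])
    then have "bounded ((\<lambda>s. \<Sum>i\<in>UNIV. \<Sum>j\<in>UNIV. \<bar>M s $ i $ j\<bar>) ` cball a d)"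
      using compact_continuous_image compact_cball compact_imp_bounded by blast
    then obtain K where K: "K > 0" "\<And>s. s \<in> cball a d \<Longrightarrow> (\<Sum>i\<in>UNIV. \<Sum>j\<in>UNIV. \<bar>M s $ i $ j\<bar>) \<le> K"
      unfolding bounded_pos by (auto simp: abs_le_iff)
    define T where "T = min d (3 / (4 * K))"
    have T: "T > 0" "T \<le> d" "T * K \<le> 3/4" using d(1) K(1) by (auto simp: T_def min_def field_simps)
    have "R (a + s) = 0" if s: "\<bar>s\<bar> \<le> T" for s
    proof -
      have in_J: "a + s \<in> cball a d" "\<bar>a + s\<bar> < \<epsilon>" if "\<bar>s\<bar> \<le> T" for s
      proof -
        show c: "a + s \<in> cball a d" using that T by (auto simp: dist_norm)
        then have "a + s \<in> {-\<epsilon><..<\<epsilon>}" using d(2) by blast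
        then show "\<bar>a + s\<bar> < \<epsilon>" by auto
      qed
      have "norm (R (a + s)) \<le> 4 * (norm (R (a + 0)) + T * 0)"
      proof (rule small_time_estimate[where R = "\<lambda>s. R (a + s)" and \<alpha> = K, OF _ _ _ _ _ s])
        fix s assume s: "\<bar>s\<bar> \<le> T"
        show "((\<lambda>s. R (a + s)) has_vector_derivative M (a + s) *v R (a + s)) (at s)"
          using vector_diff_chain_at[of "\<lambda>s. a + s" 1 s R] R[OF in_J(2)[OF s]]
          by (simp add: o_def has_vector_derivative_add_const has_vector_derivative_id add.commute[of a])
        have "norm (M (a + s) *v R (a + s)) \<le> onorm ((*v) (M (a + s))) * norm (R (a + s))"
          by (rule onorm[OF matrix_vector_mul_bounded_linear])
        also have "\<dots> \<le> K * norm (R (a + s))"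
          by (intro mult_right_mono order_trans[OF onorm_le_matrix_component_sum K(2)] in_J s) auto
        finally show "norm (M (a + s) *v R (a + s)) \<le> K * norm (R (a + s)) + 0" by simp
      qed (use T K in auto)
      then show ?thesis using True by simp
    qed
    note Rs = this
    have "R b = 0" if "dist b a < T" for b using Rs[of "b - a"] that by (simp add: dist_norm)
    then show ?thesis using True T(1) unfolding eventually_at by blast
  qed
  have "(R s = 0) = (R t = 0)"
    by (rule connected_local_const[of "{-\<epsilon><..<\<epsilon>}"]) (use loc t in auto)
  then show ?thesis using 0 by simp
qed

text \<open>Time and space derivatives of the flow are interchanged by symmetry of its second
  derivative as a function of both variables.\<close>

lemma variational_equation:
  fixes f :: "real \<times> 'a::euclidean_space \<Rightarrow> 'a"
  assumes O: "open O1" and \<Omega>: "open \<Omega>" "smooth_on \<Omega> X"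
    and f: "smooth_on ({-\<epsilon><..<\<epsilon>} \<times> O1) f" "\<And>t y. \<bar>t\<bar> < \<epsilon> \<Longrightarrow> y \<in> O1 \<Longrightarrow> f (t, y) \<in> \<Omega>"
    and ode: "\<And>t y. \<bar>t\<bar> < \<epsilon> \<Longrightarrow> y \<in> O1 \<Longrightarrow> ((\<lambda>s. f (s, y)) has_vector_derivative X (f (t, y))) (at t)"
    and ty: "\<bar>t\<bar> < \<epsilon>" "y \<in> O1"
  shows "((\<lambda>s. fder f (s, y) (0, v)) has_vector_derivative
      fder X (f (t, y)) (fder f (t, y) (0, v))) (at t)"
    and "((\<lambda>z. f (t, z)) has_derivative (\<lambda>v. fder f (t, y) (0, v))) (at y)"
proof -
  let ?S = "{-\<epsilon><..<\<epsilon>} \<times> O1"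
  have S: "open ?S" using O by (simp add: open_Times)
  have z: "(t, y) \<in> ?S" using ty by auto
  have fd: "(f has_derivative fder f z) (at z)" if "z \<in> ?S" for z
    by (rule smooth_on_derivative[OF f(1) that])
  show "((\<lambda>z. f (t, z)) has_derivative (\<lambda>v. fder f (t, y) (0, v))) (at y)"
    by (rule has_derivative_compose[where g = f and f = "\<lambda>z. (t, z)", OF _ fd[OF z]]) (auto intro!: derivative_eq_intros)
  have f1: "fder f z (1, 0) = X (f z)" if zS: "z \<in> ?S" for z
  proof -
    obtain s x where sx: "z = (s, x)" "\<bar>s\<bar> < \<epsilon>" "x \<in> O1" using zS by auto
    have "((\<lambda>s. (s, x)) has_derivative (\<lambda>h. (h, 0))) (at s)" by (auto intro!: derivative_eq_intros)
    from has_derivative_compose[OF this, of f "fder f z"] fd[OF zS]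
    have "((\<lambda>s. f (s, x)) has_derivative (\<lambda>h. fder f z (h, 0))) (at s)" by (simp add: sx(1))
    moreover have "((\<lambda>s. f (s, x)) has_derivative (\<lambda>h. h *\<^sub>R X (f z))) (at s)"
      using ode[OF sx(2,3)] by (simp add: has_vector_derivative_def sx(1))
    ultimately have "(\<lambda>h. fder f z (h, 0)) = (\<lambda>h. h *\<^sub>R X (f z))" by (rule has_derivative_unique)
    from fun_cong[OF this, of 1] show ?thesis by simp
  qed
  let ?g = "\<lambda>z. fder f z (0, v)"
  have g: "(?g has_derivative fder ?g (t, y)) (at (t, y))"
    by (rule smooth_on_derivative[OF smooth_on_frechet[OF f(1)] z])
  have "((\<lambda>s. (s, y)) has_vector_derivative (1, 0)) (at t)"
    by (auto simp: has_vector_derivative_def intro!: derivative_eq_intros)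
  then have "((\<lambda>s. ?g (s, y)) has_vector_derivative fder ?g (t, y) (1, 0)) (at t)"
    using vector_derivative_diff_chain_within[of "\<lambda>s. (s, y)" "(1, 0)" t UNIV ?g] g
    by (simp add: o_def has_derivative_at_withinI)
  also have "fder ?g (t, y) (1, 0) = fder (\<lambda>z. fder f z (1, 0)) (t, y) (0, v)"
    by (rule smooth_on_symmetric[OF S z f(1)])
  also have "\<dots> = fder (\<lambda>z. X (f z)) (t, y) (0, v)"
    using frechet_derivative_cong_open[OF S z, of "\<lambda>z. fder f z (1, 0)" "\<lambda>z. X (f z)"] f1 by auto
  also have "\<dots> = fder X (f (t, y)) (?g (t, y))"
  proof -
    have "((\<lambda>z. X (f z)) has_derivative (\<lambda>h. fder X (f (t, y)) (fder f (t, y) h))) (at (t, y))"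
      by (rule has_derivative_compose[where g = X and f = f, OF fd[OF z] smooth_on_derivative[OF \<Omega>(2) f(2)[OF ty]]])
    from fun_cong[OF frechet_derivative_at[OF this], of "(0, v)"] show ?thesis by simp
  qed
  finally show "((\<lambda>s. ?g (s, y)) has_vector_derivative fder X (f (t, y)) (?g (t, y))) (at t)" .
qed

section \<open>The linear equations for symmetries of the flat model\<close>

abbreviation ed :: "5 \<Rightarrow> (real^5 \<Rightarrow> real) \<Rightarrow> real^5 \<Rightarrow> real" where
  "ed \<equiv> fd engel_coframe"

lemma engel_dual: "dual (engel_coframe x) k = row5 (row5 1 0 0 0 0) (row5 0 1 0 0 0) (row5 0 0 1 0 0)
     (row5 (3 * x $ 2) 0 0 1 0) (row5 (- x $ 1) 0 0 0 1) $ k"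
  using dual_sheared_engel[of 0 x k] by (simp add: sheared_engel_0 sheared_dual_def)

lemma ed_coord: "ed k (\<lambda>y. y $ i) y = dual (engel_coframe y) k $ i"
proof -
  have "((\<lambda>y::real^5. y $ i) has_derivative (\<lambda>v. v $ i)) (at y)"
    by (rule bounded_linear_imp_has_derivative[OF bounded_linear_vec_nth])
  from fd_eqI[OF this, of engel_coframe k] show ?thesis .
qed

text \<open>For the Engel frame \<theta> is 0, so only [e_1, e_4] and [e_2, e_3] survive, as
  multiples of e_0. \<open>G\<close> and \<open>H\<close> are known expressions for the inner
  derivatives, so that relations between second derivatives can be read off.\<close>

lemma ed_commutator:
  assumes S: "open S" "y \<in> S" and F: "smooth_on S F"
    and G: "\<And>z. z \<in> S \<Longrightarrow> ed j F z = G z" and H: "\<And>z. z \<in> S \<Longrightarrow> ed i F z = H z"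
  shows "ed i G y - ed j H y = - (kron 1 i * kron 4 j - kron 1 j * kron 4 i - 3 * (kron 2 i * kron 3 j - kron 2 j * kron 3 i)) * ed 0 F y"
proof -
  have "ed i (ed j F) y = ed i G y" "ed j (ed i F) y = ed j H y"
    using fd_cong[OF S, of "ed j F" G engel_coframe i] fd_cong[OF S, of "ed i F" H engel_coframe j] G H by auto
  then show ?thesis
    using se_commutator[OF engel_local_se[OF S(1)] S(2) F, of i j] by (simp add: sum_5 struct_coeff_def algebra_simps)
qed

type_synonym sym_param = "(real^5) \<times> real \<times> real \<times> real \<times> real"

text \<open>\<open>a\<close> gives the contact translations, \<open>x\<close> and \<open>z\<close>
  two scalings, \<open>y\<close> the shear that fixes the mark (0 : 1), and \<open>k\<close> three
  times the field whose flow is \<open>inversion\<close>: nine parameters in all.\<close>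

definition sym_field :: "sym_param \<Rightarrow> real^5 \<Rightarrow> real^5" where
  "sym_field c p = (case c of (a, x, z, y, k) \<Rightarrow> row5
     (a $ 0 - a $ 1 * p $ 4 + 3 * a $ 2 * p $ 3 + 3 * (x + z) * p $ 0 + 3 * y * (p $ 2)^2 + 6 * k * (p $ 2)^3)
     (a $ 1 + 3 * x * p $ 1 + 3 * k * (p $ 1)^2)
     (a $ 2 + y * p $ 1 + (2 * x + z) * p $ 2 + 3 * k * p $ 1 * p $ 2)
     (a $ 3 + 2 * y * p $ 2 + (x + 2 * z) * p $ 3 + 3 * k * (p $ 2)^2)
     (a $ 4 + 3 * y * p $ 3 + 3 * z * p $ 4 + 3 * k * p $ 0))"

text \<open>The contact Hamiltonian \<open>\<alpha>\<^sup>0(X)\<close>.\<close>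

definition hamiltonian :: "(real^5 \<Rightarrow> real^5) \<Rightarrow> real^5 \<Rightarrow> real" where
  "hamiltonian X y = X y $ 0 - 3 * y $ 2 * X y $ 3 + y $ 1 * X y $ 4"

text \<open>The Lie derivative of the flat coframe along \<open>X\<close> takes values in the Lie algebra of the structure group.\<close>

definition engel_symmetry :: "(real^5) set \<Rightarrow> (real^5 \<Rightarrow> real^5) \<Rightarrow> bool" where
  "engel_symmetry S X \<longleftrightarrow> (\<forall>y\<in>S. let N = (\<lambda>i j. ed j (\<lambda>z. X z $ i) y) in
     ed 1 (hamiltonian X) y = X y $ 4 \<and> ed 2 (hamiltonian X) y = - 3 * X y $ 3 \<and>
     ed 3 (hamiltonian X) y = 3 * X y $ 2 \<and> ed 4 (hamiltonian X) y = - X y $ 1 \<and>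
     N 1 2 = 0 \<and> N 1 3 = 0 \<and> N 1 4 = 0 \<and> N 2 3 = 0 \<and> N 2 4 = 0 \<and> N 3 1 = 0 \<and> N 3 4 = 0 \<and> N 4 1 = 0 \<and> N 4 2 = 0 \<and>
     N 3 2 = 2 * N 2 1 \<and> N 4 3 = 3 * N 2 1 \<and> 2 * N 2 2 = N 1 1 + N 3 3 \<and> N 4 4 + N 2 2 = 2 * N 3 3)"

lemma constant_if_ed_zero:
  assumes F: "smooth_on (ball p r) F" "\<And>k y. y \<in> ball p r \<Longrightarrow> ed k F y = 0" and y: "y \<in> ball p r"
  shows "F y = F p"
proof (rule has_derivative_zero_constant[where s = "ball p r", THEN exE])
  show "convex (ball p r)" by simp
  fix z assume z: "z \<in> ball p r"
  have "fder F z = (\<lambda>v. 0)"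
  proof
    fix v show "fder F z v = 0"
      using sum_fd[where w = engel_coframe and v = v, OF F(1) z invertible_engel] F(2)[OF z] by simp
  qed
  then show "(F has_derivative (\<lambda>h. 0)) (at z within ball p r)"
    using smooth_on_derivative[OF F(1) z] by (auto intro: has_derivative_at_withinI)
next
  have "0 < r" using y le_less_trans[OF zero_le_dist[of p y]] by simp
  fix c assume "\<forall>x\<in>ball p r. F x = c"
  then show "F y = F p" using y \<open>0 < r\<close> by simp
qed

lemma affine_if_ed_eq:
  assumes F: "smooth_on (ball p r) F" "smooth_on (ball p r) G" "\<And>k y. y \<in> ball p r \<Longrightarrow> ed k F y = ed k G y"
  shows "\<exists>c. \<forall>y\<in>ball p r. F y = c + G y"
proof (intro exI ballI)
  fix y assume y: "y \<in> ball p r"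
  have "(\<lambda>z. F z - G z) y = (\<lambda>z. F z - G z) p"
    by (rule constant_if_ed_zero[OF _ _ y])
      (auto intro!: smooth_on_diff F(1,2) simp del: mem_ball simp: fd_diff[OF F(1,2)] F(3))
  then show "F y = (F p - G p) + G y" by simp
qed

text \<open>The commutators express all derivatives of the three free matrix entries by one function
  k and show that k is constant. Integrating back yields polynomials, one constant of integration at
  each stage.\<close>

theorem engel_symmetry_sym_field:
  assumes r: "0 < r" and X: "smooth_on (ball p r) X" and sym: "engel_symmetry (ball p r) X"
  shows "\<exists>c. \<forall>y\<in>ball p r. X y = sym_field c y"
proof -
  let ?S = "ball p r"
  have S: "open ?S" by simp
  have sX: "smooth_on ?S (\<lambda>z. X z $ i)" for i by (intro smooth_intros S X)
  have sc: "smooth_on ?S (\<lambda>z. z $ i)" for i by (intro smooth_intros S)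
  have sed: "smooth_on ?S F \<Longrightarrow> smooth_on ?S (ed k F)" for k F
    by (intro smooth_intros S se_basic(2)[OF engel_local_se[OF S]] invertible_engel)
  have sH: "smooth_on ?S (hamiltonian X)" unfolding hamiltonian_def[abs_def] by (intro smooth_intros S X)
  \<comment> \<open>The symmetry conditions leave three independent entries in the matrix of
    derivatives of X_1, ..., X_4; up to factors they are \<open>x\<close>, \<open>v\<close> and
    \<open>w\<close>.\<close>
  define x where "x y = ed 1 (\<lambda>z. X z $ 1) y / 3" for y
  define v where "v = ed 1 (\<lambda>z. X z $ 2)"
  define w where "w y = ed 4 (\<lambda>z. X z $ 4) y / 3" for y
  define k where "k y = ed 1 x y / 2" for y
  have sm: "smooth_on ?S x" "smooth_on ?S v" "smooth_on ?S w" "smooth_on ?S k"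
  proof -
    show 1: "smooth_on ?S x" "smooth_on ?S v" "smooth_on ?S w"
      unfolding x_def[abs_def] v_def w_def[abs_def] by (intro smooth_intros S sed sX; simp)+
    show "smooth_on ?S k" unfolding k_def[abs_def] by (intro smooth_on_divide S sed 1 smooth_on_const) auto
  qed
  have e: "ed 1 (\<lambda>z. X z $ 1) y = 3 * x y" "ed 2 (\<lambda>z. X z $ 1) y = 0" "ed 3 (\<lambda>z. X z $ 1) y = 0" "ed 4 (\<lambda>z. X z $ 1) y = 0"
    "ed 1 (\<lambda>z. X z $ 2) y = v y" "ed 2 (\<lambda>z. X z $ 2) y = 2 * x y + w y" "ed 3 (\<lambda>z. X z $ 2) y = 0" "ed 4 (\<lambda>z. X z $ 2) y = 0"
    "ed 1 (\<lambda>z. X z $ 3) y = 0" "ed 2 (\<lambda>z. X z $ 3) y = 2 * v y" "ed 3 (\<lambda>z. X z $ 3) y = x y + 2 * w y" "ed 4 (\<lambda>z. X z $ 3) y = 0"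
    "ed 1 (\<lambda>z. X z $ 4) y = 0" "ed 2 (\<lambda>z. X z $ 4) y = 0" "ed 3 (\<lambda>z. X z $ 4) y = 3 * v y" "ed 4 (\<lambda>z. X z $ 4) y = 3 * w y"
    "ed 1 (hamiltonian X) y = X y $ 4" "ed 2 (hamiltonian X) y = - 3 * X y $ 3"
    "ed 3 (hamiltonian X) y = 3 * X y $ 2" "ed 4 (hamiltonian X) y = - 1 * X y $ 1" "ed 1 x y = 2 * k y" if "y \<in> ?S" for y
    using sym[unfolded engel_symmetry_def Let_def, rule_format, OF that] unfolding x_def v_def w_def k_def
    by (elim conjE; linarith)+
  note kr = kron_def
  have cm: "smooth_on ?S (\<lambda>z. c * F z)" if "smooth_on ?S F" for c and F :: "real^5 \<Rightarrow> real" by (intro smooth_intros S that)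
  note rl = fd_add[where S = ?S] fd_cmult[where S = ?S] fd_minus[where S = ?S] sm sX cm
  have e0: "ed 0 (\<lambda>z. X z $ 1) y = 0" "ed 0 (\<lambda>z. X z $ 3) y = 0" if y: "y \<in> ?S" for y
    using ed_commutator[OF S y sX[of 1] e(3) e(2)] ed_commutator[OF S y sX[of 3] e(12) e(9)] by (simp_all add: kr)
  have x: "ed 0 x y = 0" "ed 2 x y = 0" "ed 3 x y = 0" "ed 4 x y = 0" if y: "y \<in> ?S" for y
    using ed_commutator[OF S y sX[of 1] e0(1) e(1)] ed_commutator[OF S y sX[of 1] e(2) e(1)]
      ed_commutator[OF S y sX[of 1] e(3) e(1)] ed_commutator[OF S y sX[of 1] e(4) e(1)] y e0(1)[OF y]
    by (simp_all add: kr rl del: mem_ball)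
  have 2: "ed 0 (\<lambda>z. X z $ 2) y = ed 4 v y" "3 * ed 0 (\<lambda>z. X z $ 2) y = - ed 3 w y" "ed 1 w y + 4 * k y = ed 2 v y"
      "ed 3 v y = 0" "ed 4 w y = 0" if y: "y \<in> ?S" for y
    using ed_commutator[OF S y sX[of 2] e(8) e(5)] ed_commutator[OF S y sX[of 2] e(7) e(6)]
      ed_commutator[OF S y sX[of 2] e(6) e(5)] ed_commutator[OF S y sX[of 2] e(7) e(5)] ed_commutator[OF S y sX[of 2] e(8) e(6)] y x[OF y] e(21)[OF y]
    by (simp_all add: kr rl del: mem_ball)
  have 3: "ed 2 w y = ed 3 v y" "ed 1 v y = 0" "ed 1 w y = - k y" "ed 4 v y = 0" if y: "y \<in> ?S" for y
    using ed_commutator[OF S y sX[of 3] e(11) e(10)] ed_commutator[OF S y sX[of 3] e(10) e(9)]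
      ed_commutator[OF S y sX[of 3] e(11) e(9)] ed_commutator[OF S y sX[of 3] e(12) e(10)] y x[OF y] e(21)[OF y] e0(2)[OF y]
    by (simp_all add: kr rl del: mem_ball)
  have 4: "3 * ed 1 w y = - ed 0 (\<lambda>z. X z $ 4) y" "ed 3 w y = ed 4 v y" if y: "y \<in> ?S" for y
    using ed_commutator[OF S y sX[of 4] e(16) e(13)] ed_commutator[OF S y sX[of 4] e(16) e(15)] y
    by (simp_all add: kr rl del: mem_ball)
  have w: "ed 1 w y = -1 * k y" "ed 2 w y = 0" "ed 3 w y = 0" "ed 4 w y = 0" if y: "y \<in> ?S" for y
    using 2[OF y] 3[OF y] 4[OF y] by simp_all
  have v: "ed 1 v y = 0" "ed 2 v y = 3 * k y" "ed 3 v y = 0" "ed 4 v y = 0" if y: "y \<in> ?S" for y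
    using 2[OF y] 3[OF y] by simp_all
  have k: "ed 0 k y = 0" "ed 2 k y = 0" "ed 3 k y = 0" "ed 4 k y = 0" "ed 0 w y = 0" "ed 0 v y = 0" "ed 1 k y = 0" if y: "y \<in> ?S" for y
  proof -
    show *: "ed 0 k y = 0" "ed 2 k y = 0" "ed 3 k y = 0" "ed 4 k y = 0" "ed 1 k y = 0"
      using ed_commutator[OF S y sm(1) x(1) e(21)] ed_commutator[OF S y sm(1) x(2) e(21)]
        ed_commutator[OF S y sm(1) x(3) e(21)] ed_commutator[OF S y sm(1) x(4) e(21)] x(1)[OF y] ed_commutator[OF S y sm(2) v(2) v(1)] y
      by (simp_all add: kr rl del: mem_ball)
    show "ed 0 w y = 0" "ed 0 v y = 0"
      using ed_commutator[OF S y sm(3) w(3) w(2)] ed_commutator[OF S y sm(2) v(3) v(2)] *(3) y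
      by (simp_all add: kr rl del: mem_ball)
  qed
  have e0': "ed 0 (\<lambda>z. X z $ 2) y = 0" "ed 0 (\<lambda>z. X z $ 4) y = 3 * k y" "ed 0 (hamiltonian X) y = 3 * x y + 3 * w y" if y: "y \<in> ?S" for y
    using 2[OF y] 4[OF y] w[OF y] v[OF y] ed_commutator[OF S y sH e(20) e(17)] e(1,16)[OF y] y
    by (simp_all add: kr rl del: mem_ball)
  define k0 where "k0 = k p"
  have k0: "k y = k0" if y: "y \<in> ?S" for y
    unfolding k0_def
  proof (rule constant_if_ed_zero[OF sm(4) _ y])
    show "ed j k z = 0" if "z \<in> ?S" for j z using k[OF that] exhaust_5[of j] by auto
  qed
  note frules = fd_add[where S = ?S] fd_diff[where S = ?S] fd_minus[where S = ?S] smooth_on_minus fd_cmult[where S = ?S] fd_mult[where S = ?S] fd_power[where S = ?S]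
    ed_coord engel_dual
  note srules = smooth_on_add smooth_on_diff smooth_on_mult smooth_on_power smooth_on_const sc S
  have all5: "ed j F z = ed j G z" if "ed 0 F z = ed 0 G z" "ed 1 F z = ed 1 G z" "ed 2 F z = ed 2 G z"
    "ed 3 F z = ed 3 G z" "ed 4 F z = ed 4 G z" for j F G z using that exhaust_5[of j] by auto
  obtain x0 where x0: "\<And>y. y \<in> ?S \<Longrightarrow> x y = x0 + (2 * k0 * y $ 1)"
  proof -
    have d: "ed j (x) z = ed j (\<lambda>y. 2 * k0 * y $ 1) z" if "z \<in> ?S" for j z
      by (rule all5) (use x[OF that] e(21)[OF that] k0[OF that] that in \<open>simp_all add: frules srules del: mem_ball\<close>)
    have "smooth_on ?S (\<lambda>y. 2 * k0 * y $ 1)" by (intro smooth_intros S)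
    from affine_if_ed_eq[OF sm(1) this d] show ?thesis using that by blast
  qed
  obtain w0 where w0: "\<And>y. y \<in> ?S \<Longrightarrow> w y = w0 + (- k0 * y $ 1)"
  proof -
    have d: "ed j (w) z = ed j (\<lambda>y. - k0 * y $ 1) z" if "z \<in> ?S" for j z
      by (rule all5) (use w[OF that] k[OF that] k0[OF that] that in \<open>simp_all add: frules srules del: mem_ball\<close>)
    have "smooth_on ?S (\<lambda>y. - k0 * y $ 1)" by (intro smooth_intros S)
    from affine_if_ed_eq[OF sm(3) this d] show ?thesis using that by blast
  qed
  obtain v0 where v0: "\<And>y. y \<in> ?S \<Longrightarrow> v y = v0 + (3 * k0 * y $ 2)"
  proof -
    have d: "ed j (v) z = ed j (\<lambda>y. 3 * k0 * y $ 2) z" if "z \<in> ?S" for j z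
      by (rule all5) (use v[OF that] k[OF that] k0[OF that] that in \<open>simp_all add: frules srules del: mem_ball\<close>)
    have "smooth_on ?S (\<lambda>y. 3 * k0 * y $ 2)" by (intro smooth_intros S)
    from affine_if_ed_eq[OF sm(2) this d] show ?thesis using that by blast
  qed
  obtain a1 where a1: "\<And>y. y \<in> ?S \<Longrightarrow> X y $ 1 = a1 + (3 * x0 * y $ 1 + 3 * k0 * (y $ 1)^2)"
  proof -
    have d: "ed j (\<lambda>z. X z $ 1) z = ed j (\<lambda>y. 3 * x0 * y $ 1 + 3 * k0 * (y $ 1)^2) z" if "z \<in> ?S" for j z
      by (rule all5) (use e(1-4)[OF that] e0[OF that] x0[OF that] v0[OF that] w0[OF that] k0[OF that] that in \<open>simp_all add: frules srules del: mem_ball\<close>)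
    have "smooth_on ?S (\<lambda>y. 3 * x0 * y $ 1 + 3 * k0 * (y $ 1)^2)" by (intro smooth_intros S)
    from affine_if_ed_eq[OF sX[of 1] this d] show ?thesis using that by blast
  qed
  obtain a2 where a2: "\<And>y. y \<in> ?S \<Longrightarrow> X y $ 2 = a2 + (v0 * y $ 1 + (2 * x0 + w0) * y $ 2 + 3 * k0 * (y $ 1 * y $ 2))"
  proof -
    have d: "ed j (\<lambda>z. X z $ 2) z = ed j (\<lambda>y. v0 * y $ 1 + (2 * x0 + w0) * y $ 2 + 3 * k0 * (y $ 1 * y $ 2)) z" if "z \<in> ?S" for j z
      by (rule all5) (use e(5-8)[OF that] e0'[OF that] x0[OF that] v0[OF that] w0[OF that] k0[OF that] that in \<open>simp_all add: frules srules del: mem_ball\<close>)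
    have "smooth_on ?S (\<lambda>y. v0 * y $ 1 + (2 * x0 + w0) * y $ 2 + 3 * k0 * (y $ 1 * y $ 2))" by (intro smooth_intros S)
    from affine_if_ed_eq[OF sX[of 2] this d] show ?thesis using that by blast
  qed
  obtain a3 where a3: "\<And>y. y \<in> ?S \<Longrightarrow> X y $ 3 = a3 + (2 * v0 * y $ 2 + (x0 + 2 * w0) * y $ 3 + 3 * k0 * (y $ 2)^2)"
  proof -
    have d: "ed j (\<lambda>z. X z $ 3) z = ed j (\<lambda>y. 2 * v0 * y $ 2 + (x0 + 2 * w0) * y $ 3 + 3 * k0 * (y $ 2)^2) z" if "z \<in> ?S" for j z
      by (rule all5) (use e(9-12)[OF that] e0[OF that] x0[OF that] v0[OF that] w0[OF that] k0[OF that] that in \<open>simp_all add: frules srules del: mem_ball\<close>)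
    have "smooth_on ?S (\<lambda>y. 2 * v0 * y $ 2 + (x0 + 2 * w0) * y $ 3 + 3 * k0 * (y $ 2)^2)" by (intro smooth_intros S)
    from affine_if_ed_eq[OF sX[of 3] this d] show ?thesis using that by blast
  qed
  obtain a4 where a4: "\<And>y. y \<in> ?S \<Longrightarrow> X y $ 4 = a4 + (3 * v0 * y $ 3 + 3 * w0 * y $ 4 + 3 * k0 * y $ 0)"
  proof -
    have d: "ed j (\<lambda>z. X z $ 4) z = ed j (\<lambda>y. 3 * v0 * y $ 3 + 3 * w0 * y $ 4 + 3 * k0 * y $ 0) z" if "z \<in> ?S" for j z
      by (rule all5) (use e(13-16)[OF that] e0'[OF that] x0[OF that] v0[OF that] w0[OF that] k0[OF that] that in \<open>simp_all add: frules srules del: mem_ball\<close>)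
    have "smooth_on ?S (\<lambda>y. 3 * v0 * y $ 3 + 3 * w0 * y $ 4 + 3 * k0 * y $ 0)" by (intro smooth_intros S)
    from affine_if_ed_eq[OF sX[of 4] this d] show ?thesis using that by blast
  qed
  \<comment> \<open>With X_1 to X_4 known, all derivatives of the Hamiltonian are known;
    \<open>h\<close> is the Hamiltonian up to its additive constant, and X_0 is recovered from
    it.\<close>
  define h where "h y = (- a1 * y $ 4 + 3 * a2 * y $ 3 + 3 * (x0 + w0) * y $ 0 + 3 * v0 * (y $ 2)^2 + 6 * k0 * (y $ 2)^3)
      - 3 * (y $ 2 * (a3 + (2 * v0 * y $ 2 + (x0 + 2 * w0) * y $ 3 + 3 * k0 * (y $ 2)^2)))
      + y $ 1 * (a4 + (3 * v0 * y $ 3 + 3 * w0 * y $ 4 + 3 * k0 * y $ 0))" for y :: "real^5"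
  obtain a0 where a0: "\<And>y. y \<in> ?S \<Longrightarrow> hamiltonian X y = a0 + h y"
  proof -
    have "ed j (hamiltonian X) z = ed j h z" if z: "z \<in> ?S" for j z
      unfolding h_def[abs_def]
      by (rule all5; use e(17-20)[OF z] e0'(3)[OF z] x0[OF z] w0[OF z] a1[OF z] a2[OF z] a3[OF z] a4[OF z] z in
          \<open>simp add: frules srules algebra_simps power2_eq_square del: mem_ball\<close>)
    note d = this
    have "smooth_on ?S h" unfolding h_def[abs_def] by (intro smooth_intros S)
    from affine_if_ed_eq[OF sH this d] show ?thesis using that by blast
  qed
  have "X y = sym_field (row5 a0 a1 a2 a3 a4, x0, w0, v0, k0) y" if y: "y \<in> ?S" for y
    using a0[OF y] a1[OF y] a2[OF y] a3[OF y] a4[OF y]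
    by (simp add: sym_field_def vec5_eq_iff hamiltonian_def h_def)
  then show ?thesis by blast
qed

text \<open>The Lie derivative of the Engel coframe, expressed in itself. By Cartan's formula, row 0
  is the differential of the Hamiltonian plus the contraction of X with \<alpha>^1 \<and> \<alpha>^4
  - 3 \<alpha>^2 \<and> \<alpha>^3; the other forms are dx^i and contribute only dX_i.\<close>

definition lie_matrix :: "(real^5 \<Rightarrow> real^5) \<Rightarrow> real^5 \<Rightarrow> real^5^5" where
  "lie_matrix X y = (\<chi> i j. if i = 0 then ed j (hamiltonian X) y + row5 0 (- X y $ 4) (3 * X y $ 3) (- 3 * X y $ 2) (X y $ 1) $ j
     else ed j (\<lambda>z. X z $ i) y)"

lemma engel_symmetry_lie_matrix:
  "engel_symmetry S X \<longleftrightarrow> (\<forall>y\<in>S. let N = (\<lambda>i j. lie_matrix X y $ i $ j) in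
     N 0 1 = 0 \<and> N 0 2 = 0 \<and> N 0 3 = 0 \<and> N 0 4 = 0 \<and>
     N 1 2 = 0 \<and> N 1 3 = 0 \<and> N 1 4 = 0 \<and> N 2 3 = 0 \<and> N 2 4 = 0 \<and> N 3 1 = 0 \<and> N 3 4 = 0 \<and> N 4 1 = 0 \<and> N 4 2 = 0 \<and>
     N 3 2 = 2 * N 2 1 \<and> N 4 3 = 3 * N 2 1 \<and> 2 * N 2 2 = N 1 1 + N 3 3 \<and> N 4 4 + N 2 2 = 2 * N 3 3)"
  unfolding engel_symmetry_def lie_matrix_def Let_def by (auto simp: algebra_simps)

lemma has_vector_derivative_row5:
  assumes "(f0 has_real_derivative d0) (at t)" "(f1 has_real_derivative d1) (at t)" "(f2 has_real_derivative d2) (at t)"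
    "(f3 has_real_derivative d3) (at t)" "(f4 has_real_derivative d4) (at t)"
  shows "((\<lambda>s. row5 (f0 s) (f1 s) (f2 s) (f3 s) (f4 s)) has_vector_derivative row5 d0 d1 d2 d3 d4) (at t)"
proof -
  have "(\<lambda>h. h *\<^sub>R row5 d0 d1 d2 d3 d4) = (\<lambda>h. row5 (d0 * h) (d1 * h) (d2 * h) (d3 * h) (d4 * h))"
    by (simp add: fun_eq_iff vec5_eq_iff)
  then show ?thesis
    using has_derivative_row5[OF assms[unfolded has_field_derivative_def]] by (simp add: has_vector_derivative_def)
qed

lemma has_real_derivative_nth:
  fixes w :: "real \<Rightarrow> real^'n"
  assumes "(w has_vector_derivative d) (at t)"
  shows "((\<lambda>s. w s $ i) has_real_derivative d $ i) (at t)"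
  using bounded_linear.has_vector_derivative[OF bounded_linear_vec_nth assms]
  by (simp add: has_real_derivative_iff_has_vector_derivative)

lemma engel_coframe_mult: "engel_coframe y *v v = row5 (v $ 0 - 3 * y $ 2 * v $ 3 + y $ 1 * v $ 4) (v $ 1) (v $ 2) (v $ 3) (v $ 4)"
  by (simp add: vec5_eq_iff matrix_vector_5 engel_coframe_def)

text \<open>A vector dragged along by the linearised flow has zero Lie derivative, so its components
  change only through the Lie derivative of the coframe.\<close>

lemma coframe_along_flow:
  assumes X: "smooth_on \<Omega> X" and c: "c t \<in> \<Omega>" "(c has_vector_derivative X (c t)) (at t)"
    and \<xi>: "(\<xi> has_vector_derivative fder X (c t) (\<xi> t)) (at t)"
  shows "((\<lambda>s. engel_coframe (c s) *v \<xi> s) has_vector_derivative lie_matrix X (c t) *v (engel_coframe (c t) *v \<xi> t)) (at t)"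
proof -
  let ?p = "c t"
  define D where "D = fder X ?p (\<xi> t)"
  let ?w = "engel_coframe ?p *v \<xi> t"
  have dX: "(X has_derivative fder X ?p) (at ?p)" by (rule smooth_on_derivative[OF X c(1)])
  have dXi: "((\<lambda>z. X z $ i) has_derivative (\<lambda>v. fder X ?p v $ i)) (at ?p)" for i
    by (rule bounded_linear.has_derivative[OF bounded_linear_vec_nth dX])
  have expand: "F' (\<xi> t) = (\<Sum>k\<in>UNIV. ed k F ?p * ?w $ k)" if F: "(F has_derivative F') (at ?p)" for F F'
  proof -
    have "F' (\<xi> t) = F' (\<Sum>k\<in>UNIV. (engel_coframe ?p $ k \<bullet> \<xi> t) *\<^sub>R dual (engel_coframe ?p) k)"
      by (rule arg_cong[OF dual_expand[OF invertible_engel]])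
    also have "\<dots> = (\<Sum>k\<in>UNIV. (engel_coframe ?p $ k \<bullet> \<xi> t) * F' (dual (engel_coframe ?p) k))"
      by (simp only: linear_sum[OF has_derivative_linear[OF F]] linear_scale[OF has_derivative_linear[OF F]] real_scaleR_def)
    also have "\<dots> = (\<Sum>k\<in>UNIV. ed k F ?p * ?w $ k)"
      by (rule sum.cong) (simp_all add: fd_eqI[OF F] matrix_vector_mul_component mult.commute)
    finally show ?thesis .
  qed
  have Di: "D $ i = (\<Sum>k\<in>UNIV. ed k (\<lambda>z. X z $ i) ?p * ?w $ k)" for i
    unfolding D_def by (rule expand[OF dXi])
  have "(hamiltonian X has_derivative (\<lambda>v. fder X ?p v $ 0
      - 3 * (v $ 2 * X ?p $ 3 + ?p $ 2 * fder X ?p v $ 3)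
      + (v $ 1 * X ?p $ 4 + ?p $ 1 * fder X ?p v $ 4))) (at ?p)"
    unfolding hamiltonian_def[abs_def]
    by (rule derivative_eq_intros dXi has_derivative_coord refl)+ (simp add: fun_eq_iff algebra_simps)
  from expand[OF this] have H: "D $ 0 - 3 * (\<xi> t $ 2 * X ?p $ 3 + ?p $ 2 * D $ 3) + (\<xi> t $ 1 * X ?p $ 4 + ?p $ 1 * D $ 4) =
    (\<Sum>k\<in>UNIV. ed k (hamiltonian X) ?p * ?w $ k)" by (simp add: D_def)
  note di = has_real_derivative_nth[OF c(2)] has_real_derivative_nth[OF \<xi>, folded D_def]
  have "((\<lambda>s. row5 (\<xi> s $ 0 - 3 * c s $ 2 * \<xi> s $ 3 + c s $ 1 * \<xi> s $ 4) (\<xi> s $ 1) (\<xi> s $ 2) (\<xi> s $ 3) (\<xi> s $ 4)) has_vector_derivative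
      row5 (D $ 0 - 3 * (X ?p $ 2 * \<xi> t $ 3 + ?p $ 2 * D $ 3) + (X ?p $ 1 * \<xi> t $ 4 + ?p $ 1 * D $ 4))
        (D $ 1) (D $ 2) (D $ 3) (D $ 4)) (at t)"
    by (intro has_vector_derivative_row5 di) (auto intro!: derivative_eq_intros di simp: algebra_simps)
  also have "row5 (D $ 0 - 3 * (X ?p $ 2 * \<xi> t $ 3 + ?p $ 2 * D $ 3) + (X ?p $ 1 * \<xi> t $ 4 + ?p $ 1 * D $ 4))
        (D $ 1) (D $ 2) (D $ 3) (D $ 4) = lie_matrix X ?p *v ?w"
  proof -
    have "(lie_matrix X ?p *v ?w) $ 0 = (\<Sum>k\<in>UNIV. ed k (hamiltonian X) ?p * ?w $ k) - X ?p $ 4 * ?w $ 1 + 3 * X ?p $ 3 * ?w $ 2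
        - 3 * X ?p $ 2 * ?w $ 3 + X ?p $ 1 * ?w $ 4"
      by (simp add: matrix_vector_5 lie_matrix_def sum_5 algebra_simps)
    moreover have "(lie_matrix X ?p *v ?w) $ i = D $ i" if "i \<noteq> 0" for i
      unfolding Di using that by (simp add: matrix_vector_5 lie_matrix_def sum_5)
    ultimately show ?thesis unfolding H[symmetric] by (simp add: vec5_eq_iff engel_coframe_mult algebra_simps)
  qed
  finally show ?thesis by (simp add: engel_coframe_mult)
qed

context
  fixes \<Omega> X \<epsilon> and c w :: "real \<Rightarrow> real^5"
  assumes \<Omega>: "open \<Omega>" and X: "smooth_on \<Omega> X" and sym: "engel_symmetry \<Omega> X"
    and c: "\<And>s. \<bar>s\<bar> < \<epsilon> \<Longrightarrow> c s \<in> \<Omega>" "continuous_on {-\<epsilon><..<\<epsilon>} c"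
    and w: "\<And>s. \<bar>s\<bar> < \<epsilon> \<Longrightarrow> (w has_vector_derivative lie_matrix X (c s) *v w s) (at s)"
begin

private abbreviation "N s \<equiv> lie_matrix X (c s)"

private lemma N_continuous: "continuous_on {-\<epsilon><..<\<epsilon>} N" "continuous_on {-\<epsilon><..<\<epsilon>} (\<lambda>s. N s $ i $ j)"
proof -
  have H: "smooth_on \<Omega> (hamiltonian X)" unfolding hamiltonian_def[abs_def] by (intro smooth_intros \<Omega> X)
  have ed: "smooth_on \<Omega> F \<Longrightarrow> smooth_on \<Omega> (ed j F)" for F j
    by (intro smooth_intros \<Omega> se_basic(2)[OF engel_local_se[OF \<Omega>]] invertible_engel)
  have row: "smooth_on \<Omega> (\<lambda>y. row5 0 (- X y $ 4) (3 * X y $ 3) (- 3 * X y $ 2) (X y $ 1))" by (intro smooth_intros \<Omega> X)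
  have "smooth_on \<Omega> (\<lambda>y. lie_matrix X y $ i $ j)" for i j
    using smooth_on_add[OF \<Omega> ed[OF H, of j] smooth_on_vec_nth[OF \<Omega> row, of j]] ed[OF smooth_on_vec_nth[OF \<Omega> X], of j i]
    by (cases "i = 0") (simp_all add: lie_matrix_def)
  then have "smooth_on \<Omega> (lie_matrix X)" by (rule smooth_on_matrixI[OF \<Omega>])
  moreover have "c ` {-\<epsilon><..<\<epsilon>} \<subseteq> \<Omega>" using c(1) by (auto simp: abs_less_iff)
  ultimately show *: "continuous_on {-\<epsilon><..<\<epsilon>} N"
    using continuous_on_compose2[OF smooth_on_continuous c(2)] by blast
  show "continuous_on {-\<epsilon><..<\<epsilon>} (\<lambda>s. N s $ i $ j)" by (intro continuous_intros *)
qed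

private lemma w_continuous: "continuous_on {-\<epsilon><..<\<epsilon>} (\<lambda>s. w s $ i)"
  by (intro continuous_intros continuous_at_imp_continuous_on ballI has_vector_derivative_continuous[OF w]) auto

private lemma w_nth: "\<bar>s\<bar> < \<epsilon> \<Longrightarrow> ((\<lambda>s. w s $ i) has_real_derivative (N s *v w s) $ i) (at s)"
  by (rule has_real_derivative_nth[OF w])

private lemma continuous_row5:
  assumes "continuous_on S f0" "continuous_on S f1" "continuous_on S f2" "continuous_on S f3" "continuous_on S f4"
  shows "continuous_on S (\<lambda>s. row5 (f0 s) (f1 s) (f2 s) (f3 s) (f4 s) :: 'b::real_normed_vector^5)"
proof -
  have "row5 (f0 s) (f1 s) (f2 s) (f3 s) (f4 s) = axis 0 (f0 s) + axis 1 (f1 s) + axis 2 (f2 s) + axis 3 (f3 s) + axis 4 (f4 s)" for s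
    by (simp add: vec5_eq_iff axis_def)
  then show ?thesis
    by (simp only:) (intro continuous_intros bounded_linear.continuous_on[OF bounded_linear_axis] assms)
qed

private lemma N_facts:
  assumes "\<bar>s\<bar> < \<epsilon>"
  shows "N s $ 0 $ 1 = 0" "N s $ 0 $ 2 = 0" "N s $ 0 $ 3 = 0" "N s $ 0 $ 4 = 0"
    "N s $ 1 $ 2 = 0" "N s $ 1 $ 3 = 0" "N s $ 1 $ 4 = 0" "N s $ 2 $ 3 = 0" "N s $ 2 $ 4 = 0" "N s $ 3 $ 1 = 0" "N s $ 3 $ 4 = 0"
    "N s $ 4 $ 1 = 0" "N s $ 4 $ 2 = 0" "N s $ 3 $ 2 = 2 * N s $ 2 $ 1" "N s $ 4 $ 3 = 3 * N s $ 2 $ 1"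
    "N s $ 1 $ 1 = 2 * N s $ 2 $ 2 - N s $ 3 $ 3" "N s $ 4 $ 4 = 2 * N s $ 3 $ 3 - N s $ 2 $ 2"
  using sym[unfolded engel_symmetry_lie_matrix Let_def, rule_format, OF c(1)[OF assms]] by (elim conjE; linarith)+

context
  fixes s t assumes st: "\<bar>s\<bar> < \<epsilon>" "\<bar>t\<bar> < \<epsilon>"
begin

lemma symmetry_preserves_zero: "w s = 0 \<Longrightarrow> w t = 0"
  by (rule linear_ode_zero[where M = N, OF N_continuous(1) w st])

text \<open>Since the entries of row 0 after the first vanish, \<open>w s $ 0\<close> solves a
  linear equation by itself. It is padded with zeros to a vector of length five for
  \<open>linear_ode_zero\<close>.\<close>

lemma symmetry_preserves_contact:
  assumes "w s $ 0 = 0"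
  shows "w t $ 0 = 0"
proof -
  let ?R = "\<lambda>s. row5 (w s $ 0) 0 0 0 0" and ?M = "\<lambda>s. row5 (row5 (N s $ 0 $ 0) 0 0 0 0) 0 0 0 0"
  have "?R t = 0"
  proof (rule linear_ode_zero[where M = ?M, OF _ _ st])
    show "continuous_on {-\<epsilon><..<\<epsilon>} ?M" by (intro continuous_row5 N_continuous continuous_intros)
    show "(?R has_vector_derivative ?M s *v ?R s) (at s)" if s: "\<bar>s\<bar> < \<epsilon>" for s
      by (rule has_vector_derivative_eq_rhs[OF has_vector_derivative_row5[OF w_nth[OF s] DERIV_const DERIV_const DERIV_const DERIV_const]])
        (simp add: vec5_eq_iff matrix_vector_5 N_facts[OF s])
    show "?R s = 0" using assms by (simp add: vec5_eq_iff)
  qed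
  then show ?thesis by (simp add: vec5_eq_iff)
qed

lemma symmetry_preserves_line:
  assumes "w s $ 0 = 0" "w s $ 1 = 0" "w s $ 2 = 0" "w s $ 3 = 0"
  shows "w t $ 0 = 0" "w t $ 1 = 0" "w t $ 2 = 0" "w t $ 3 = 0"
proof -
  let ?R = "\<lambda>s. row5 (w s $ 0) (w s $ 1) (w s $ 2) (w s $ 3) 0"
  let ?M = "\<lambda>s. row5 (row5 (N s $ 0 $ 0) 0 0 0 0) (row5 (N s $ 1 $ 0) (N s $ 1 $ 1) 0 0 0)
    (row5 (N s $ 2 $ 0) (N s $ 2 $ 1) (N s $ 2 $ 2) 0 0) (row5 (N s $ 3 $ 0) 0 (N s $ 3 $ 2) (N s $ 3 $ 3) 0) 0"
  have "?R t = 0"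
  proof (rule linear_ode_zero[where M = ?M, OF _ _ st])
    show "continuous_on {-\<epsilon><..<\<epsilon>} ?M" by (intro continuous_row5 N_continuous continuous_intros)
    show "(?R has_vector_derivative ?M s *v ?R s) (at s)" if s: "\<bar>s\<bar> < \<epsilon>" for s
      by (rule has_vector_derivative_eq_rhs[OF has_vector_derivative_row5[OF w_nth[OF s] w_nth[OF s] w_nth[OF s] w_nth[OF s] DERIV_const]])
        (simp add: vec5_eq_iff matrix_vector_5 N_facts[OF s])
    show "?R s = 0" using assms by (simp add: vec5_eq_iff)
  qed
  then show "w t $ 0 = 0" "w t $ 1 = 0" "w t $ 2 = 0" "w t $ 3 = 0" by (simp_all add: vec5_eq_iff)
qed

text \<open>The Lie matrix maps the span of the three quadrics to itself modulo multiples of w_0;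
  hence w_0 and the quadrics form a homogeneous linear system, with coefficients depending on
  w.\<close>

lemma symmetry_preserves_cubic:
  assumes "w s $ 0 = 0" "w s $ 1 * w s $ 3 - (w s $ 2)\<^sup>2 = 0" "w s $ 2 * w s $ 4 - (w s $ 3)\<^sup>2 = 0" "w s $ 2 * w s $ 3 - w s $ 1 * w s $ 4 = 0"
  shows "w t $ 0 = 0" "w t $ 1 * w t $ 3 - (w t $ 2)\<^sup>2 = 0" "w t $ 2 * w t $ 4 - (w t $ 3)\<^sup>2 = 0" "w t $ 2 * w t $ 3 - w t $ 1 * w t $ 4 = 0"
proof -
  let ?R = "\<lambda>s. row5 (w s $ 0) (w s $ 1 * w s $ 3 - (w s $ 2)\<^sup>2) (w s $ 2 * w s $ 4 - (w s $ 3)\<^sup>2) (w s $ 2 * w s $ 3 - w s $ 1 * w s $ 4) 0"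
  let ?M = "\<lambda>s. row5 (row5 (N s $ 0 $ 0) 0 0 0 0)
    (row5 (N s $ 1 $ 0 * w s $ 3 + w s $ 1 * N s $ 3 $ 0 - 2 * w s $ 2 * N s $ 2 $ 0) (2 * N s $ 2 $ 2) 0 0 0)
    (row5 (N s $ 2 $ 0 * w s $ 4 + w s $ 2 * N s $ 4 $ 0 - 2 * w s $ 3 * N s $ 3 $ 0) 0 (2 * N s $ 3 $ 3) (- N s $ 2 $ 1) 0)
    (row5 (N s $ 2 $ 0 * w s $ 3 + w s $ 2 * N s $ 3 $ 0 - N s $ 1 $ 0 * w s $ 4 - w s $ 1 * N s $ 4 $ 0) (- 2 * N s $ 2 $ 1) 0 (N s $ 2 $ 2 + N s $ 3 $ 3) 0) 0"
  have "?R t = 0"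
  proof (rule linear_ode_zero[where M = ?M, OF _ _ st])
    show "continuous_on {-\<epsilon><..<\<epsilon>} ?M" by (intro continuous_row5 N_continuous w_continuous continuous_intros)
    show "(?R has_vector_derivative ?M s *v ?R s) (at s)" if s: "\<bar>s\<bar> < \<epsilon>" for s
    proof -
      have "((\<lambda>s. w s $ 1 * w s $ 3 - (w s $ 2)\<^sup>2) has_real_derivative
          (N s *v w s) $ 1 * w s $ 3 + (N s *v w s) $ 3 * w s $ 1 - 2 * w s $ 2 * (N s *v w s) $ 2) (at s)"
        "((\<lambda>s. w s $ 2 * w s $ 4 - (w s $ 3)\<^sup>2) has_real_derivative
          (N s *v w s) $ 2 * w s $ 4 + (N s *v w s) $ 4 * w s $ 2 - 2 * w s $ 3 * (N s *v w s) $ 3) (at s)"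
        "((\<lambda>s. w s $ 2 * w s $ 3 - w s $ 1 * w s $ 4) has_real_derivative
          (N s *v w s) $ 2 * w s $ 3 + (N s *v w s) $ 3 * w s $ 2 - ((N s *v w s) $ 1 * w s $ 4 + (N s *v w s) $ 4 * w s $ 1)) (at s)"
        by (auto intro!: derivative_eq_intros w_nth[OF s])
      then show ?thesis
        by (intro has_vector_derivative_eq_rhs[OF has_vector_derivative_row5[OF w_nth[OF s] _ _ _ DERIV_const]])
          (assumption | simp add: vec5_eq_iff matrix_vector_5 N_facts[OF s] algebra_simps power2_eq_square)+
    qed
    show "?R s = 0" using assms by (simp add: vec5_eq_iff)
  qed
  then show "w t $ 0 = 0" "w t $ 1 * w t $ 3 - (w t $ 2)\<^sup>2 = 0" "w t $ 2 * w t $ 4 - (w t $ 3)\<^sup>2 = 0" "w t $ 2 * w t $ 3 - w t $ 1 * w t $ 4 = 0"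
    by (simp_all add: vec5_eq_iff)
qed

end

end

text \<open>Differentiating the invariance of the three quadrics at the points \<open>(1, \<tau>, \<tau>\<^sup>2, \<tau>\<^sup>3)\<close> gives two quintics in
  \<open>\<tau>\<close>, which are determined by their values at five points once the mark is preserved.\<close>

lemma lie_algebra_conditions:
  fixes N :: "real^5^5"
  assumes contact: "\<And>z. z $ 0 = 0 \<Longrightarrow> (N *v z) $ 0 = 0"
    and cubic: "\<And>\<tau>. let z = row5 0 1 \<tau> (\<tau>^2) (\<tau>^3); n = N *v z in
      n $ 1 * z $ 3 + z $ 1 * n $ 3 - 2 * z $ 2 * n $ 2 = 0 \<and> n $ 2 * z $ 4 + z $ 2 * n $ 4 - 2 * z $ 3 * n $ 3 = 0"
    and line: "\<And>i. i \<noteq> 4 \<Longrightarrow> (N *v row5 0 0 0 0 1) $ i = 0"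
  shows "N $ 0 $ 1 = 0 \<and> N $ 0 $ 2 = 0 \<and> N $ 0 $ 3 = 0 \<and> N $ 0 $ 4 = 0 \<and>
     N $ 1 $ 2 = 0 \<and> N $ 1 $ 3 = 0 \<and> N $ 1 $ 4 = 0 \<and> N $ 2 $ 3 = 0 \<and> N $ 2 $ 4 = 0 \<and> N $ 3 $ 1 = 0 \<and> N $ 3 $ 4 = 0 \<and>
     N $ 4 $ 1 = 0 \<and> N $ 4 $ 2 = 0 \<and>
     N $ 3 $ 2 = 2 * N $ 2 $ 1 \<and> N $ 4 $ 3 = 3 * N $ 2 $ 1 \<and> 2 * N $ 2 $ 2 = N $ 1 $ 1 + N $ 3 $ 3 \<and> N $ 4 $ 4 + N $ 2 $ 2 = 2 * N $ 3 $ 3"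
proof -
  have c: "N $ 0 $ 1 = 0" "N $ 0 $ 2 = 0" "N $ 0 $ 3 = 0" "N $ 0 $ 4 = 0"
    using contact[of "row5 0 1 0 0 0"] contact[of "row5 0 0 1 0 0"] contact[of "row5 0 0 0 1 0"] contact[of "row5 0 0 0 0 1"]
    by (simp_all add: matrix_vector_5)
  have l: "N $ 1 $ 4 = 0" "N $ 2 $ 4 = 0" "N $ 3 $ 4 = 0"
    using line[of 1] line[of 2] line[of 3] by (simp_all add: matrix_vector_5)
  have q: "N $ 3 $ 1 + \<tau> * (N $ 3 $ 2 - 2 * N $ 2 $ 1) + \<tau>^2 * (N $ 1 $ 1 + N $ 3 $ 3 - 2 * N $ 2 $ 2)
      + \<tau>^3 * (N $ 1 $ 2 - 2 * N $ 2 $ 3) + \<tau>^4 * N $ 1 $ 3 = 0"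
    "\<tau> * N $ 4 $ 1 + \<tau>^2 * (N $ 4 $ 2 - 2 * N $ 3 $ 1) + \<tau>^3 * (N $ 4 $ 3 + N $ 2 $ 1 - 2 * N $ 3 $ 2)
      + \<tau>^4 * (N $ 4 $ 4 + N $ 2 $ 2 - 2 * N $ 3 $ 3) + \<tau>^5 * N $ 2 $ 3 = 0" for \<tau>
    using cubic[of \<tau>] by (simp_all add: Let_def matrix_vector_5 l algebra_simps power_numeral_reduce)
  \<comment> \<open>Preservation of the mark removes entries of the last column, so the first
    polynomial has degree 4 and the second no constant term; five values determine either of
    them.\<close>
  have 1: "N $ 3 $ 1 = 0" "N $ 3 $ 2 = 2 * N $ 2 $ 1" "N $ 1 $ 1 + N $ 3 $ 3 = 2 * N $ 2 $ 2" "N $ 1 $ 2 = 2 * N $ 2 $ 3" "N $ 1 $ 3 = 0"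
    using q(1)[of 0] q(1)[of 1] q(1)[of "-1"] q(1)[of 2] q(1)[of "-2"] by simp_all
  have 2: "N $ 4 $ 1 = 0" "N $ 4 $ 2 = 2 * N $ 3 $ 1" "N $ 4 $ 3 + N $ 2 $ 1 = 2 * N $ 3 $ 2" "N $ 4 $ 4 + N $ 2 $ 2 = 2 * N $ 3 $ 3" "N $ 2 $ 3 = 0"
    using q(2)[of 1] q(2)[of "-1"] q(2)[of 2] q(2)[of "-2"] q(2)[of 3] by simp_all
  show ?thesis using c l 1 2 by simp
qed

section \<open>The polynomial fields are symmetries\<close>

definition sym_field_deriv :: "sym_param \<Rightarrow> real^5 \<Rightarrow> real^5 \<Rightarrow> real^5" where
  "sym_field_deriv c p v = (case c of (a, x, z, y, k) \<Rightarrow> row5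
     (- a $ 1 * v $ 4 + 3 * a $ 2 * v $ 3 + 3 * (x + z) * v $ 0 + 6 * y * p $ 2 * v $ 2 + 18 * k * (p $ 2)^2 * v $ 2)
     (3 * x * v $ 1 + 6 * k * p $ 1 * v $ 1)
     (y * v $ 1 + (2 * x + z) * v $ 2 + 3 * k * (v $ 1 * p $ 2 + p $ 1 * v $ 2))
     (2 * y * v $ 2 + (x + 2 * z) * v $ 3 + 6 * k * p $ 2 * v $ 2)
     (3 * y * v $ 3 + 3 * z * v $ 4 + 3 * k * v $ 0))"

lemma has_derivative_sym_field: "(sym_field c has_derivative sym_field_deriv c p) (at p)"
proof -
  obtain a x z y k where c: "c = (a, x, z, y, k)" by (cases c)
  show ?thesis
    unfolding sym_field_def[abs_def] sym_field_deriv_def[abs_def] c prod.case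
    by (rule has_derivative_row5; (rule derivative_eq_intros has_derivative_coord refl)+)
      (simp_all add: fun_eq_iff algebra_simps power2_eq_square)
qed

lemma smooth_on_sym_field: "open S \<Longrightarrow> smooth_on S (sym_field c)"
  by (cases c) (simp add: sym_field_def[abs_def], intro smooth_intros)

lemma engel_symmetry_sym_field_converse: "engel_symmetry S (sym_field c)"
proof -
  obtain a x z y k where c: "c = (a, x, z, y, k)" by (cases c)
  have d: "ed j (\<lambda>z. sym_field c z $ i) p = sym_field_deriv c p (dual (engel_coframe p) j) $ i" for i j p
    by (rule fd_eqI[OF bounded_linear.has_derivative[OF bounded_linear_vec_nth has_derivative_sym_field]])
  have "(hamiltonian (sym_field c) has_derivative (\<lambda>v. sym_field_deriv c p v $ 0
      - 3 * (v $ 2 * sym_field c p $ 3 + p $ 2 * sym_field_deriv c p v $ 3)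
      + (v $ 1 * sym_field c p $ 4 + p $ 1 * sym_field_deriv c p v $ 4))) (at p)" for p
    unfolding hamiltonian_def[abs_def]
    by (rule derivative_eq_intros has_derivative_coord bounded_linear.has_derivative[OF bounded_linear_vec_nth has_derivative_sym_field] refl)+
      (simp add: fun_eq_iff algebra_simps)
  note h = fd_eqI[OF this]
  show ?thesis
    unfolding engel_symmetry_def Let_def d h
    by (simp add: c sym_field_deriv_def sym_field_def engel_dual) (simp add: algebra_simps power2_eq_square power3_eq_cube)
qed

lemma sym_field_bracket:
  "fder (sym_field c') p (sym_field c p) - fder (sym_field c) p (sym_field c' p) =
   sym_field_deriv c' p (sym_field c p) - sym_field_deriv c p (sym_field c' p)"
  using frechet_derivative_at[OF has_derivative_sym_field] by metis

lemma sym_field_linear: "sym_field (c + c') p = sym_field c p + sym_field c' p" "sym_field (s *\<^sub>R c) p = s *\<^sub>R sym_field c p"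
  by (cases c; cases c'; simp add: sym_field_def vec5_eq_iff algebra_simps)
    (cases c; simp add: sym_field_def vec5_eq_iff algebra_simps)

text \<open>The coefficients are recovered from finite differences of the components at p, p + h
  e_1, p - h e_1 and p + h e_2, which lie in the ball.\<close>

lemma sym_field_zero:
  assumes r: "0 < r" and 0: "\<And>q. q \<in> ball p r \<Longrightarrow> sym_field c q = 0"
  shows "c = 0"
proof -
  obtain a x z y k where c: "c = (a, x, z, y, k)" by (cases c)
  define h where "h = r / 2"
  have h: "h \<noteq> 0" using r by (simp add: h_def)
  have n: "norm (axis i s :: real^5) = \<bar>s\<bar>" for i s by (simp add: norm_eq_sqrt_inner inner_axis_axis)
  have q: "sym_field c (p + axis i s) = 0" if "\<bar>s\<bar> \<le> h" for i s
    by (rule 0) (use that r n[of i s] in \<open>simp add: dist_norm h_def\<close>)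
  have z: "sym_field c p = 0" "sym_field c (p + axis 1 h) = 0" "sym_field c (p + axis 1 (- h)) = 0" "sym_field c (p + axis 2 h) = 0"
    using q[of h 1] q[of "- h" 1] q[of h 2] 0[of p] r by (simp_all add: h_def)
  have 1: "a $ 1 + 3 * x * p $ 1 + 3 * k * (p $ 1)^2 = 0" "a $ 1 + 3 * x * (p $ 1 + h) + 3 * k * (p $ 1 + h)^2 = 0"
    "a $ 1 + 3 * x * (p $ 1 - h) + 3 * k * (p $ 1 - h)^2 = 0"
    using z(1-3) by (simp_all add: c sym_field_def vec5_eq_iff axis_def)
  then have "6 * k * h^2 = 0" by algebra
  then have k: "k = 0" using h by simp
  then have "3 * x * h = 0" using 1 by algebra
  then have x: "x = 0" using h by simp
  have a1: "a $ 1 = 0" using 1 k x by simp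
  have 2: "a $ 2 + y * p $ 1 + z * p $ 2 = 0" "a $ 2 + y * (p $ 1 + h) + z * p $ 2 = 0" "a $ 2 + y * p $ 1 + z * (p $ 2 + h) = 0"
    using z(1,2,4) by (simp_all add: c k x sym_field_def vec5_eq_iff axis_def)
  then have "y * h = 0" "z * h = 0" by algebra+
  then have y: "y = 0" "z = 0" using h by simp_all
  show ?thesis using z(1) 2 y by (auto simp: c k x a1 sym_field_def vec5_eq_iff zero_prod_def)
qed

section \<open>Vector fields and flows in charts\<close>

context five_manifold
begin

lemma tangent_map_self: "\<kappa> \<in> A \<Longrightarrow> p \<in> cdom \<kappa> \<Longrightarrow> tangent_map \<kappa> \<kappa> id p *v u = u"
proof -
  assume \<kappa>: "\<kappa> \<in> A" and p: "p \<in> cdom \<kappa>"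
  have y: "coord \<kappa> p \<in> coord \<kappa> ` cdom \<kappa>" using p by blast
  have "((\<lambda>y. coord \<kappa> (icoord \<kappa> y)) has_derivative (\<lambda>u. u)) (at (coord \<kappa> p))"
    by (rule has_derivative_transform_within_open[OF has_derivative_ident chart(2)[OF \<kappa>] y])
      (use chart(8)[OF \<kappa>] in auto)
  from has_derivative_unique[OF this transition_derivative[OF \<kappa> \<kappa>]] p show ?thesis by (metis IntI)
qed

lemma tangent_map_trans:
  assumes "\<kappa> \<in> A" "\<mu> \<in> A" "\<nu> \<in> A" and p: "p \<in> cdom \<kappa> \<inter> cdom \<mu> \<inter> cdom \<nu>"
  shows "tangent_map \<kappa> \<nu> id p *v u = tangent_map \<mu> \<nu> id p *v (tangent_map \<kappa> \<mu> id p *v u)"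
proof -
  let ?W = "cdom \<kappa> \<inter> (cdom \<mu> \<inter> cdom \<nu>)"
  have S: "open (coord \<kappa> ` ?W)"
    by (rule chart_image_open'[OF assms(1)]) (intro open_Int chart(1) assms)
  have y: "coord \<kappa> p \<in> coord \<kappa> ` ?W" using p by blast
  have i: "icoord \<kappa> (coord \<kappa> p) = p" using chart(6)[OF assms(1)] p by blast
  have d: "((\<lambda>y. coord \<nu> (icoord \<mu> (coord \<mu> (icoord \<kappa> y)))) has_derivative
      (\<lambda>u. tangent_map \<mu> \<nu> id p *v (tangent_map \<kappa> \<mu> id p *v u))) (at (coord \<kappa> p))"
    by (rule has_derivative_compose[where g = "\<lambda>y. coord \<nu> (icoord \<mu> y)", OF transition_derivative[OF assms(1,2)]])
      (use transition_derivative[OF assms(2,3), of p] p in \<open>simp_all add: i id_def\<close>)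
  have "((\<lambda>y. coord \<nu> (icoord \<kappa> y)) has_derivative
      (\<lambda>u. tangent_map \<mu> \<nu> id p *v (tangent_map \<kappa> \<mu> id p *v u))) (at (coord \<kappa> p))"
    by (rule has_derivative_transform_within_open[OF d S y]) (use chart(6)[OF assms(1)] chart(6)[OF assms(2)] in auto)
  from has_derivative_unique[OF this transition_derivative[OF assms(1,3)]] p show ?thesis by (metis IntE IntI)
qed

text \<open>A vector field on \<open>V\<close> from its expression in the single chart
  \<open>\<kappa>\<close>, with the normalisation to 0 that makes equality of vector fields equality
  of functions.\<close>

definition lift :: "'p chart \<Rightarrow> 'p set \<Rightarrow> (real^5 \<Rightarrow> real^5) \<Rightarrow> 'p vfield" where
  "lift \<kappa> V X = (\<lambda>\<mu> q. if \<mu> \<in> A \<and> q \<in> cdom \<mu> \<inter> V then tangent_map \<kappa> \<mu> id q *v X (coord \<kappa> q) else 0)"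

lemma smooth_on_mult_tangent:
  assumes "\<kappa> \<in> A" "\<mu> \<in> A" and S: "open S" "S \<subseteq> coord \<mu> ` (cdom \<mu> \<inter> cdom \<kappa>)"
  shows "smooth_on S (\<lambda>y. tangent_map \<kappa> \<mu> id (icoord \<mu> y))"
proof -
  let ?T = "coord \<kappa> ` (cdom \<kappa> \<inter> cdom \<mu>)"
  have T: "open ?T" using chart_image_open'[OF assms(1) chart(1)[OF assms(2)]] .
  have "(\<lambda>y. coord \<kappa> (icoord \<mu> y)) ` S \<subseteq> ?T" using S(2) chart(6)[OF assms(2)] by force
  from smooth_on_compose[OF S(1) T this smooth_on_subset[OF chart_transition[OF assms(2,1)] S(2)]
      smooth_on_jacobian[OF T chart_transition[OF assms(1,2)]]]
  show ?thesis by (simp add: tangent_map_def o_def)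
qed

context
  fixes \<kappa> V B
  assumes \<kappa>: "\<kappa> \<in> A" and V: "open V" "V \<subseteq> cdom \<kappa>" and B: "B = coord \<kappa> ` V"
begin

lemma B_open: "open B"
  unfolding B by (rule chart_image_open[OF \<kappa> V])

lemma vector_field_lift:
  assumes X: "smooth_on B X"
  shows "vector_field A V (lift \<kappa> V X)"
  unfolding vector_field_def
proof (intro conjI ballI allI impI)
  fix \<mu> assume \<mu>: "\<mu> \<in> A"
  let ?S = "coord \<mu> ` (cdom \<mu> \<inter> V)"
  have S: "open ?S" "?S \<subseteq> coord \<mu> ` (cdom \<mu> \<inter> cdom \<kappa>)" using chart_image_open'[OF \<mu> V(1)] V(2) by auto
  have "smooth_on ?S (\<lambda>y. X (coord \<kappa> (icoord \<mu> y)))"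
    by (rule smooth_on_compose[OF S(1) B_open _ smooth_on_subset[OF chart_transition[OF \<mu> \<kappa>] S(2)] X])
      (use chart(6)[OF \<mu>] in \<open>force simp: B\<close>)
  then have "smooth_on ?S (\<lambda>y. tangent_map \<kappa> \<mu> id (icoord \<mu> y) *v X (coord \<kappa> (icoord \<mu> y)))"
    by (intro smooth_intros S(1) smooth_on_mult_tangent[OF \<kappa> \<mu> S])
  then show "smooth_on ?S (lift \<kappa> V X \<mu> \<circ> icoord \<mu>)"
    by (rule smooth_on_congI[OF S(1)]) (use \<mu> chart(6)[OF \<mu>] in \<open>auto simp: lift_def\<close>)
next
  fix \<mu> \<nu> q assume "\<mu> \<in> A" "\<nu> \<in> A" "q \<in> cdom \<mu> \<inter> cdom \<nu> \<inter> V"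
  then show "lift \<kappa> V X \<nu> q = tangent_map \<mu> \<nu> id q *v lift \<kappa> V X \<mu> q"
    using tangent_map_trans[OF \<kappa>, of \<mu> \<nu> q] V(2) by (auto simp: lift_def)
qed (auto simp: lift_def)

lemma lift_self: "q \<in> V \<Longrightarrow> lift \<kappa> V X \<kappa> q = X (coord \<kappa> q)"
  using tangent_map_self[OF \<kappa>] V \<kappa> by (auto simp: lift_def)

lemma lift_of_vector_field:
  assumes Y: "vector_field A V Y"
  shows "Y = lift \<kappa> V (\<lambda>y. Y \<kappa> (icoord \<kappa> y))"
proof (intro ext)
  fix \<mu> q
  show "Y \<mu> q = lift \<kappa> V (\<lambda>y. Y \<kappa> (icoord \<kappa> y)) \<mu> q"
  proof (cases "\<mu> \<in> A \<and> q \<in> cdom \<mu> \<inter> V")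
    case True
    then have q: "q \<in> cdom \<kappa> \<inter> cdom \<mu> \<inter> V" "icoord \<kappa> (coord \<kappa> q) = q" using V(2) chart(6)[OF \<kappa>] by auto
    have "Y \<mu> q = tangent_map \<kappa> \<mu> id q *v Y \<kappa> q" using Y \<kappa> True q(1) unfolding vector_field_def by blast
    then show ?thesis using True q(2) by (simp add: lift_def)
  next
    case False
    then have "Y \<mu> q = 0" using Y unfolding vector_field_def by blast
    then show ?thesis using False by (auto simp: lift_def)
  qed
qed

lemma lift_cong: "(\<And>y. y \<in> B \<Longrightarrow> X y = Y y) \<Longrightarrow> lift \<kappa> V X = lift \<kappa> V Y"
  unfolding lift_def B by (intro ext) auto

lemma lift_eqD: "lift \<kappa> V X = lift \<kappa> V Y \<Longrightarrow> y \<in> B \<Longrightarrow> X y = Y y"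
  unfolding B using lift_self[of _ X] lift_self[of _ Y] by (metis imageE)

text \<open>In another chart both fields are transformed by the derivative of the transition map \<open>T\<close>; the second derivatives
  of \<open>T\<close> cancel in the bracket by symmetry.\<close>

lemma vf_bracket_lift:
  assumes X: "smooth_on B X" and Y: "smooth_on B Y"
  shows "vf_bracket A V (lift \<kappa> V X) (lift \<kappa> V Y) =
    lift \<kappa> V (\<lambda>y. fder Y y (X y) - fder X y (Y y))"
proof (intro ext)
  fix \<mu> q
  show "vf_bracket A V (lift \<kappa> V X) (lift \<kappa> V Y) \<mu> q =
    lift \<kappa> V (\<lambda>y. fder Y y (X y) - fder X y (Y y)) \<mu> q"
  proof (cases "\<mu> \<in> A \<and> q \<in> cdom \<mu> \<inter> V")
    case True
    then have \<mu>: "\<mu> \<in> A" and q: "q \<in> cdom \<mu>" "q \<in> V" "q \<in> cdom \<kappa>" using V(2) by auto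
    let ?T = "\<lambda>y. coord \<mu> (icoord \<kappa> y)" and ?T' = "\<lambda>y. coord \<kappa> (icoord \<mu> y)"
    let ?W = "coord \<kappa> ` (cdom \<kappa> \<inter> (cdom \<mu> \<inter> V))" and ?O = "coord \<mu> ` (cdom \<mu> \<inter> V)"
    define x where "x = coord \<kappa> q"
    have W: "open ?W" "?W \<subseteq> B" "?W \<subseteq> coord \<kappa> ` (cdom \<kappa> \<inter> cdom \<mu>)"
      using chart_image_open'[OF \<kappa> open_Int[OF chart(1)[OF \<mu>] V(1)]] by (auto simp: B)
    have x: "x \<in> ?W" "icoord \<kappa> x = q" using q chart(6)[OF \<kappa>] by (auto simp: x_def)
    have O: "open ?O" "coord \<mu> q \<in> ?O" using chart_image_open'[OF \<mu> V(1)] q by auto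
    have sT: "smooth_on ?W ?T" by (rule smooth_on_subset[OF chart_transition[OF \<kappa> \<mu>] W(3)])
    have T: "(?T has_derivative fder ?T z) (at z)" if "z \<in> ?W" for z
      by (rule smooth_on_derivative[OF sT that])
    have lift: "lift \<kappa> V Z \<mu> (icoord \<mu> (?T z)) = fder ?T z (Z z)" if z: "z \<in> ?W" for z Z
    proof -
      obtain q' where q': "q' \<in> cdom \<kappa>" "q' \<in> cdom \<mu>" "q' \<in> V" "z = coord \<kappa> q'" using z by blast
      then have i: "icoord \<kappa> z = q'" "icoord \<mu> (?T z) = q'" using chart(6)[OF \<kappa>] chart(6)[OF \<mu>] by simp_all
      have "tangent_map \<kappa> \<mu> id q' *v Z z = fder ?T z (Z z)"
        using fun_cong[OF frechet_derivative_at[OF transition_derivative[OF \<kappa> \<mu>, of q']], of "Z z"] q' by simp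
      then show ?thesis unfolding i(2) using q' \<mu> by (simp add: lift_def)
    qed
    have D: "fder (lift \<kappa> V Z \<mu> \<circ> icoord \<mu>) (coord \<mu> q) (fder ?T x v) =
        fder (\<lambda>z. fder ?T z (Z x)) x v +
        fder ?T x (fder Z x v)" if Z: "smooth_on B Z" for Z v
    proof -
      have "smooth_on ?O (lift \<kappa> V Z \<mu> \<circ> icoord \<mu>)"
        using vector_field_lift[OF Z] \<mu> unfolding vector_field_def by blast
      then have "((lift \<kappa> V Z \<mu> \<circ> icoord \<mu>) has_derivative fder (lift \<kappa> V Z \<mu> \<circ> icoord \<mu>) (?T x)) (at (?T x))"
        using smooth_on_derivative O(2) by (fastforce simp: x(2))
      from has_derivative_compose[OF T[OF x(1)] this]
      have "((\<lambda>z. (lift \<kappa> V Z \<mu> \<circ> icoord \<mu>) (?T z)) has_derivative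
          (\<lambda>v. fder (lift \<kappa> V Z \<mu> \<circ> icoord \<mu>) (coord \<mu> q) (fder ?T x v))) (at x)"
        by (simp add: x(2))
      from has_derivative_transform_within_open[OF this W(1) x(1), of "\<lambda>z. fder ?T z (Z z)"] lift
      have "((\<lambda>z. fder ?T z (Z z)) has_derivative
          (\<lambda>v. fder (lift \<kappa> V Z \<mu> \<circ> icoord \<mu>) (coord \<mu> q) (fder ?T x v))) (at x)" by simp
      from fun_cong[OF frechet_derivative_at[OF this], of v]
      show ?thesis using frechet_derivative_along[OF W(1) x(1) sT smooth_on_subset[OF Z W(2)], of v] by simp
    qed
    have l: "lift \<kappa> V Z \<mu> q = fder ?T x (Z x)" for Z
      using lift[OF x(1), of Z] chart(6)[OF \<mu> q(1)] by (simp add: x(2))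
    have "vf_bracket A V (lift \<kappa> V X) (lift \<kappa> V Y) \<mu> q =
        fder (lift \<kappa> V Y \<mu> \<circ> icoord \<mu>) (coord \<mu> q) (fder ?T x (X x)) -
        fder (lift \<kappa> V X \<mu> \<circ> icoord \<mu>) (coord \<mu> q) (fder ?T x (Y x))"
      using True by (simp add: vf_bracket_def l)
    also have "\<dots> = fder ?T x (fder Y x (X x) - fder X x (Y x))"
      unfolding D[OF X] D[OF Y] smooth_on_symmetric[OF W(1) x(1) sT, of "Y x" "X x"]
      using linear_diff[OF has_derivative_linear[OF T[OF x(1)]]] by simp
    finally show ?thesis by (simp add: l x_def)
  qed (auto simp: vf_bracket_def lift_def)
qed

end

end

lemma jacobian_eq:
  fixes f :: "real^'m \<Rightarrow> real^'n"
  assumes "(f has_derivative f') (at x)"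
  shows "jacobian f (at x) *v u = f' u"
  unfolding jacobian_def frechet_derivative_at[OF assms, symmetric]
  using matrix_works[of f'] has_derivative_linear[OF assms] by auto

text \<open>Contact space, cubic and mark are rendered as predicates on Engel components, so that
  one transport argument covers all three.\<close>

definition contact_cone :: "real^5 \<Rightarrow> bool" where
  "contact_cone z \<longleftrightarrow> z $ 0 = 0"

definition cubic_quadrics :: "real^5 \<Rightarrow> bool" where
  "cubic_quadrics z \<longleftrightarrow> z $ 0 = 0 \<and> z $ 1 * z $ 3 - (z $ 2)\<^sup>2 = 0 \<and> z $ 2 * z $ 4 - (z $ 3)\<^sup>2 = 0 \<and> z $ 2 * z $ 3 - z $ 1 * z $ 4 = 0"

definition mark_line :: "real^5 \<Rightarrow> bool" where
  "mark_line z \<longleftrightarrow> z $ 0 = 0 \<and> z $ 1 = 0 \<and> z $ 2 = 0 \<and> z $ 3 = 0"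

section \<open>Flows and the invariance of the flat structure\<close>

context twisted_cubic_manifold
begin

context
  fixes \<kappa> p r V
  assumes \<kappa>: "\<kappa> \<in> A" and r: "0 < r" "ball p r \<subseteq> coord \<kappa> ` cdom \<kappa>" and V: "V = {q \<in> cdom \<kappa>. coord \<kappa> q \<in> ball p r}"
    and flat: "\<And>q. q \<in> cdom \<kappa> \<Longrightarrow> adapted_cubic (engel_coframe (coord \<kappa> q)) (C \<kappa> q) (G \<kappa> q)"
      "\<And>q. q \<in> cdom \<kappa> \<Longrightarrow> adapted_mark (engel_coframe (coord \<kappa> q)) (l \<kappa> q)"
begin

lemma V_props: "open V" "V \<subseteq> cdom \<kappa>" "ball p r = coord \<kappa> ` V"
proof -
  have "V = cdom \<kappa> \<inter> coord \<kappa> -` ball p r" using V by blast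
  then show "open V" using continuous_open_preimage[OF chart(4,1)[OF \<kappa>] open_ball] by simp
  show "V \<subseteq> cdom \<kappa>" using V by blast
  show "ball p r = coord \<kappa> ` V" using r(2) unfolding V by blast
qed

lemma flat_sets:
  assumes "q \<in> cdom \<kappa>"
  shows "C \<kappa> q = {v. contact_cone (engel_coframe (coord \<kappa> q) *v v)}"
    "G \<kappa> q = {v. cubic_quadrics (engel_coframe (coord \<kappa> q) *v v)}"
    "l \<kappa> q = {v. mark_line (engel_coframe (coord \<kappa> q) *v v)}"
  using flat[OF assms] by (simp_all add: adapted_cubic_def adapted_mark_def contact_cone_def cubic_quadrics_def mark_line_def Let_def)

context
  fixes X \<epsilon> D \<Phi>
  assumes X: "smooth_on (ball p r) X" and flow: "local_flow A V (lift \<kappa> V X) \<epsilon> D \<Phi>"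
begin

private abbreviation "f z \<equiv> coord \<kappa> (\<Phi> (fst z) (icoord \<kappa> (snd z)))"

private lemma D: "0 < \<epsilon>" "open D" "D \<subseteq> V" "D \<subseteq> cdom \<kappa>" "\<And>t q. q \<in> D \<Longrightarrow> \<bar>t\<bar> < \<epsilon> \<Longrightarrow> \<Phi> t q \<in> V"
  "\<And>t q. q \<in> D \<Longrightarrow> \<bar>t\<bar> < \<epsilon> \<Longrightarrow> \<Phi> t q \<in> cdom \<kappa>" "\<And>q. q \<in> D \<Longrightarrow> \<Phi> 0 q = q" "\<And>q. q \<in> D \<Longrightarrow> icoord \<kappa> (coord \<kappa> q) = q"
proof -
  show *: "0 < \<epsilon>" "open D" "D \<subseteq> V" "\<And>t q. q \<in> D \<Longrightarrow> \<bar>t\<bar> < \<epsilon> \<Longrightarrow> \<Phi> t q \<in> V" "\<And>q. q \<in> D \<Longrightarrow> \<Phi> 0 q = q"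
    using flow unfolding local_flow_def by blast+
  show "D \<subseteq> cdom \<kappa>" "\<And>t q. q \<in> D \<Longrightarrow> \<bar>t\<bar> < \<epsilon> \<Longrightarrow> \<Phi> t q \<in> cdom \<kappa>" using * V_props(2) by blast+
  then show "\<And>q. q \<in> D \<Longrightarrow> icoord \<kappa> (coord \<kappa> q) = q" using chart(6)[OF \<kappa>] by blast
qed

private lemma O1: "open (coord \<kappa> ` D)" by (rule chart_image_open[OF \<kappa> D(2,4)])

private lemma f_B: "\<bar>t\<bar> < \<epsilon> \<Longrightarrow> y \<in> coord \<kappa> ` D \<Longrightarrow> f (t, y) \<in> ball p r"
  using D(5,8) V_props(3) by auto

private lemma f_smooth: "smooth_on ({-\<epsilon><..<\<epsilon>} \<times> coord \<kappa> ` D) f"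
proof -
  have *: "{(t, y). \<bar>t\<bar> < \<epsilon> \<and> y \<in> coord \<kappa> ` (cdom \<kappa> \<inter> D) \<and> \<Phi> t (icoord \<kappa> y) \<in> cdom \<kappa>} = {-\<epsilon><..<\<epsilon>} \<times> coord \<kappa> ` D"
    using D(4,6,8) by (auto simp: abs_less_iff)
  have "smooth_on {(t, y). \<bar>t\<bar> < \<epsilon> \<and> y \<in> coord \<kappa> ` (cdom \<kappa> \<inter> D) \<and> \<Phi> t (icoord \<kappa> y) \<in> cdom \<kappa>}
          (\<lambda>(t, y). coord \<kappa> (\<Phi> t (icoord \<kappa> y)))"
    using flow \<kappa> unfolding local_flow_def by blast
  then show ?thesis unfolding * case_prod_beta .
qed

private lemma f_ode:
  assumes "\<bar>t\<bar> < \<epsilon>" "y \<in> coord \<kappa> ` D"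
  shows "((\<lambda>s. f (s, y)) has_vector_derivative X (f (t, y))) (at t)"
proof -
  obtain q where q: "q \<in> D" "y = coord \<kappa> q" using assms by blast
  have "((\<lambda>s. coord \<kappa> (\<Phi> s q)) has_vector_derivative lift \<kappa> V X \<kappa> (\<Phi> t q)) (at t)"
    using flow \<kappa> q assms(1) D(6) unfolding local_flow_def by blast
  then show ?thesis using q(2) D(8)[OF q(1)] lift_self[OF \<kappa> V_props(1,2) V_props(3) D(5)[OF q(1) assms(1)], of X] by simp
qed

private lemma f_tangent:
  assumes t: "\<bar>t\<bar> < \<epsilon>" and q: "q \<in> D"
  shows "tangent_map \<kappa> \<kappa> (\<Phi> t) q *v v = fder f (t, coord \<kappa> q) (0, v)"
    "((\<lambda>y. coord \<kappa> (\<Phi> t (icoord \<kappa> y))) has_derivative (\<lambda>v. tangent_map \<kappa> \<kappa> (\<Phi> t) q *v v)) (at (coord \<kappa> q))"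
proof -
  have y: "coord \<kappa> q \<in> coord \<kappa> ` D" using q by blast
  note v = variational_equation(2)[OF O1 open_ball X f_smooth f_B f_ode t y]
  then have d: "((coord \<kappa> \<circ> \<Phi> t \<circ> icoord \<kappa>) has_derivative (\<lambda>v. fder f (t, coord \<kappa> q) (0, v))) (at (coord \<kappa> q))"
    by (simp add: o_def)
  show *: "tangent_map \<kappa> \<kappa> (\<Phi> t) q *v v = fder f (t, coord \<kappa> q) (0, v)" for v
    unfolding tangent_map_def by (rule jacobian_eq[OF d])
  show "((\<lambda>y. coord \<kappa> (\<Phi> t (icoord \<kappa> y))) has_derivative (\<lambda>v. tangent_map \<kappa> \<kappa> (\<Phi> t) q *v v)) (at (coord \<kappa> q))"
    unfolding * using v by simp
qed

text \<open>The Engel components, at the point reached at time t, of the image of v under the flow;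
  as a curve in t they satisfy the linear equation given by the Lie matrix.\<close>

private definition "w q v t = engel_coframe (coord \<kappa> (\<Phi> t q)) *v (tangent_map \<kappa> \<kappa> (\<Phi> t) q *v v)"

private lemma w_ode:
  assumes t: "\<bar>t\<bar> < \<epsilon>" and q: "q \<in> D"
  shows "(w q v has_vector_derivative lie_matrix X (coord \<kappa> (\<Phi> t q)) *v w q v t) (at t)"
proof -
  let ?y = "coord \<kappa> q"
  let ?\<xi> = "\<lambda>s. fder f (s, ?y) (0, v)"
  have y: "?y \<in> coord \<kappa> ` D" using q by blast
  have "((\<lambda>s. engel_coframe (f (s, ?y)) *v ?\<xi> s) has_vector_derivative lie_matrix X (f (t, ?y)) *v (engel_coframe (f (t, ?y)) *v ?\<xi> t)) (at t)"
    by (rule coframe_along_flow[where c = "\<lambda>s. f (s, ?y)" and \<xi> = ?\<xi>, OF X f_B[OF t y] f_ode[OF t y]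
          variational_equation(1)[OF O1 open_ball X f_smooth f_B f_ode t y]])
  then have "((\<lambda>s. engel_coframe (f (s, ?y)) *v ?\<xi> s) has_vector_derivative lie_matrix X (coord \<kappa> (\<Phi> t q)) *v w q v t) (at t)"
    using D(8)[OF q] by (simp add: w_def f_tangent(1)[OF t q])
  then show ?thesis
    by (rule has_vector_derivative_transform_within_open[where S = "{-\<epsilon><..<\<epsilon>}"])
      (use t D(8)[OF q] in \<open>auto simp: w_def f_tangent(1)[OF _ q] abs_less_iff\<close>)
qed

private lemma tangent_0: "q \<in> D \<Longrightarrow> tangent_map \<kappa> \<kappa> (\<Phi> 0) q *v v = v"
proof -
  assume q: "q \<in> D"
  have y: "coord \<kappa> q \<in> coord \<kappa> ` D" using q by blast
  have 0: "\<bar>0::real\<bar> < \<epsilon>" using D(1) by simp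
  have "((\<lambda>y. coord \<kappa> (\<Phi> 0 (icoord \<kappa> y))) has_derivative (\<lambda>v. v)) (at (coord \<kappa> q))"
    by (rule has_derivative_transform_within_open[OF has_derivative_ident O1 y]) (use D(7,8) in auto)
  from fun_cong[OF has_derivative_unique[OF f_tangent(2)[OF 0 q] this]] show ?thesis .
qed

private lemma w_0: "q \<in> D \<Longrightarrow> w q v 0 = engel_coframe (coord \<kappa> q) *v v"
  unfolding w_def by (simp add: tangent_0 D(7))

text \<open>\<open>preserved_at\<close> refers to arbitrary charts at both ends, while the analysis
  is done in \<open>\<kappa>\<close>; the tangent map is factored through
  \<open>\<kappa>\<close>.\<close>

private lemma tangent_chain:
  assumes t: "\<bar>t\<bar> < \<epsilon>" and q: "q \<in> D" and \<mu>: "\<mu> \<in> A" "\<nu> \<in> A" "q \<in> cdom \<mu>" "\<Phi> t q \<in> cdom \<nu>"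
  shows "tangent_map \<mu> \<nu> (\<Phi> t) q *v v =
    tangent_map \<kappa> \<nu> id (\<Phi> t q) *v (tangent_map \<kappa> \<kappa> (\<Phi> t) q *v (tangent_map \<mu> \<kappa> id q *v v))"
proof -
  have q\<kappa>: "q \<in> cdom \<kappa>" "\<Phi> t q \<in> cdom \<kappa>" using D(4,6) q t by auto
  have i: "icoord \<mu> (coord \<mu> q) = q" using chart(6)[OF \<mu>(1,3)] .
  have S: "open (coord \<mu> ` (cdom \<mu> \<inter> D))" "coord \<mu> q \<in> coord \<mu> ` (cdom \<mu> \<inter> D)"
    using chart_image_open'[OF \<mu>(1) D(2)] \<mu>(3) q by auto
  have d1: "((\<lambda>y. coord \<kappa> (icoord \<mu> y)) has_derivative (\<lambda>v. tangent_map \<mu> \<kappa> id q *v v)) (at (coord \<mu> q))"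
    using transition_derivative[OF \<mu>(1) \<kappa>, of q] \<mu>(3) q\<kappa> by blast
  have d2: "((\<lambda>y. coord \<kappa> (\<Phi> t (icoord \<kappa> (coord \<kappa> (icoord \<mu> y))))) has_derivative
      (\<lambda>v. tangent_map \<kappa> \<kappa> (\<Phi> t) q *v (tangent_map \<mu> \<kappa> id q *v v))) (at (coord \<mu> q))"
    by (rule has_derivative_compose[OF d1, of "\<lambda>y. coord \<kappa> (\<Phi> t (icoord \<kappa> y))"]) (use f_tangent(2)[OF t q] in \<open>simp add: i\<close>)
  have d3: "((\<lambda>y. coord \<nu> (icoord \<kappa> y)) has_derivative (\<lambda>v. tangent_map \<kappa> \<nu> id (\<Phi> t q) *v v)) (at (coord \<kappa> (\<Phi> t q)))"
    using transition_derivative[OF \<kappa> \<mu>(2), of "\<Phi> t q"] \<mu>(4) q\<kappa> by blast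
  have "((\<lambda>y. coord \<nu> (icoord \<kappa> (coord \<kappa> (\<Phi> t (icoord \<kappa> (coord \<kappa> (icoord \<mu> y))))))) has_derivative
      (\<lambda>v. tangent_map \<kappa> \<nu> id (\<Phi> t q) *v (tangent_map \<kappa> \<kappa> (\<Phi> t) q *v (tangent_map \<mu> \<kappa> id q *v v)))) (at (coord \<mu> q))"
    by (rule has_derivative_compose[OF d2, of "\<lambda>y. coord \<nu> (icoord \<kappa> y)"]) (use d3 in \<open>simp add: i D(8)[OF q] id_def\<close>)
  then have "((coord \<nu> \<circ> \<Phi> t \<circ> icoord \<mu>) has_derivative
      (\<lambda>v. tangent_map \<kappa> \<nu> id (\<Phi> t q) *v (tangent_map \<kappa> \<kappa> (\<Phi> t) q *v (tangent_map \<mu> \<kappa> id q *v v)))) (at (coord \<mu> q))"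
    by (rule has_derivative_transform_within_open[OF _ S]) (use chart(6)[OF \<mu>(1)] D(6,8) chart(6)[OF \<kappa>] t in auto)
  from jacobian_eq[OF this] show ?thesis unfolding tangent_map_def .
qed

text \<open>The equivalence \<open>pres\<close> gives membership in both directions. Equality of the
  image with the whole set also needs surjectivity of the tangent map, which follows from
  \<open>inj\<close> by finite dimension.\<close>

private lemma preserved_if:
  assumes Y: "tangent_sets A Y" and YP: "\<And>q. q \<in> cdom \<kappa> \<Longrightarrow> Y \<kappa> q = {v. P (engel_coframe (coord \<kappa> q) *v v)}"
    and pres: "\<And>v s. \<bar>s\<bar> < \<epsilon> \<Longrightarrow> P (w q v s) \<longleftrightarrow> P (w q v 0)"
    and inj: "\<And>v s. \<bar>s\<bar> < \<epsilon> \<Longrightarrow> w q v s = 0 \<Longrightarrow> w q v 0 = 0" and t: "\<bar>t\<bar> < \<epsilon>" and q: "q \<in> D"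
  shows "preserved_at A (\<Phi> t) q Y"
proof -
  let ?T = "tangent_map \<kappa> \<kappa> (\<Phi> t) q"
  have q\<kappa>: "q \<in> cdom \<kappa>" "\<Phi> t q \<in> cdom \<kappa>" using D(4,6) q t by auto
  have mem: "?T *v v \<in> Y \<kappa> (\<Phi> t q) \<longleftrightarrow> v \<in> Y \<kappa> q" for v
    using pres[OF t, of v] by (simp add: YP q\<kappa> w_0[OF q]) (simp add: w_def)
  have "?T *v v = 0 \<longrightarrow> v = 0" for v
  proof
    assume "?T *v v = 0"
    then have "engel_coframe (coord \<kappa> q) *v v = 0" using inj[OF t, of v] by (simp add: w_0[OF q]) (simp add: w_def)
    then show "v = 0" using invertible_engel[of "coord \<kappa> q"]
      unfolding invertible_def by (metis matrix_vector_mul_assoc matrix_vector_mul_lid matrix_vector_mult_0_right)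
  qed
  then have "inj ((*v) ?T)" using linear_injective_0[OF matrix_vector_mul_linear] by blast
  then have surj: "surj ((*v) ?T)" by (rule linear_injective_imp_surjective[OF matrix_vector_mul_linear]) (rule refl)
  have k: "(\<lambda>v. ?T *v v) ` Y \<kappa> q = Y \<kappa> (\<Phi> t q)"
  proof (intro equalityI subsetI)
    fix u assume u: "u \<in> Y \<kappa> (\<Phi> t q)"
    obtain v where "u = ?T *v v" using surj by blast
    then show "u \<in> (\<lambda>v. ?T *v v) ` Y \<kappa> q" using mem u by blast
  qed (use mem in blast)
  show ?thesis unfolding preserved_at_def
  proof (intro ballI impI)
    fix \<mu> \<nu> assume \<mu>: "\<mu> \<in> A" "\<nu> \<in> A" and c: "q \<in> cdom \<mu> \<and> \<Phi> t q \<in> cdom \<nu>"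
    have 1: "Y \<kappa> q = (\<lambda>v. tangent_map \<mu> \<kappa> id q *v v) ` Y \<mu> q"
      using Y \<mu>(1) \<kappa> c q\<kappa>(1) unfolding tangent_sets_def by blast
    have 2: "Y \<nu> (\<Phi> t q) = (\<lambda>v. tangent_map \<kappa> \<nu> id (\<Phi> t q) *v v) ` Y \<kappa> (\<Phi> t q)"
      using Y \<mu>(2) \<kappa> c q\<kappa>(2) unfolding tangent_sets_def by blast
    show "(\<lambda>v. tangent_map \<mu> \<nu> (\<Phi> t) q *v v) ` Y \<mu> q = Y \<nu> (\<Phi> t q)"
      unfolding 2 k[symmetric] 1 image_image using tangent_chain[OF t q \<mu>] c by simp
  qed
qed

lemma preserved_by_flow:
  assumes sym: "engel_symmetry (ball p r) X" and t: "\<bar>t\<bar> < \<epsilon>" and q: "q \<in> D"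
  shows "preserved_at A (\<Phi> t) q C" "preserved_at A (\<Phi> t) q G" "preserved_at A (\<Phi> t) q l"
proof -
  have y: "coord \<kappa> q \<in> coord \<kappa> ` D" using q by blast
  let ?c = "\<lambda>s. coord \<kappa> (\<Phi> s q)"
  have c: "?c s \<in> ball p r" if "\<bar>s\<bar> < \<epsilon>" for s using f_B[OF that y] D(8)[OF q] by simp
  have cc: "continuous_on {-\<epsilon><..<\<epsilon>} ?c"
    using has_vector_derivative_continuous[OF f_ode[OF _ y]] D(8)[OF q]
    by (intro continuous_at_imp_continuous_on ballI) (auto simp: abs_less_iff)
  have e: "\<bar>0::real\<bar> < \<epsilon>" using D(1) by simp
  note pr = open_ball X sym c cc w_ode[OF _ q]
  have z: "w q v s = 0 \<Longrightarrow> w q v 0 = 0" if "\<bar>s\<bar> < \<epsilon>" for v s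
    by (rule symmetry_preserves_zero[OF pr that e])
  have "contact_cone (w q v s) \<Longrightarrow> contact_cone (w q v s')" if "\<bar>s\<bar> < \<epsilon>" "\<bar>s'\<bar> < \<epsilon>" for v s s'
    unfolding contact_cone_def by (rule symmetry_preserves_contact[OF pr that])
  then show "preserved_at A (\<Phi> t) q C"
    using e z by (intro preserved_if[OF sets(1) flat_sets(1) _ _ t q]) blast+
  have "cubic_quadrics (w q v s) \<Longrightarrow> cubic_quadrics (w q v s')" if "\<bar>s\<bar> < \<epsilon>" "\<bar>s'\<bar> < \<epsilon>" for v s s'
    unfolding cubic_quadrics_def using symmetry_preserves_cubic[OF pr that] by blast
  then show "preserved_at A (\<Phi> t) q G"
    using e z by (intro preserved_if[OF sets(2) flat_sets(2) _ _ t q]) blast+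
  have "mark_line (w q v s) \<Longrightarrow> mark_line (w q v s')" if "\<bar>s\<bar> < \<epsilon>" "\<bar>s'\<bar> < \<epsilon>" for v s s'
    unfolding mark_line_def using symmetry_preserves_line[OF pr that] by blast
  then show "preserved_at A (\<Phi> t) q l"
    using e z by (intro preserved_if[OF sets(3) flat_sets(3) _ _ t q]) blast+
qed

text \<open>The vector v can be chosen with any prescribed initial components z. Invariance makes
  the defining functions vanish along the whole curve, and their derivatives at time 0 are linear
  conditions on the Lie matrix.\<close>

lemma lie_matrix_if_preserved:
  assumes pres: "\<And>t. \<bar>t\<bar> < \<epsilon> \<Longrightarrow> preserved_at A (\<Phi> t) q C \<and> preserved_at A (\<Phi> t) q G \<and> preserved_at A (\<Phi> t) q l" and q: "q \<in> D"
  shows "engel_symmetry {coord \<kappa> q} X"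
proof -
  have e: "\<bar>0::real\<bar> < \<epsilon>" using D(1) by simp
  let ?N = "lie_matrix X (coord \<kappa> q)"
  have q\<kappa>: "q \<in> cdom \<kappa>" "\<And>t. \<bar>t\<bar> < \<epsilon> \<Longrightarrow> \<Phi> t q \<in> cdom \<kappa>" using D(4,6) q by auto
  have img: "tangent_map \<kappa> \<kappa> (\<Phi> t) q *v v \<in> Y \<kappa> (\<Phi> t q)" if "preserved_at A (\<Phi> t) q Y" "v \<in> Y \<kappa> q" "\<bar>t\<bar> < \<epsilon>" for t v Y
    using that \<kappa> q\<kappa> unfolding preserved_at_def by blast
  have "\<exists>v. w q v 0 = z \<and> (w q v has_vector_derivative ?N *v z) (at 0) \<and>
      (contact_cone z \<longrightarrow> (\<forall>t. \<bar>t\<bar> < \<epsilon> \<longrightarrow> contact_cone (w q v t))) \<and>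
      (cubic_quadrics z \<longrightarrow> (\<forall>t. \<bar>t\<bar> < \<epsilon> \<longrightarrow> cubic_quadrics (w q v t))) \<and>
      (mark_line z \<longrightarrow> (\<forall>t. \<bar>t\<bar> < \<epsilon> \<longrightarrow> mark_line (w q v t)))" for z
  proof -
    obtain v where v: "engel_coframe (coord \<kappa> q) *v v = z"
      using invertible_engel[of "coord \<kappa> q"] unfolding invertible_def by (metis matrix_vector_mul_assoc matrix_vector_mul_lid)
    have w0: "w q v 0 = z" using w_0[OF q, of v] v by simp
    moreover have "(w q v has_vector_derivative ?N *v z) (at 0)" using w_ode[OF e q, of v] D(7)[OF q] w0 by simp
    moreover have "contact_cone z \<longrightarrow> (\<forall>t. \<bar>t\<bar> < \<epsilon> \<longrightarrow> contact_cone (w q v t))"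
      using img[of _ C v] pres q\<kappa> by (auto simp: flat_sets w_def v)
    moreover have "cubic_quadrics z \<longrightarrow> (\<forall>t. \<bar>t\<bar> < \<epsilon> \<longrightarrow> cubic_quadrics (w q v t))"
      using img[of _ G v] pres q\<kappa> by (auto simp: flat_sets w_def v)
    moreover have "mark_line z \<longrightarrow> (\<forall>t. \<bar>t\<bar> < \<epsilon> \<longrightarrow> mark_line (w q v t))"
      using img[of _ l v] pres q\<kappa> by (auto simp: flat_sets w_def v)
    ultimately show ?thesis by blast
  qed
  then obtain v where v: "\<And>z. w q (v z) 0 = z" "\<And>z. (w q (v z) has_vector_derivative ?N *v z) (at 0)"
    "\<And>z t. contact_cone z \<Longrightarrow> \<bar>t\<bar> < \<epsilon> \<Longrightarrow> contact_cone (w q (v z) t)"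
    "\<And>z t. cubic_quadrics z \<Longrightarrow> \<bar>t\<bar> < \<epsilon> \<Longrightarrow> cubic_quadrics (w q (v z) t)"
    "\<And>z t. mark_line z \<Longrightarrow> \<bar>t\<bar> < \<epsilon> \<Longrightarrow> mark_line (w q (v z) t)" by metis
  have zero: "d = 0" if d: "(h has_real_derivative d) (at 0)" and h: "\<And>t. \<bar>t\<bar> < \<epsilon> \<Longrightarrow> h t = 0" for h :: "real \<Rightarrow> real" and d
  proof -
    have "(h has_real_derivative 0) (at 0)"
      by (rule has_field_derivative_transform_within_open[where f = "\<lambda>_. 0" and S = "{-\<epsilon><..<\<epsilon>}"]) (use e h in \<open>auto simp: abs_less_iff\<close>)
    then show ?thesis using DERIV_unique d by blast
  qed
  note wn = has_real_derivative_nth[OF v(2)]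
  have "(?N *v z) $ 0 = 0" if "z $ 0 = 0" for z
    by (rule zero[OF wn]) (use v(3)[of z] that in \<open>auto simp: contact_cone_def\<close>)
  moreover have "let z = row5 0 1 \<tau> (\<tau>^2) (\<tau>^3); n = ?N *v z in
      n $ 1 * z $ 3 + z $ 1 * n $ 3 - 2 * z $ 2 * n $ 2 = 0 \<and> n $ 2 * z $ 4 + z $ 2 * n $ 4 - 2 * z $ 3 * n $ 3 = 0" for \<tau>
  proof -
    let ?z = "row5 0 1 \<tau> (\<tau>^2) (\<tau>^3)"
    let ?w = "w q (v ?z)"
    have cq: "cubic_quadrics ?z" by (simp add: cubic_quadrics_def power2_eq_square power3_eq_cube)
    have d: "((\<lambda>s. ?w s $ 1 * ?w s $ 3 - (?w s $ 2)\<^sup>2) has_real_derivative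
        (?N *v ?z) $ 1 * ?w 0 $ 3 + (?N *v ?z) $ 3 * ?w 0 $ 1 - 2 * ?w 0 $ 2 * (?N *v ?z) $ 2) (at 0)"
      "((\<lambda>s. ?w s $ 2 * ?w s $ 4 - (?w s $ 3)\<^sup>2) has_real_derivative
        (?N *v ?z) $ 2 * ?w 0 $ 4 + (?N *v ?z) $ 4 * ?w 0 $ 2 - 2 * ?w 0 $ 3 * (?N *v ?z) $ 3) (at 0)"
      by (auto intro!: derivative_eq_intros wn)
    show ?thesis
      using zero[OF d(1)] zero[OF d(2)] v(4)[OF cq] unfolding v(1) Let_def cubic_quadrics_def by (simp add: mult.commute)
  qed
  moreover have "(?N *v row5 0 0 0 0 1) $ i = 0" if "i \<noteq> 4" for i
    by (rule zero[OF wn]) (use v(5)[of "row5 0 0 0 0 1"] that exhaust_5[of i] in \<open>auto simp: mark_line_def\<close>)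
  ultimately show ?thesis unfolding engel_symmetry_lie_matrix Let_def
    using lie_algebra_conditions[of ?N] by simp
qed

end

theorem infinitesimal_symmetries_flat: "infinitesimal_symmetries A C G l V = range (\<lambda>c. lift \<kappa> V (sym_field c))"
proof (intro equalityI subsetI)
  note lv = \<kappa> V_props
  fix Y assume Y: "Y \<in> infinitesimal_symmetries A C G l V"
  then have vf: "vector_field A V Y" by (simp add: infinitesimal_symmetries_def)
  define X where "X y = Y \<kappa> (icoord \<kappa> y)" for y
  have lX: "Y = lift \<kappa> V X" unfolding X_def[abs_def] by (rule lift_of_vector_field[OF lv vf])
  have "smooth_on (coord \<kappa> ` (cdom \<kappa> \<inter> V)) (Y \<kappa> \<circ> icoord \<kappa>)" using vf \<kappa> unfolding vector_field_def by blast
  moreover have "cdom \<kappa> \<inter> V = V" using V_props(2) by blast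
  ultimately have sX: "smooth_on (ball p r) X" using V_props(3) by (simp add: X_def[abs_def] o_def)
  have "engel_symmetry {coord \<kappa> q} X" if q: "q \<in> V" for q
  proof -
    have "q \<in> cdom \<kappa> \<inter> V" using q V_props(2) by blast
    \<comment> \<open>Membership among the symmetries says something only along an actual flow, so
      one is produced around each point of \<open>V\<close>.\<close>
    from local_flow_exists[OF V_props(1) vf \<kappa> this] obtain \<epsilon> D \<Phi> where fl: "q \<in> D" "local_flow A V Y \<epsilon> D \<Phi>" by blast
    show ?thesis
    proof (rule lie_matrix_if_preserved[OF sX _ _ fl(1)])
      show "local_flow A V (lift \<kappa> V X) \<epsilon> D \<Phi>" using fl(2) lX by simp
      show "preserved_at A (\<Phi> t) q C \<and> preserved_at A (\<Phi> t) q G \<and> preserved_at A (\<Phi> t) q l" if "\<bar>t\<bar> < \<epsilon>" for t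
        using Y fl that unfolding infinitesimal_symmetries_def by blast
    qed
  qed
  then have "engel_symmetry (ball p r) X" unfolding engel_symmetry_def V_props(3) by blast
  from engel_symmetry_sym_field[OF r(1) sX this] obtain c where "\<And>y. y \<in> ball p r \<Longrightarrow> X y = sym_field c y" by blast
  then have "lift \<kappa> V X = lift \<kappa> V (sym_field c)" by (rule lift_cong[OF lv])
  then show "Y \<in> range (\<lambda>c. lift \<kappa> V (sym_field c))" unfolding lX by blast
next
  fix Y assume "Y \<in> range (\<lambda>c. lift \<kappa> V (sym_field c))"
  then obtain c where Y: "Y = lift \<kappa> V (sym_field c)" by blast
  have s: "smooth_on (ball p r) (sym_field c)" by (rule smooth_on_sym_field) simp
  show "Y \<in> infinitesimal_symmetries A C G l V"
    unfolding infinitesimal_symmetries_def Y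
    using vector_field_lift[OF \<kappa> V_props s] preserved_by_flow[OF s _ engel_symmetry_sym_field_converse] by blast
qed

end

end

section \<open>The parabolic subalgebra\<close>

text \<open>A symmetry with parameters \<open>(a, x, z, y, k)\<close> corresponds to the derivation of the octonions whose diagonal part has
  the weights \<open>- x - 2 z\<close>, \<open>2 x + z\<close>, \<open>z - x\<close>; the signs and the factor 3 come from matching the root vectors.\<close>

definition zorn_der :: "sym_param \<Rightarrow> split_oct \<Rightarrow> split_oct" where
  "zorn_der c q = (case c of (a, x, z, y, k) \<Rightarrow> case q of (\<alpha>, u, v, \<beta>) \<Rightarrow>
     (- (a $ 2 * u $ 2 + y * u $ 3 + a $ 3 * v $ 1),
      vector [(- x - 2 * z) * u $ 1 - a $ 0 * u $ 2 - a $ 4 * u $ 3 + a $ 2 * v $ 3 - y * v $ 2 + a $ 3 * (\<alpha> - \<beta>),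
        (2 * x + z) * u $ 2 + 3 * k * u $ 3 + y * v $ 1,
        (z - x) * u $ 3 - a $ 1 * u $ 2 - a $ 2 * v $ 1],
      vector [(x + 2 * z) * v $ 1,
        - (2 * x + z) * v $ 2 + a $ 0 * v $ 1 + a $ 1 * v $ 3 + a $ 2 * (\<alpha> - \<beta>) - a $ 3 * u $ 3,
        (x - z) * v $ 3 + a $ 4 * v $ 1 - 3 * k * v $ 2 + y * (\<alpha> - \<beta>) + a $ 3 * u $ 2],
      a $ 2 * u $ 2 + y * u $ 3 + a $ 3 * v $ 1))"

definition oct_u :: "3 \<Rightarrow> split_oct" where "oct_u i = (0, axis i 1, 0, 0)"

definition oct_v :: "3 \<Rightarrow> split_oct" where "oct_v i = (0, 0, axis i 1, 0)"

text \<open>For \<open>zorn_der c\<close> the images of u_2 and u_3 display all nine parameters; the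
  combinations for \<open>x\<close> and \<open>z\<close> invert the diagonal weights 2 x + z and z -
  x.\<close>

definition der_param :: "(split_oct \<Rightarrow> split_oct) \<Rightarrow> sym_param" where
  "der_param D = (let (\<alpha>, u, v, \<beta>) = D (oct_u 2); (\<alpha>', u', v', \<beta>') = D (oct_u 3) in
     (row5 (- u $ 1) (- u $ 3) \<beta> (v $ 3) (- u' $ 1), (u $ 2 - u' $ 3) / 3, (u $ 2 + 2 * u' $ 3) / 3, \<beta>', u' $ 2 / 3))"

lemmas oct_simps = vec_eq_iff forall_3 cross3_def inner_vec_def sum_3 vector_3 axis_def

lemma der_param_zorn_der: "der_param (zorn_der c) = c"
  by (cases c) (simp add: der_param_def zorn_der_def oct_u_def oct_simps vec5_eq_iff forall_5[unfolded vec_eq_iff] row5_def algebra_simps)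

lemma der_param_add: "der_param (\<lambda>q. D q + E q) = der_param D + der_param E"
  by (cases "D (oct_u 2)"; cases "D (oct_u 3)"; cases "E (oct_u 2)"; cases "E (oct_u 3)")
    (simp add: der_param_def vec5_eq_iff field_simps)

lemma der_param_diff: "der_param (\<lambda>q. D q - E q) = der_param D - der_param E"
  by (cases "D (oct_u 2)"; cases "D (oct_u 3)"; cases "E (oct_u 2)"; cases "E (oct_u 3)")
    (simp add: der_param_def vec5_eq_iff field_simps)

lemma der_param_scale: "der_param (\<lambda>q. s *\<^sub>R D q) = s *\<^sub>R der_param D"
  by (cases "D (oct_u 2)"; cases "D (oct_u 3)") (simp add: der_param_def vec5_eq_iff field_simps)

lemma linear_zorn_der: "linear (zorn_der c)"
  by (rule linearI; cases c) (auto simp: zorn_der_def oct_simps algebra_simps)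

lemma derivation_zorn_der: "zorn_der c (oct_mult p q) = oct_mult (zorn_der c p) q + oct_mult p (zorn_der c q)"
proof -
  obtain a x z y k where c: "c = (a, x, z, y, k)" by (cases c)
  obtain \<alpha> u v \<beta> where p: "p = (\<alpha>, u, v, \<beta>)" by (cases p)
  obtain \<alpha>' u' v' \<beta>' where q: "q = (\<alpha>', u', v', \<beta>')" by (cases q)
  show ?thesis
    by (simp add: c p q zorn_der_def oct_simps) (simp add: algebra_simps)
qed

lemma zorn_der_p1: "zorn_der c \<in> p1"
proof -
  obtain a x z y k where c: "c = (a, x, z, y, k)" by (cases c)
  have "zorn_der c null_vector = (- x - 2 * z) *\<^sub>R null_vector"
    by (simp add: c zorn_der_def null_vector_def oct_simps)
  then show ?thesis
    unfolding p1_def split_g2_def using linear_zorn_der derivation_zorn_der by blast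
qed

lemma oct_products:
  "oct_mult (oct_u 2) (oct_u 2) = 0" "oct_mult (oct_u 3) (oct_u 3) = 0"
  "oct_mult (oct_u 1) (oct_u 2) = oct_v 3" "oct_mult (oct_u 2) (oct_u 1) = - oct_v 3"
  "oct_mult (oct_u 3) (oct_u 1) = oct_v 2" "oct_mult (oct_u 1) (oct_u 3) = - oct_v 2"
  "oct_mult (oct_u 2) (oct_u 3) = oct_v 1" "oct_mult (oct_u 3) (oct_u 2) = - oct_v 1"
  "oct_mult (oct_v 2) (oct_v 3) = - oct_u 1"
  "oct_mult (oct_u 1) (oct_v 1) = (1, 0, 0, 0)" "oct_mult (oct_v 1) (oct_u 1) = (0, 0, 0, 1)"
  by (simp_all add: oct_u_def oct_v_def oct_simps zero_prod_def)

text \<open>The octonions u_1, u_2, u_3 generate the algebra and D u_1 = r u_1. Vanishing parameters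
  remove most entries of D u_2 and D u_3; the relations u_i u_i = 0 and the anticommutation of
  distinct u_i remove the others.\<close>

lemma p1_zero:
  assumes D: "D \<in> p1" and 0: "der_param D = 0"
  shows "D q = 0"
proof -
  have lin: "linear D" and der: "\<And>x y. D (oct_mult x y) = oct_mult (D x) y + oct_mult x (D y)"
    using D unfolding p1_def split_g2_def by blast+
  obtain r where r: "D (oct_u 1) = r *\<^sub>R oct_u 1" using D unfolding p1_def null_vector_def oct_u_def by blast
  obtain \<alpha> u v \<beta> where u2: "D (oct_u 2) = (\<alpha>, u, v, \<beta>)" by (cases "D (oct_u 2)")
  obtain \<alpha>' u' v' \<beta>' where u3: "D (oct_u 3) = (\<alpha>', u', v', \<beta>')" by (cases "D (oct_u 3)")
  note D0 = linear_0[OF lin] and Dm = linear_neg[OF lin]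
  have p: "u $ 1 = 0" "u $ 2 = 0" "u $ 3 = 0" "u' $ 1 = 0" "u' $ 2 = 0" "u' $ 3 = 0" "\<beta> = 0" "\<beta>' = 0" "v $ 3 = 0"
    using 0 by (auto simp: der_param_def u2 u3 zero_prod_def vec5_eq_iff)
  have a: "\<alpha> = 0" "v $ 2 = 0"
    using der[of "oct_u 2" "oct_u 2"] p by (simp_all add: oct_products D0 u2) (simp_all add: oct_u_def oct_simps zero_prod_def)
  have b: "\<alpha>' = 0" "v' $ 3 = 0"
    using der[of "oct_u 3" "oct_u 3"] p by (simp_all add: oct_products D0 u3) (simp_all add: oct_u_def oct_simps zero_prod_def)
  have c: "v $ 1 = 0"
    using der[of "oct_u 1" "oct_u 2"] der[of "oct_u 2" "oct_u 1"] p a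
    by (simp add: oct_products Dm u2 r) (simp add: oct_u_def oct_v_def oct_simps zero_prod_def)
  have u2: "D (oct_u 2) = 0" using p a c by (simp add: u2 oct_simps zero_prod_def)
  have d: "v' $ 1 = 0"
    using der[of "oct_u 1" "oct_u 3"] der[of "oct_u 3" "oct_u 1"] p b
    by (simp add: oct_products Dm u3 r) (simp add: oct_u_def oct_v_def oct_simps zero_prod_def)
  have e: "v' $ 2 = 0"
    using der[of "oct_u 2" "oct_u 3"] der[of "oct_u 3" "oct_u 2"] p b
    by (simp add: oct_products Dm u3 u2) (simp add: oct_u_def oct_v_def oct_simps zero_prod_def)
  have u3: "D (oct_u 3) = 0" using p b d e by (simp add: u3 oct_simps zero_prod_def)
  have v3: "D (oct_v 3) = r *\<^sub>R oct_v 3"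
    using der[of "oct_u 1" "oct_u 2"] by (simp add: oct_products r u2) (simp add: oct_u_def oct_v_def oct_simps zero_prod_def)
  have v2: "D (oct_v 2) = r *\<^sub>R oct_v 2"
    using der[of "oct_u 3" "oct_u 1"] by (simp add: oct_products r u3) (simp add: oct_u_def oct_v_def oct_simps zero_prod_def)
  have v1: "D (oct_v 1) = 0"
    using der[of "oct_u 2" "oct_u 3"] by (simp add: oct_products u2 u3) (simp add: oct_u_def oct_v_def oct_simps zero_prod_def)
  \<comment> \<open>D multiplies v_2 and v_3 by r, hence their product - u_1 by 2 r; but it
    multiplies u_1 by r.\<close>
  have r0: "r = 0"
    using der[of "oct_v 2" "oct_v 3"] by (simp add: oct_products Dm v2 v3 r) (simp add: oct_u_def oct_v_def oct_simps zero_prod_def)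
  have e: "D (1, 0, 0, 0) = 0" "D (0, 0, 0, 1) = 0"
    using der[of "oct_u 1" "oct_v 1"] der[of "oct_v 1" "oct_u 1"]
    by (simp_all add: oct_products r v1 r0) (simp_all add: oct_u_def oct_v_def oct_simps zero_prod_def)
  obtain \<alpha> u v \<beta> where q: "q = (\<alpha>, u, v, \<beta>)" by (cases q)
  have "q = \<alpha> *\<^sub>R (1, 0, 0, 0) + u $ 1 *\<^sub>R oct_u 1 + u $ 2 *\<^sub>R oct_u 2 + u $ 3 *\<^sub>R oct_u 3
      + v $ 1 *\<^sub>R oct_v 1 + v $ 2 *\<^sub>R oct_v 2 + v $ 3 *\<^sub>R oct_v 3 + \<beta> *\<^sub>R (0, 0, 0, 1)"
    by (simp add: q oct_u_def oct_v_def oct_simps)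
  then have "D q = D (\<alpha> *\<^sub>R (1, 0, 0, 0) + u $ 1 *\<^sub>R oct_u 1 + u $ 2 *\<^sub>R oct_u 2 + u $ 3 *\<^sub>R oct_u 3
      + v $ 1 *\<^sub>R oct_v 1 + v $ 2 *\<^sub>R oct_v 2 + v $ 3 *\<^sub>R oct_v 3 + \<beta> *\<^sub>R (0, 0, 0, 1))" by simp
  also have "\<dots> = 0" by (simp only: linear_add[OF lin] linear_scale[OF lin] r r0 u2 u3 v1 v2 v3 e) simp
  finally show ?thesis .
qed

lemma p1_diff:
  assumes "D \<in> p1" "E \<in> p1"
  shows "(\<lambda>q. D q - E q) \<in> p1"
proof -
  have D: "linear D" "\<And>x y. D (oct_mult x y) = oct_mult (D x) y + oct_mult x (D y)"
    and E: "linear E" "\<And>x y. E (oct_mult x y) = oct_mult (E x) y + oct_mult x (E y)"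
    using assms unfolding p1_def split_g2_def by blast+
  obtain r s where "D null_vector = r *\<^sub>R null_vector" "E null_vector = s *\<^sub>R null_vector"
    using assms unfolding p1_def by blast
  then have n: "D null_vector - E null_vector = (r - s) *\<^sub>R null_vector" by (simp add: scaleR_diff_left)
  have l: "linear (\<lambda>q. D q - E q)" by (intro linear_compose_sub D E)
  have om: "oct_mult (a - b) y = oct_mult a y - oct_mult b y" "oct_mult x (a - b) = oct_mult x a - oct_mult x b" for a b x y
    by (cases a; cases b; cases x; cases y; simp add: oct_simps algebra_simps)+
  have "D (oct_mult x y) - E (oct_mult x y) = oct_mult (D x - E x) y + oct_mult x (D y - E y)" for x y
    by (simp only: D(2) E(2) om add_diff_add)
  then show ?thesis unfolding p1_def split_g2_def using n l by blast
qed

lemma p1_eq: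
  assumes D: "D \<in> p1"
  shows "D = zorn_der (der_param D)"
proof
  fix q
  let ?E = "\<lambda>q. D q - zorn_der (der_param D) q"
  have "der_param ?E = 0" unfolding der_param_diff der_param_zorn_der by simp
  from p1_zero[OF p1_diff[OF D zorn_der_p1] this, of q] show "D q = zorn_der (der_param D) q" by simp
qed

text \<open>The commutator of derivations corresponds to the bracket of the fields in the same order
  as in \<open>vf_bracket\<close>, so the parameters give a homomorphism and not an
  antihomomorphism.\<close>

lemma sym_field_der_param_bracket:
  "sym_field (der_param (\<lambda>q. zorn_der c (zorn_der c' q) - zorn_der c' (zorn_der c q))) p =
   sym_field_deriv c' p (sym_field c p) - sym_field_deriv c p (sym_field c' p)"
proof -
  obtain a x z y k where c: "c = (a, x, z, y, k)" by (cases c)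
  obtain a' x' z' y' k' where c': "c' = (a', x', z', y', k')" by (cases c')
  show ?thesis
    by (simp add: c c' der_param_def zorn_der_def oct_u_def sym_field_def sym_field_deriv_def vec5_eq_iff vector_3 axis_def)
      (simp add: field_simps power2_eq_square power3_eq_cube)
qed

lemma vector_space_vf_scale: "vector_space (vf_scale :: real \<Rightarrow> 'p vfield \<Rightarrow> 'p vfield)"
  by unfold_locales (auto simp: vf_scale_def fun_eq_iff algebra_simps)

lemma (in five_manifold) lift_linear:
  "lift \<kappa> V (sym_field (c + c')) = lift \<kappa> V (sym_field c) + lift \<kappa> V (sym_field c')"
  "lift \<kappa> V (sym_field (s *\<^sub>R c)) = vf_scale s (lift \<kappa> V (sym_field c))"
  by (auto simp: lift_def vf_scale_def fun_eq_iff sym_field_linear matrix_vector_right_distrib matrix_vector_mult_scaleR)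

section \<open>The symmetry algebra of the flat model\<close>

context twisted_cubic_manifold
begin

context
  fixes \<kappa> p r V
  assumes \<kappa>: "\<kappa> \<in> A" and r: "0 < r" "ball p r \<subseteq> coord \<kappa> ` cdom \<kappa>" and V: "V = {q \<in> cdom \<kappa>. coord \<kappa> q \<in> ball p r}"
    and flat: "\<And>q. q \<in> cdom \<kappa> \<Longrightarrow> adapted_cubic (engel_coframe (coord \<kappa> q)) (C \<kappa> q) (G \<kappa> q)"
      "\<And>q. q \<in> cdom \<kappa> \<Longrightarrow> adapted_mark (engel_coframe (coord \<kappa> q)) (l \<kappa> q)"
begin

private abbreviation "\<F> c \<equiv> lift \<kappa> V (sym_field c)"

private lemma symmetries_eq: "infinitesimal_symmetries A C G l V = range \<F>"
  by (rule infinitesimal_symmetries_flat[OF \<kappa> r V flat])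

private lemma V_facts: "open V" "V \<subseteq> cdom \<kappa>" "ball p r = coord \<kappa> ` V"
  by (rule V_props[OF \<kappa> r V flat]; assumption)+

lemma inj_sym_field: "inj \<F>"
proof (rule injI)
  fix c c' assume e: "\<F> c = \<F> c'"
  have "sym_field (c + (- 1) *\<^sub>R c') y = 0" if "y \<in> ball p r" for y
    using lift_eqD[OF \<kappa> V_facts e that] by (simp only: sym_field_linear) simp
  from sym_field_zero[OF r(1) this] show "c = c'" by simp
qed

text \<open>The map from parameters to fields is linear and injective, and the parameter space has
  dimension 5 + 4.\<close>

lemma symmetry_dimension: "vector_space.dim vf_scale (infinitesimal_symmetries A C G l V) = 9"
proof -
  interpret vs: finite_dimensional_vector_space_pair_1 "scaleR :: real \<Rightarrow> sym_param \<Rightarrow> sym_param" Basis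
    "vf_scale :: real \<Rightarrow> 'p vfield \<Rightarrow> 'p vfield"
    unfolding finite_dimensional_vector_space_pair_1_def
    using vector_space_vf_scale eucl.finite_dimensional_vector_space_axioms by blast
  have "Vector_Spaces.linear scaleR vf_scale \<F>"
    using lift_linear by unfold_locales blast+
  from vs.dim_image_eq[OF this, of UNIV] inj_sym_field
  have "vector_space.dim vf_scale (range \<F>) = DIM(sym_param)"
    by (simp add: inj_on_subset dim_raw_def[symmetric])
  then show ?thesis unfolding symmetries_eq by simp
qed

text \<open>On \<open>p1\<close> the map \<open>der_param\<close> is inverse to
  \<open>zorn_der\<close>; composed with the lift of polynomial fields it is bijective and respects
  brackets.\<close>

lemma symmetries_p1: "isomorphic_p1 A V (infinitesimal_symmetries A C G l V)"
  unfolding isomorphic_p1_def symmetries_eq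
proof (intro exI[of _ "\<lambda>D. \<F> (der_param D)"] conjI ballI allI)
  show "bij_betw (\<lambda>D. \<F> (der_param D)) p1 (range \<F>)"
    unfolding bij_betw_def
  proof
    show "inj_on (\<lambda>D. \<F> (der_param D)) p1"
      using inj_sym_field p1_eq by (intro inj_onI) (metis injD)
    show "(\<lambda>D. \<F> (der_param D)) ` p1 = range \<F>"
    proof (intro equalityI subsetI)
      fix Y assume "Y \<in> range \<F>"
      then obtain c where "Y = \<F> (der_param (zorn_der c))" by (auto simp: der_param_zorn_der)
      then show "Y \<in> (\<lambda>D. \<F> (der_param D)) ` p1" using zorn_der_p1 by blast
    qed auto
  qed
  fix D E s assume D: "D \<in> p1"
  show "\<F> (der_param (\<lambda>x. s *\<^sub>R D x)) = vf_scale s (\<F> (der_param D))"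
    by (simp only: der_param_scale lift_linear)
  assume E: "E \<in> p1"
  show "\<F> (der_param (\<lambda>x. D x + E x)) = \<F> (der_param D) + \<F> (der_param E)"
    by (simp only: der_param_add lift_linear)
  let ?c = "der_param D" and ?c' = "der_param E"
  have "der_param (\<lambda>x. D (E x) - E (D x)) = der_param (\<lambda>q. zorn_der ?c (zorn_der ?c' q) - zorn_der ?c' (zorn_der ?c q))"
    using p1_eq[OF D] p1_eq[OF E] by metis
  then have "\<F> (der_param (\<lambda>x. D (E x) - E (D x))) =
      lift \<kappa> V (\<lambda>y. fder (sym_field ?c') y (sym_field ?c y) - fder (sym_field ?c) y (sym_field ?c' y))"
    unfolding sym_field_bracket sym_field_der_param_bracket[symmetric] by simp
  also have "\<dots> = vf_bracket A V (\<F> ?c) (\<F> ?c')"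
    by (rule vf_bracket_lift[OF \<kappa> V_facts, symmetric]) (rule smooth_on_sym_field, simp)+
  finally show "\<F> (der_param (\<lambda>x. D (E x) - E (D x))) = vf_bracket A V (\<F> ?c) (\<F> ?c')" .
qed

end

lemma flat_imp_symmetries:
  assumes "flat U A C G l"
  shows "symmetries_locally_p1 U A C G l"
  unfolding symmetries_locally_p1_def
proof (intro ballI allI impI)
  fix p0 N assume p: "p0 \<in> U" and N: "open N \<and> p0 \<in> N"
  obtain \<kappa> where \<kappa>: "\<kappa> \<in> A" "p0 \<in> cdom \<kappa>"
    and fl: "\<And>q. q \<in> cdom \<kappa> \<Longrightarrow> adapted_cubic (engel_coframe (coord \<kappa> q)) (C \<kappa> q) (G \<kappa> q)"
      "\<And>q. q \<in> cdom \<kappa> \<Longrightarrow> adapted_mark (engel_coframe (coord \<kappa> q)) (l \<kappa> q)"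
    using assms p unfolding flat_def by blast
  note ch = chart[OF \<kappa>(1)]
  have "open (coord \<kappa> ` (cdom \<kappa> \<inter> N))" "coord \<kappa> p0 \<in> coord \<kappa> ` (cdom \<kappa> \<inter> N)"
    using chart_image_open'[OF \<kappa>(1)] N \<kappa>(2) by blast+
  then obtain r where r: "0 < r" "ball (coord \<kappa> p0) r \<subseteq> coord \<kappa> ` (cdom \<kappa> \<inter> N)" using open_contains_ball by blast
  \<comment> \<open>The preimage of a coordinate ball: connected, and inside \<open>N\<close>
    because the ball lies in the image of the part of the chart contained in
    \<open>N\<close>.\<close>
  define V where "V = {q \<in> cdom \<kappa>. coord \<kappa> q \<in> ball (coord \<kappa> p0) r}"
  have r': "ball (coord \<kappa> p0) r \<subseteq> coord \<kappa> ` cdom \<kappa>" using r(2) by blast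
  have pr: "open V" "V \<subseteq> cdom \<kappa>" "ball (coord \<kappa> p0) r = coord \<kappa> ` V"
    by (rule V_props[OF \<kappa>(1) r(1) r' V_def fl]; assumption)+
  have VN: "V \<subseteq> N"
  proof
    fix q assume q: "q \<in> V"
    then obtain q' where q': "q' \<in> cdom \<kappa>" "q' \<in> N" "coord \<kappa> q = coord \<kappa> q'" using r(2) unfolding V_def by blast
    have "q = q'" using q ch(6)[of q] ch(6)[OF q'(1)] unfolding V_def q'(3) by simp
    then show "q \<in> N" using q' by simp
  qed
  have "V = icoord \<kappa> ` ball (coord \<kappa> p0) r"
    unfolding pr(3) image_image using ch(6) subsetD[OF pr(2)] by (simp cong: image_cong)
  then have "connected V"
    using connected_continuous_image[OF continuous_on_subset[OF ch(5) r']] by simp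
  then show "\<exists>V. open V \<and> connected V \<and> p0 \<in> V \<and> V \<subseteq> N \<inter> U \<and>
        vector_space.dim vf_scale (infinitesimal_symmetries A C G l V) = 9 \<and>
        isomorphic_p1 A V (infinitesimal_symmetries A C G l V)"
  proof (intro exI[of _ V] conjI)
    show "p0 \<in> V" using \<kappa>(2) r(1) by (simp add: V_def)
    show "vector_space.dim vf_scale (infinitesimal_symmetries A C G l V) = 9"
      by (rule symmetry_dimension[OF \<kappa>(1) r(1) r' V_def fl])
    show "isomorphic_p1 A V (infinitesimal_symmetries A C G l V)"
      by (rule symmetries_p1[OF \<kappa>(1) r(1) r' V_def fl])
  qed (use pr VN ch(3) in auto)
qed

end

theorem theorem1:
  fixes U :: "'p::{t2_space,second_countable_topology} set"
    and A :: "'p chart set"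
    and C G l :: "'p tangent_sets"
    and W :: "'p coframe"
    and a b c J M P L Q R S :: "'p \<Rightarrow> real"
  assumes "manifold5 U A"
    and "marked_contact_engel U A C G l"
    and "adapted_coframe A C G l W"
    and "structure_equations A W a b c J M P"
    and "derived_functions A W a b c M P L Q R S"
  shows
    "(\<forall>\<phi> B W' a' b' c' J' M' P' L' Q' R' S'.
        diffeo U A \<phi> \<and> smooth_fun A B \<and> (\<forall>p\<in>U. B p \<in> structure_group) \<and>
        coframe A W' \<and> transformed_coframe A B \<phi> W W' \<and>
        structure_equations A W' a' b' c' J' M' P' \<and>
        derived_functions A W' a' b' c' M' P' L' Q' R' S' \<longrightarrow>
          (vanish_on U [J] \<longleftrightarrow> vanish_on U [J']) \<and>
          (vanish_on U [J, L] \<longleftrightarrow> vanish_on U [J', L']) \<and>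
          (vanish_on U [J, L, M] \<longleftrightarrow> vanish_on U [J', L', M']) \<and>
          (vanish_on U [J, L, M, P] \<longleftrightarrow> vanish_on U [J', L', M', P']) \<and>
          (vanish_on U [J, L, M, P, Q] \<longleftrightarrow> vanish_on U [J', L', M', P', Q']) \<and>
          (vanish_on U [J, L, M, P, Q, R] \<longleftrightarrow> vanish_on U [J', L', M', P', Q', R']) \<and>
          (vanish_on U [J, L, M, P, Q, R, S] \<longleftrightarrow> vanish_on U [J', L', M', P', Q', R', S'])) \<and>
     (flat U A C G l \<longleftrightarrow> vanish_on U [J, L, M, P, Q, R, S]) \<and>
     (vanish_on U [J, L, M, P, Q, R, S] \<longrightarrow> symmetries_locally_p1 U A C G l)"
proof -
  interpret five_manifold U A by unfold_locales (rule assms(1))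
  have sets: "tangent_sets A C" "tangent_sets A G" "tangent_sets A l"
    using assms(2) unfolding marked_contact_engel_def marked_contact_twisted_cubic_def contact_twisted_cubic_def by blast+
  interpret twisted_cubic_manifold U A C G l by unfold_locales (rule sets)+
  have W: "coframe A W" using assms(3) by (simp add: adapted_coframe_def)
  have charts: "\<exists>\<kappa>. engel_chart \<kappa> \<and> q \<in> cdom \<kappa>" if "q \<in> U" for q
    using assms(2) that unfolding marked_contact_engel_def engel_chart_def by blast
  have flat_iff: "flat U A C G l \<longleftrightarrow> vanish_on U [J, L, M, P, Q, R, S]"
    using flat_imp_vanish[OF assms(3-5)] vanish_imp_flat[OF assms(3-5) _ charts] by blast
  moreover have "vanish_on U [J, L, M, P, Q, R, S] \<longrightarrow> symmetries_locally_p1 U A C G l"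
    using flat_imp_symmetries flat_iff by blast
  moreover have "(vanish_on U [J] \<longleftrightarrow> vanish_on U [J']) \<and>
          (vanish_on U [J, L] \<longleftrightarrow> vanish_on U [J', L']) \<and>
          (vanish_on U [J, L, M] \<longleftrightarrow> vanish_on U [J', L', M']) \<and>
          (vanish_on U [J, L, M, P] \<longleftrightarrow> vanish_on U [J', L', M', P']) \<and>
          (vanish_on U [J, L, M, P, Q] \<longleftrightarrow> vanish_on U [J', L', M', P', Q']) \<and>
          (vanish_on U [J, L, M, P, Q, R] \<longleftrightarrow> vanish_on U [J', L', M', P', Q', R']) \<and>
          (vanish_on U [J, L, M, P, Q, R, S] \<longleftrightarrow> vanish_on U [J', L', M', P', Q', R', S'])"
    if h: "diffeo U A \<phi>" "smooth_fun A B" "\<forall>p\<in>U. B p \<in> structure_group" "coframe A W'" "transformed_coframe A B \<phi> W W'"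
      "structure_equations A W' a' b' c' J' M' P'" "derived_functions A W' a' b' c' M' P' L' Q' R' S'"
    for \<phi> B W' a' b' c' J' M' P' L' Q' R' S'
  proof -
    have t: "vanish_on U (take (Suc n) [J, L, M, P, Q, R, S]) \<longleftrightarrow> vanish_on U (take (Suc n) [J', L', M', P', Q', R', S'])"
      if "n < 7" for n
      by (rule global_invariants_iff; (rule assms W h that | use h in blast))
    show ?thesis
      using t[of 0] t[of 1] t[of 2] t[of 3] t[of 4] t[of 5] t[of 6] by (simp add: numeral_eq_Suc)
  qed
  ultimately show ?thesis by blast
qed

end
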